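(* Let $d\ge2$ and $1\le m\le d$. Assume the following. (1) $F$ is twice continuously differentiable and convex with $0\preceq \nabla^2F(\theta)\preceq L_f I_d$ for all $\theta\in\mathbb{R}^d$, and there exist $\delta_1,\lambda>0$ such that $\nabla^2F(\theta)\succeq\lambda I_d$ for all $\theta$ in the $\delta_1$-ball centered at $\theta^\star$. (2) $\mathbb{E}[\nabla f(\theta;\zeta)]=\nabla F(\theta)$ for all $\theta$, and for some $0<\delta\le 2$ there exists $M>0$ such that $\mathbb{E}\|\nabla f(\theta;\zeta)-\nabla F(\theta)\|^{2+\delta}\le M(\|\theta-\theta^\star\|^{2+\delta}+1)$ for all $\theta$. (3) There are $L_h,L_p>0$ such that for all $\theta,\theta'$, $\mathbb{E}\|\nabla^2f(\theta;\zeta)-\nabla^2f(\theta';\zeta)\|^2\le L_h\|\theta-\theta'\|^2$, and $\mathbb{E}\|[\nabla^2f(\theta^\star;\zeta)]^2-H^2\|\le L_p$, where $H=\nabla^2F(\theta^\star)$. (4) The direction tuples $\widetilde V_i=(v_i^{(1)},\dots,v_i^{(m)})$, $i\ge1$, are i.i.d. over $i$, and for each $i$ the vectors $v_i^{(1)},\dots,v_i^{(m)}$ are sampled uniformly without replacement from $\{\sqrt d\,u_1,\dots,\sqrt d\,u_d\}$, where $\{u_1,\dots,u_d\}$ is either the canonical basis of $\mathbb{R}^d$ or an arbitrary fixed orthonormal basis of $\mathbb{R}^d$. Let $\eta_n=\eta_0n^{-\alpha}$ with $\eta_0>0$, $\alpha\in(\tfrac12,1)$, and $h_n=h_0n^{-\gamma}$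 with $h_0>0$, $\gamma\in(\tfrac12,1)$. Then the resulting averaged $(m+1)$-query Kiefer-Wolfowitz estimator $\overline\theta_n^{(m,\mathrm{WOR})}$ satisfies, as $n\to\infty$, $$\sqrt n\,\big(\overline\theta_n^{(m,\mathrm{WOR})}-\theta^\star\big)\Longrightarrow\mathcal{N}\left(0,\;H^{-1}Q_m^{(\mathrm{WOR})}H^{-1}\right),\qquad Q_m^{(\mathrm{WOR})}=\frac{d-m}{m(d-1)}\,Q+\frac{d(m-1)}{m(d-1)}\,S,$$ where $S=\mathbb{E}[\nabla f(\theta^\star;\zeta)\nabla f(\theta^\star;\zeta)^\top]$, $Q=\mathbb{E}[vv^\top Svv^\top]$ with $v$ uniform on $\{\sqrt d\,u_1,\dots,\sqrt d\,u_d\}$, and $\Longrightarrow$ denotes convergence in distribution.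
   Context: Setting: $\zeta\sim\mathcal{P}_\zeta$ is a random data point, $f(\theta;\zeta)$ is an individual loss, convex in $\theta\in\mathbb{R}^d$, $F(\theta)=\mathbb{E}[f(\theta;\zeta)]$ and $\theta^\star=\mathrm{argmin}\,F$. Derivatives of $f$ are in $\theta$. $\zeta_1,\zeta_2,\dots$ are i.i.d. copies of $\zeta$. $\|\cdot\|$ is the Euclidean norm for vectors and the spectral norm for matrices. $(m+1)$-query Kiefer-Wolfowitz iterates: for $h>0$, $v\in\mathbb{R}^d$ put $\widehat g_{h,v}(\theta;\zeta)=\frac{f(\theta+hv;\zeta)-f(\theta;\zeta)}{h}\,v$. Given an arbitrary initial point $\theta_0\in\mathbb{R}^d$ and random direction tuples independent of the data, $$\theta_i=\theta_{i-1}-\frac{\eta_i}{m}\sum_{j=1}^m\widehat g_{h_i,v_i^{(j)}}(\theta_{i-1};\zeta_i),\qquad \overline\theta_n^{(m,\mathrm{WOR})}=\frac1n\sum_{i=1}^n\theta_i .$$ *)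

theory Defs
  imports "HOL-Probability.Probability"
begin

definition grad :: "('a::real_inner \<Rightarrow> real) \<Rightarrow> 'a \<Rightarrow> 'a" where
  "grad g x = (THE D. GDERIV g x :> D)"

definition hess :: "(real^'n \<Rightarrow> real) \<Rightarrow> real^'n \<Rightarrow> real^'n^'n" where
  "hess g x = jacobian (grad g) (at x)"

definition twice_differentiable :: "(real^'n \<Rightarrow> real) \<Rightarrow> bool" where
  "twice_differentiable g \<longleftrightarrow> g differentiable_on UNIV \<and> grad g differentiable_on UNIV"

definition psd :: "real^'n^'n \<Rightarrow> bool" where
  "psd A \<longleftrightarrow> transpose A = A \<and> (\<forall>x. 0 \<le> x \<bullet> (A *v x))"

definition loewner_le :: "real^'n^'n \<Rightarrow> real^'n^'n \<Rightarrow> bool" (infix \<open>\<preceq>\<^sub>L\<close> 50) where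
  "A \<preceq>\<^sub>L B \<longleftrightarrow> psd (B - A)"

(* The instance norm on real^'n^'n is the Frobenius norm, hence the detour through onorm. *)
definition spectral_norm :: "real^'n^'n \<Rightarrow> real" where
  "spectral_norm A = onorm (\<lambda>x. A *v x)"

definition outer :: "real^'n \<Rightarrow> real^'n^'n" where
  "outer x = (\<chi> i j. x $ i * x $ j)"

definition orthonormal_basis :: "(real^'n) set \<Rightarrow> bool" where
  "orthonormal_basis B \<longleftrightarrow> pairwise orthogonal B \<and> (\<forall>u\<in>B. norm u = 1) \<and> span B = UNIV"

definition scaled_directions :: "(real^'n) set \<Rightarrow> (real^'n) set" where
  "scaled_directions B = (\<lambda>u. sqrt (real CARD('n)) *\<^sub>R u) ` B"

(* The possible outcomes of m ordered draws without replacement from D; sampling without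
   replacement is the uniform distribution on this set. *)
definition wor_tuples :: "nat \<Rightarrow> 'a set \<Rightarrow> (nat \<Rightarrow> 'a) set" where
  "wor_tuples m D = {w \<in> {1..m} \<rightarrow>\<^sub>E D. inj_on w {1..m}}"

definition kw_gradient ::
  "('a::real_vector \<Rightarrow> 'z \<Rightarrow> real) \<Rightarrow> real \<Rightarrow> 'a \<Rightarrow> 'a \<Rightarrow> 'z \<Rightarrow> 'a" where
  "kw_gradient f h v \<theta> z = ((f (\<theta> + h *\<^sub>R v) z - f \<theta> z) / h) *\<^sub>R v"

primrec kw_iterate ::
  "('a::real_vector \<Rightarrow> 'z \<Rightarrow> real) \<Rightarrow> nat \<Rightarrow> (nat \<Rightarrow> real) \<Rightarrow> (nat \<Rightarrow> real) \<Rightarrow> 'a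
    \<Rightarrow> (nat \<Rightarrow> 'z) \<Rightarrow> (nat \<Rightarrow> nat \<Rightarrow> 'a) \<Rightarrow> nat \<Rightarrow> 'a" where
  "kw_iterate f m \<eta> h \<theta>\<^sub>0 z v 0 = \<theta>\<^sub>0"
| "kw_iterate f m \<eta> h \<theta>\<^sub>0 z v (Suc n) =
     kw_iterate f m \<eta> h \<theta>\<^sub>0 z v n
     - (\<eta> (Suc n) / real m) *\<^sub>R
       (\<Sum>j=1..m. kw_gradient f (h (Suc n)) (v (Suc n) j)
          (kw_iterate f m \<eta> h \<theta>\<^sub>0 z v n) (z (Suc n)))"

definition kw_average ::
  "('a::real_vector \<Rightarrow> 'z \<Rightarrow> real) \<Rightarrow> nat \<Rightarrow> (nat \<Rightarrow> real) \<Rightarrow> (nat \<Rightarrow> real) \<Rightarrow> 'a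
    \<Rightarrow> (nat \<Rightarrow> 'z) \<Rightarrow> (nat \<Rightarrow> nat \<Rightarrow> 'a) \<Rightarrow> nat \<Rightarrow> 'a" where
  "kw_average f m \<eta> h \<theta>\<^sub>0 z v n = (1 / real n) *\<^sub>R (\<Sum>i=1..n. kw_iterate f m \<eta> h \<theta>\<^sub>0 z v i)"

definition std_normal_vec :: "(real^'n) measure" where
  "std_normal_vec = density lborel (\<lambda>x. ennreal (\<Prod>i\<in>UNIV. std_normal_density (x $ i)))"

(* The image of the standard normal law under an affine map b + A x with A A^T = C. Such an A
   exists for every positive semidefinite C, and the law does not depend on the choice of A. In
   contrast to a density, this covers singular C. *)
definition multi_normal :: "real^'n \<Rightarrow> real^'n^'n \<Rightarrow> (real^'n) measure" where
  "multi_normal b C =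
     distr std_normal_vec borel (\<lambda>x. b + (SOME A :: real^'n^'n. A ** transpose A = C) *v x)"

(* weak_conv_m only covers measures on the real line. *)
definition weak_conv_vec :: "(nat \<Rightarrow> (real^'n) measure) \<Rightarrow> (real^'n) measure \<Rightarrow> bool" where
  "weak_conv_vec \<mu> N \<longleftrightarrow>
     (\<forall>g :: real^'n \<Rightarrow> real. continuous_on UNIV g \<longrightarrow> bounded (range g) \<longrightarrow>
        (\<lambda>n. \<integral>x. g x \<partial>\<mu> n) \<longlonglongrightarrow> (\<integral>x. g x \<partial>N))"

end

theory Submission
  imports Defs
begin

text \<open>Write \<open>x\<^sub>i = \<theta>\<^sub>i - \<theta>\<^sup>\<star>\<close>. The random gradient used in step \<open>i + 1\<close> is the sum of \<open>H x\<^sub>i\<close>, a linearisation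
  error \<open>O(\<parallel>x\<^sub>i\<parallel>\<^sup>2)\<close>, a bias \<open>O(h\<^sub>i)\<close>, the i.i.d. noise of the idealised query \<open>m\<^sup>-\<^sup>1 \<Sum>\<^sub>j v\<^sub>j v\<^sub>j\<^sup>T \<nabla>f\<close> at \<open>\<theta>\<^sup>\<star>\<close>,
  and a martingale difference that is small when \<open>x\<^sub>i\<close> and \<open>h\<^sub>i\<close> are. Dividing the recursion by the step size and
  summing by parts shows that \<open>H \<Sum> x\<^sub>i\<close> equals minus the summed noise up to \<open>o(\<surd>n)\<close>, as soon as
  \<open>E \<parallel>x\<^sub>i\<parallel>\<^sup>2 = O(\<eta>\<^sub>i)\<close>. That rate only holds where the mean loss is strongly convex. However, the iterates come
  arbitrarily close to the minimiser, since \<open>\<Sum> \<eta>\<^sub>i = \<infinity>\<close> while \<open>\<Sum> (\<eta>\<^sub>i h\<^sub>i + \<eta>\<^sub>i\<^sup>2) < \<infinity>\<close>, and from then on they leave a small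
  ball around it with small probability, so the estimates can be made on the event of not leaving.

  The Hessian condition at \<open>\<theta>\<^sup>\<star>\<close> gives a Taylor estimate of the random gradient in \<open>L\<^sup>1\<close> only. This suffices for the
  linearisation error, and interpolation with the moment of order \<open>2 + \<delta>\<close> turns it into the
  continuity in \<open>L\<^sup>2\<close> that controls the martingale part.

  The i.i.d. noise is treated by characteristic functions. These determine weak limits through Gaussian smoothing, which
  turns pointwise convergence of characteristic functions into convergence of densities. The covariance follows
  from the exchangeability of sampling without replacement.\<close>

subsection \<open>Positive semidefinite matrices\<close>

text \<open>Strong convexity holds in a ball only, so the drift controls no more than the truncated
  square \<open>min (X i \<omega>) (\<delta>\<^sup>2)\<close>, and rates are available only for
  paths that stay near the minimiser. Every local estimate is therefore weighted by the indicator
  \<open>J N i\<close> of not having left the ball between times \<open>N\<close> and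
  \<open>i\<close>. It is known at time \<open>i\<close>, hence it comes out of an integral over the
  next innovation and keeps martingale differences centred. \<open>N\<close> is fixed before
  \<open>n\<close> grows, so that the exit probability is small for all \<open>n\<close> at once.
  Convexity of the individual losses puts each difference quotient between the directional
  derivatives at its two ends; bias and moments of the queries thus come from moments of gradients.
  The summed linearisation error is at most of order n^(1 - \<alpha>) and the summed bias of order
  n^(1 - \<gamma>), both o(sqrt n) as the exponents exceed 1/2; the boundary term of the summation
  by parts, over sqrt n, is of order n^((\<alpha> - 1)/2). The limit covariance may be singular, so
  the limit itself may have no density; this is why laws are smoothed before densities are
  compared.\<close>

lemma psd_bilinear_sym:
  fixes C :: "real^'n^'n"
  assumes "psd C"
  shows "x \<bullet> (C *v y) = y \<bullet> (C *v x)"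
  by (metis assms dot_lmul_matrix inner_commute psd_def vector_transpose_matrix)

text \<open>The quadratic polynomial in \<open>quad\<close> is nonnegative, so its discriminant is
  not positive. The form may be degenerate, which makes \<open>c = 0\<close> a case of its
  own.\<close>

lemma psd_cauchy_schwarz:
  fixes C :: "real^'n^'n"
  assumes "psd C"
  shows "(x \<bullet> (C *v y))\<^sup>2 \<le> (x \<bullet> (C *v x)) * (y \<bullet> (C *v y))"
proof -
  define a b c where "a = x \<bullet> (C *v x)" and "b = x \<bullet> (C *v y)" and "c = y \<bullet> (C *v y)"
  have quad: "0 \<le> a + 2 * t * b + t\<^sup>2 * c" for t
  proof -
    have "0 \<le> (x + t *\<^sub>R y) \<bullet> (C *v (x + t *\<^sub>R y))"
      using assms by (simp add: psd_def)
    also have "\<dots> = a + 2 * t * b + t\<^sup>2 * c"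
      using psd_bilinear_sym[OF assms, of y x]
      by (simp add: a_def b_def c_def algebra_simps matrix_vector_right_distrib
          matrix_vector_mult_scaleR power2_eq_square)
    finally show ?thesis .
  qed
  have "c \<ge> 0" using assms by (simp add: c_def psd_def)
  have "b\<^sup>2 \<le> a * c"
  proof (cases "c = 0")
    case True
    \<comment> \<open>If \<open>b\<close> were nonzero, this value of \<open>t\<close> would give
      \<open>a - (a + 1) < 0\<close>.\<close>
    have "b = 0"
      using quad[of "- (a + 1) / (2 * b)"] True by (cases "b = 0") (auto simp: field_simps)
    then show ?thesis using True by simp
  next
    case False
    with \<open>c \<ge> 0\<close> have "c > 0" by simp
    have "a + 2 * (- b / c) * b + (- b / c)\<^sup>2 * c = a - b\<^sup>2 / c"
      using \<open>c > 0\<close> by (simp add: power2_eq_square field_simps)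
    with quad[of "- b / c"] have "0 \<le> a - b\<^sup>2 / c" by simp
    then show ?thesis using \<open>c > 0\<close> by (simp add: field_simps)
  qed
  then show ?thesis by (simp add: a_def b_def c_def)
qed

text \<open>Cauchy-Schwarz for the semi-inner product of \<open>C\<close>, applied to
  \<open>C *v x\<close> and \<open>x\<close>, gives |Cx|^4 \<le> (L |Cx|^2) (L |x|^2); dividing by
  |Cx|^2 and taking roots avoids any use of eigenvalues.\<close>

lemma psd_norm_mult_le:
  fixes C :: "real^'n^'n"
  assumes "psd C" "psd (mat L - C)"
  shows "norm (C *v x) \<le> L * norm x"
proof -
  have up: "y \<bullet> (C *v y) \<le> L * (norm y)\<^sup>2" for y
  proof -
    have "0 \<le> y \<bullet> ((mat L - C) *v y)" using assms(2) by (simp add: psd_def)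
    moreover have "mat L *v y = L *\<^sub>R y"
      by (simp add: vec_eq_iff matrix_vector_mult_def mat_def if_distrib if_distribR cong: if_cong)
    ultimately show ?thesis
      by (simp add: matrix_vector_mult_diff_rdistrib inner_diff_right power2_norm_eq_inner)
  qed
  have nonneg: "0 \<le> y \<bullet> (C *v y)" for y using assms(1) by (simp add: psd_def)
  let ?y = "C *v x"
  have "(norm ?y ^ 2)\<^sup>2 = (?y \<bullet> (C *v x))\<^sup>2" by (simp add: power2_norm_eq_inner)
  also have "\<dots> \<le> (?y \<bullet> (C *v ?y)) * (x \<bullet> (C *v x))" by (rule psd_cauchy_schwarz) fact
  also have "\<dots> \<le> (L * (norm ?y)\<^sup>2) * (L * (norm x)\<^sup>2)"
    by (intro mult_mono up nonneg) (meson nonneg order.trans up)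
  finally have le: "(norm ?y)\<^sup>2 * (norm ?y)\<^sup>2 \<le> (norm ?y)\<^sup>2 * (L * norm x)\<^sup>2"
    by (simp add: power2_eq_square algebra_simps)
  show ?thesis
  proof (cases "x = 0")
    case False
    have "0 \<le> L * (norm x)\<^sup>2" using nonneg up order.trans by blast
    then have "0 \<le> L" using False by (simp add: zero_le_mult_iff)
    show ?thesis
    proof (cases "?y = 0")
      case False
      then have "(norm ?y)\<^sup>2 \<le> (L * norm x)\<^sup>2"
        by (intro mult_le_cancel_left_pos[THEN iffD1, OF _ le]) simp
      then show ?thesis by (rule power2_le_imp_le) (use \<open>0 \<le> L\<close> in simp)
    qed (use \<open>0 \<le> L\<close> in simp)
  qed simp
qed

lemma outer_mult_vec: "outer y *v x = (y \<bullet> x) *\<^sub>R y"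
  by (simp add: vec_eq_iff outer_def matrix_vector_mult_def inner_vec_def sum_distrib_left
      sum_distrib_right algebra_simps)

lemma transpose_outer: "transpose (outer y) = outer y"
  by (simp add: outer_def transpose_def vec_eq_iff mult.commute)

lemma transpose_diff: "transpose (A - B) = transpose A - transpose (B :: real^'n^'m)"
  by (simp add: transpose_def vec_eq_iff)

text \<open>Outer-product Cholesky factorisation, eliminating one coordinate direction at a time.\<close>

lemma psd_cholesky_step:
  fixes C :: "real^'n^'n"
  assumes "psd C" "finite T"
  shows "\<exists>y::'n \<Rightarrow> real^'n. psd (C - (\<Sum>k\<in>T. outer (y k))) \<and>
           (\<forall>k\<in>T. (C - (\<Sum>k\<in>T. outer (y k))) *v axis k 1 = 0)"
  using assms(2)
proof induction
  case empty
  then show ?case using assms(1) by simp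
next
  case (insert k T)
  then obtain y where y: "psd (C - (\<Sum>k\<in>T. outer (y k)))"
    "\<And>j. j \<in> T \<Longrightarrow> (C - (\<Sum>k\<in>T. outer (y k))) *v axis j 1 = 0" by blast
  define R where "R = C - (\<Sum>k\<in>T. outer (y k))"
  define e :: "real^'n" where "e = axis k 1"
  define p where "p = e \<bullet> (R *v e)"
  have R: "psd R" using y by (simp add: R_def)
  \<comment> \<open>For \<open>p = 0\<close> Cauchy-Schwarz gives \<open>R *v e = 0\<close>, while
    division by zero makes \<open>w = 0\<close>: nothing is subtracted and nothing has to
    be.\<close>
  define w where "w = (1 / sqrt p) *\<^sub>R (R *v e)"
  define y' where "y' = y(k := w)"
  have eq: "C - (\<Sum>k\<in>insert k T. outer (y' k)) = R - outer w"
  proof -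
    have "(\<Sum>j\<in>T. outer (y' j)) = (\<Sum>j\<in>T. outer (y j))"
      using insert(2) by (intro sum.cong) (auto simp: y'_def)
    then show ?thesis using insert(1,2) by (simp add: R_def y'_def)
  qed
  have "p \<ge> 0" using R by (simp add: p_def psd_def)
  have w_dot: "w \<bullet> x = (x \<bullet> (R *v e)) / sqrt p" for x
    by (simp add: w_def inner_commute)
  have Re0: "R *v e = 0" if "p = 0"
    using psd_cauchy_schwarz[OF R, of "R *v e" e] that by (simp add: p_def)
  \<comment> \<open>Nonnegativity of the Schur complement is Cauchy-Schwarz for \<open>R\<close> at
    \<open>x\<close> and \<open>e\<close>.\<close>
  have psd': "psd (R - outer w)"
  proof -
    have "0 \<le> x \<bullet> ((R - outer w) *v x)" for x
    proof -
      have "(w \<bullet> x)\<^sup>2 \<le> x \<bullet> (R *v x)"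
      proof (cases "p = 0")
        case True
        then show ?thesis using R by (simp add: w_dot psd_def)
      next
        case False
        then have "p > 0" using \<open>p \<ge> 0\<close> by simp
        then show ?thesis
          using psd_cauchy_schwarz[OF R, of x e]
          by (simp add: w_dot power_divide p_def[symmetric] field_simps)
      qed
      then show ?thesis
        by (simp add: matrix_vector_mult_diff_rdistrib outer_mult_vec inner_diff_right
            power2_eq_square inner_commute)
    qed
    moreover have "transpose (R - outer w) = R - outer w"
      using R by (simp add: transpose_diff transpose_outer psd_def)
    ultimately show ?thesis by (simp add: psd_def)
  qed
  have "(R - outer w) *v axis j 1 = 0" if "j \<in> insert k T" for j
  proof (cases "j = k")
    case True
    have "w \<bullet> e = p / sqrt p" by (simp add: w_dot p_def)
    then have "(w \<bullet> e) *\<^sub>R w = R *v e"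
      using Re0 \<open>p \<ge> 0\<close> by (cases "p = 0") (auto simp: w_def real_div_sqrt)
    then show ?thesis using True
      by (simp add: e_def[symmetric] matrix_vector_mult_diff_rdistrib outer_mult_vec)
  next
    case False
    then have R0: "R *v axis j 1 = 0" using that y(2) by (simp add: R_def)
    then have "w \<bullet> axis j 1 = 0" by (simp add: w_dot psd_bilinear_sym[OF R])
    then show ?thesis by (simp add: R0 matrix_vector_mult_diff_rdistrib outer_mult_vec)
  qed
  with psd' show ?case unfolding eq[symmetric] by blast
qed

text \<open>Once every coordinate is eliminated, the residual kills all axis vectors and vanishes;
  the eliminated vectors are the columns of \<open>A\<close>. This gives the choice in
  \<open>multi_normal\<close> a witness.\<close>

lemma psd_sqrt:
  fixes C :: "real^'n^'n"
  assumes "psd C"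
  shows "\<exists>A :: real^'n^'n. A ** transpose A = C"
proof -
  obtain y :: "'n \<Rightarrow> real^'n" where y: "\<And>k. (C - (\<Sum>k\<in>UNIV. outer (y k))) *v axis k 1 = 0"
    using psd_cholesky_step[OF assms finite, of UNIV] by auto
  define A :: "real^'n^'n" where "A = (\<chi> i k. y k $ i)"
  have "C - (\<Sum>k\<in>UNIV. outer (y k)) = 0"
    using y by (simp add: matrix_vector_mult_basis column_def vec_eq_iff)
  moreover have "(\<Sum>k\<in>UNIV. outer (y k)) = A ** transpose A"
    by (simp add: A_def outer_def matrix_matrix_mult_def transpose_def vec_eq_iff)
  ultimately show ?thesis by auto
qed

subsection \<open>Gaussian smoothing\<close>

text \<open>Lebesgue measure on vectors is the image of a product measure indexed by basis vectors
  rather than by coordinates, so the factors are reindexed along \<open>axis i 1\<close>, which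
  \<open>idx\<close> inverts.\<close>

lemma integral_lborel_vec_prod:
  fixes f :: "'n::finite \<Rightarrow> real \<Rightarrow> 'b::{real_normed_field,banach,second_countable_topology}"
  assumes int: "\<And>i. integrable lborel (f i)"
  shows "integrable lborel (\<lambda>x::real^'n. \<Prod>i\<in>UNIV. f i (x $ i))"
    and "(\<integral>x. (\<Prod>i\<in>UNIV. f i (x $ i)) \<partial>(lborel :: (real^'n) measure)) = (\<Prod>i\<in>UNIV. \<integral>x. f i x \<partial>lborel)"
proof -
  define idx :: "real^'n \<Rightarrow> 'n" where "idx b = (THE i. b = axis i 1)" for b
  have idx: "idx (axis i 1) = i" for i by (auto simp: idx_def axis_eq_axis)
  have B: "(Basis :: (real^'n) set) = (\<lambda>i. axis i 1) ` UNIV" by (auto simp: Basis_vec_def)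
  have inj: "inj (\<lambda>i::'n. axis i (1::real))" by (auto simp: inj_on_def axis_eq_axis)
  interpret product_sigma_finite "\<lambda>_::real^'n. lborel :: real measure" by standard
  have comp: "(\<Sum>b\<in>Basis. g b *\<^sub>R b) $ i = g (axis i 1)" for g :: "real^'n \<Rightarrow> real" and i
  proof -
    have "(\<Sum>b\<in>Basis. g b *\<^sub>R b) $ i = (\<Sum>j\<in>UNIV. if j = i then g (axis j 1) else 0)"
      unfolding B sum_component
      by (subst sum.reindex[OF inj], unfold o_def, intro sum.cong) (auto simp: axis_def)
    then show ?thesis by simp
  qed
  have eq: "(\<Prod>i\<in>UNIV. f i ((\<Sum>b\<in>Basis. g b *\<^sub>R b) $ i)) = (\<Prod>b\<in>(Basis::(real^'n) set). f (idx b) (g b))" for g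
    unfolding comp unfolding B by (subst prod.reindex[OF inj]) (simp add: idx)
  have fm: "f i \<in> borel_measurable borel" for i
    using borel_measurable_integrable[OF int[of i]] by simp
  have m1: "(\<lambda>g. \<Sum>b\<in>Basis. g b *\<^sub>R b) \<in> (\<Pi>\<^sub>M b\<in>(Basis::(real^'n) set). lborel) \<rightarrow>\<^sub>M borel"
    by (intro borel_measurable_sum borel_measurable_scaleR measurable_component_singleton[THEN measurable_compose]) auto
  have m2: "(\<lambda>x::real^'n. \<Prod>i\<in>UNIV. f i (x $ i)) \<in> borel_measurable borel"
  proof (rule borel_measurable_prod)
    fix i
    have "(\<lambda>x::real^'n. x $ i) \<in> borel \<rightarrow>\<^sub>M borel"
      by (intro borel_measurable_continuous_onI continuous_intros)
    then show "(\<lambda>x::real^'n. f i (x $ i)) \<in> borel_measurable borel"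
      by (rule measurable_compose) (rule fm)
  qed
  note vec = lborel_eq[where 'a="real^'n"]
  have "integrable (\<Pi>\<^sub>M b\<in>(Basis::(real^'n) set). lborel) (\<lambda>g. \<Prod>b\<in>(Basis::(real^'n) set). f (idx b) (g b))"
    by (intro product_integrable_prod int) simp
  then show "integrable lborel (\<lambda>x::real^'n. \<Prod>i\<in>UNIV. f i (x $ i))"
    by (simp only: vec integrable_distr_eq[OF m1 m2] eq)
  have "(\<integral>x. (\<Prod>i\<in>UNIV. f i (x $ i)) \<partial>(lborel :: (real^'n) measure))
     = (\<integral>g. (\<Prod>b\<in>(Basis::(real^'n) set). f (idx b) (g b)) \<partial>(\<Pi>\<^sub>M b\<in>Basis. lborel))"
    by (simp only: vec integral_distr[OF m1 m2] eq)
  also have "\<dots> = (\<Prod>b\<in>(Basis::(real^'n) set). \<integral>x. f (idx b) x \<partial>lborel)"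
    by (rule product_integral_prod) (auto intro: int)
  also have "\<dots> = (\<Prod>i\<in>UNIV. \<integral>x. f i x \<partial>lborel)"
    unfolding B by (subst prod.reindex[OF inj]) (simp add: idx)
  finally show "(\<integral>x. (\<Prod>i\<in>UNIV. f i (x $ i)) \<partial>(lborel :: (real^'n) measure)) = (\<Prod>i\<in>UNIV. \<integral>x. f i x \<partial>lborel)" .
qed

section \<open>The standard normal density and its characteristic function\<close>

definition std_normal_vec_density :: "real^'n \<Rightarrow> real" where
  "std_normal_vec_density x = (\<Prod>i\<in>UNIV. std_normal_density (x $ i))"

lemma std_normal_vec_density_measurable [measurable]:
  "std_normal_vec_density \<in> borel_measurable borel"
  unfolding std_normal_vec_density_def[abs_def]
proof (rule borel_measurable_prod)
  fix i
  have "(\<lambda>x::real^'a. x $ i) \<in> borel \<rightarrow>\<^sub>M borel"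
    by (intro borel_measurable_continuous_onI continuous_intros)
  then show "(\<lambda>x::real^'a. std_normal_density (x $ i)) \<in> borel_measurable borel"
    by (rule measurable_compose) simp
qed

lemma std_normal_vec_density_pos: "0 < std_normal_vec_density x"
  unfolding std_normal_vec_density_def by (intro prod_pos ballI normal_density_pos) simp

lemma std_normal_vec_density_nonneg [simp]: "0 \<le> std_normal_vec_density x"
  using std_normal_vec_density_pos[of x] by simp

text \<open>The normalising constant is kept as the value at 0. What matters is that the density is
  proportional to the normal characteristic function, which \<open>smoothed_density_char\<close>
  exploits.\<close>

lemma std_normal_vec_density_eq:
  "std_normal_vec_density (x :: real^'n) = std_normal_vec_density (0::real^'n) * exp (- (x \<bullet> x) / 2)"
proof -
  have sd: "std_normal_density y = std_normal_density 0 * exp (- (y * y) / 2)" for y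
    by (simp add: std_normal_density_def power2_eq_square)
  have "std_normal_density (x $ i) = std_normal_density ((0::real^'n) $ i) * exp (- (x $ i * x $ i) / 2)" for i
    by (subst sd) (simp only: zero_index)
  then have "(\<Prod>i\<in>UNIV. std_normal_density (x $ i))
      = (\<Prod>i\<in>UNIV. std_normal_density ((0::real^'n) $ i)) * (\<Prod>i\<in>UNIV. exp (- (x $ i * x $ i) / 2))"
    unfolding prod.distrib[symmetric] by (intro prod.cong refl)
  also have "(\<Prod>i\<in>UNIV. exp (- (x $ i * x $ i) / 2)) = exp (- (x \<bullet> x) / 2)"
    by (simp add: exp_sum[symmetric] inner_vec_def sum_negf sum_divide_distrib)
  finally show ?thesis by (simp only: std_normal_vec_density_def)
qed

lemma integrable_std_normal_density: "integrable lborel std_normal_density"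
  using integrable_normal_density[of 1 0] by simp

lemma integrable_std_normal_vec_density: "integrable lborel std_normal_vec_density"
  unfolding std_normal_vec_density_def[abs_def]
  by (rule integral_lborel_vec_prod(1)) (rule integrable_std_normal_density)

lemma integral_std_normal_vec_density: "(\<integral>x. std_normal_vec_density x \<partial>(lborel :: (real^'n) measure)) = 1"
proof -
  have "(\<integral>x. std_normal_vec_density x \<partial>(lborel :: (real^'n) measure)) = (\<Prod>i\<in>(UNIV::'n set). \<integral>x. std_normal_density x \<partial>lborel)"
    unfolding std_normal_vec_density_def[abs_def]
    by (rule integral_lborel_vec_prod(2)) (rule integrable_std_normal_density)
  also have "\<dots> = 1"
    by (simp add: integral_normal_density)
  finally show ?thesis .
qed

lemma std_normal_vec_eq: "std_normal_vec = density lborel (\<lambda>x. ennreal (std_normal_vec_density x))"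
  unfolding std_normal_vec_def std_normal_vec_density_def ..

lemma sets_std_normal_vec [simp, measurable_cong]: "sets std_normal_vec = sets borel"
  by (simp add: std_normal_vec_def)

lemma space_std_normal_vec [simp]: "space std_normal_vec = UNIV"
  by (simp add: std_normal_vec_def)

lemma prob_space_std_normal_vec: "prob_space (std_normal_vec :: (real^'n) measure)"
proof
  have "emeasure (std_normal_vec :: (real^'n) measure) UNIV = (\<integral>\<^sup>+x. ennreal (std_normal_vec_density x) \<partial>(lborel :: (real^'n) measure))"
    by (simp add: std_normal_vec_eq emeasure_density)
  also have "\<dots> = ennreal (\<integral>x. std_normal_vec_density x \<partial>(lborel :: (real^'n) measure))"
    by (intro nn_integral_eq_integral integrable_std_normal_vec_density) auto
  finally show "emeasure (std_normal_vec :: (real^'n) measure) (space std_normal_vec) = 1"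
    by (simp add: integral_std_normal_vec_density)
qed

lemma char_std_normal_vec:
  fixes u :: "real^'n"
  shows "(\<integral>x. iexp (u \<bullet> x) \<partial>std_normal_vec) = complex_of_real (exp (- (u \<bullet> u) / 2))"
proof -
  have int: "integrable lborel (\<lambda>x. std_normal_density x *\<^sub>R iexp (t * x))" for t
    by (rule Bochner_Integration.integrable_bound[OF integrable_std_normal_density])
       (auto intro!: AE_I2)
  have one: "(\<integral>x. std_normal_density x *\<^sub>R iexp (t * x) \<partial>lborel) = complex_of_real (exp (- t\<^sup>2 / 2))" for t
    using fun_cong[OF char_std_normal_distribution, of t]
    by (simp add: char_def integral_density)
  have "(\<integral>x. iexp (u \<bullet> x) \<partial>std_normal_vec) = (\<integral>x. std_normal_vec_density x *\<^sub>R iexp (u \<bullet> x) \<partial>lborel)"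
    unfolding std_normal_vec_eq by (subst integral_density) auto
  also have "\<dots> = (\<integral>x. (\<Prod>i\<in>UNIV. std_normal_density (x $ i) *\<^sub>R iexp (u $ i * x $ i)) \<partial>lborel)"
    by (simp add: std_normal_vec_density_def inner_vec_def scaleR_conv_of_real prod.distrib
        exp_sum[symmetric] sum_distrib_left)
  also have "\<dots> = (\<Prod>i\<in>UNIV. \<integral>x. std_normal_density x *\<^sub>R iexp (u $ i * x) \<partial>lborel)"
    by (rule integral_lborel_vec_prod) (rule int)
  also have "\<dots> = (\<Prod>i\<in>UNIV. complex_of_real (exp (- (u $ i)\<^sup>2 / 2)))"
    by (simp only: one)
  also have "\<dots> = complex_of_real (exp (- (u \<bullet> u) / 2))"
    by (simp add: inner_vec_def power2_eq_square exp_sum[symmetric] sum_negf sum_divide_distrib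
        flip: of_real_prod)
  finally show ?thesis .
qed

text \<open>The positive part of \<open>g - f n\<close> is dominated by \<open>g\<close> and tends
  to 0; equal total masses make the L1 distance twice its integral.\<close>

lemma scheffe:
  fixes f :: "nat \<Rightarrow> 'a \<Rightarrow> real"
  assumes int: "\<And>n. integrable M (f n)" "integrable M g"
    and nonneg: "\<And>n x. 0 \<le> f n x" "\<And>x. 0 \<le> g x"
    and eq: "\<And>n. (\<integral>x. f n x \<partial>M) = (\<integral>x. g x \<partial>M)"
    and lim: "\<And>x. (\<lambda>n. f n x) \<longlonglongrightarrow> g x"
  shows "(\<lambda>n. \<integral>x. \<bar>f n x - g x\<bar> \<partial>M) \<longlonglongrightarrow> 0"
proof -
  have [measurable]: "f n \<in> borel_measurable M" "g \<in> borel_measurable M" for n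
    using int by auto
  have int_max: "integrable M (\<lambda>x. max 0 (g x - f n x))" for n
    by (rule Bochner_Integration.integrable_bound[OF int(2)]) (auto simp: nonneg)
  have "(\<lambda>n. \<integral>x. max 0 (g x - f n x) \<partial>M) \<longlonglongrightarrow> (\<integral>x. 0 \<partial>M)"
  proof (rule integral_dominated_convergence[where w=g])
    show "AE x in M. (\<lambda>n. max 0 (g x - f n x)) \<longlonglongrightarrow> 0"
    proof (intro AE_I2)
      fix x
      show "(\<lambda>n. max 0 (g x - f n x)) \<longlonglongrightarrow> 0"
        using tendsto_max[OF tendsto_const[of 0] tendsto_diff[OF tendsto_const[of "g x"] lim[of x]]] by simp
    qed
  qed (auto simp: nonneg int)
  moreover have "(\<integral>x. \<bar>f n x - g x\<bar> \<partial>M) = 2 * (\<integral>x. max 0 (g x - f n x) \<partial>M)" for n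
  proof -
    have "(\<integral>x. \<bar>f n x - g x\<bar> \<partial>M) = (\<integral>x. (f n x - g x) + 2 * max 0 (g x - f n x) \<partial>M)"
      by (intro Bochner_Integration.integral_cong) (auto simp: max_def abs_if)
    also have "\<dots> = 2 * (\<integral>x. max 0 (g x - f n x) \<partial>M)"
      using int int_max eq by simp
    finally show ?thesis .
  qed
  ultimately show ?thesis using tendsto_mult_right_zero[of "\<lambda>n. \<integral>x. max 0 (g x - f n x) \<partial>M" sequentially 2] by simp
qed

lemma integrable_bounded_prob:
  fixes f :: "'a \<Rightarrow> 'b::{banach,second_countable_topology}"
  assumes "prob_space M" "f \<in> borel_measurable M" "\<And>x. norm (f x) \<le> B"
  shows "integrable M f"
proof -
  interpret prob_space M by fact
  show ?thesis by (rule integrable_const_bound[where B=B]) (use assms in auto)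
qed

text \<open>The density of the law of a vector perturbed by an independent standard normal one.\<close>

definition smoothed_density :: "(real^'n) measure \<Rightarrow> real^'n \<Rightarrow> real" where
  "smoothed_density \<nu> y = (\<integral>x. std_normal_vec_density (y - x) \<partial>\<nu>)"

text \<open>Fourier inversion without an inversion theorem: exp(-|y - x|^2/2) is the mean of
  \<open>iexp (u \<bullet> (x - y))\<close> over a standard normal \<open>u\<close>, and Fubini
  moves the integral over \<open>\<nu>\<close> inside. Hence the smoothed density depends on
  \<open>\<nu>\<close> only through its characteristic function.\<close>

lemma smoothed_density_char:
  fixes \<nu> :: "(real^'n) measure"
  assumes "prob_space \<nu>" and [measurable_cong]: "sets \<nu> = sets borel"
  shows "complex_of_real (smoothed_density \<nu> y) = complex_of_real (std_normal_vec_density (0::real^'n)) *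
    (\<integral>u. iexp (- (u \<bullet> y)) * (\<integral>x. iexp (u \<bullet> x) \<partial>\<nu>) \<partial>std_normal_vec)"
proof -
  interpret nu: prob_space \<nu> by fact
  interpret Z: prob_space "std_normal_vec :: (real^'n) measure" by (rule prob_space_std_normal_vec)
  interpret pair_prob_space \<nu> "std_normal_vec :: (real^'n) measure" ..
  define c where "c = complex_of_real (std_normal_vec_density (0::real^'n))"
  have "complex_of_real (smoothed_density \<nu> y) = (\<integral>x. c * (\<integral>u. iexp (u \<bullet> (x - y)) \<partial>std_normal_vec) \<partial>\<nu>)"
    unfolding smoothed_density_def integral_complex_of_real[symmetric]
  proof (intro Bochner_Integration.integral_cong refl)
    fix x
    have "(\<integral>u. iexp (u \<bullet> (x - y)) \<partial>std_normal_vec) = complex_of_real (exp (- ((y - x) \<bullet> (y - x)) / 2))"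
      using char_std_normal_vec[of "x - y"] by (simp add: inner_commute inner_diff_left inner_diff_right)
    then show "complex_of_real (std_normal_vec_density (y - x)) = c * (\<integral>u. iexp (u \<bullet> (x - y)) \<partial>std_normal_vec)"
      by (subst std_normal_vec_density_eq) (simp add: c_def)
  qed
  also have "\<dots> = c * (\<integral>x. (\<integral>u. iexp (u \<bullet> (x - y)) \<partial>std_normal_vec) \<partial>\<nu>)" by simp
  also have "(\<integral>x. (\<integral>u. iexp (u \<bullet> (x - y)) \<partial>std_normal_vec) \<partial>\<nu>)
      = (\<integral>u. (\<integral>x. iexp (u \<bullet> (x - y)) \<partial>\<nu>) \<partial>std_normal_vec)"
    by (rule Fubini_integral[symmetric], rule integrable_const_bound[where B=1]) (auto)
  also have "\<dots> = (\<integral>u. iexp (- (u \<bullet> y)) * (\<integral>x. iexp (u \<bullet> x) \<partial>\<nu>) \<partial>std_normal_vec)"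
    by (simp add: inner_diff_right algebra_simps exp_diff exp_minus divide_inverse)
  finally show ?thesis by (simp add: c_def)
qed

text \<open>Substitute \<open>z = y - x\<close> and exchange the integrals. \<open>F\<close> is
  integrable because, for each \<open>x\<close>, its absolute value integrates to at most
  \<open>B\<close> over \<open>y\<close>.\<close>

lemma smoothed_integral:
  fixes \<nu> :: "(real^'n) measure" and g :: "real^'n \<Rightarrow> real"
  assumes "prob_space \<nu>" and sets[measurable_cong]: "sets \<nu> = sets borel"
    and [measurable]: "g \<in> borel_measurable borel" and bd: "\<And>x. \<bar>g x\<bar> \<le> B"
  shows "integrable lborel (\<lambda>y. g y * smoothed_density \<nu> y)"
    and "(\<integral>x. (\<integral>z. g (x + z) \<partial>std_normal_vec) \<partial>\<nu>) = (\<integral>y. g y * smoothed_density \<nu> y \<partial>lborel)"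
proof -
  interpret nu: prob_space \<nu> by fact
  interpret pair_sigma_finite \<nu> "lborel :: (real^'n) measure" ..
  have shift: "(\<integral>y. k (y - x) \<partial>lborel) = (\<integral>y. k y \<partial>lborel)"
    if "k \<in> borel_measurable borel" for k :: "real^'n \<Rightarrow> real" and x
  proof -
    have "(\<integral>y. k y \<partial>lborel) = (\<integral>y. k y \<partial>distr lborel borel ((+) (-x)))" by (simp add: lborel_distr_plus)
    also have "\<dots> = (\<integral>y. k (y - x) \<partial>lborel)" using that by (subst integral_distr) auto
    finally show ?thesis ..
  qed
  have int_shift: "integrable lborel (\<lambda>y. k (y - x))"
    if "integrable lborel k" for k :: "real^'n \<Rightarrow> real" and x
  proof -
    have m: "k \<in> borel_measurable borel" using borel_measurable_integrable[OF that] by simp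
    have "integrable (distr lborel borel ((+) (-x))) k" using that by (simp add: lborel_distr_plus)
    then show ?thesis using m by (subst (asm) integrable_distr_eq) auto
  qed
  define F where "F = (\<lambda>(x, y). g y * std_normal_vec_density (y - x :: real^'n))"
  have F[measurable]: "F \<in> borel_measurable (\<nu> \<Otimes>\<^sub>M lborel)"
    unfolding F_def by measurable
  have B: "0 \<le> B" using bd[of 0] by linarith
  have intF: "integrable (\<nu> \<Otimes>\<^sub>M lborel) F"
  proof (rule Fubini_integrable)
    show "F \<in> borel_measurable (\<nu> \<Otimes>\<^sub>M lborel)" by (rule F)
    show "AE x in \<nu>. integrable lborel (\<lambda>y. F (x, y))"
    proof (intro AE_I2)
      fix x :: "real^'n"
      have i: "integrable lborel (\<lambda>y. B * std_normal_vec_density (y - x))"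
        using int_shift[OF integrable_std_normal_vec_density, of x] by simp
      show "integrable lborel (\<lambda>y. F (x, y))"
        unfolding F_def
        by (rule Bochner_Integration.integrable_bound[OF i])
           (auto simp: abs_mult intro!: AE_I2 mult_right_mono order_trans[OF bd abs_ge_self])
    qed
    show "integrable \<nu> (\<lambda>x. \<integral>y. norm (F (x, y)) \<partial>lborel)"
    proof (rule nu.integrable_const_bound[where B=B])
      show "AE x in \<nu>. norm (\<integral>y. norm (F (x, y)) \<partial>lborel) \<le> B"
      proof (intro AE_I2)
        fix x :: "real^'n"
        have "(\<integral>y. norm (F (x, y)) \<partial>lborel) \<le> (\<integral>y. B * std_normal_vec_density (y - x) \<partial>lborel)"
          using B int_shift[OF integrable_std_normal_vec_density, of x]
          by (intro integral_mono') (auto simp: F_def abs_mult intro!: mult_right_mono bd)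
        also have "\<dots> = B" by (simp add: shift integral_std_normal_vec_density)
        finally show "norm (\<integral>y. norm (F (x, y)) \<partial>lborel) \<le> B" by simp
      qed
    qed measurable
  qed
  have eq: "(\<integral>x. F (x, y) \<partial>\<nu>) = g y * smoothed_density \<nu> y" for y
    by (simp add: F_def smoothed_density_def)
  show "integrable lborel (\<lambda>y. g y * smoothed_density \<nu> y)"
    using integrable_snd[of "\<lambda>x y. F (x, y)"] intF unfolding eq[symmetric] by simp
  have "(\<integral>x. (\<integral>z. g (x + z) \<partial>std_normal_vec) \<partial>\<nu>) = (\<integral>x. (\<integral>y. F (x, y) \<partial>lborel) \<partial>\<nu>)"
  proof (rule Bochner_Integration.integral_cong[OF refl])
    fix x
    have "(\<integral>z. g (x + z) \<partial>std_normal_vec) = (\<integral>z. std_normal_vec_density z * g (x + z) \<partial>lborel)"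
      unfolding std_normal_vec_eq by (subst integral_density) auto
    also have "\<dots> = (\<integral>y. F (x, y) \<partial>lborel)"
      using shift[of "\<lambda>z. std_normal_vec_density z * g (x + z)" x] by (simp add: F_def mult.commute)
    finally show "(\<integral>z. g (x + z) \<partial>std_normal_vec) = (\<integral>y. F (x, y) \<partial>lborel)" .
  qed
  also have "\<dots> = (\<integral>y. (\<integral>x. F (x, y) \<partial>\<nu>) \<partial>lborel)"
    using Fubini_integral[of "\<lambda>x y. F (x, y)"] intF by simp
  finally show "(\<integral>x. (\<integral>z. g (x + z) \<partial>std_normal_vec) \<partial>\<nu>) = (\<integral>y. g y * smoothed_density \<nu> y \<partial>lborel)"
    by (simp add: eq)
qed

text \<open>Dominated convergence in \<open>smoothed_density_char\<close> makes the densities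
  converge pointwise, and Scheffe's lemma upgrades this to convergence in total variation. Hence
  \<open>g\<close> may be any bounded measurable function, and tightness never enters.\<close>

lemma smoothed_weak_conv:
  fixes \<mu> :: "nat \<Rightarrow> (real^'n) measure" and \<nu> :: "(real^'n) measure" and g :: "real^'n \<Rightarrow> real"
  assumes p: "\<And>n. prob_space (\<mu> n)" "\<And>n. sets (\<mu> n) = sets borel"
    and q: "prob_space \<nu>" "sets \<nu> = sets borel"
    and char: "\<And>u. (\<lambda>n. \<integral>x. iexp (u \<bullet> x) \<partial>\<mu> n) \<longlonglongrightarrow> (\<integral>x. iexp (u \<bullet> x) \<partial>\<nu>)"
    and g[measurable]: "g \<in> borel_measurable borel" and bd: "\<And>x. \<bar>g x\<bar> \<le> B"
  shows "(\<lambda>n. \<integral>x. (\<integral>z. g (x + z) \<partial>std_normal_vec) \<partial>\<mu> n) \<longlonglongrightarrow> (\<integral>x. (\<integral>z. g (x + z) \<partial>std_normal_vec) \<partial>\<nu>)"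
proof -
  note p(2)[measurable_cong] q(2)[measurable_cong]
  let ?p = "\<lambda>n. smoothed_density (\<mu> n)" and ?q = "smoothed_density \<nu>"
  have B: "0 \<le> B" using bd[of 0] by linarith
  have norm_char: "norm (\<integral>x. iexp (u \<bullet> x) \<partial>M) \<le> 1" if "prob_space M" for u :: "real^'n" and M
  proof -
    interpret prob_space M by fact
    have "norm (\<integral>x. iexp (u \<bullet> x) \<partial>M) \<le> (\<integral>x. norm (iexp (u \<bullet> x)) \<partial>M)"
      by (rule integral_norm_bound)
    also have "\<dots> = 1" by (simp add: prob_space)
    finally show ?thesis .
  qed
  have meas_char[measurable]: "(\<lambda>u. \<integral>x. iexp (u \<bullet> x) \<partial>M) \<in> borel_measurable borel"
    if "prob_space M" "sets M = sets borel" for M :: "(real^'n) measure"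
  proof -
    interpret prob_space M by fact
    note that(2)[measurable_cong]
    show ?thesis by measurable
  qed
  interpret Z: prob_space "std_normal_vec :: (real^'n) measure" by (rule prob_space_std_normal_vec)
  have dens_lim: "(\<lambda>n. ?p n y) \<longlonglongrightarrow> ?q y" for y
  proof -
    have [measurable]: "(\<lambda>u. \<integral>x. iexp (u \<bullet> x) \<partial>\<mu> n) \<in> borel_measurable borel"
      "(\<lambda>u. \<integral>x. iexp (u \<bullet> x) \<partial>\<nu>) \<in> borel_measurable borel" for n
      using meas_char p q by auto
    have "(\<lambda>n. complex_of_real (?p n y)) \<longlonglongrightarrow> complex_of_real (?q y)"
      unfolding smoothed_density_char[OF p] smoothed_density_char[OF q]
    proof (intro tendsto_intros integral_dominated_convergence[where w="\<lambda>_. 1"])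
      show "AE u in std_normal_vec. (\<lambda>n. iexp (- (u \<bullet> y)) * (\<integral>x. iexp (u \<bullet> x) \<partial>\<mu> n))
          \<longlonglongrightarrow> iexp (- (u \<bullet> y)) * (\<integral>x. iexp (u \<bullet> x) \<partial>\<nu>)"
        by (intro AE_I2 tendsto_intros char)
      show "AE u in std_normal_vec. norm (iexp (- (u \<bullet> y)) * (\<integral>x. iexp (u \<bullet> x) \<partial>\<mu> n)) \<le> 1" for n
        using norm_char[OF p(1)] by (auto simp: norm_mult intro!: AE_I2)
    qed auto
    then show ?thesis by (simp add: tendsto_of_real_iff)
  qed
  have nonneg: "0 \<le> smoothed_density M y" for M y
    unfolding smoothed_density_def by simp
  have total: "integrable lborel (smoothed_density M)" "(\<integral>y. smoothed_density M y \<partial>lborel) = 1"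
    if "prob_space M" "sets M = sets borel" for M :: "(real^'n) measure"
    using smoothed_integral[OF that, of "\<lambda>_. 1" 1] prob_space.prob_space[OF that(1)] Z.prob_space by auto
  have L1: "(\<lambda>n. B * (\<integral>y. \<bar>?p n y - ?q y\<bar> \<partial>lborel)) \<longlonglongrightarrow> 0"
  proof (intro tendsto_mult_right_zero scheffe)
    show "integrable lborel (?p n)" "integrable lborel ?q" "integral\<^sup>L lborel (?p n) = integral\<^sup>L lborel ?q" for n
      using total p q by simp_all
  qed (rule nonneg dens_lim)+
  have "(\<lambda>n. (\<integral>y. g y * ?p n y \<partial>lborel) - (\<integral>y. g y * ?q y \<partial>lborel)) \<longlonglongrightarrow> 0"
  proof (rule Lim_null_comparison[OF _ L1], intro always_eventually allI)
    fix n
    have i: "integrable lborel (\<lambda>y. g y * ?p n y)" "integrable lborel (\<lambda>y. g y * ?q y)"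
      using smoothed_integral(1)[OF p g bd] smoothed_integral(1)[OF q g bd] by auto
    have ip: "integrable lborel (\<lambda>y. ?p n y - ?q y)" using total p q by auto
    have "norm ((\<integral>y. g y * ?p n y \<partial>lborel) - (\<integral>y. g y * ?q y \<partial>lborel))
        = norm (\<integral>y. g y * (?p n y - ?q y) \<partial>lborel)"
      using i by (simp add: right_diff_distrib)
    also have "\<dots> \<le> (\<integral>y. norm (g y * (?p n y - ?q y)) \<partial>lborel)" by (rule integral_norm_bound)
    also have "\<dots> \<le> (\<integral>y. B * \<bar>?p n y - ?q y\<bar> \<partial>lborel)"
      using ip B by (intro integral_mono') (auto simp: abs_mult intro!: mult_right_mono bd)
    finally show "norm ((\<integral>y. g y * ?p n y \<partial>lborel) - (\<integral>y. g y * ?q y \<partial>lborel)) \<le> B * (\<integral>y. \<bar>?p n y - ?q y\<bar> \<partial>lborel)"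
      by simp
  qed
  then show ?thesis
    unfolding smoothed_integral(2)[OF p g bd] smoothed_integral(2)[OF q g bd]
    using LIM_zero_iff by blast
qed

subsection \<open>Weak convergence and the central limit theorem\<close>

lemma LIMSEQ_double_approx:
  fixes a :: "nat \<Rightarrow> real"
  assumes "\<And>k n. \<bar>b k n - a n\<bar> \<le> e k" "\<And>k. \<bar>c k - l\<bar> \<le> e k"
    and "\<And>k. (\<lambda>n. b k n) \<longlonglongrightarrow> c k" "e \<longlonglongrightarrow> 0"
  shows "a \<longlonglongrightarrow> l"
proof (rule LIMSEQ_I)
  fix r :: real assume "0 < r"
  then have "eventually (\<lambda>k. e k < r / 3) sequentially"
    using order_tendstoD(2)[OF assms(4), of "r/3"] by simp
  then obtain k where k: "e k < r / 3" by (auto simp: eventually_sequentially)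
  obtain N where N: "\<And>n. n \<ge> N \<Longrightarrow> norm (b k n - c k) < r / 3"
    using LIMSEQ_D[OF assms(3)[of k], of "r/3"] \<open>0 < r\<close> by auto
  have "norm (a n - l) < r" if "n \<ge> N" for n
    using assms(1)[of k n] assms(2)[of k] N[OF that] k unfolding real_norm_def by linarith
  then show "\<exists>N. \<forall>n\<ge>N. norm (a n - l) < r" by blast
qed

lemma lipschitz_borel_measurable:
  fixes g :: "'a::euclidean_space \<Rightarrow> real"
  assumes "\<And>x y. \<bar>g x - g y\<bar> \<le> L * dist x y"
  shows "g \<in> borel_measurable borel"
proof (rule borel_measurable_continuous_onI)
  have "(max L 0)-lipschitz_on UNIV g"
  proof (rule lipschitz_onI)
    fix x y :: 'a
    have "L * dist x y \<le> max L 0 * dist x y" by (intro mult_right_mono) auto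
    then show "dist (g x) (g y) \<le> max L 0 * dist x y"
      using assms[of x y] by (simp add: dist_real_def)
  qed simp
  then show "continuous_on UNIV g" by (rule lipschitz_on_continuous_on)
qed

text \<open>The smoothing is removed by letting its size \<open>1 / s k\<close> tend to 0. The
  Lipschitz property makes the error at most \<open>e k\<close> uniformly over all laws, which is
  what \<open>LIMSEQ_double_approx\<close> asks for.\<close>

lemma lipschitz_weak_conv:
  fixes \<mu> :: "nat \<Rightarrow> (real^'n) measure" and \<nu> :: "(real^'n) measure" and g :: "real^'n \<Rightarrow> real"
  assumes p: "\<And>n. prob_space (\<mu> n)" "\<And>n. sets (\<mu> n) = sets borel"
    and q: "prob_space \<nu>" "sets \<nu> = sets borel"
    and char: "\<And>u. (\<lambda>n. \<integral>x. iexp (u \<bullet> x) \<partial>\<mu> n) \<longlonglongrightarrow> (\<integral>x. iexp (u \<bullet> x) \<partial>\<nu>)"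
    and bd: "\<And>x. \<bar>g x\<bar> \<le> B" and lip: "\<And>x y. \<bar>g x - g y\<bar> \<le> L * dist x y"
  shows "(\<lambda>n. \<integral>x. g x \<partial>\<mu> n) \<longlonglongrightarrow> (\<integral>x. g x \<partial>\<nu>)"
proof -
  interpret Z: prob_space "std_normal_vec :: (real^'n) measure" by (rule prob_space_std_normal_vec)
  have [measurable]: "g \<in> borel_measurable borel" by (rule lipschitz_borel_measurable[OF lip])
  have B: "0 \<le> B" using order_trans[OF abs_ge_zero bd] .
  have L: "0 \<le> L"
  proof -
    have "0 \<le> L * dist (axis undefined 1 :: real^'n) 0"
      using order_trans[OF abs_ge_zero lip] .
    moreover have "0 < dist (axis undefined 1 :: real^'n) 0" by (simp add: axis_eq_0_iff)
    ultimately show ?thesis by (simp add: zero_le_mult_iff)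
  qed
  define s where "s k = real (Suc k)" for k
  have s: "s k > 0" for k by (simp add: s_def)
  have nn: "0 \<le> L * norm z / s k" for z :: "real^'n" and k
    using L s[of k] by simp
  have mb: "norm (min (L * norm z / s k) (2 * B)) \<le> 2 * B" for z :: "real^'n" and k
    using nn[of z k] B by (simp add: min_def)
  \<comment> \<open>The cap \<open>2 * B\<close> allows dominated convergence with a constant bound,
    so that no moment of the norm of a normal vector is computed.\<close>
  define e where "e k = (\<integral>z. min (L * norm z / s k) (2 * B) \<partial>(std_normal_vec :: (real^'n) measure))" for k
  have "e \<longlonglongrightarrow> (\<integral>z. 0 \<partial>(std_normal_vec :: (real^'n) measure))"
    unfolding e_def
  proof (rule integral_dominated_convergence[where w="\<lambda>_. 2 * B"])
    show "AE z in std_normal_vec. (\<lambda>k. min (L * norm (z :: real^'n) / s k) (2 * B)) \<longlonglongrightarrow> 0"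
    proof (intro AE_I2)
      fix z :: "real^'n"
      have "(\<lambda>k. L * norm z / s k) \<longlonglongrightarrow> 0"
        unfolding s_def using LIMSEQ_Suc[OF lim_const_over_n[of "L * norm z"]] by simp
      then show "(\<lambda>k. min (L * norm z / s k) (2 * B)) \<longlonglongrightarrow> 0"
        using tendsto_min[of _ 0 sequentially "\<lambda>_. 2 * B" "2 * B"] B by simp
    qed
    show "AE z in std_normal_vec. norm (min (L * norm (z :: real^'n) / s k) (2 * B)) \<le> 2 * B" for k
      using mb by (intro AE_I2)
  qed auto
  then have e0: "e \<longlonglongrightarrow> 0" by simp
  have sm: "(\<lambda>x. s k *\<^sub>R x) \<in> M \<rightarrow>\<^sub>M borel" if "sets M = sets borel" for k and M :: "(real^'n) measure"
    unfolding measurable_cong_sets[OF that refl] by (intro borel_measurable_continuous_onI continuous_intros)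
  \<comment> \<open>This is the mean of \<open>g (X + Z / s k)\<close> for \<open>X\<close> with law
    \<open>M\<close> and a standard normal \<open>Z\<close>. Scaling the law by \<open>s k\<close>
    instead of shrinking the noise leaves noise of unit size, the case of
    \<open>smoothed_weak_conv\<close>.\<close>
  define G where "G k M = (\<integral>x. (\<integral>z. g ((1 / s k) *\<^sub>R (x + z)) \<partial>std_normal_vec) \<partial>distr M borel (\<lambda>x. s k *\<^sub>R x))"
    for k and M :: "(real^'n) measure"
  have close: "\<bar>G k M - (\<integral>x. g x \<partial>M)\<bar> \<le> e k" if M: "prob_space M" "sets M = sets borel" for k M
  proof -
    interpret M: prob_space M by fact
    note M(2)[measurable_cong]
    define I where "I x = (\<integral>z. g (x + (1 / s k) *\<^sub>R z) \<partial>(std_normal_vec :: (real^'n) measure))" for x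
    have Im[measurable]: "I \<in> borel_measurable M" unfolding I_def by measurable
    have gi: "integrable std_normal_vec (\<lambda>z. g (x + (1 / s k) *\<^sub>R z))" for x
      by (rule Z.integrable_const_bound[where B=B]) (auto simp: bd)
    have Ig: "\<bar>I x - g x\<bar> \<le> e k" for x
    proof -
      have "I x - g x = (\<integral>z. g (x + (1 / s k) *\<^sub>R z) - g x \<partial>(std_normal_vec :: (real^'n) measure))"
        using gi Z.prob_space by (simp add: I_def)
      also have "\<bar>\<dots>\<bar> \<le> (\<integral>z. \<bar>g (x + (1 / s k) *\<^sub>R z) - g x\<bar> \<partial>(std_normal_vec :: (real^'n) measure))"
        using integral_norm_bound[of std_normal_vec "\<lambda>z. g (x + (1 / s k) *\<^sub>R z) - g x"] by simp
      also have "\<dots> \<le> e k"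
        unfolding e_def
      proof (rule integral_mono')
        show "integrable std_normal_vec (\<lambda>z :: real^'n. min (L * norm z / s k) (2 * B))"
        proof (rule Z.integrable_const_bound[where B="2 * B"])
          show "AE z in std_normal_vec. norm (min (L * norm (z :: real^'n) / s k) (2 * B)) \<le> 2 * B"
            using mb by (intro AE_I2)
        qed auto
        fix z :: "real^'n"
        have "\<bar>g (x + (1 / s k) *\<^sub>R z) - g x\<bar> \<le> 2 * B"
          using bd[of x] bd[of "x + (1 / s k) *\<^sub>R z"] by linarith
        moreover have "\<bar>g (x + (1 / s k) *\<^sub>R z) - g x\<bar> \<le> L * norm z / s k"
          using lip[of "x + (1 / s k) *\<^sub>R z" x] s[of k] by (simp add: dist_norm)
        ultimately show "\<bar>g (x + (1 / s k) *\<^sub>R z) - g x\<bar> \<le> min (L * norm z / s k) (2 * B)" by simp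
      qed (use nn B in simp)
      finally show ?thesis .
    qed
    have intI: "integrable M I"
    proof (rule M.integrable_const_bound[where B="B + e k"])
      show "AE x in M. norm (I x) \<le> B + e k"
        using Ig bd by (intro AE_I2) (smt (verit) real_norm_def)
    qed simp
    have intg: "integrable M g"
      by (rule M.integrable_const_bound[where B=B]) (auto simp: bd)
    have "G k M = (\<integral>x. I x \<partial>M)"
      unfolding G_def I_def using s[of k] by (subst integral_distr) (auto simp: scaleR_add_right)
    then have "\<bar>G k M - (\<integral>x. g x \<partial>M)\<bar> = \<bar>\<integral>x. I x - g x \<partial>M\<bar>"
      using intI intg by simp
    also have "\<dots> \<le> (\<integral>x. \<bar>I x - g x\<bar> \<partial>M)"
      using integral_norm_bound[of M "\<lambda>x. I x - g x"] by simp
    also have "\<dots> \<le> (\<integral>x. e k \<partial>M)"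
      using intI intg by (intro integral_mono) (auto intro: Ig)
    finally show ?thesis by (simp add: M.prob_space)
  qed
  show ?thesis
  proof (rule LIMSEQ_double_approx[where b="\<lambda>k n. G k (\<mu> n)" and c="\<lambda>k. G k \<nu>" and e=e])
    show "(\<lambda>n. G k (\<mu> n)) \<longlonglongrightarrow> G k \<nu>" for k
      unfolding G_def
    proof (rule smoothed_weak_conv[where B=B])
      fix u :: "real^'n"
      have "(\<integral>x. iexp (u \<bullet> x) \<partial>distr M borel (\<lambda>x. s k *\<^sub>R x)) = (\<integral>x. iexp ((s k *\<^sub>R u) \<bullet> x) \<partial>M)"
        if "sets M = sets borel" for M
        by (subst integral_distr[OF sm[OF that]]) auto
      then show "(\<lambda>n. \<integral>x. iexp (u \<bullet> x) \<partial>distr (\<mu> n) borel (\<lambda>x. s k *\<^sub>R x))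
          \<longlonglongrightarrow> (\<integral>x. iexp (u \<bullet> x) \<partial>distr \<nu> borel (\<lambda>x. s k *\<^sub>R x))"
        using char[of "s k *\<^sub>R u"] p(2) q(2) by simp
    next
      show "prob_space (distr (\<mu> n) borel (\<lambda>x. s k *\<^sub>R x))" for n
        by (intro prob_space.prob_space_distr p sm)
      show "prob_space (distr \<nu> borel (\<lambda>x. s k *\<^sub>R x))"
        by (intro prob_space.prob_space_distr q sm)
    qed (auto simp: bd)
  qed (use close p q e0 in auto)
qed

text \<open>The bound \<open>lower\<close> is proved for arbitrary bounded continuous functions;
  applied to \<open>g\<close> and to \<open>- g\<close> it gives the limit.\<close>

lemma weak_conv_vec_lipschitzI:
  fixes \<mu> :: "nat \<Rightarrow> (real^'n) measure" and \<nu> :: "(real^'n) measure"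
  assumes p: "\<And>n. prob_space (\<mu> n)" "\<And>n. sets (\<mu> n) = sets borel"
    and q: "prob_space \<nu>" "sets \<nu> = sets borel"
    and conv: "\<And>g B L. (\<And>x. \<bar>g x\<bar> \<le> B) \<Longrightarrow> (\<And>x y. \<bar>g x - g y\<bar> \<le> L * dist x y) \<Longrightarrow>
      (\<lambda>n. \<integral>x. g x \<partial>\<mu> n) \<longlonglongrightarrow> (\<integral>x. g x \<partial>\<nu>)"
  shows "weak_conv_vec \<mu> \<nu>"
proof -
  interpret q: prob_space \<nu> by fact
  have int: "integrable M g" if "prob_space M" "sets M = sets borel" "g \<in> borel_measurable borel"
    "\<And>x. \<bar>g x\<bar> \<le> B" for M and g :: "real^'n \<Rightarrow> real" and B
    using that by (intro integrable_bounded_prob[where B=B]) (auto cong: measurable_cong_sets)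
  text \<open>Lower semicontinuity, via the Lipschitz regularisations \<open>inf\<^sub>y g y + k dist x y\<close>, which
    increase to \<open>g\<close>.\<close>
  have lower: "\<forall>\<^sub>F n in sequentially. (\<integral>x. g x \<partial>\<nu>) - r < (\<integral>x. g x \<partial>\<mu> n)"
    if cont: "continuous_on UNIV g" and bd: "\<And>x. \<bar>g x\<bar> \<le> B" and r: "0 < r"
    for g :: "real^'n \<Rightarrow> real" and B r
  proof -
    have gm[measurable]: "g \<in> borel_measurable borel" using cont by (rule borel_measurable_continuous_onI)
    define gk where "gk k x = (INF y. g y + real k * dist x y)" for k :: nat and x
    have bdd: "bdd_below (range (\<lambda>y. g y + real k * dist x y))" for k x
    proof (rule bdd_belowI2[where m="-B"])
      fix y
      have "0 \<le> real k * dist x y" by simp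
      then show "- B \<le> g y + real k * dist x y" using bd[of y] by linarith
    qed
    have gk_le: "gk k x \<le> g y + real k * dist x y" for k x y
      unfolding gk_def by (rule cINF_lower[OF bdd]) simp
    have gk_ge: "c \<le> gk k x" if "\<And>y. c \<le> g y + real k * dist x y" for c k x
      unfolding gk_def by (rule cINF_greatest) (auto intro: that)
    have gk_bd: "\<bar>gk k x\<bar> \<le> B" for k x
    proof -
      have "- B \<le> gk k x"
      proof (rule gk_ge)
        fix y
        have "0 \<le> real k * dist x y" by simp
        then show "- B \<le> g y + real k * dist x y" using bd[of y] by linarith
      qed
      moreover have "gk k x \<le> B" using gk_le[of k x x] bd[of x] by simp
      ultimately show ?thesis by simp
    qed
    have gk_half: "gk k x \<le> gk k x' + real k * dist x x'" for k x x'
    proof -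
      have "gk k x - real k * dist x x' \<le> gk k x'"
      proof (rule gk_ge)
        fix y
        have "real k * dist x y \<le> real k * dist x x' + real k * dist x' y"
          unfolding distrib_left[symmetric] by (intro mult_left_mono dist_triangle) simp
        then show "gk k x - real k * dist x x' \<le> g y + real k * dist x' y"
          using gk_le[of k x y] by linarith
      qed
      then show ?thesis by linarith
    qed
    have gk_lip: "\<bar>gk k x - gk k y\<bar> \<le> real k * dist x y" for k x y
      using gk_half[of k x y] gk_half[of k y x] by (simp add: dist_commute abs_le_iff)
    have gk_lim: "(\<lambda>k. gk k x) \<longlonglongrightarrow> g x" for x
    proof (rule LIMSEQ_I)
      fix e :: real assume e: "0 < e"
      obtain \<delta> where \<delta>: "\<delta> > 0" "\<And>y. dist y x < \<delta> \<Longrightarrow> dist (g y) (g x) < e / 2"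
        using cont e unfolding continuous_on_iff by (metis UNIV_I half_gt_zero)
      \<comment> \<open>From this index on, the penalty outside the \<open>\<delta>\<close>-ball is
        at least \<open>2 * B\<close>, the largest possible gap between two values of
        \<open>g\<close>.\<close>
      obtain N :: nat where N: "2 * B / \<delta> \<le> real N" using real_arch_simple by blast
      have "norm (gk k x - g x) < e" if k: "N \<le> k" for k
      proof -
        have "g x - e / 2 \<le> gk k x"
        proof (rule gk_ge)
          fix y
          show "g x - e / 2 \<le> g y + real k * dist x y"
          proof (cases "dist y x < \<delta>")
            case True
            have "0 \<le> real k * dist x y" by simp
            with \<delta>(2)[OF True] show ?thesis unfolding dist_real_def by linarith
          next
            case False
            have "2 * B \<le> real N * \<delta>" using N \<delta>(1) by (simp add: field_simps)
            also have "\<dots> \<le> real k * dist x y"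
              using k False \<delta>(1) by (intro mult_mono) (auto simp: dist_commute)
            finally show ?thesis using bd[of x] bd[of y] e by linarith
          qed
        qed
        then show ?thesis using gk_le[of k x x] e by simp
      qed
      then show "\<exists>N. \<forall>k\<ge>N. norm (gk k x - g x) < e" by blast
    qed
    have gkm[measurable]: "gk k \<in> borel_measurable borel" for k
      by (rule lipschitz_borel_measurable[OF gk_lip])
    have "(\<lambda>k. \<integral>x. gk k x \<partial>\<nu>) \<longlonglongrightarrow> (\<integral>x. g x \<partial>\<nu>)"
      by (rule integral_dominated_convergence[where w="\<lambda>_. B"])
         (use gk_lim gk_bd in \<open>auto simp only: measurable_cong_sets[OF q(2) refl] gm gkm real_norm_def intro!: AE_I2 q.integrable_const\<close>)
    then have "\<forall>\<^sub>F k in sequentially. (\<integral>x. g x \<partial>\<nu>) - r / 2 < (\<integral>x. gk k x \<partial>\<nu>)"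
      using order_tendstoD(1) r by fastforce
    then obtain k where k: "(\<integral>x. g x \<partial>\<nu>) - r / 2 < (\<integral>x. gk k x \<partial>\<nu>)"
      by (auto simp: eventually_sequentially)
    have "(\<lambda>n. \<integral>x. gk k x \<partial>\<mu> n) \<longlonglongrightarrow> (\<integral>x. gk k x \<partial>\<nu>)"
      by (rule conv[OF gk_bd gk_lip])
    then have "\<forall>\<^sub>F n in sequentially. (\<integral>x. gk k x \<partial>\<nu>) - r / 2 < (\<integral>x. gk k x \<partial>\<mu> n)"
      using order_tendstoD(1) r by fastforce
    then show ?thesis
    proof eventually_elim
      case (elim n)
      have "(\<integral>x. gk k x \<partial>\<mu> n) \<le> (\<integral>x. g x \<partial>\<mu> n)"
        by (intro integral_mono int[OF p gkm gk_bd] int[OF p gm bd]) (use gk_le[of k x x for x] in simp)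
      with elim k show ?case by linarith
    qed
  qed
  show ?thesis
    unfolding weak_conv_vec_def
  proof (intro allI impI)
    fix g :: "real^'n \<Rightarrow> real"
    assume cont: "continuous_on UNIV g" and "bounded (range g)"
    then obtain B where bd: "\<And>x. \<bar>g x\<bar> \<le> B" by (auto simp: bounded_iff)
    show "(\<lambda>n. \<integral>x. g x \<partial>\<mu> n) \<longlonglongrightarrow> (\<integral>x. g x \<partial>\<nu>)"
    proof (rule tendstoI)
      fix e :: real assume e: "0 < e"
      have "\<forall>\<^sub>F n in sequentially. (\<integral>x. - g x \<partial>\<nu>) - e < (\<integral>x. - g x \<partial>\<mu> n)"
        by (rule lower[of "\<lambda>x. - g x" B e]) (auto intro!: continuous_intros cont simp: bd e)
      then show "\<forall>\<^sub>F n in sequentially. dist (\<integral>x. g x \<partial>\<mu> n) (\<integral>x. g x \<partial>\<nu>) < e"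
        using lower[OF cont bd e]
        by eventually_elim (auto simp: dist_real_def)
    qed
  qed
qed

section \<open>Characteristic functions of normal laws and of normalised sums\<close>

lemma sets_multi_normal [simp]: "sets (multi_normal b C) = sets borel"
  by (simp add: multi_normal_def)

lemma affine_measurable_std_normal_vec:
  "(\<lambda>x::real^'n. b + A *v x) \<in> std_normal_vec \<rightarrow>\<^sub>M borel"
proof -
  have "continuous_on UNIV (\<lambda>x::real^'n. b + A *v x)"
    by (intro continuous_intros linear_continuous_on) simp
  from borel_measurable_continuous_onI[OF this] show ?thesis
    by (simp cong: measurable_cong_sets)
qed

lemma prob_space_multi_normal: "prob_space (multi_normal b C)"
  unfolding multi_normal_def
  by (intro prob_space.prob_space_distr prob_space_std_normal_vec affine_measurable_std_normal_vec)

text \<open>Only \<open>A ** transpose A = C\<close> enters, through |A^T u|^2 =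
  \<open>u \<bullet> (C *v u)\<close>, so the value is the same for every admissible
  \<open>A\<close>.\<close>

lemma char_multi_normal:
  fixes C :: "real^'n^'n"
  assumes "psd C"
  shows "(\<integral>x. iexp (u \<bullet> x) \<partial>multi_normal 0 C) = complex_of_real (exp (- (u \<bullet> (C *v u)) / 2))"
proof -
  define A where "A = (SOME A :: real^'n^'n. A ** transpose A = C)"
  have A: "A ** transpose A = C"
    unfolding A_def by (rule someI_ex[OF psd_sqrt[OF assms]])
  have "(\<integral>x. iexp (u \<bullet> x) \<partial>multi_normal 0 C) = (\<integral>z. iexp (u \<bullet> (0 + A *v z)) \<partial>std_normal_vec)"
    unfolding multi_normal_def A_def[symmetric]
    by (rule integral_distr[OF affine_measurable_std_normal_vec]) simp
  also have "\<dots> = (\<integral>z. iexp ((transpose A *v u) \<bullet> z) \<partial>std_normal_vec)"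
    by (simp add: dot_lmul_matrix vector_transpose_matrix)
  also have "\<dots> = complex_of_real (exp (- ((transpose A *v u) \<bullet> (transpose A *v u)) / 2))"
    by (rule char_std_normal_vec)
  also have "(transpose A *v u) \<bullet> (transpose A *v u) = u \<bullet> (C *v u)"
    by (simp add: A[symmetric] dot_lmul_matrix vector_transpose_matrix matrix_vector_mul_assoc[symmetric])
  finally show ?thesis .
qed

text \<open>The variance may vanish, since the limit covariance may be singular in the direction
  considered; then all \<open>Y i\<close> are 0 almost surely and both sides are 1.\<close>

lemma (in prob_space) clt_char_real:
  fixes Y :: "nat \<Rightarrow> 'a \<Rightarrow> real"
  assumes indep: "indep_vars (\<lambda>_. borel) Y UNIV"
    and distr: "\<And>i. distr M borel (Y i) = distr M borel (Y 0)"
    and sq: "integrable M (\<lambda>\<omega>. (Y 0 \<omega>)\<^sup>2)"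
    and mean: "expectation (Y 0) = 0"
    and var: "expectation (\<lambda>\<omega>. (Y 0 \<omega>)\<^sup>2) = v"
  shows "(\<lambda>n. \<integral>\<omega>. iexp ((\<Sum>i<n. Y i \<omega>) / sqrt (real n)) \<partial>M) \<longlonglongrightarrow> complex_of_real (exp (- v / 2))"
proof -
  have [measurable]: "Y i \<in> borel_measurable M" for i
    using indep by (simp add: indep_vars_def2)
  have tr: "expectation (\<lambda>\<omega>. k (Y i \<omega>)) = expectation (\<lambda>\<omega>. k (Y 0 \<omega>))"
    if "k \<in> borel_measurable borel" for k :: "real \<Rightarrow> real" and i
    using that integral_distr[of "Y i" M borel k] integral_distr[of "Y 0" M borel k] distr[of i] by simp
  have tri: "integrable M (\<lambda>\<omega>. (Y i \<omega>)\<^sup>2)" for i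
    using integrable_distr_eq[of "Y i" M borel "\<lambda>y. y\<^sup>2"] integrable_distr_eq[of "Y 0" M borel "\<lambda>y. y\<^sup>2"] distr[of i] sq
    by simp
  have mean': "expectation (Y i) = 0" for i using tr[of "\<lambda>y. y" i] mean by simp
  have var': "expectation (\<lambda>\<omega>. (Y i \<omega>)\<^sup>2) = v" for i using tr[of "\<lambda>y. y\<^sup>2" i] var by simp
  have "v \<ge> 0" unfolding var[symmetric] by simp
  show ?thesis
  proof (cases "v = 0")
    case True
    have "AE \<omega> in M. Y i \<omega> = 0" for i
      using integral_nonneg_eq_0_iff_AE[OF tri[of i]] var'[of i] True by simp
    then have "AE \<omega> in M. \<forall>i. Y i \<omega> = 0" by (simp add: AE_all_countable)
    then have "AE \<omega> in M. iexp ((\<Sum>i<n. Y i \<omega>) / sqrt (real n)) = 1" for n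
      by eventually_elim simp
    then have "(\<integral>\<omega>. iexp ((\<Sum>i<n. Y i \<omega>) / sqrt (real n)) \<partial>M) = (\<integral>\<omega>. 1 \<partial>M)" for n
      by (intro integral_cong_AE) auto
    then show ?thesis using True by (simp add: prob_space)
  next
    case False
    with \<open>v \<ge> 0\<close> have v: "v > 0" by simp
    define \<sigma> where "\<sigma> = sqrt v"
    have \<sigma>: "\<sigma> > 0" "\<sigma>\<^sup>2 = v" using v by (auto simp: \<sigma>_def)
    let ?D = "\<lambda>n. distr M borel (\<lambda>x. (\<Sum>i<n. Y i x) / sqrt (real n * \<sigma>\<^sup>2))"
    have "weak_conv_m ?D std_normal_distribution"
      by (rule central_limit_theorem_zero_mean[OF indep mean' \<sigma>(1) tri _ distr])
         (simp add: mean' var' \<sigma>(2))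
    \<comment> \<open>Evaluation at \<open>\<sigma>\<close> undoes the division by the standard
      deviation.\<close>
    then have "(\<lambda>n. char (?D n) \<sigma>) \<longlonglongrightarrow> char std_normal_distribution \<sigma>"
      by (intro levy_continuity1 real_dist_normal_dist real_distribution_distr) auto
    moreover have "char (?D n) \<sigma> = (\<integral>\<omega>. iexp ((\<Sum>i<n. Y i \<omega>) / sqrt (real n)) \<partial>M)" for n
    proof -
      have "\<sigma> * (y / sqrt (real n * \<sigma>\<^sup>2)) = y / sqrt (real n)" for y
        using \<sigma>(1) by (simp add: real_sqrt_mult)
      then show ?thesis
        unfolding char_def by (subst integral_distr) (auto simp flip: of_real_mult)
    qed
    ultimately show ?thesis using \<sigma>(2) by (simp add: char_std_normal_distribution)
  qed
qed

text \<open>The Cramer-Wold device on the level of characteristic functions: for fixed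
  \<open>u\<close> only the scalars \<open>u \<bullet> X i \<omega>\<close> matter.\<close>

lemma (in prob_space) clt_char_vec:
  fixes X :: "nat \<Rightarrow> 'a \<Rightarrow> real^'n"
  assumes indep: "indep_vars (\<lambda>_. borel) X UNIV"
    and distr: "\<And>i. distr M borel (X i) = distr M borel (X 0)"
    and sq: "integrable M (\<lambda>\<omega>. (u \<bullet> X 0 \<omega>)\<^sup>2)"
    and mean: "expectation (\<lambda>\<omega>. u \<bullet> X 0 \<omega>) = 0"
    and var: "expectation (\<lambda>\<omega>. (u \<bullet> X 0 \<omega>)\<^sup>2) = v"
  shows "(\<lambda>n. \<integral>\<omega>. iexp (u \<bullet> ((1 / sqrt (real n)) *\<^sub>R (\<Sum>i<n. X i \<omega>))) \<partial>M)
    \<longlonglongrightarrow> complex_of_real (exp (- v / 2))"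
proof -
  have [measurable]: "X i \<in> borel_measurable M" for i
    using indep by (simp add: indep_vars_def2)
  have "distr M borel (\<lambda>\<omega>. u \<bullet> X i \<omega>) = distr (distr M borel (X i)) borel (\<lambda>x. u \<bullet> x)" for i
    by (subst distr_distr) (auto simp: comp_def)
  then have d: "distr M borel (\<lambda>\<omega>. u \<bullet> X i \<omega>) = distr M borel (\<lambda>\<omega>. u \<bullet> X 0 \<omega>)" for i
    by (simp add: distr[of i])
  have "indep_vars (\<lambda>_. borel) (\<lambda>i \<omega>. u \<bullet> X i \<omega>) UNIV"
    by (rule indep_vars_compose2[OF indep]) simp
  from clt_char_real[OF this d sq mean var]
  show ?thesis by (simp add: inner_sum_right)
qed

subsection \<open>Step sizes\<close>

text \<open>A Toeplitz argument: the head of the sum is a constant while \<open>s\<close> is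
  unbounded, and the tail is at most a small multiple of the total weight.\<close>

lemma weighted_cesaro:
  fixes w c s :: "nat \<Rightarrow> real"
  assumes w: "\<And>i. 0 \<le> w i" and ws: "\<And>n. (\<Sum>i<n. w i) \<le> C * s n" and s: "filterlim s at_top sequentially"
    and c: "c \<longlonglongrightarrow> 0"
  shows "(\<lambda>n. (\<Sum>i<n. w i * c i) / s n) \<longlonglongrightarrow> 0"
proof (rule LIMSEQ_I)
  fix r :: real assume r: "0 < r"
  define C' where "C' = max C 0 + 1"
  have C': "C' > 0" "C \<le> C'" by (auto simp: C'_def)
  define e where "e = r / (2 * C')"
  have e: "e > 0" using r C' by (simp add: e_def)
  obtain N where N: "\<And>i. i \<ge> N \<Longrightarrow> \<bar>c i\<bar> < e"
    using LIMSEQ_D[OF c e] by auto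
  define A where "A = (\<Sum>i<N. w i * \<bar>c i\<bar>)"
  have "\<forall>\<^sub>F n in sequentially. 2 * A / r + 1 < s n \<and> 1 < s n"
    using s by (auto simp: filterlim_at_top_dense intro: eventually_conj)
  then obtain N' where N': "\<And>n. n \<ge> N' \<Longrightarrow> 2 * A / r + 1 < s n \<and> 1 < s n"
    by (auto simp: eventually_sequentially)
  have "norm ((\<Sum>i<n. w i * c i) / s n - 0) < r" if n: "n \<ge> max N N'" for n
  proof -
    have sn: "2 * A / r + 1 < s n" "0 < s n" using N'[of n] n by auto
    have split: "{..<n} = {..<N} \<union> {N..<n}" "{..<N} \<inter> {N..<n} = {}" using n by auto
    have "\<bar>\<Sum>i<n. w i * c i\<bar> \<le> (\<Sum>i<n. w i * \<bar>c i\<bar>)"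
      using w by (intro order_trans[OF sum_abs] sum_mono) (simp add: abs_mult)
    also have "\<dots> = A + (\<Sum>i\<in>{N..<n}. w i * \<bar>c i\<bar>)"
      unfolding A_def split(1) by (rule sum.union_disjoint) (use split(2) in auto)
    also have "(\<Sum>i\<in>{N..<n}. w i * \<bar>c i\<bar>) \<le> (\<Sum>i\<in>{N..<n}. w i * e)"
      using N w by (intro sum_mono mult_left_mono) (auto intro: less_imp_le)
    also have "\<dots> \<le> (\<Sum>i<n. w i * e)"
      using w e by (intro sum_mono2) auto
    also have "\<dots> = (\<Sum>i<n. w i) * e" by (simp add: sum_distrib_right)
    also have "\<dots> \<le> (C' * s n) * e"
      using ws[of n] C' sn e by (intro mult_right_mono) (auto intro: order_trans mult_right_mono)
    also have "\<dots> = r / 2 * s n" using C' by (simp add: e_def)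
    finally have "\<bar>\<Sum>i<n. w i * c i\<bar> \<le> A + r / 2 * s n" by simp
    moreover have "A < r / 2 * s n" using sn r by (simp add: field_simps)
    ultimately have "\<bar>\<Sum>i<n. w i * c i\<bar> < r * s n" by (simp add: field_simps)
    then have "\<bar>\<Sum>i<n. w i * c i\<bar> / s n < r" using sn(2) by (simp only: pos_divide_less_eq)
    moreover have "norm ((\<Sum>i<n. w i * c i) / s n - 0) = \<bar>\<Sum>i<n. w i * c i\<bar> / s n"
      using sn(2) unfolding real_norm_def diff_0_right abs_divide by simp
    ultimately show ?thesis by (simp only:)
  qed
  then show "\<exists>no. \<forall>n\<ge>no. norm ((\<Sum>i<n. w i * c i) / s n - 0) < r" by blast
qed

lemma cesaro_null:
  fixes c :: "nat \<Rightarrow> real"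
  assumes "c \<longlonglongrightarrow> 0"
  shows "(\<lambda>n. (\<Sum>i<n. c i) / real n) \<longlonglongrightarrow> 0"
  using weighted_cesaro[OF _ _ filterlim_real_sequentially assms, of "\<lambda>_. 1" 1] by simp

lemma sum_inverse_sqrt_le: "(\<Sum>i<n. 1 / sqrt (real (Suc i))) \<le> 2 * sqrt (real n)"
proof (induction n)
  case (Suc n)
  have "sqrt (real n) \<le> sqrt (real (Suc n))" by simp
  then have "1 \<le> 2 * sqrt (real (Suc n)) * (sqrt (real (Suc n)) - sqrt (real n))"
  proof -
    have "1 = (sqrt (real (Suc n)) + sqrt (real n)) * (sqrt (real (Suc n)) - sqrt (real n))"
      by (simp add: algebra_simps)
    also have "\<dots> \<le> (2 * sqrt (real (Suc n))) * (sqrt (real (Suc n)) - sqrt (real n))"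
      by (intro mult_right_mono) auto
    finally show ?thesis .
  qed
  then have "1 / sqrt (real (Suc n)) \<le> 2 * (sqrt (real (Suc n)) - sqrt (real n))"
    by (simp add: field_simps)
  with Suc show ?case by simp
qed simp

text \<open>Apply \<open>weighted_cesaro\<close> with the weights
  \<open>1 / sqrt (real (Suc i))\<close>, whose sums are O(sqrt n). It turns a pointwise rate o(1 /
  sqrt i) into the o(sqrt n) wanted for an error term.\<close>

lemma sum_over_sqrt_null:
  fixes a :: "nat \<Rightarrow> real"
  assumes "(\<lambda>i. a i * sqrt (real (Suc i))) \<longlonglongrightarrow> 0"
  shows "(\<lambda>n. (\<Sum>i<n. a i) / sqrt (real n)) \<longlonglongrightarrow> 0"
proof -
  have "filterlim (\<lambda>n. sqrt (real n)) at_top sequentially"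
    by (rule filterlim_compose[OF sqrt_at_top filterlim_real_sequentially])
  from weighted_cesaro[OF _ sum_inverse_sqrt_le this assms] show ?thesis by simp
qed

text \<open>The mean value theorem bounds the increment by \<alpha> i^(\<alpha> - 1). The second
  exponent comes from the summation by parts: sqrt i times the rate i^(-\<alpha>/2) of the root mean
  square of the iterates.\<close>

lemma powr_increment_null:
  fixes \<alpha> :: real
  assumes "0 < \<alpha>" "\<alpha> < 1"
  shows "(\<lambda>i. (real (Suc i) powr \<alpha> - real i powr \<alpha>) * real i powr ((1 - \<alpha>) / 2)) \<longlonglongrightarrow> 0"
proof (rule real_tendsto_sandwich[of "\<lambda>_. 0" _ _ "\<lambda>i. \<alpha> * real i powr ((\<alpha> - 1) / 2)"])
  show "\<forall>\<^sub>F i in sequentially. 0 \<le> (real (Suc i) powr \<alpha> - real i powr \<alpha>) * real i powr ((1 - \<alpha>) / 2)"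
    using assms by (intro always_eventually allI mult_nonneg_nonneg) (auto intro!: powr_mono2)
  show "\<forall>\<^sub>F i in sequentially. (real (Suc i) powr \<alpha> - real i powr \<alpha>) * real i powr ((1 - \<alpha>) / 2)
      \<le> \<alpha> * real i powr ((\<alpha> - 1) / 2)"
    using eventually_gt_at_top[of 0]
  proof eventually_elim
    case (elim i)
    have "\<exists>z::real. z > real i \<and> z < real (Suc i) \<and> real (Suc i) powr \<alpha> - real i powr \<alpha> = (real (Suc i) - real i) * (\<alpha> * z powr (\<alpha> - 1))"
      using elim by (intro MVT2) (auto intro!: has_real_derivative_powr)
    then obtain z where z: "z > real i" "real (Suc i) powr \<alpha> - real i powr \<alpha> = \<alpha> * z powr (\<alpha> - 1)"
      by auto
    have "z powr (\<alpha> - 1) \<le> real i powr (\<alpha> - 1)"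
      using z elim assms by (intro powr_mono2') auto
    then have "(real (Suc i) powr \<alpha> - real i powr \<alpha>) * real i powr ((1 - \<alpha>) / 2)
        \<le> (\<alpha> * real i powr (\<alpha> - 1)) * real i powr ((1 - \<alpha>) / 2)"
      unfolding z(2) using assms by (intro mult_right_mono mult_left_mono) auto
    also have "\<dots> = \<alpha> * real i powr ((\<alpha> - 1) / 2)"
      by (simp add: powr_add[symmetric] field_simps)
    finally show ?case .
  qed
  have "(\<lambda>i. real i powr ((\<alpha> - 1) / 2)) \<longlonglongrightarrow> 0"
    using assms by (intro tendsto_neg_powr filterlim_real_sequentially) simp
  then show "(\<lambda>i. \<alpha> * real i powr ((\<alpha> - 1) / 2)) \<longlonglongrightarrow> 0"
    by (rule tendsto_mult_right_zero)
qed simp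

lemma powr_increment_null':
  fixes \<alpha> :: real
  assumes "0 < \<alpha>" "\<alpha> < 1"
  shows "(\<lambda>i. real (Suc i) powr \<alpha> - real i powr \<alpha>) \<longlonglongrightarrow> 0"
proof (rule real_tendsto_sandwich[OF _ _ tendsto_const powr_increment_null[OF assms]])
  show "\<forall>\<^sub>F i in sequentially. 0 \<le> real (Suc i) powr \<alpha> - real i powr \<alpha>"
    using assms by (intro always_eventually allI) (auto intro!: powr_mono2)
  show "\<forall>\<^sub>F i in sequentially. real (Suc i) powr \<alpha> - real i powr \<alpha>
      \<le> (real (Suc i) powr \<alpha> - real i powr \<alpha>) * real i powr ((1 - \<alpha>) / 2)"
    using eventually_gt_at_top[of 0]
  proof eventually_elim
    case (elim i)
    have "1 \<le> real i powr ((1 - \<alpha>) / 2)" using elim assms by (intro ge_one_powr_ge_zero) auto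
    then have "(real (Suc i) powr \<alpha> - real i powr \<alpha>) * 1 \<le> (real (Suc i) powr \<alpha> - real i powr \<alpha>) * real i powr ((1 - \<alpha>) / 2)"
      using assms by (intro mult_left_mono) (auto intro!: powr_mono2)
    then show ?case by simp
  qed
qed

text \<open>Since \<open>\<alpha> < 1\<close>, the steps vary slowly, \<open>\<eta>\<^sub>i - \<eta>\<^sub>i\<^sub>+\<^sub>1 = o(\<eta>\<^sub>i \<eta>\<^sub>i\<^sub>+\<^sub>1)\<close>, so a multiple of the step
  size is a supersolution of the recursion.\<close>

lemma contraction_recursion:
  fixes y \<eta> :: "nat \<Rightarrow> real"
  assumes \<alpha>: "0 < \<alpha>" "\<alpha> < 1" and \<eta>0: "0 < \<eta>\<^sub>0" and \<eta>: "\<And>n. \<eta> n = \<eta>\<^sub>0 * real n powr (- \<alpha>)"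
    and c: "0 < c"
    and rec: "\<And>i. i \<ge> N \<Longrightarrow> y (Suc i) \<le> (1 - c * \<eta> (Suc i)) * y i + C * (\<eta> (Suc i))\<^sup>2"
  shows "\<exists>K\<ge>0. \<forall>\<^sub>F i in sequentially. y i \<le> K * \<eta> i"
proof -
  have "\<eta> \<longlonglongrightarrow> 0"
    unfolding \<eta> using \<alpha> by (intro tendsto_mult_right_zero tendsto_neg_powr filterlim_real_sequentially) auto
  then have "(\<lambda>i. c * \<eta> (Suc i)) \<longlonglongrightarrow> 0" by (intro tendsto_mult_right_zero LIMSEQ_Suc)
  then have ev1: "\<forall>\<^sub>F i in sequentially. c * \<eta> (Suc i) < 1" by (rule order_tendstoD) simp
  have ev2: "\<forall>\<^sub>F i in sequentially. real (Suc i) powr \<alpha> - real i powr \<alpha> < c / 2 * \<eta>\<^sub>0"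
    using powr_increment_null'[OF \<alpha>] by (rule order_tendstoD) (use c \<eta>0 in simp)
  obtain N1 where N1: "N1 \<ge> N" "N1 > 0"
    "\<And>i. i \<ge> N1 \<Longrightarrow> c * \<eta> (Suc i) < 1" "\<And>i. i \<ge> N1 \<Longrightarrow> real (Suc i) powr \<alpha> - real i powr \<alpha> < c / 2 * \<eta>\<^sub>0"
    using eventually_conj[OF eventually_conj[OF ev1 ev2] eventually_ge_at_top[of "Suc N"]]
    unfolding eventually_sequentially by (metis Suc_le_D Suc_leD le_refl order_trans zero_less_Suc)
  have \<eta>pos: "\<eta> i > 0" if "i > 0" for i using that \<eta>0 by (simp add: \<eta>)
  \<comment> \<open>The first value makes the noise term at most half of the contraction; the second
    starts the induction at \<open>N1\<close>.\<close>
  define K where "K = max (2 * \<bar>C\<bar> / c) (\<bar>y N1\<bar> / \<eta> N1)"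
  have K: "2 * \<bar>C\<bar> / c \<le> K" "\<bar>y N1\<bar> / \<eta> N1 \<le> K" "0 \<le> K"
    using c by (auto simp: K_def le_max_iff_disj)
  have main: "y i \<le> K * \<eta> i" if "i \<ge> N1" for i
    using that
  proof (induction i rule: dec_induct)
    case base
    have "\<bar>y N1\<bar> \<le> K * \<eta> N1" using K(2) \<eta>pos[of N1] N1(2) by (simp add: field_simps)
    then show ?case by simp
  next
    case (step i)
    define e e' where "e = \<eta> i" and "e' = \<eta> (Suc i)"
    have pos: "e > 0" "e' > 0" using \<eta>pos step N1(2) by (auto simp: e_def e'_def)
    have inv: "real j powr \<alpha> = \<eta>\<^sub>0 / \<eta> j" if "j > 0" for j
      using that \<eta>0 by (simp add: \<eta> powr_minus_divide)
    have "\<eta>\<^sub>0 / e' - \<eta>\<^sub>0 / e < c / 2 * \<eta>\<^sub>0"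
      using N1(4)[of i] step N1(2) inv[of i] inv[of "Suc i"] by (simp add: e_def e'_def del: of_nat_Suc)
    then have "\<eta>\<^sub>0 * (1 / e' - 1 / e) < \<eta>\<^sub>0 * (c / 2)" by (simp add: algebra_simps)
    then have "1 / e' - 1 / e < c / 2" using \<eta>0 by simp
    \<comment> \<open>This uses the other half of the contraction: the reciprocal step sizes grow by
      less than \<open>c / 2\<close>, so the step size itself drops by at most this amount.\<close>
    then have slow: "e - e' \<le> c / 2 * (e * e')" using pos by (simp add: field_simps)
    have "e' \<le> e"
      unfolding e_def e'_def \<eta> using \<alpha> \<eta>0 step N1(2) by (intro mult_left_mono powr_mono2') auto
    have "y (Suc i) \<le> (1 - c * e') * y i + C * e'\<^sup>2"
      using rec[of i] step N1(1) by (simp add: e'_def)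
    also have "\<dots> \<le> (1 - c * e') * (K * e) + \<bar>C\<bar> * (e * e')"
    proof (intro add_mono mult_left_mono)
      show "y i \<le> K * e" using step by (simp add: e_def)
      show "0 \<le> 1 - c * e'" using N1(3)[of i] step by (simp add: e'_def)
      show "C * e'\<^sup>2 \<le> \<bar>C\<bar> * (e * e')"
        unfolding power2_eq_square using pos \<open>e' \<le> e\<close> by (intro mult_mono mult_right_mono) auto
    qed
    also have "\<bar>C\<bar> * (e * e') \<le> (c / 2 * K) * (e * e')"
      using K(1) c pos by (intro mult_right_mono) (auto simp: field_simps)
    also have "(1 - c * e') * (K * e) + (c / 2 * K) * (e * e') = K * e' + K * (e - e') - K * (c / 2 * (e * e'))"
      by (simp add: field_simps)
    also have "\<dots> \<le> K * e'" using mult_left_mono[OF slow K(3)] by simp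
    finally show ?case by (simp add: e'_def)
  qed
  show ?thesis using main K(3) unfolding eventually_sequentially by blast
qed

subsection \<open>Stochastic approximation\<close>

lemma (in prob_space) integrable_norm_add_scaleR_sq:
  fixes g :: "'a \<Rightarrow> 'b::euclidean_space"
  assumes [measurable]: "g \<in> borel_measurable M" and sq: "integrable M (\<lambda>w. (norm (g w))\<^sup>2)"
  shows "integrable M g"
    and "integrable M (\<lambda>w. (norm (a + c *\<^sub>R g w))\<^sup>2)"
    and "(\<integral>w. (norm (a + c *\<^sub>R g w))\<^sup>2 \<partial>M) = (norm a)\<^sup>2 + 2 * c * (a \<bullet> (\<integral>w. g w \<partial>M)) + c\<^sup>2 * (\<integral>w. (norm (g w))\<^sup>2 \<partial>M)"
proof -
  have "integrable M (\<lambda>w. norm (g w))"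
    by (rule square_integrable_imp_integrable[OF _ sq]) simp
  then show i: "integrable M g" by (simp add: integrable_norm_iff)
  have eq: "(norm (a + c *\<^sub>R g w))\<^sup>2 = (norm a)\<^sup>2 + 2 * c * (a \<bullet> g w) + c\<^sup>2 * (norm (g w))\<^sup>2" for w
    unfolding power2_norm_eq_inner
    by (simp add: inner_add_left inner_add_right inner_commute power2_eq_square[of c] algebra_simps)
  show "integrable M (\<lambda>w. (norm (a + c *\<^sub>R g w))\<^sup>2)"
    unfolding eq using i sq by (intro Bochner_Integration.integrable_add integrable_mult_right integrable_inner_right) auto
  show "(\<integral>w. (norm (a + c *\<^sub>R g w))\<^sup>2 \<partial>M) = (norm a)\<^sup>2 + 2 * c * (a \<bullet> (\<integral>w. g w \<partial>M)) + c\<^sup>2 * (\<integral>w. (norm (g w))\<^sup>2 \<partial>M)"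
    unfolding eq using i sq by (simp add: prob_space)
qed

lemma (in prob_space) expectation_le_sqrt:
  assumes [measurable]: "Z \<in> borel_measurable M" and sq: "integrable M (\<lambda>\<omega>. (Z \<omega>)\<^sup>2)"
  shows "expectation Z \<le> sqrt (expectation (\<lambda>\<omega>. (Z \<omega>)\<^sup>2))"
proof -
  have i: "integrable M Z" by (rule square_integrable_imp_integrable[OF _ sq]) simp
  have "0 \<le> variance Z" by simp
  then have "(expectation Z)\<^sup>2 \<le> expectation (\<lambda>\<omega>. (Z \<omega>)\<^sup>2)"
    using variance_eq[OF i sq] by simp
  then show ?thesis by (rule real_le_rsqrt)
qed

text \<open>Conditional expectations are avoided. The assumption \<open>nn_integral_step\<close>
  says that \<open>W (Suc i)\<close> has law \<open>\<mu>\<close> and is independent of the past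
  \<open>F i\<close>, in the form in which this is used: the newest innovation can be integrated out
  first, with the past frozen.\<close>

locale innovation_filtration = prob_space \<Omega> + noise: prob_space \<mu>
  for \<Omega> :: "'w measure" and \<mu> :: "'z measure" +
  fixes F :: "nat \<Rightarrow> 'w measure" and W :: "nat \<Rightarrow> 'w \<Rightarrow> 'z"
  assumes space_F: "\<And>i. space (F i) = space \<Omega>"
    and F_sub: "\<And>i. sets (F i) \<subseteq> sets \<Omega>"
    and F_mono: "\<And>i. sets (F i) \<subseteq> sets (F (Suc i))"
    and W_adapted: "\<And>i. W (Suc i) \<in> F (Suc i) \<rightarrow>\<^sub>M \<mu>"
    and nn_integral_step: "\<And>i \<phi>. \<phi> \<in> borel_measurable (F i \<Otimes>\<^sub>M \<mu>) \<Longrightarrow>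
      (\<integral>\<^sup>+\<omega>. \<phi> (\<omega>, W (Suc i) \<omega>) \<partial>\<Omega>) = (\<integral>\<^sup>+\<omega>. (\<integral>\<^sup>+w. \<phi> (\<omega>, w) \<partial>\<mu>) \<partial>\<Omega>)"
begin

lemma F_to_Suc: "X \<in> F i \<rightarrow>\<^sub>M N \<Longrightarrow> X \<in> F (Suc i) \<rightarrow>\<^sub>M N"
  using F_mono[of i] space_F[of i] space_F[of "Suc i"] by (auto simp: measurable_def)

lemma F_to_\<Omega>: "X \<in> F i \<rightarrow>\<^sub>M N \<Longrightarrow> X \<in> \<Omega> \<rightarrow>\<^sub>M N"
  using F_sub[of i] space_F[of i] by (auto simp: measurable_def)

lemma W_measurable: "W (Suc i) \<in> \<Omega> \<rightarrow>\<^sub>M \<mu>"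
  by (rule F_to_\<Omega>[OF W_adapted])

lemma pair_W_measurable: "(\<lambda>\<omega>. (\<omega>, W (Suc i) \<omega>)) \<in> \<Omega> \<rightarrow>\<^sub>M F i \<Otimes>\<^sub>M \<mu>"
  by (intro measurable_Pair F_to_\<Omega>[of _ i] W_measurable) simp

lemma pair_W_adapted: "(\<lambda>\<omega>. (\<omega>, W (Suc i) \<omega>)) \<in> F (Suc i) \<rightarrow>\<^sub>M F i \<Otimes>\<^sub>M \<mu>"
  by (intro measurable_Pair F_to_Suc W_adapted) simp

text \<open>The substitute for conditioning: a bound \<open>\<Psi>\<close> on the integral over the
  innovation, with the past frozen, bounds the full expectation, and its integrability is
  inherited.\<close>

lemma step_le:
  fixes \<phi> :: "'w \<Rightarrow> 'z \<Rightarrow> real"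
  assumes meas: "(\<lambda>(\<omega>, w). \<phi> \<omega> w) \<in> borel_measurable (F i \<Otimes>\<^sub>M \<mu>)"
    and nonneg: "\<And>\<omega> w. 0 \<le> \<phi> \<omega> w"
    and int: "\<And>\<omega>. integrable \<mu> (\<phi> \<omega>)" and le: "\<And>\<omega>. (\<integral>w. \<phi> \<omega> w \<partial>\<mu>) \<le> \<Psi> \<omega>"
    and \<Psi>: "integrable \<Omega> \<Psi>"
  shows "integrable \<Omega> (\<lambda>\<omega>. \<phi> \<omega> (W (Suc i) \<omega>))"
    and "(\<integral>\<omega>. \<phi> \<omega> (W (Suc i) \<omega>) \<partial>\<Omega>) \<le> (\<integral>\<omega>. \<Psi> \<omega> \<partial>\<Omega>)"
proof -
  have \<Psi>0: "0 \<le> \<Psi> \<omega>" for \<omega>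
    by (rule order_trans[OF Bochner_Integration.integral_nonneg le]) (rule nonneg)
  have m: "(\<lambda>\<omega>. \<phi> \<omega> (W (Suc i) \<omega>)) \<in> borel_measurable \<Omega>"
    using measurable_compose[OF pair_W_measurable meas] by simp
  have "(\<integral>\<^sup>+\<omega>. ennreal (\<phi> \<omega> (W (Suc i) \<omega>)) \<partial>\<Omega>) = (\<integral>\<^sup>+\<omega>. (\<integral>\<^sup>+w. ennreal (\<phi> \<omega> w) \<partial>\<mu>) \<partial>\<Omega>)"
    using nn_integral_step[of "\<lambda>(\<omega>, w). ennreal (\<phi> \<omega> w)" i] meas by simp
  also have "\<dots> \<le> (\<integral>\<^sup>+\<omega>. ennreal (\<Psi> \<omega>) \<partial>\<Omega>)"
    using nonneg int le by (intro nn_integral_mono) (simp add: nn_integral_eq_integral ennreal_leI)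
  also have "\<dots> = ennreal (\<integral>\<omega>. \<Psi> \<omega> \<partial>\<Omega>)"
    using \<Psi>0 \<Psi> by (intro nn_integral_eq_integral) auto
  finally have nn: "(\<integral>\<^sup>+\<omega>. ennreal (\<phi> \<omega> (W (Suc i) \<omega>)) \<partial>\<Omega>) \<le> ennreal (\<integral>\<omega>. \<Psi> \<omega> \<partial>\<Omega>)" .
  then have "(\<integral>\<^sup>+\<omega>. ennreal (\<phi> \<omega> (W (Suc i) \<omega>)) \<partial>\<Omega>) < \<infinity>"
    using ennreal_less_top le_less_trans by (metis infinity_ennreal_def)
  then show "integrable \<Omega> (\<lambda>\<omega>. \<phi> \<omega> (W (Suc i) \<omega>))"
    using nonneg m by (intro integrableI_nonneg) auto
  show "(\<integral>\<omega>. \<phi> \<omega> (W (Suc i) \<omega>) \<partial>\<Omega>) \<le> (\<integral>\<omega>. \<Psi> \<omega> \<partial>\<Omega>)"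
    by (rule integral_real_bounded[OF _ nn]) (intro Bochner_Integration.integral_nonneg \<Psi>0)
qed

end

text \<open>\<open>\<phi>\<close> is the mean field (later the gradient of the mean loss),
  \<open>G i\<close> its noisy and biased query at step \<open>i\<close>, and \<open>Gs\<close> the
  noise of the idealised query at \<open>\<theta>s\<close>. Here \<open>\<delta>\<close> is the
  localisation radius, unrelated to the moment exponent of that name in the model. The assumption
  \<open>close\<close> is continuity in mean square without a rate: a small
  \<open>\<epsilon>\<close> is paid for by a large \<open>K\<close>. Bounds on \<open>G i\<close>
  are asked for \<open>1 \<le> i\<close>, since \<open>h 0 = 0\<close> by the value of
  \<open>powr\<close> at 0.\<close>

locale stochastic_approximation = innovation_filtration \<Omega> \<mu> F W
  for \<Omega> :: "'w measure" and \<mu> :: "'z measure" and F :: "nat \<Rightarrow> 'w measure" and W :: "nat \<Rightarrow> 'w \<Rightarrow> 'z" +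
  fixes G :: "nat \<Rightarrow> 'a::euclidean_space \<Rightarrow> 'z \<Rightarrow> 'a" and Gs :: "'z \<Rightarrow> 'a" and \<phi> H Hi :: "'a \<Rightarrow> 'a"
    and \<theta>s \<theta>\<^sub>0 :: 'a and \<eta>\<^sub>0 \<alpha> h\<^sub>0 \<gamma> \<delta> lam C2 Cb CR :: real and \<eta> h :: "nat \<Rightarrow> real"
  assumes \<eta>_def: "\<And>n. \<eta> n = \<eta>\<^sub>0 * real n powr (- \<alpha>)" and h_def: "\<And>n. h n = h\<^sub>0 * real n powr (- \<gamma>)"
    and \<eta>0: "0 < \<eta>\<^sub>0" and \<alpha>: "1/2 < \<alpha>" "\<alpha> < 1" and h0: "0 < h\<^sub>0" and \<gamma>: "1/2 < \<gamma>"
    and \<delta>: "0 < \<delta>" and lam: "0 < lam"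
    and G_meas: "\<And>i. (\<lambda>(\<theta>, w). G i \<theta> w) \<in> borel_measurable (borel \<Otimes>\<^sub>M \<mu>)"
    and Gs_meas: "Gs \<in> borel_measurable \<mu>"
    and \<phi>_meas: "\<phi> \<in> borel_measurable borel"
    and G_sq: "\<And>i \<theta>. 1 \<le> i \<Longrightarrow> integrable \<mu> (\<lambda>w. (norm (G i \<theta> w))\<^sup>2)"
    and G_sq_le: "\<And>i \<theta>. 1 \<le> i \<Longrightarrow> (\<integral>w. (norm (G i \<theta> w))\<^sup>2 \<partial>\<mu>) \<le> C2 * (1 + (norm (\<theta> - \<theta>s))\<^sup>2)"
    and Gs_sq: "integrable \<mu> (\<lambda>w. (norm (Gs w))\<^sup>2)" and Gs_mean: "(\<integral>w. Gs w \<partial>\<mu>) = 0"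
    and bias: "\<And>i \<theta>. 1 \<le> i \<Longrightarrow> norm ((\<integral>w. G i \<theta> w \<partial>\<mu>) - \<phi> \<theta>) \<le> Cb * h i"
    and close: "\<And>\<epsilon>. 0 < \<epsilon> \<Longrightarrow> \<exists>K. \<forall>i\<ge>1. \<forall>\<theta>. norm (\<theta> - \<theta>s) \<le> \<delta> \<longrightarrow>
      (\<integral>w. (norm (G i \<theta> w - Gs w))\<^sup>2 \<partial>\<mu>) \<le> \<epsilon> + K * (norm (\<theta> - \<theta>s) + h i)"
    and \<phi>_mono: "\<And>\<theta>. lam * min ((norm (\<theta> - \<theta>s))\<^sup>2) (\<delta>\<^sup>2) \<le> (\<theta> - \<theta>s) \<bullet> \<phi> \<theta>"
    and \<phi>_lin: "\<And>\<theta>. norm (\<phi> \<theta> - H (\<theta> - \<theta>s)) \<le> CR * (norm (\<theta> - \<theta>s))\<^sup>2"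
    and Hi: "bounded_linear Hi" "\<And>x. Hi (H x) = x"
begin

section \<open>Iterates, adaptedness and the one-step drift\<close>

primrec th :: "nat \<Rightarrow> 'w \<Rightarrow> 'a" where
  "th 0 \<omega> = \<theta>\<^sub>0"
| "th (Suc i) \<omega> = th i \<omega> - \<eta> (Suc i) *\<^sub>R G (Suc i) (th i \<omega>) (W (Suc i) \<omega>)"

definition x :: "nat \<Rightarrow> 'w \<Rightarrow> 'a" where "x i \<omega> = th i \<omega> - \<theta>s"

definition X :: "nat \<Rightarrow> 'w \<Rightarrow> real" where "X i \<omega> = (norm (x i \<omega>))\<^sup>2"

lemma x_Suc: "x (Suc i) \<omega> = x i \<omega> - \<eta> (Suc i) *\<^sub>R G (Suc i) (th i \<omega>) (W (Suc i) \<omega>)"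
  by (simp add: x_def)

lemma X_nonneg [simp]: "0 \<le> X i \<omega>" by (simp add: X_def)

lemma \<eta>_pos: "0 < \<eta> (Suc i)" using \<eta>0 by (simp add: \<eta>_def)
lemma \<eta>_nonneg: "0 \<le> \<eta> i" using \<eta>0 by (simp add: \<eta>_def)
lemma h_pos: "0 < h (Suc i)" using h0 by (simp add: h_def)
lemma h_nonneg: "0 \<le> h i" using h0 by (simp add: h_def)

lemma Cb_nonneg: "0 \<le> Cb"
proof -
  have "0 \<le> Cb * h 1" using order_trans[OF norm_ge_zero bias[of 1]] by simp
  then show ?thesis using h_pos[of 0] by (simp add: zero_le_mult_iff)
qed

lemma C2_nonneg: "0 \<le> C2"
proof -
  have "0 \<le> (\<integral>w. (norm (G 1 \<theta>s w))\<^sup>2 \<partial>\<mu>)" by simp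
  also have "\<dots> \<le> C2 * (1 + (norm (\<theta>s - \<theta>s))\<^sup>2)" by (rule G_sq_le) simp
  finally show ?thesis by simp
qed

lemma CR_nonneg: "0 \<le> CR"
proof -
  obtain b :: 'a where "b \<in> Basis" using nonempty_Basis by blast
  then have "0 \<le> CR * 1" using order_trans[OF norm_ge_zero \<phi>_lin[of "\<theta>s + b"]] by simp
  then show ?thesis by simp
qed

lemma th_adapted: "th i \<in> borel_measurable (F i)"
proof (induction i)
  case (Suc i)
  have "(\<lambda>\<omega>. (th i \<omega>, W (Suc i) \<omega>)) \<in> F (Suc i) \<rightarrow>\<^sub>M borel \<Otimes>\<^sub>M \<mu>"
    by (intro measurable_Pair F_to_Suc Suc W_adapted)
  from measurable_compose[OF this G_meas[of "Suc i"]]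
  have "(\<lambda>\<omega>. G (Suc i) (th i \<omega>) (W (Suc i) \<omega>)) \<in> borel_measurable (F (Suc i))" by simp
  then have "(\<lambda>\<omega>. th i \<omega> - \<eta> (Suc i) *\<^sub>R G (Suc i) (th i \<omega>) (W (Suc i) \<omega>)) \<in> borel_measurable (F (Suc i))"
    using F_to_Suc[OF Suc] by simp
  then show ?case by simp
qed simp

lemma x_adapted: "x i \<in> borel_measurable (F i)"
  unfolding x_def[abs_def] using th_adapted[of i] by simp

lemma X_adapted: "X i \<in> borel_measurable (F i)"
  unfolding X_def[abs_def] using x_adapted[of i] by simp

lemmas th_measurable [measurable] = F_to_\<Omega>[OF th_adapted]
lemmas x_measurable [measurable] = F_to_\<Omega>[OF x_adapted]
lemmas X_measurable [measurable] = F_to_\<Omega>[OF X_adapted]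

lemma G_section: "G i \<theta> \<in> borel_measurable \<mu>"
  using measurable_compose[OF measurable_Pair1'[of \<theta> borel \<mu>] G_meas[of i]] by simp

lemma G_past: "(\<lambda>p. G (Suc i) (th i (fst p)) (snd p)) \<in> borel_measurable (F i \<Otimes>\<^sub>M \<mu>)"
proof -
  have "(\<lambda>p. (th i (fst p), snd p)) \<in> F i \<Otimes>\<^sub>M \<mu> \<rightarrow>\<^sub>M borel \<Otimes>\<^sub>M \<mu>"
    by (intro measurable_Pair measurable_compose[OF measurable_fst th_adapted] measurable_snd)
  from measurable_compose[OF this G_meas[of "Suc i"]] show ?thesis by simp
qed

text \<open>Expand the square: the cross term splits into the mean field, bounded below by
  \<open>\<phi>_mono\<close>, and the bias; the last term is the second moment of the query.\<close>

lemma drift: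
  fixes \<theta> :: 'a
  defines "r \<equiv> norm (\<theta> - \<theta>s)"
  shows "integrable \<mu> (\<lambda>w. (norm ((\<theta> - \<theta>s) - \<eta> (Suc i) *\<^sub>R G (Suc i) \<theta> w))\<^sup>2)" (is ?int)
    and "(\<integral>w. (norm ((\<theta> - \<theta>s) - \<eta> (Suc i) *\<^sub>R G (Suc i) \<theta> w))\<^sup>2 \<partial>\<mu>) \<le>
      r\<^sup>2 - 2 * \<eta> (Suc i) * lam * min (r\<^sup>2) (\<delta>\<^sup>2) + 2 * \<eta> (Suc i) * Cb * h (Suc i) * r
        + (\<eta> (Suc i))\<^sup>2 * C2 * (1 + r\<^sup>2)" (is ?le)
proof -
  let ?e = "\<eta> (Suc i)" and ?g = "\<integral>w. G (Suc i) \<theta> w \<partial>\<mu>"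
  have G2: "integrable \<mu> (\<lambda>w. (norm (G (Suc i) \<theta> w))\<^sup>2)" by (rule G_sq) simp
  note sq2 = noise.integrable_norm_add_scaleR_sq(2)[OF G_section G2, of "\<theta> - \<theta>s" "- ?e", simplified]
    and sq3 = noise.integrable_norm_add_scaleR_sq(3)[OF G_section G2, of "\<theta> - \<theta>s" "- ?e", simplified]
  show ?int using sq2 by simp
  have "(\<theta> - \<theta>s) \<bullet> ?g = (\<theta> - \<theta>s) \<bullet> \<phi> \<theta> + (\<theta> - \<theta>s) \<bullet> (?g - \<phi> \<theta>)"
    by (simp add: inner_diff_right)
  moreover have "\<bar>(\<theta> - \<theta>s) \<bullet> (?g - \<phi> \<theta>)\<bar> \<le> r * (Cb * h (Suc i))"
    unfolding r_def using bias[of "Suc i" \<theta>]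
    by (intro order_trans[OF Cauchy_Schwarz_ineq2] mult_left_mono) auto
  ultimately have "lam * min (r\<^sup>2) (\<delta>\<^sup>2) - r * (Cb * h (Suc i)) \<le> (\<theta> - \<theta>s) \<bullet> ?g"
    using \<phi>_mono[of \<theta>] unfolding r_def by linarith
  then have "2 * ?e * (lam * min (r\<^sup>2) (\<delta>\<^sup>2) - r * (Cb * h (Suc i))) \<le> 2 * ?e * ((\<theta> - \<theta>s) \<bullet> ?g)"
    using \<eta>_nonneg by (intro mult_left_mono) auto
  moreover have "?e\<^sup>2 * (\<integral>w. (norm (G (Suc i) \<theta> w))\<^sup>2 \<partial>\<mu>) \<le> ?e\<^sup>2 * (C2 * (1 + r\<^sup>2))"
    unfolding r_def by (intro mult_left_mono G_sq_le) auto
  ultimately show ?le using sq3 by (simp add: r_def algebra_simps)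
qed

text \<open>A template for the recursions below. The weight \<open>J\<close> is known at time
  \<open>i\<close>: it is 1 in the global estimates and the indicator of not having left the ball in
  the local ones.\<close>

lemma step_X:
  assumes J[measurable]: "J \<in> borel_measurable (F i)" and J01: "\<And>\<omega>. 0 \<le> J \<omega>"
    and le: "\<And>\<omega>. J \<omega> * ((X i \<omega>) - 2 * \<eta> (Suc i) * lam * min (X i \<omega>) (\<delta>\<^sup>2) + 2 * \<eta> (Suc i) * Cb * h (Suc i) * norm (x i \<omega>)
        + (\<eta> (Suc i))\<^sup>2 * C2 * (1 + X i \<omega>)) \<le> \<Psi> \<omega>"
    and \<Psi>: "integrable \<Omega> \<Psi>"
  shows "integrable \<Omega> (\<lambda>\<omega>. J \<omega> * X (Suc i) \<omega>)"
    and "(\<integral>\<omega>. J \<omega> * X (Suc i) \<omega> \<partial>\<Omega>) \<le> (\<integral>\<omega>. \<Psi> \<omega> \<partial>\<Omega>)"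
proof -
  define \<phi>' where "\<phi>' \<omega> w = J \<omega> * (norm (x i \<omega> - \<eta> (Suc i) *\<^sub>R G (Suc i) (th i \<omega>) w))\<^sup>2" for \<omega> w
  have m: "(\<lambda>(\<omega>, w). \<phi>' \<omega> w) \<in> borel_measurable (F i \<Otimes>\<^sub>M \<mu>)"
    unfolding \<phi>'_def case_prod_beta
    using G_past measurable_compose[OF measurable_fst x_adapted, of i \<mu>] measurable_compose[OF measurable_fst J, of \<mu>] by simp
  have int: "integrable \<mu> (\<phi>' \<omega>)" for \<omega>
    using drift(1)[of "th i \<omega>" i] unfolding \<phi>'_def x_def by simp
  have "(\<integral>w. \<phi>' \<omega> w \<partial>\<mu>) \<le> \<Psi> \<omega>" for \<omega>
  proof -
    have "(\<integral>w. \<phi>' \<omega> w \<partial>\<mu>) = J \<omega> * (\<integral>w. (norm (x i \<omega> - \<eta> (Suc i) *\<^sub>R G (Suc i) (th i \<omega>) w))\<^sup>2 \<partial>\<mu>)"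
      unfolding \<phi>'_def by simp
    also have "\<dots> \<le> \<Psi> \<omega>"
      using mult_left_mono[OF drift(2)[of "th i \<omega>" i] J01[of \<omega>]] le[of \<omega>] unfolding x_def X_def by linarith
    finally show ?thesis .
  qed
  from step_le[OF m _ int this \<Psi>] 
  show "integrable \<Omega> (\<lambda>\<omega>. J \<omega> * X (Suc i) \<omega>)" "(\<integral>\<omega>. J \<omega> * X (Suc i) \<omega> \<partial>\<Omega>) \<le> (\<integral>\<omega>. \<Psi> \<omega> \<partial>\<Omega>)"
    unfolding \<phi>'_def X_def x_Suc by (simp_all add: J01)
qed

definition a :: "nat \<Rightarrow> real" where "a i = \<eta> i * h i + (\<eta> i)\<^sup>2"

lemma a_nonneg: "0 \<le> a i" unfolding a_def using \<eta>_nonneg h_nonneg by simp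

text \<open>The exponents are \<alpha> + \<gamma> for the bias and 2 \<alpha> for the variance, both
  above 1.\<close>

lemma summable_a: "summable a"
proof -
  have eq: "a i = (\<eta>\<^sub>0 * h\<^sub>0) * real i powr (- (\<alpha> + \<gamma>)) + \<eta>\<^sub>0\<^sup>2 * real i powr (- (2 * \<alpha>))" for i
    by (simp add: a_def \<eta>_def h_def power2_eq_square powr_add[symmetric] algebra_simps flip: powr_add)
  show ?thesis
    unfolding eq using \<alpha> \<gamma> by (intro summable_add summable_mult) (auto simp: summable_real_powr_iff)
qed

definition Kd :: real where "Kd = Cb + C2"

lemma Kd_nonneg: "0 \<le> Kd" using Cb_nonneg C2_nonneg by (simp add: Kd_def)

text \<open>The bias term is linear in the distance; \<open>2 * r \<le> 1 + r\<^sup>2\<close> makes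
  it quadratic. The result has the Robbins-Siegmund form: a factor with summable excess over 1, a
  summable perturbation and a negative drift.\<close>

lemma drift_crude:
  assumes "0 \<le> r"
  shows "r\<^sup>2 - 2 * \<eta> (Suc i) * lam * min (r\<^sup>2) (\<delta>\<^sup>2) + 2 * \<eta> (Suc i) * Cb * h (Suc i) * r + (\<eta> (Suc i))\<^sup>2 * C2 * (1 + r\<^sup>2)
    \<le> r\<^sup>2 + Kd * a (Suc i) * (1 + r\<^sup>2) - 2 * lam * \<eta> (Suc i) * min (r\<^sup>2) (\<delta>\<^sup>2)"
proof -
  have r: "2 * r \<le> 1 + r\<^sup>2" using zero_le_power2[of "r - 1"] by (simp add: power2_eq_square algebra_simps)
  let ?e = "\<eta> (Suc i)" and ?h = "h (Suc i)"
  have nn: "0 \<le> ?e * ?h" "0 \<le> ?e\<^sup>2" using \<eta>_nonneg h_nonneg by auto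
  have "2 * ?e * Cb * ?h * r = (Cb * (?e * ?h)) * (2 * r)" by simp
  also have "\<dots> \<le> (Cb * (?e * ?h)) * (1 + r\<^sup>2)" using r nn Cb_nonneg by (intro mult_left_mono) auto
  also have "\<dots> \<le> (Kd * (?e * ?h)) * (1 + r\<^sup>2)"
    using nn C2_nonneg by (intro mult_right_mono) (auto simp: Kd_def)
  finally have 1: "2 * ?e * Cb * ?h * r \<le> (Kd * (?e * ?h)) * (1 + r\<^sup>2)" .
  have "?e\<^sup>2 * C2 * (1 + r\<^sup>2) \<le> (Kd * ?e\<^sup>2) * (1 + r\<^sup>2)"
    using nn Cb_nonneg by (intro mult_right_mono) (auto simp: Kd_def algebra_simps)
  with 1 show ?thesis by (simp add: a_def algebra_simps)
qed

section \<open>Global bound on the second moments and return to the minimiser\<close>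

lemma X_integrable [simp]: "integrable \<Omega> (X i)"
proof (induction i)
  case 0
  then show ?case by (simp add: X_def[abs_def] x_def)
next
  case (Suc i)
  have "integrable \<Omega> (\<lambda>\<omega>. 1 * X (Suc i) \<omega>)"
  proof (rule step_X(1))
    show "integrable \<Omega> (\<lambda>\<omega>. X i \<omega> + Kd * a (Suc i) * (1 + X i \<omega>))" using Suc by simp
    fix \<omega>
    have "0 \<le> 2 * lam * \<eta> (Suc i) * min (X i \<omega>) (\<delta>\<^sup>2)" using lam \<eta>_nonneg by simp
    with drift_crude[OF norm_ge_zero, of "x i \<omega>" i] show "1 * (X i \<omega> - 2 * \<eta> (Suc i) * lam * min (X i \<omega>) (\<delta>\<^sup>2) + 2 * \<eta> (Suc i) * Cb * h (Suc i) * norm (x i \<omega>)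
        + (\<eta> (Suc i))\<^sup>2 * C2 * (1 + X i \<omega>)) \<le> X i \<omega> + Kd * a (Suc i) * (1 + X i \<omega>)"
      unfolding X_def mult_1_left by linarith
  qed auto
  then show ?case by simp
qed

lemma x_norm_integrable [simp]: "integrable \<Omega> (\<lambda>\<omega>. norm (x i \<omega>))"
proof (rule square_integrable_imp_integrable)
  show "integrable \<Omega> (\<lambda>\<omega>. (norm (x i \<omega>))\<^sup>2)" using X_integrable[of i] by (simp add: X_def[abs_def])
qed simp

lemma integrable_J:
  assumes "integrable \<Omega> Z" "J \<in> borel_measurable \<Omega>" "\<And>\<omega>. 0 \<le> J \<omega>" "\<And>\<omega>. J \<omega> \<le> 1"
  shows "integrable \<Omega> (\<lambda>\<omega>. J \<omega> * Z \<omega> :: real)"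
  by (rule Bochner_Integration.integrable_bound[OF assms(1)])
     (use assms in \<open>auto simp: abs_mult intro!: AE_I2 mult_left_le_one_le\<close>)

text \<open>The drift is bounded below only by a multiple of this truncated distance, and the exit
  estimate starts from it.\<close>

definition w :: "nat \<Rightarrow> real" where "w i = (\<integral>\<omega>. min (X i \<omega>) (\<delta>\<^sup>2) \<partial>\<Omega>)"

lemma min_X_integrable [simp]: "integrable \<Omega> (\<lambda>\<omega>. min (X i \<omega>) (\<delta>\<^sup>2))"
  by (rule Bochner_Integration.integrable_bound[OF X_integrable[of i]]) (auto intro!: AE_I2)

lemma w_nonneg: "0 \<le> w i" unfolding w_def by (intro Bochner_Integration.integral_nonneg) simp

lemma X_recursion:
  "expectation (X (Suc i)) + 2 * lam * \<eta> (Suc i) * w i \<le> expectation (X i) + Kd * a (Suc i) * (1 + expectation (X i))"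
proof -
  have "(\<integral>\<omega>. 1 * X (Suc i) \<omega> \<partial>\<Omega>) \<le> (\<integral>\<omega>. X i \<omega> + Kd * a (Suc i) * (1 + X i \<omega>) - 2 * lam * \<eta> (Suc i) * min (X i \<omega>) (\<delta>\<^sup>2) \<partial>\<Omega>)"
  proof (rule step_X(2))
    fix \<omega>
    show "1 * (X i \<omega> - 2 * \<eta> (Suc i) * lam * min (X i \<omega>) (\<delta>\<^sup>2) + 2 * \<eta> (Suc i) * Cb * h (Suc i) * norm (x i \<omega>)
        + (\<eta> (Suc i))\<^sup>2 * C2 * (1 + X i \<omega>)) \<le> X i \<omega> + Kd * a (Suc i) * (1 + X i \<omega>) - 2 * lam * \<eta> (Suc i) * min (X i \<omega>) (\<delta>\<^sup>2)"
      using drift_crude[of "norm (x i \<omega>)" i] unfolding X_def by simp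
  qed auto
  also have "\<dots> = expectation (X i) + Kd * a (Suc i) * (1 + expectation (X i)) - 2 * lam * \<eta> (Suc i) * w i"
    by (simp add: w_def prob_space)
  finally show ?thesis by simp
qed

text \<open>A discrete Gronwall argument: the factors \<open>1 + Kd * a (Suc i)\<close> have bounded
  products because \<open>a\<close> is summable.\<close>

lemma X_bounded: "\<exists>B. \<forall>n. expectation (X n) \<le> B"
proof -
  have "1 + expectation (X n) \<le> (1 + expectation (X 0)) * exp (\<Sum>i<n. Kd * a (Suc i))" for n
  proof (induction n)
    case (Suc n)
    have "0 \<le> 2 * lam * \<eta> (Suc n) * w n" using lam \<eta>_nonneg w_nonneg by simp
    then have "1 + expectation (X (Suc n)) \<le> (1 + Kd * a (Suc n)) * (1 + expectation (X n))"
      using X_recursion[of n] by (simp add: algebra_simps)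
    also have "\<dots> \<le> exp (Kd * a (Suc n)) * ((1 + expectation (X 0)) * exp (\<Sum>i<n. Kd * a (Suc i)))"
      using Suc by (intro mult_mono exp_ge_add_one_self) (auto intro!: add_nonneg_nonneg)
    finally show ?case by (simp add: exp_add mult_ac)
  qed simp
  moreover have "(\<Sum>i<n. Kd * a (Suc i)) \<le> Kd * suminf (\<lambda>i. a (Suc i))" for n
    unfolding sum_distrib_left[symmetric] using summable_a a_nonneg Kd_nonneg
    by (intro mult_left_mono sum_le_suminf) (auto simp: summable_Suc_iff)
  moreover have "0 \<le> expectation (X 0)" by (intro Bochner_Integration.integral_nonneg) simp
  ultimately have "1 + expectation (X n) \<le> (1 + expectation (X 0)) * exp (Kd * suminf (\<lambda>i. a (Suc i)))" for n
    by (meson add_nonneg_nonneg exp_le_cancel_iff mult_left_mono order_trans zero_le_one)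
  then show ?thesis by (metis add.commute add_le_imp_le_diff)
qed

text \<open>Telescoping \<open>X_recursion\<close> bounds the sums of
  \<open>\<eta> (Suc i) * w i\<close>, which a positive lower bound on \<open>w\<close> would make
  diverge. This yields arbitrarily late small values rather than convergence; one such time suffices
  as a starting point.\<close>

lemma w_small: "0 < \<epsilon> \<Longrightarrow> \<exists>N\<ge>N0. w N < \<epsilon>"
proof (rule ccontr)
  assume \<epsilon>: "0 < \<epsilon>" and "\<not> (\<exists>N\<ge>N0. w N < \<epsilon>)"
  then have ge: "\<epsilon> \<le> w N" if "N \<ge> N0" for N using that by force
  obtain B where B: "\<And>n. expectation (X n) \<le> B" using X_bounded by blast
  have B0: "0 \<le> B" using order_trans[OF _ B[of 0]] by (simp add: Bochner_Integration.integral_nonneg)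
  have tele: "2 * lam * (\<Sum>i<n. \<eta> (Suc i) * w i) \<le> expectation (X 0) + Kd * (1 + B) * (\<Sum>i<n. a (Suc i))" for n
  proof -
    have "expectation (X n) + 2 * lam * (\<Sum>i<n. \<eta> (Suc i) * w i) \<le> expectation (X 0) + Kd * (1 + B) * (\<Sum>i<n. a (Suc i))"
    proof (induction n)
      case (Suc n)
      have "Kd * a (Suc n) * (1 + expectation (X n)) \<le> Kd * a (Suc n) * (1 + B)"
        using B[of n] Kd_nonneg a_nonneg by (intro mult_left_mono) auto
      then show ?case using X_recursion[of n] Suc by (simp add: algebra_simps)
    qed simp
    moreover have "0 \<le> expectation (X n)" by (intro Bochner_Integration.integral_nonneg) simp
    ultimately show ?thesis by linarith
  qed
  define A where "A = (expectation (X 0) + Kd * (1 + B) * suminf (\<lambda>i. a (Suc i))) / (2 * lam)"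
  have sumA: "(\<Sum>i<n. \<eta> (Suc i) * w i) \<le> A" for n
  proof -
    have "(\<Sum>i<n. a (Suc i)) \<le> suminf (\<lambda>i. a (Suc i))"
      using summable_a a_nonneg by (intro sum_le_suminf) (auto simp: summable_Suc_iff)
    then have "Kd * (1 + B) * (\<Sum>i<n. a (Suc i)) \<le> Kd * (1 + B) * suminf (\<lambda>i. a (Suc i))"
      using Kd_nonneg B0 by (intro mult_left_mono) auto
    with tele[of n] have "2 * lam * (\<Sum>i<n. \<eta> (Suc i) * w i) \<le> expectation (X 0) + Kd * (1 + B) * suminf (\<lambda>i. a (Suc i))"
      by linarith
    then show ?thesis using lam by (simp add: A_def pos_le_divide_eq mult.commute)
  qed
  have "summable (\<lambda>i. \<eta> (Suc (i + N0)) * w (i + N0))"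
  proof -
    have "summable (\<lambda>i. \<eta> (Suc i) * w i)"
      by (rule summableI_nonneg_bounded[OF _ sumA]) (simp add: \<eta>_nonneg w_nonneg)
    then show ?thesis by (simp add: summable_iff_shift[of "\<lambda>i. \<eta> (Suc i) * w i"])
  qed
  then have "summable (\<lambda>i. \<epsilon> * \<eta> (Suc (i + N0)))"
  proof (rule summable_comparison_test'[where N=0])
    fix i
    show "norm (\<epsilon> * \<eta> (Suc (i + N0))) \<le> \<eta> (Suc (i + N0)) * w (i + N0)"
      using mult_right_mono[OF ge[of "i + N0"] \<eta>_nonneg[of "Suc (i + N0)"]] \<eta>_nonneg[of "Suc (i + N0)"] \<epsilon>
      by (simp add: abs_mult mult.commute)
  qed
  then have "summable (\<lambda>i. \<eta> (i + Suc N0))" using \<epsilon> by simp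
  then have "summable \<eta>" by (simp only: summable_iff_shift)
  then have "summable (\<lambda>n. real n powr (- \<alpha>))"
    using \<eta>0 unfolding \<eta>_def by simp
  then show False using \<alpha> by (simp add: summable_real_powr_iff)
qed

end

subsection \<open>Localisation near the minimiser\<close>

context stochastic_approximation
begin

definition ind :: "nat \<Rightarrow> 'w \<Rightarrow> real" where "ind k \<omega> = (if norm (x k \<omega>) \<le> \<delta> then 1 else 0)"

text \<open>For \<open>n < N\<close> the product is empty and equals 1, so sums starting at 0 can
  carry this weight throughout.\<close>

definition J :: "nat \<Rightarrow> nat \<Rightarrow> 'w \<Rightarrow> real" where "J N n \<omega> = (\<Prod>k\<in>{N..n}. ind k \<omega>)"

lemma J_Suc: "J N (Suc n) \<omega> = (if N \<le> Suc n then J N n \<omega> * ind (Suc n) \<omega> else 1)"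
  by (simp add: J_def prod.cl_ivl_Suc)

lemma J_cases: "J N n \<omega> = 0 \<or> J N n \<omega> = 1"
proof (cases "\<exists>k\<in>{N..n}. ind k \<omega> = 0")
  case True
  then show ?thesis unfolding J_def by (intro disjI1 prod_zero) auto
next
  case False
  then have "ind k \<omega> = 1" if "k \<in> {N..n}" for k using that by (auto simp: ind_def split: if_splits)
  then show ?thesis by (simp add: J_def)
qed

lemma J_nonneg [simp]: "0 \<le> J N n \<omega>" and J_le_1 [simp]: "J N n \<omega> \<le> 1"
  using J_cases[of N n \<omega>] by auto

lemma J_eq_1D: "J N n \<omega> = 1 \<Longrightarrow> N \<le> k \<Longrightarrow> k \<le> n \<Longrightarrow> norm (x k \<omega>) \<le> \<delta>"
proof (rule ccontr)
  assume J: "J N n \<omega> = 1" and k: "N \<le> k" "k \<le> n" and "\<not> norm (x k \<omega>) \<le> \<delta>"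
  then have "ind k \<omega> = 0" by (simp add: ind_def)
  then have "J N n \<omega> = 0" unfolding J_def using k by (intro prod_zero) auto
  with J show False by simp
qed

lemma J_eq_1_mono:
  assumes "J N n \<omega> = 1" "i \<le> n"
  shows "J N i \<omega> = 1"
proof -
  have "ind k \<omega> = 1" if "k \<in> {N..i}" for k
    using J_eq_1D[OF assms(1), of k] that assms(2) by (simp add: ind_def)
  then show ?thesis by (simp add: J_def)
qed

lemma F_mono_le: 
  assumes "Z \<in> F i \<rightarrow>\<^sub>M M" "i \<le> n"
  shows "Z \<in> F n \<rightarrow>\<^sub>M M"
  using assms(2) by (induction n rule: dec_induct) (auto intro: F_to_Suc assms(1))

lemma J_adapted: "J N n \<in> borel_measurable (F n)"
  unfolding J_def[abs_def]
proof (rule borel_measurable_prod)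
  fix k assume k: "k \<in> {N..n}"
  have [measurable]: "x k \<in> borel_measurable (F k)" by (rule x_adapted)
  have "ind k \<in> borel_measurable (F k)"
    unfolding ind_def[abs_def] by measurable
  then show "(\<lambda>\<omega>. ind k \<omega>) \<in> borel_measurable (F n)" using F_mono_le k by auto
qed

lemmas J_measurable [measurable] = F_to_\<Omega>[OF J_adapted]

lemma J_integrable [simp]: "integrable \<Omega> (J N n)"
  by (rule integrable_const_bound[where B=1]) (auto intro!: AE_I2)

lemma JX_integrable [simp]: "integrable \<Omega> (\<lambda>\<omega>. J N n \<omega> * X i \<omega>)"
  by (rule integrable_J) auto

lemma Jx_integrable [simp]: "integrable \<Omega> (\<lambda>\<omega>. J N n \<omega> * norm (x i \<omega>))"
  by (rule integrable_J) auto

lemma J_X_le: "N \<le> n \<Longrightarrow> J N n \<omega> * X n \<omega> \<le> J N n \<omega> * \<delta>\<^sup>2"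
  using J_cases[of N n \<omega>] J_eq_1D[of N n \<omega> n] by (auto simp: X_def intro!: power_mono)

text \<open>A maximal inequality for a stopped process: \<open>u\<close> charges the current squared
  distance to paths still inside the ball and \<open>\<delta>\<^sup>2\<close> to paths that have
  left. It starts at \<open>w N\<close> and grows only by the summable perturbation, because the
  drift inside the ball has the right sign.\<close>

lemma exit_probability:
  assumes "N \<le> n"
  shows "\<delta>\<^sup>2 * (1 - expectation (J N n)) \<le> w N + Kd * (1 + \<delta>\<^sup>2) * (\<Sum>i\<in>{N..<n}. a (Suc i))"
proof -
  define u where "u n = expectation (\<lambda>\<omega>. J N n \<omega> * X n \<omega>) + \<delta>\<^sup>2 * (1 - expectation (J N n))" for n
  have u_eq: "u n = expectation (\<lambda>\<omega>. J N n \<omega> * X n \<omega> + \<delta>\<^sup>2 * (1 - J N n \<omega>))" for n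
    by (simp add: u_def prob_space)
  have "u n \<le> w N + Kd * (1 + \<delta>\<^sup>2) * (\<Sum>i\<in>{N..<n}. a (Suc i))"
    using assms
  proof (induction n rule: dec_induct)
    case base
    have "J N N \<omega> * X N \<omega> + \<delta>\<^sup>2 * (1 - J N N \<omega>) = min (X N \<omega>) (\<delta>\<^sup>2)" for \<omega>
      using \<delta> power_mono[of "norm (x N \<omega>)" \<delta> 2] power_mono[of \<delta> "norm (x N \<omega>)" 2]
      by (auto simp: J_def ind_def X_def min_def)
    then have "u N = w N" unfolding u_eq w_def by simp
    then show ?case by simp
  next
    case (step n)
    \<comment> \<open>A path that leaves at \<open>Suc n\<close> has squared distance at least
      \<open>\<delta>\<^sup>2\<close>, so charging \<open>\<delta>\<^sup>2\<close> instead does not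
      increase \<open>u\<close>.\<close>
    have le: "J N (Suc n) \<omega> * X (Suc n) \<omega> + \<delta>\<^sup>2 * (1 - J N (Suc n) \<omega>) \<le> J N n \<omega> * X (Suc n) \<omega> + \<delta>\<^sup>2 * (1 - J N n \<omega>)" for \<omega>
    proof (cases "norm (x (Suc n) \<omega>) \<le> \<delta>")
      case True
      then show ?thesis using step by (simp add: J_Suc ind_def)
    next
      case False
      then have "\<delta>\<^sup>2 \<le> X (Suc n) \<omega>" using \<delta> by (auto simp: X_def intro!: power_mono)
      then have "J N n \<omega> * \<delta>\<^sup>2 \<le> J N n \<omega> * X (Suc n) \<omega>" by (intro mult_left_mono) auto
      then show ?thesis using False step by (simp add: J_Suc ind_def algebra_simps)
    qed
    have "u (Suc n) \<le> expectation (\<lambda>\<omega>. J N n \<omega> * X (Suc n) \<omega> + \<delta>\<^sup>2 * (1 - J N n \<omega>))"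
      unfolding u_eq by (intro integral_mono le) auto
    also have "\<dots> = expectation (\<lambda>\<omega>. J N n \<omega> * X (Suc n) \<omega>) + \<delta>\<^sup>2 * (1 - expectation (J N n))"
      by (simp add: prob_space)
    also have "expectation (\<lambda>\<omega>. J N n \<omega> * X (Suc n) \<omega>) \<le> expectation (\<lambda>\<omega>. J N n \<omega> * X n \<omega> + Kd * a (Suc n) * (1 + \<delta>\<^sup>2))"
    proof (rule step_X(2)[OF J_adapted])
      fix \<omega>
      have nn: "0 \<le> Kd * a (Suc n) * (1 + \<delta>\<^sup>2)" using Kd_nonneg a_nonneg by simp
      consider "J N n \<omega> = 0" | "J N n \<omega> = 1" using J_cases by blast
      then show "J N n \<omega> * (X n \<omega> - 2 * \<eta> (Suc n) * lam * min (X n \<omega>) (\<delta>\<^sup>2) + 2 * \<eta> (Suc n) * Cb * h (Suc n) * norm (x n \<omega>)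
        + (\<eta> (Suc n))\<^sup>2 * C2 * (1 + X n \<omega>)) \<le> J N n \<omega> * X n \<omega> + Kd * a (Suc n) * (1 + \<delta>\<^sup>2)"
      proof cases
        case 2
        have "0 \<le> 2 * lam * \<eta> (Suc n) * min (X n \<omega>) (\<delta>\<^sup>2)" using lam \<eta>_nonneg by simp
        moreover have "X n \<omega> \<le> \<delta>\<^sup>2" using J_X_le[of N n \<omega>] 2 step by simp
        then have "Kd * a (Suc n) * (1 + X n \<omega>) \<le> Kd * a (Suc n) * (1 + \<delta>\<^sup>2)"
          using Kd_nonneg a_nonneg by (intro mult_left_mono) auto
        ultimately show ?thesis
          using drift_crude[OF norm_ge_zero, of "x n \<omega>" n] unfolding 2 mult_1_left X_def by linarith
      qed (use nn in simp)
    qed auto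
    also have "\<dots> = expectation (\<lambda>\<omega>. J N n \<omega> * X n \<omega>) + Kd * a (Suc n) * (1 + \<delta>\<^sup>2)" by (simp add: prob_space)
    finally have "u (Suc n) \<le> u n + Kd * a (Suc n) * (1 + \<delta>\<^sup>2)" by (simp add: u_def)
    with step show ?case by (simp add: algebra_simps)
  qed
  moreover have "0 \<le> expectation (\<lambda>\<omega>. J N n \<omega> * X n \<omega>)" by (intro Bochner_Integration.integral_nonneg) simp
  ultimately show ?thesis unfolding u_def by linarith
qed

text \<open>The tail of the perturbations fixes a time after which they are harmless, and
  \<open>w_small\<close> supplies a start \<open>N\<close> beyond it; the resulting bound is uniform
  in \<open>n\<close>.\<close>

lemma stays_near:
  assumes \<epsilon>: "0 < \<epsilon>"
  shows "\<exists>N. \<forall>n\<ge>N. 1 - expectation (J N n) \<le> \<epsilon>"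
proof -
  define c where "c = Kd * (1 + \<delta>\<^sup>2) + 1"
  have c: "0 < c" "Kd * (1 + \<delta>\<^sup>2) \<le> c" using Kd_nonneg by (auto simp: c_def intro!: add_nonneg_pos)
  define e where "e = \<delta>\<^sup>2 * \<epsilon> / (2 * c)"
  have e: "0 < e" using \<epsilon> \<delta> c by (simp add: e_def)
  have "summable (\<lambda>i. a (Suc i))" using summable_a by (simp add: summable_Suc_iff)
  then obtain N0 where N0: "\<And>m n. m \<ge> N0 \<Longrightarrow> norm (\<Sum>i\<in>{m..<n}. a (Suc i)) < e"
    using e unfolding summable_Cauchy by metis
  obtain N where N: "N \<ge> N0" "w N < \<delta>\<^sup>2 * \<epsilon> / 2"
    using w_small[of "\<delta>\<^sup>2 * \<epsilon> / 2" N0] \<epsilon> \<delta> by auto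
  have "1 - expectation (J N n) \<le> \<epsilon>" if n: "n \<ge> N" for n
  proof -
    have S: "0 \<le> (\<Sum>i\<in>{N..<n}. a (Suc i))" by (intro sum_nonneg a_nonneg)
    have "\<delta>\<^sup>2 * (1 - expectation (J N n)) \<le> w N + Kd * (1 + \<delta>\<^sup>2) * (\<Sum>i\<in>{N..<n}. a (Suc i))"
      by (rule exit_probability[OF n])
    also have "Kd * (1 + \<delta>\<^sup>2) * (\<Sum>i\<in>{N..<n}. a (Suc i)) \<le> c * e"
      using N0[OF N(1), of n] S c by (intro mult_mono) auto
    also have "c * e = \<delta>\<^sup>2 * \<epsilon> / 2" using c by (simp add: e_def)
    finally have "\<delta>\<^sup>2 * (1 - expectation (J N n)) \<le> \<delta>\<^sup>2 * \<epsilon>" using N(2) by linarith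
    then show ?thesis using \<delta> by simp
  qed
  then show ?thesis by blast
qed

definition y :: "nat \<Rightarrow> nat \<Rightarrow> real" where "y N i = expectation (\<lambda>\<omega>. J N i \<omega> * X i \<omega>)"

lemma y_nonneg: "0 \<le> y N i" unfolding y_def by (intro Bochner_Integration.integral_nonneg) simp

text \<open>By 2 \<gamma> > 1 > \<alpha> the squared bias is of the order of a step size, so after
  multiplication by another step size it joins the variance term.\<close>

lemma h_sq_le: "(h (Suc i))\<^sup>2 \<le> h\<^sub>0\<^sup>2 / \<eta>\<^sub>0 * \<eta> (Suc i)"
proof -
  have "(h (Suc i))\<^sup>2 = h\<^sub>0\<^sup>2 * real (Suc i) powr (- (2 * \<gamma>))"
    by (simp add: h_def power2_eq_square powr_add[symmetric])
  also have "\<dots> \<le> h\<^sub>0\<^sup>2 * real (Suc i) powr (- \<alpha>)"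
    using \<alpha> \<gamma> by (intro mult_left_mono powr_mono) auto
  also have "\<dots> = h\<^sub>0\<^sup>2 / \<eta>\<^sub>0 * \<eta> (Suc i)" using \<eta>0 by (simp add: \<eta>_def)
  finally show ?thesis .
qed

text \<open>Inside the ball the truncation disappears and the drift is linear with rate
  \<open>2 * lam\<close>. Half of it is spent on the bias by Young's inequality, which leaves the
  factor \<open>1 - lam * \<eta> (Suc i)\<close>.\<close>

lemma y_rate: "\<exists>K\<ge>0. \<forall>\<^sub>F i in sequentially. y N i \<le> K * \<eta> i"
proof (rule contraction_recursion[OF _ \<alpha>(2) \<eta>0 \<eta>_def lam])
  show "0 < \<alpha>" using \<alpha> by simp
  define C where "C = Cb\<^sup>2 * h\<^sub>0\<^sup>2 / (lam * \<eta>\<^sub>0) + C2 * (1 + \<delta>\<^sup>2)"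
  have C: "0 \<le> C" unfolding C_def using lam \<eta>0 C2_nonneg by simp
  fix i assume i: "N \<le> i"
  let ?e = "\<eta> (Suc i)" and ?h = "h (Suc i)"
  have "y N (Suc i) \<le> expectation (\<lambda>\<omega>. J N i \<omega> * X (Suc i) \<omega>)"
    unfolding y_def
  proof (rule integral_mono)
    fix \<omega>
    have "J N (Suc i) \<omega> \<le> J N i \<omega>" using i by (simp add: J_Suc ind_def)
    then show "J N (Suc i) \<omega> * X (Suc i) \<omega> \<le> J N i \<omega> * X (Suc i) \<omega>" by (rule mult_right_mono) simp
  qed auto
  also have "\<dots> \<le> expectation (\<lambda>\<omega>. (1 - lam * ?e) * (J N i \<omega> * X i \<omega>) + C * ?e\<^sup>2)"
  proof (rule step_X(2)[OF J_adapted])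
    fix \<omega>
    consider "J N i \<omega> = 0" | "J N i \<omega> = 1" using J_cases by blast
    then show "J N i \<omega> * (X i \<omega> - 2 * ?e * lam * min (X i \<omega>) (\<delta>\<^sup>2) + 2 * ?e * Cb * ?h * norm (x i \<omega>)
        + ?e\<^sup>2 * C2 * (1 + X i \<omega>)) \<le> (1 - lam * ?e) * (J N i \<omega> * X i \<omega>) + C * ?e\<^sup>2"
    proof cases
      case 1
      then show ?thesis using C by simp
    next
      case 2
      have X\<delta>: "X i \<omega> \<le> \<delta>\<^sup>2" using J_X_le[OF i, of \<omega>] 2 by simp
      have "0 \<le> (lam * norm (x i \<omega>) - Cb * ?h)\<^sup>2" by simp
      then have "lam * (2 * Cb * ?h * norm (x i \<omega>)) \<le> lam * (lam * X i \<omega> + Cb\<^sup>2 * ?h\<^sup>2 / lam)"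
        using lam by (simp add: X_def power2_eq_square algebra_simps)
      then have "2 * Cb * ?h * norm (x i \<omega>) \<le> lam * X i \<omega> + Cb\<^sup>2 * ?h\<^sup>2 / lam" using lam by simp
      also have "\<dots> \<le> lam * X i \<omega> + Cb\<^sup>2 * (h\<^sub>0\<^sup>2 / \<eta>\<^sub>0 * ?e) / lam"
        using lam h_sq_le[of i] by (intro add_left_mono divide_right_mono mult_left_mono) auto
      finally have "?e * (2 * Cb * ?h * norm (x i \<omega>)) \<le> ?e * (lam * X i \<omega> + Cb\<^sup>2 * (h\<^sub>0\<^sup>2 / \<eta>\<^sub>0 * ?e) / lam)"
        using \<eta>_nonneg by (intro mult_left_mono)
      moreover have "?e\<^sup>2 * C2 * (1 + X i \<omega>) \<le> ?e\<^sup>2 * C2 * (1 + \<delta>\<^sup>2)"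
        using X\<delta> C2_nonneg by (intro mult_left_mono) auto
      moreover have "min (X i \<omega>) (\<delta>\<^sup>2) = X i \<omega>" using X\<delta> by simp
      ultimately show ?thesis unfolding 2 C_def
        by (simp add: algebra_simps power2_eq_square)
    qed
  qed auto
  also have "\<dots> = (1 - lam * ?e) * y N i + C * ?e\<^sup>2" by (simp add: y_def prob_space)
  finally show "y N (Suc i) \<le> (1 - lam * ?e) * y N i + C * ?e\<^sup>2" .
qed

lemma J_norm_le: "expectation (\<lambda>\<omega>. J N i \<omega> * norm (x i \<omega>)) \<le> sqrt (y N i)"
proof -
  have eq: "(J N i \<omega> * norm (x i \<omega>))\<^sup>2 = J N i \<omega> * X i \<omega>" for \<omega>
    using J_cases[of N i \<omega>] by (auto simp: X_def)
  show ?thesis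
    using expectation_le_sqrt[of "\<lambda>\<omega>. J N i \<omega> * norm (x i \<omega>)"] unfolding eq y_def by simp
qed

lemma \<eta>_null: "\<eta> \<longlonglongrightarrow> 0"
  unfolding \<eta>_def using \<alpha> by (intro tendsto_mult_right_zero tendsto_neg_powr filterlim_real_sequentially) auto

lemma h_null: "h \<longlonglongrightarrow> 0"
  unfolding h_def using \<gamma> by (intro tendsto_mult_right_zero tendsto_neg_powr filterlim_real_sequentially) auto

lemma y_null: "y N \<longlonglongrightarrow> 0"
proof -
  obtain K where K: "\<forall>\<^sub>F i in sequentially. y N i \<le> K * \<eta> i" using y_rate by blast
  show ?thesis
    by (rule real_tendsto_sandwich[OF _ K tendsto_const tendsto_mult_right_zero[OF \<eta>_null]])
       (simp add: y_nonneg)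
qed

section \<open>The martingale part of the noise\<close>

definition g :: "nat \<Rightarrow> 'a \<Rightarrow> 'a" where "g i \<theta> = (\<integral>w. G i \<theta> w \<partial>\<mu>)"

definition \<psi> :: "nat \<Rightarrow> 'a \<Rightarrow> real" where "\<psi> i \<theta> = (\<integral>w. (norm (G i \<theta> w - Gs w))\<^sup>2 \<partial>\<mu>)"

lemma g_measurable: "g i \<in> borel_measurable borel"
  unfolding g_def[abs_def] by (rule noise.borel_measurable_lebesgue_integral) (rule G_meas)

lemma \<psi>_measurable: "\<psi> i \<in> borel_measurable borel"
  unfolding \<psi>_def[abs_def]
proof (rule noise.borel_measurable_lebesgue_integral)
  have "(\<lambda>p. Gs (snd p)) \<in> borel_measurable (borel \<Otimes>\<^sub>M \<mu>)"
    by (rule measurable_compose[OF measurable_snd Gs_meas])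
  moreover have "(\<lambda>p. G i (fst p) (snd p)) \<in> borel_measurable (borel \<Otimes>\<^sub>M \<mu>)"
    using G_meas[of i] by (simp only: case_prod_unfold)
  ultimately show "(\<lambda>(\<theta>, w). (norm (G i \<theta> w - Gs w))\<^sup>2) \<in> borel_measurable (borel \<Otimes>\<^sub>M \<mu>)"
    unfolding case_prod_unfold by (intro borel_measurable_power measurable_compose[OF _ borel_measurable_norm] borel_measurable_diff)
qed

lemma \<psi>_nonneg: "0 \<le> \<psi> i \<theta>" by (simp add: \<psi>_def)

lemma integrable_G: "1 \<le> i \<Longrightarrow> integrable \<mu> (G i \<theta>)"
  by (rule noise.integrable_norm_add_scaleR_sq(1)[OF G_section G_sq])

lemma integrable_Gs: "integrable \<mu> Gs"
  by (rule noise.integrable_norm_add_scaleR_sq(1)[OF Gs_meas Gs_sq])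

lemma \<psi>_bound:
  assumes "1 \<le> i"
  shows "integrable \<mu> (\<lambda>w. (norm (G i \<theta> w - Gs w))\<^sup>2)"
    and "\<psi> i \<theta> \<le> 2 * C2 * (1 + (norm (\<theta> - \<theta>s))\<^sup>2) + 2 * (\<integral>w. (norm (Gs w))\<^sup>2 \<partial>\<mu>)"
proof -
  have le: "(norm (G i \<theta> w - Gs w))\<^sup>2 \<le> 2 * (norm (G i \<theta> w))\<^sup>2 + 2 * (norm (Gs w))\<^sup>2" for w
  proof -
    have "(norm (G i \<theta> w - Gs w))\<^sup>2 \<le> (norm (G i \<theta> w) + norm (Gs w))\<^sup>2"
      by (intro power_mono norm_triangle_ineq4) simp
    also have "\<dots> \<le> 2 * (norm (G i \<theta> w))\<^sup>2 + 2 * (norm (Gs w))\<^sup>2"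
      using zero_le_power2[of "norm (G i \<theta> w) - norm (Gs w)"] by (simp add: power2_eq_square algebra_simps)
    finally show ?thesis .
  qed
  have int: "integrable \<mu> (\<lambda>w. 2 * (norm (G i \<theta> w))\<^sup>2 + 2 * (norm (Gs w))\<^sup>2)"
    using G_sq[OF assms] Gs_sq by simp
  have m: "(\<lambda>w. (norm (G i \<theta> w - Gs w))\<^sup>2) \<in> borel_measurable \<mu>"
    using G_section[of i \<theta>] Gs_meas by simp
  show i: "integrable \<mu> (\<lambda>w. (norm (G i \<theta> w - Gs w))\<^sup>2)"
    by (rule Bochner_Integration.integrable_bound[OF int m]) (use le in \<open>auto intro!: AE_I2\<close>)
  have "\<psi> i \<theta> \<le> (\<integral>w. 2 * (norm (G i \<theta> w))\<^sup>2 + 2 * (norm (Gs w))\<^sup>2 \<partial>\<mu>)"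
    unfolding \<psi>_def by (intro integral_mono i int le)
  also have "\<dots> = 2 * (\<integral>w. (norm (G i \<theta> w))\<^sup>2 \<partial>\<mu>) + 2 * (\<integral>w. (norm (Gs w))\<^sup>2 \<partial>\<mu>)"
    using G_sq[OF assms] Gs_sq by simp
  finally show "\<psi> i \<theta> \<le> 2 * C2 * (1 + (norm (\<theta> - \<theta>s))\<^sup>2) + 2 * (\<integral>w. (norm (Gs w))\<^sup>2 \<partial>\<mu>)"
    using G_sq_le[OF assms, of \<theta>] by linarith
qed

text \<open>What the query at \<open>th i\<close> adds to the idealised noise, centred. It
  integrates to 0 over the innovation, as \<open>Gs\<close> has mean 0; the factor
  \<open>J N i\<close> belongs to the past, so this persists when the increments are switched off
  after an exit.\<close>

definition Dm :: "nat \<Rightarrow> nat \<Rightarrow> 'w \<Rightarrow> 'z \<Rightarrow> 'a" where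
  "Dm N i \<omega> z = J N i \<omega> *\<^sub>R (G (Suc i) (th i \<omega>) z - g (Suc i) (th i \<omega>) - Gs z)"

definition Mart :: "nat \<Rightarrow> nat \<Rightarrow> 'w \<Rightarrow> 'a" where
  "Mart N n \<omega> = (\<Sum>i<n. Dm N i \<omega> (W (Suc i) \<omega>))"

lemma Dm_past: "(\<lambda>p. Dm N i (fst p) (snd p)) \<in> borel_measurable (F i \<Otimes>\<^sub>M \<mu>)"
  unfolding Dm_def
  by (intro borel_measurable_scaleR borel_measurable_diff G_past
      measurable_compose[OF measurable_snd Gs_meas] measurable_compose[OF measurable_fst J_adapted]
      measurable_compose[OF measurable_compose[OF measurable_fst th_adapted] g_measurable])

lemma Mart_adapted: "Mart N n \<in> borel_measurable (F n)"
proof (induction n)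
  case (Suc n)
  have "(\<lambda>\<omega>. Dm N n \<omega> (W (Suc n) \<omega>)) \<in> borel_measurable (F (Suc n))"
    using measurable_compose[OF pair_W_adapted Dm_past] by simp
  then show ?case using F_to_Suc[OF Suc] unfolding Mart_def[abs_def] by simp
qed (simp add: Mart_def[abs_def])

lemmas Mart_measurable [measurable] = F_to_\<Omega>[OF Mart_adapted]

definition dv :: "nat \<Rightarrow> nat \<Rightarrow> real" where
  "dv N i = expectation (\<lambda>\<omega>. J N i \<omega> * \<psi> (Suc i) (th i \<omega>))"

lemma J\<psi>_integrable [simp]: "integrable \<Omega> (\<lambda>\<omega>. J N i \<omega> * \<psi> (Suc i) (th i \<omega>))"
proof (rule integrable_J)
  have [measurable]: "(\<lambda>\<omega>. \<psi> (Suc i) (th i \<omega>)) \<in> borel_measurable \<Omega>"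
    by (rule measurable_compose[OF th_measurable \<psi>_measurable])
  have "integrable \<Omega> (\<lambda>\<omega>. 2 * C2 * (1 + X i \<omega>) + 2 * (\<integral>w. (norm (Gs w))\<^sup>2 \<partial>\<mu>))" by simp
  then show "integrable \<Omega> (\<lambda>\<omega>. \<psi> (Suc i) (th i \<omega>))"
    by (rule Bochner_Integration.integrable_bound)
       (use \<psi>_bound(2)[of "Suc i"] \<psi>_nonneg in \<open>auto simp: X_def x_def abs_of_nonneg intro!: AE_I2 order_trans[OF _ abs_ge_self]\<close>)
qed auto

text \<open>Increments are orthogonal to the past, so second moments add up. The variance of an
  increment is at most the raw second moment \<open>\<psi>\<close>, and \<open>J N n\<close> equals
  its own square.\<close>

lemma Mart_step:
  "integrable \<Omega> (\<lambda>\<omega>. (norm (Mart N n \<omega>))\<^sup>2) \<and> expectation (\<lambda>\<omega>. (norm (Mart N n \<omega>))\<^sup>2) \<le> (\<Sum>i<n. dv N i)"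
proof (induction n)
  case 0
  then show ?case by (simp add: Mart_def[abs_def])
next
  case (Suc n)
  define \<phi>' where "\<phi>' \<omega> w = (norm (Mart N n \<omega> + Dm N n \<omega> w))\<^sup>2" for \<omega> w
  have m: "(\<lambda>(\<omega>, w). \<phi>' \<omega> w) \<in> borel_measurable (F n \<Otimes>\<^sub>M \<mu>)"
    unfolding \<phi>'_def case_prod_unfold
    by (intro borel_measurable_power measurable_compose[OF _ borel_measurable_norm] borel_measurable_add Dm_past
        measurable_compose[OF measurable_fst Mart_adapted])
  have inner: "integrable \<mu> (\<phi>' \<omega>)" "(\<integral>w. \<phi>' \<omega> w \<partial>\<mu>) \<le> (norm (Mart N n \<omega>))\<^sup>2 + J N n \<omega> * \<psi> (Suc n) (th n \<omega>)" for \<omega>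
  proof -
    define \<theta> where "\<theta> = th n \<omega>"
    define Y where "Y w = G (Suc n) \<theta> w - Gs w" for w
    have Ym: "Y \<in> borel_measurable \<mu>" unfolding Y_def[abs_def] using G_section[of "Suc n" \<theta>] Gs_meas by simp
    have Y2: "integrable \<mu> (\<lambda>w. (norm (Y w))\<^sup>2)" unfolding Y_def by (rule \<psi>_bound(1)) simp
    have EY: "(\<integral>w. Y w \<partial>\<mu>) = g (Suc n) \<theta>"
      unfolding Y_def g_def using integrable_G[of "Suc n" \<theta>] integrable_Gs by (simp add: Gs_mean)
    let ?m = "g (Suc n) \<theta>"
    note c2 = noise.integrable_norm_add_scaleR_sq(2)[OF Ym Y2, of "- ?m" 1, simplified]
      and c3 = noise.integrable_norm_add_scaleR_sq(3)[OF Ym Y2, of "- ?m" 1, simplified]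
    define Y' where "Y' w = Y w - ?m" for w
    have Y'm: "Y' \<in> borel_measurable \<mu>" unfolding Y'_def[abs_def] using Ym by simp
    have Y'2: "integrable \<mu> (\<lambda>w. (norm (Y' w))\<^sup>2)" using c2 by (simp add: Y'_def add.commute)
    have "(\<integral>w. (norm (Y' w))\<^sup>2 \<partial>\<mu>) = \<psi> (Suc n) \<theta> - (norm ?m)\<^sup>2"
      using c3 unfolding EY by (simp add: Y'_def Y_def \<psi>_def add.commute power2_norm_eq_inner)
    then have le: "(\<integral>w. (norm (Y' w))\<^sup>2 \<partial>\<mu>) \<le> \<psi> (Suc n) \<theta>" by simp
    have Yi: "integrable \<mu> Y" by (rule noise.integrable_norm_add_scaleR_sq(1)[OF Ym Y2])
    have EY': "(\<integral>w. Y' w \<partial>\<mu>) = 0" unfolding Y'_def using Yi EY by (simp add: noise.prob_space)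
    have eq: "\<phi>' \<omega> = (\<lambda>w. (norm (Mart N n \<omega> + J N n \<omega> *\<^sub>R Y' w))\<^sup>2)"
      by (simp add: \<phi>'_def Dm_def Y'_def Y_def \<theta>_def fun_eq_iff algebra_simps)
    show "integrable \<mu> (\<phi>' \<omega>)" unfolding eq by (rule noise.integrable_norm_add_scaleR_sq(2)[OF Y'm Y'2])
    have "(J N n \<omega>)\<^sup>2 = J N n \<omega>" using J_cases[of N n \<omega>] by auto
    then have "(\<integral>w. \<phi>' \<omega> w \<partial>\<mu>) = (norm (Mart N n \<omega>))\<^sup>2 + J N n \<omega> * (\<integral>w. (norm (Y' w))\<^sup>2 \<partial>\<mu>)"
      unfolding eq noise.integrable_norm_add_scaleR_sq(3)[OF Y'm Y'2] EY' by simp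
    also have "\<dots> \<le> (norm (Mart N n \<omega>))\<^sup>2 + J N n \<omega> * \<psi> (Suc n) \<theta>"
      using le by (intro add_left_mono mult_left_mono) auto
    finally show "(\<integral>w. \<phi>' \<omega> w \<partial>\<mu>) \<le> (norm (Mart N n \<omega>))\<^sup>2 + J N n \<omega> * \<psi> (Suc n) (th n \<omega>)" by (simp add: \<theta>_def)
  qed
  have int: "integrable \<Omega> (\<lambda>\<omega>. (norm (Mart N n \<omega>))\<^sup>2 + J N n \<omega> * \<psi> (Suc n) (th n \<omega>))" using Suc by simp
  have eq: "\<phi>' \<omega> (W (Suc n) \<omega>) = (norm (Mart N (Suc n) \<omega>))\<^sup>2" for \<omega>
    by (simp add: \<phi>'_def Mart_def)
  have nn: "0 \<le> \<phi>' \<omega> w" for \<omega> w by (simp add: \<phi>'_def)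
  note s = step_le[OF m nn inner int]
  have "expectation (\<lambda>\<omega>. (norm (Mart N (Suc n) \<omega>))\<^sup>2) \<le> expectation (\<lambda>\<omega>. (norm (Mart N n \<omega>))\<^sup>2 + J N n \<omega> * \<psi> (Suc n) (th n \<omega>))"
    using s(2) unfolding eq .
  also have "\<dots> = expectation (\<lambda>\<omega>. (norm (Mart N n \<omega>))\<^sup>2) + dv N n" using Suc by (simp add: dv_def)
  finally show ?case using s(1) Suc unfolding eq by simp
qed

text \<open>\<open>close\<close> is applied with half of the tolerance; the rest tends to 0 with the
  root mean square of the iterates and with \<open>h\<close>. Convergence without a rate suffices,
  because the second moment of \<open>Mart\<close>, divided by \<open>n\<close>, is bounded by a
  Cesaro mean of \<open>dv\<close>.\<close>

lemma dv_null: "dv N \<longlonglongrightarrow> 0"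
proof (rule LIMSEQ_I)
  fix r :: real assume r: "0 < r"
  obtain K where K: "\<And>i \<theta>. 1 \<le> i \<Longrightarrow> norm (\<theta> - \<theta>s) \<le> \<delta> \<Longrightarrow> \<psi> i \<theta> \<le> r / 2 + K * (norm (\<theta> - \<theta>s) + h i)"
    using close[of "r / 2"] r unfolding \<psi>_def by auto
  define K' where "K' = max K 0"
  have le: "dv N i \<le> r / 2 + K' * (sqrt (y N i) + h (Suc i))" if i: "i \<ge> N" for i
  proof -
    have "dv N i \<le> expectation (\<lambda>\<omega>. r / 2 + K' * (J N i \<omega> * norm (x i \<omega>) + h (Suc i)))"
      unfolding dv_def
    proof (rule integral_mono)
      fix \<omega>
      show "J N i \<omega> * \<psi> (Suc i) (th i \<omega>) \<le> r / 2 + K' * (J N i \<omega> * norm (x i \<omega>) + h (Suc i))"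
      proof (cases "J N i \<omega> = 0")
        case True
        then show ?thesis using r h_nonneg[of "Suc i"] by (simp add: K'_def)
      next
        case False
        then have J: "J N i \<omega> = 1" using J_cases by blast
        then have "norm (th i \<omega> - \<theta>s) \<le> \<delta>" using J_eq_1D[OF J i] by (simp add: x_def)
        from K[OF _ this, of "Suc i"] have "\<psi> (Suc i) (th i \<omega>) \<le> r / 2 + K * (norm (x i \<omega>) + h (Suc i))"
          by (simp add: x_def)
        also have "\<dots> \<le> r / 2 + K' * (norm (x i \<omega>) + h (Suc i))"
          using h_nonneg[of "Suc i"] by (intro add_left_mono mult_right_mono) (auto simp: K'_def)
        finally show ?thesis by (simp add: J)
      qed
    qed auto
    also have "\<dots> = r / 2 + K' * (expectation (\<lambda>\<omega>. J N i \<omega> * norm (x i \<omega>)) + h (Suc i))"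
      by (simp add: prob_space)
    also have "\<dots> \<le> r / 2 + K' * (sqrt (y N i) + h (Suc i))"
      using J_norm_le[of N i] by (intro add_left_mono mult_left_mono add_right_mono) (auto simp: K'_def)
    finally show ?thesis .
  qed
  have "(\<lambda>i. K' * (sqrt (y N i) + h (Suc i))) \<longlonglongrightarrow> K' * (sqrt 0 + 0)"
    by (intro tendsto_intros y_null LIMSEQ_Suc[OF h_null])
  then have "\<forall>\<^sub>F i in sequentially. K' * (sqrt (y N i) + h (Suc i)) < r / 2"
    using r by (intro order_tendstoD(2)) auto
  then have "\<forall>\<^sub>F i in sequentially. norm (dv N i - 0) < r"
    using eventually_ge_at_top[of N]
  proof eventually_elim
    case (elim i)
    have "0 \<le> dv N i" unfolding dv_def by (intro Bochner_Integration.integral_nonneg) (simp add: \<psi>_nonneg)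
    then show ?case using le[OF elim(2)] elim(1) by simp
  qed
  then show "\<exists>no. \<forall>n\<ge>no. norm (dv N n - 0) < r" by (simp add: eventually_sequentially)
qed

lemma Mart_norm_integrable [simp]: "integrable \<Omega> (\<lambda>\<omega>. norm (Mart N n \<omega>))"
  by (rule square_integrable_imp_integrable) (use Mart_step in auto)

lemma Mart_null: "(\<lambda>n. expectation (\<lambda>\<omega>. norm (Mart N n \<omega>)) / sqrt (real n)) \<longlonglongrightarrow> 0"
proof (rule real_tendsto_sandwich[OF _ _ tendsto_const])
  show "\<forall>\<^sub>F n in sequentially. 0 \<le> expectation (\<lambda>\<omega>. norm (Mart N n \<omega>)) / sqrt (real n)"
    by (intro always_eventually allI divide_nonneg_nonneg Bochner_Integration.integral_nonneg) auto
  show "\<forall>\<^sub>F n in sequentially. expectation (\<lambda>\<omega>. norm (Mart N n \<omega>)) / sqrt (real n) \<le> sqrt ((\<Sum>i<n. dv N i) / real n)"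
  proof (intro always_eventually allI)
    fix n
    have "expectation (\<lambda>\<omega>. norm (Mart N n \<omega>)) \<le> sqrt (expectation (\<lambda>\<omega>. (norm (Mart N n \<omega>))\<^sup>2))"
      using Mart_step by (intro expectation_le_sqrt) auto
    also have "\<dots> \<le> sqrt (\<Sum>i<n. dv N i)" using Mart_step by simp
    finally show "expectation (\<lambda>\<omega>. norm (Mart N n \<omega>)) / sqrt (real n) \<le> sqrt ((\<Sum>i<n. dv N i) / real n)"
      by (simp add: real_sqrt_divide divide_right_mono)
  qed
  show "(\<lambda>n. sqrt ((\<Sum>i<n. dv N i) / real n)) \<longlonglongrightarrow> 0"
    using tendsto_real_sqrt[OF cesaro_null[OF dv_null]] by simp
qed

end

subsection \<open>Averaging of the iterates\<close>

context stochastic_approximation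
begin

text \<open>The reciprocal step size, with value 0 at 0 because \<open>powr\<close> vanishes there;
  the summation by parts then has no boundary term at the initial point.\<close>

definition \<rho> :: "nat \<Rightarrow> real" where "\<rho> i = real i powr \<alpha> / \<eta>\<^sub>0"

lemma \<rho>_Suc: "\<rho> (Suc i) = 1 / \<eta> (Suc i)"
  using \<eta>0 by (simp add: \<rho>_def \<eta>_def powr_minus_divide)

lemma \<rho>_nonneg: "0 \<le> \<rho> i" using \<eta>0 by (simp add: \<rho>_def)

lemma \<rho>_mono: "\<rho> i \<le> \<rho> (Suc i)"
  using \<eta>0 \<alpha> unfolding \<rho>_def by (intro divide_right_mono powr_mono2) auto

lemma abel_sum:
  "(\<Sum>i<n. \<rho> (Suc i) *\<^sub>R (x i \<omega> - x (Suc i) \<omega>)) = (\<Sum>i<n. (\<rho> (Suc i) - \<rho> i) *\<^sub>R x i \<omega>) - \<rho> n *\<^sub>R x n \<omega>"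
proof (induction n)
  case 0
  then show ?case using \<alpha> by (simp add: \<rho>_def)
next
  case (Suc n)
  then show ?case by (simp add: algebra_simps)
qed

definition cH :: real where "cH = onorm Hi"

lemma cH: "norm (Hi z) \<le> cH * norm z" "0 \<le> cH"
  unfolding cH_def using Hi(1) by (auto intro: onorm onorm_pos_le)

text \<open>Each distance carries the weight of its own time, so expectations reduce to
  \<open>y N i\<close> term by term. The first two summands account for the average running over
  1..n while the recursion is summed over 0..n-1.\<close>

definition err :: "nat \<Rightarrow> nat \<Rightarrow> 'w \<Rightarrow> real" where
  "err N n \<omega> = J N n \<omega> * norm (x n \<omega>) + norm (\<theta>\<^sub>0 - \<theta>s)
    + cH * ((\<Sum>i<n. (\<rho> (Suc i) - \<rho> i) * (J N i \<omega> * norm (x i \<omega>))) + \<rho> n * (J N n \<omega> * norm (x n \<omega>))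
      + CR * (\<Sum>i<n. J N i \<omega> * X i \<omega>) + Cb * (\<Sum>i<n. h (Suc i)) + norm (Mart N n \<omega>))"

lemma err_nonneg: "0 \<le> err N n \<omega>"
  unfolding err_def using cH(2) \<rho>_mono \<rho>_nonneg CR_nonneg Cb_nonneg h_nonneg
  by (intro add_nonneg_nonneg mult_nonneg_nonneg sum_nonneg) (auto simp: X_def)

text \<open>On this event all earlier weights are 1 as well, so \<open>Dm\<close> is the unweighted
  difference and the recursion can be solved exactly for \<open>H (x i \<omega>)\<close>, hence for
  \<open>x i \<omega>\<close> by \<open>Hi\<close>.\<close>

lemma sum_x_decomposition:
  assumes J: "J N n \<omega> = 1"
  shows "norm ((\<Sum>i=1..n. x i \<omega>) + Hi (\<Sum>i<n. Gs (W (Suc i) \<omega>))) \<le> err N n \<omega>"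
proof -
  interpret Hi: bounded_linear Hi by (rule Hi(1))
  have Ji: "J N i \<omega> = 1" if "i \<le> n" for i using J_eq_1_mono[OF J that] .
  define R where "R i = \<phi> (th i \<omega>) - H (x i \<omega>)" for i
  define b where "b i = g (Suc i) (th i \<omega>) - \<phi> (th i \<omega>)" for i
  have xi: "x i \<omega> = Hi (\<rho> (Suc i) *\<^sub>R (x i \<omega> - x (Suc i) \<omega>) - R i - b i - Dm N i \<omega> (W (Suc i) \<omega>) - Gs (W (Suc i) \<omega>))"
    if "i < n" for i
  proof -
    have "\<rho> (Suc i) *\<^sub>R (x i \<omega> - x (Suc i) \<omega>) = G (Suc i) (th i \<omega>) (W (Suc i) \<omega>)"
      using \<eta>_pos[of i] by (simp add: x_Suc \<rho>_Suc)
    then have "\<rho> (Suc i) *\<^sub>R (x i \<omega> - x (Suc i) \<omega>) - R i - b i - Dm N i \<omega> (W (Suc i) \<omega>) - Gs (W (Suc i) \<omega>) = H (x i \<omega>)"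
      using Ji[of i] that by (simp add: R_def b_def Dm_def)
    then show ?thesis by (simp add: Hi(2))
  qed
  let ?A = "\<Sum>i<n. \<rho> (Suc i) *\<^sub>R (x i \<omega> - x (Suc i) \<omega>)"
  let ?S = "\<Sum>i<n. Gs (W (Suc i) \<omega>)"
  have "(\<Sum>i<n. x i \<omega>) = Hi (?A - (\<Sum>i<n. R i) - (\<Sum>i<n. b i) - Mart N n \<omega> - ?S)"
    unfolding Mart_def sum_subtractf[symmetric] Hi.sum by (intro sum.cong) (simp_all add: xi[symmetric])
  then have s: "(\<Sum>i<n. x i \<omega>) + Hi ?S = Hi (?A - (\<Sum>i<n. R i) - (\<Sum>i<n. b i) - Mart N n \<omega>)"
    by (simp add: Hi.diff)
  have shift: "(\<Sum>i=1..n. x i \<omega>) = (\<Sum>i<n. x i \<omega>) + x n \<omega> - x 0 \<omega>"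
    by (induction n) (simp_all add: algebra_simps)
  have nA: "norm ?A \<le> (\<Sum>i<n. (\<rho> (Suc i) - \<rho> i) * (J N i \<omega> * norm (x i \<omega>))) + \<rho> n * (J N n \<omega> * norm (x n \<omega>))"
  proof -
    have "norm ?A \<le> norm (\<Sum>i<n. (\<rho> (Suc i) - \<rho> i) *\<^sub>R x i \<omega>) + norm (\<rho> n *\<^sub>R x n \<omega>)"
      unfolding abel_sum by (rule norm_triangle_ineq4)
    also have "norm (\<rho> n *\<^sub>R x n \<omega>) = \<rho> n * (J N n \<omega> * norm (x n \<omega>))" using J \<rho>_nonneg by simp
    also have "norm (\<Sum>i<n. (\<rho> (Suc i) - \<rho> i) *\<^sub>R x i \<omega>) \<le> (\<Sum>i<n. (\<rho> (Suc i) - \<rho> i) * (J N i \<omega> * norm (x i \<omega>)))"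
      using \<rho>_mono Ji by (intro sum_norm_le) (auto simp: less_imp_le)
    finally show ?thesis by simp
  qed
  have nR: "norm (\<Sum>i<n. R i) \<le> CR * (\<Sum>i<n. J N i \<omega> * X i \<omega>)"
    unfolding sum_distrib_left using \<phi>_lin Ji by (intro sum_norm_le) (auto simp: R_def X_def x_def less_imp_le)
  have nb: "norm (\<Sum>i<n. b i) \<le> Cb * (\<Sum>i<n. h (Suc i))"
    unfolding sum_distrib_left using bias by (intro sum_norm_le) (auto simp: b_def g_def)
  let ?V = "?A - (\<Sum>i<n. R i) - (\<Sum>i<n. b i) - Mart N n \<omega>"
  have "norm ?V \<le> norm ?A + norm (\<Sum>i<n. R i) + norm (\<Sum>i<n. b i) + norm (Mart N n \<omega>)"
    by (meson add_mono_thms_linordered_semiring(3) norm_triangle_ineq4 order_trans)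
  then have V: "norm ?V \<le> (\<Sum>i<n. (\<rho> (Suc i) - \<rho> i) * (J N i \<omega> * norm (x i \<omega>))) + \<rho> n * (J N n \<omega> * norm (x n \<omega>))
      + CR * (\<Sum>i<n. J N i \<omega> * X i \<omega>) + Cb * (\<Sum>i<n. h (Suc i)) + norm (Mart N n \<omega>)"
    using nA nR nb by linarith
  have "(\<Sum>i=1..n. x i \<omega>) + Hi ?S = x n \<omega> - x 0 \<omega> + Hi ?V"
    unfolding shift using s by (simp add: algebra_simps)
  then have "norm ((\<Sum>i=1..n. x i \<omega>) + Hi ?S) \<le> norm (x n \<omega>) + norm (x 0 \<omega>) + norm (Hi ?V)"
    using norm_triangle_ineq[of "x n \<omega> - x 0 \<omega>" "Hi ?V"] norm_triangle_ineq4[of "x n \<omega>" "x 0 \<omega>"] by simp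
  also have "\<dots> \<le> norm (x n \<omega>) + norm (x 0 \<omega>) + cH * norm ?V"
    using cH(1)[of ?V] by simp
  also have "cH * norm ?V \<le> cH * ((\<Sum>i<n. (\<rho> (Suc i) - \<rho> i) * (J N i \<omega> * norm (x i \<omega>))) + \<rho> n * (J N n \<omega> * norm (x n \<omega>))
      + CR * (\<Sum>i<n. J N i \<omega> * X i \<omega>) + Cb * (\<Sum>i<n. h (Suc i)) + norm (Mart N n \<omega>))"
    by (rule mult_left_mono[OF V cH(2)])
  finally show ?thesis by (simp add: err_def J x_def)
qed

lemma err_integrable [simp]: "integrable \<Omega> (err N n)"
  unfolding err_def[abs_def]
  by (intro Bochner_Integration.integrable_add integrable_mult_right Bochner_Integration.integrable_sum) auto

lemma err_expectation_le:
  "expectation (err N n) \<le> sqrt (y N n) + norm (\<theta>\<^sub>0 - \<theta>s)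
    + cH * ((\<Sum>i<n. (\<rho> (Suc i) - \<rho> i) * sqrt (y N i)) + \<rho> n * sqrt (y N n)
      + CR * (\<Sum>i<n. y N i) + Cb * (\<Sum>i<n. h (Suc i)) + expectation (\<lambda>\<omega>. norm (Mart N n \<omega>)))"
proof -
  have "expectation (err N n) = expectation (\<lambda>\<omega>. J N n \<omega> * norm (x n \<omega>)) + norm (\<theta>\<^sub>0 - \<theta>s)
    + cH * ((\<Sum>i<n. (\<rho> (Suc i) - \<rho> i) * expectation (\<lambda>\<omega>. J N i \<omega> * norm (x i \<omega>)))
      + \<rho> n * expectation (\<lambda>\<omega>. J N n \<omega> * norm (x n \<omega>))
      + CR * (\<Sum>i<n. y N i) + Cb * (\<Sum>i<n. h (Suc i)) + expectation (\<lambda>\<omega>. norm (Mart N n \<omega>)))"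
    unfolding err_def[abs_def] y_def by (simp add: Bochner_Integration.integral_sum prob_space)
  also have "\<dots> \<le> sqrt (y N n) + norm (\<theta>\<^sub>0 - \<theta>s)
    + cH * ((\<Sum>i<n. (\<rho> (Suc i) - \<rho> i) * sqrt (y N i)) + \<rho> n * sqrt (y N n)
      + CR * (\<Sum>i<n. y N i) + Cb * (\<Sum>i<n. h (Suc i)) + expectation (\<lambda>\<omega>. norm (Mart N n \<omega>)))"
    using cH(2) \<rho>_mono \<rho>_nonneg J_norm_le
    by (intro add_mono mult_left_mono sum_mono order_refl) auto
  finally show ?thesis .
qed

lemma sqrt_Suc_le: "0 < i \<Longrightarrow> sqrt (real (Suc i)) \<le> sqrt 2 * real i powr (1/2)"
proof -
  assume "0 < i"
  then have "sqrt (real (Suc i)) \<le> sqrt (2 * real i)" by simp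
  then show ?thesis by (simp add: real_sqrt_mult powr_half_sqrt)
qed

text \<open>With \<open>y N i\<close> of order i^(-\<alpha>), the conditions on the exponents enter:
  \<alpha> < 1 for the terms of the summation by parts (\<open>t2\<close>, \<open>t3\<close>),
  \<alpha> > 1/2 for the linearisation error (\<open>t4\<close>), \<gamma> > 1/2 for the bias
  (\<open>t5\<close>). The martingale term is \<open>Mart_null\<close>.\<close>

lemma err_null: "(\<lambda>n. expectation (err N n) / sqrt (real n)) \<longlonglongrightarrow> 0"
proof -
  obtain K where K: "0 \<le> K" "\<forall>\<^sub>F i in sequentially. y N i \<le> K * \<eta> i" using y_rate by blast
  have sy: "\<forall>\<^sub>F i in sequentially. sqrt (y N i) \<le> sqrt (K * \<eta>\<^sub>0) * real i powr (- \<alpha> / 2) \<and> 0 < i"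
    using K(2) eventually_gt_at_top[of 0]
  proof eventually_elim
    case (elim i)
    have "sqrt (y N i) \<le> sqrt (K * \<eta> i)" using elim by simp
    also have "\<dots> = sqrt (K * \<eta>\<^sub>0) * sqrt (real i powr (- \<alpha>))" by (simp add: \<eta>_def real_sqrt_mult)
    also have "sqrt (real i powr (- \<alpha>)) = real i powr (- \<alpha> / 2)"
      by (simp add: powr_half_sqrt[symmetric] powr_powr)
    finally show ?case using elim by simp
  qed
  have inv: "(\<lambda>n. 1 / sqrt (real n)) \<longlonglongrightarrow> 0"
    by (intro tendsto_divide_0[OF tendsto_const] filterlim_at_top_imp_at_infinity
        filterlim_compose[OF sqrt_at_top filterlim_real_sequentially])
  have t1: "(\<lambda>n. sqrt (y N n) * (1 / sqrt (real n))) \<longlonglongrightarrow> 0"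
    using tendsto_mult[OF tendsto_real_sqrt[OF y_null[of N]] inv] by simp
  have t2: "(\<lambda>n. (\<Sum>i<n. (\<rho> (Suc i) - \<rho> i) * sqrt (y N i)) / sqrt (real n)) \<longlonglongrightarrow> 0"
  proof (rule sum_over_sqrt_null, rule real_tendsto_sandwich[OF _ _ tendsto_const])
    show "\<forall>\<^sub>F i in sequentially. 0 \<le> (\<rho> (Suc i) - \<rho> i) * sqrt (y N i) * sqrt (real (Suc i))"
      using \<rho>_mono y_nonneg by (intro always_eventually allI mult_nonneg_nonneg) auto
    define c where "c = sqrt (K * \<eta>\<^sub>0) * sqrt 2 / \<eta>\<^sub>0"
    show "\<forall>\<^sub>F i in sequentially. (\<rho> (Suc i) - \<rho> i) * sqrt (y N i) * sqrt (real (Suc i))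
        \<le> c * ((real (Suc i) powr \<alpha> - real i powr \<alpha>) * real i powr ((1 - \<alpha>) / 2))"
      using sy
    proof eventually_elim
      case (elim i)
      have "(\<rho> (Suc i) - \<rho> i) * sqrt (y N i) * sqrt (real (Suc i))
        \<le> (\<rho> (Suc i) - \<rho> i) * (sqrt (K * \<eta>\<^sub>0) * real i powr (- \<alpha> / 2)) * (sqrt 2 * real i powr (1/2))"
        using \<rho>_mono[of i] elim sqrt_Suc_le[of i] y_nonneg K(1) \<eta>0
        by (intro mult_mono mult_left_mono mult_nonneg_nonneg) auto
      also have "\<dots> = c * ((real (Suc i) powr \<alpha> - real i powr \<alpha>) * (real i powr (- \<alpha> / 2) * real i powr (1/2)))"
        unfolding \<rho>_def c_def using \<eta>0 by (simp add: field_simps)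
      also have "real i powr (- \<alpha> / 2) * real i powr (1/2) = real i powr ((1 - \<alpha>) / 2)"
        by (simp add: powr_add[symmetric] field_simps)
      finally show ?case .
    qed
    show "(\<lambda>i. c * ((real (Suc i) powr \<alpha> - real i powr \<alpha>) * real i powr ((1 - \<alpha>) / 2))) \<longlonglongrightarrow> 0"
      using \<alpha> by (intro tendsto_mult_right_zero powr_increment_null) auto
  qed
  have t3: "(\<lambda>n. (\<rho> n * sqrt (y N n)) * (1 / sqrt (real n))) \<longlonglongrightarrow> 0"
  proof (rule real_tendsto_sandwich[OF _ _ tendsto_const])
    show "\<forall>\<^sub>F n in sequentially. 0 \<le> (\<rho> n * sqrt (y N n)) * (1 / sqrt (real n))"
      using \<rho>_nonneg y_nonneg by (intro always_eventually allI mult_nonneg_nonneg) auto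
    define c where "c = sqrt (K * \<eta>\<^sub>0) / \<eta>\<^sub>0"
    show "\<forall>\<^sub>F n in sequentially. (\<rho> n * sqrt (y N n)) * (1 / sqrt (real n)) \<le> c * real n powr ((\<alpha> - 1) / 2)"
      using sy
    proof eventually_elim
      case (elim n)
      have "(\<rho> n * sqrt (y N n)) * (1 / sqrt (real n)) \<le> (\<rho> n * (sqrt (K * \<eta>\<^sub>0) * real n powr (- \<alpha> / 2))) * (1 / sqrt (real n))"
        using \<rho>_nonneg[of n] elim by (intro mult_right_mono mult_left_mono) auto
      also have "(\<rho> n * (sqrt (K * \<eta>\<^sub>0) * real n powr (- \<alpha> / 2))) * (1 / sqrt (real n))
          = c * (real n powr \<alpha> * real n powr (- \<alpha> / 2) * real n powr (- 1 / 2))"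
        using elim by (simp add: \<rho>_def c_def powr_minus_divide powr_half_sqrt mult_ac)
      also have "real n powr \<alpha> * real n powr (- \<alpha> / 2) * real n powr (- 1 / 2) = real n powr ((\<alpha> - 1) / 2)"
        by (simp add: powr_add[symmetric] field_simps)
      finally show ?case .
    qed
    show "(\<lambda>n. c * real n powr ((\<alpha> - 1) / 2)) \<longlonglongrightarrow> 0"
      using \<alpha> by (intro tendsto_mult_right_zero tendsto_neg_powr filterlim_real_sequentially) auto
  qed
  have t4: "(\<lambda>n. (\<Sum>i<n. y N i) / sqrt (real n)) \<longlonglongrightarrow> 0"
  proof (rule sum_over_sqrt_null, rule real_tendsto_sandwich[OF _ _ tendsto_const])
    show "\<forall>\<^sub>F i in sequentially. 0 \<le> y N i * sqrt (real (Suc i))"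
      using y_nonneg by (intro always_eventually allI mult_nonneg_nonneg) auto
    define c where "c = K * \<eta>\<^sub>0 * sqrt 2"
    show "\<forall>\<^sub>F i in sequentially. y N i * sqrt (real (Suc i)) \<le> c * real i powr (1/2 - \<alpha>)"
      using K(2) eventually_gt_at_top[of 0]
    proof eventually_elim
      case (elim i)
      have "y N i * sqrt (real (Suc i)) \<le> (K * \<eta> i) * (sqrt 2 * real i powr (1/2))"
        using elim sqrt_Suc_le[of i] y_nonneg K(1) \<eta>_nonneg by (intro mult_mono) auto
      also have "\<dots> = c * (real i powr (- \<alpha>) * real i powr (1/2))" by (simp add: c_def \<eta>_def)
      also have "real i powr (- \<alpha>) * real i powr (1/2) = real i powr (1/2 - \<alpha>)"
        by (simp add: powr_add[symmetric])
      finally show ?case .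
    qed
    show "(\<lambda>i. c * real i powr (1/2 - \<alpha>)) \<longlonglongrightarrow> 0"
      using \<alpha> by (intro tendsto_mult_right_zero tendsto_neg_powr filterlim_real_sequentially) auto
  qed
  have t5: "(\<lambda>n. (\<Sum>i<n. h (Suc i)) / sqrt (real n)) \<longlonglongrightarrow> 0"
  proof (rule sum_over_sqrt_null)
    have "h (Suc i) * sqrt (real (Suc i)) = h\<^sub>0 * real (Suc i) powr (1/2 - \<gamma>)" for i
      unfolding h_def powr_half_sqrt[OF of_nat_0_le_iff, symmetric]
      by (simp add: powr_add[symmetric] del: of_nat_Suc)
    moreover have "(\<lambda>i. h\<^sub>0 * real (Suc i) powr (1/2 - \<gamma>)) \<longlonglongrightarrow> 0"
      using \<gamma> by (intro tendsto_mult_right_zero LIMSEQ_Suc[where f="\<lambda>i. real i powr (1/2 - \<gamma>)"]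
          tendsto_neg_powr filterlim_real_sequentially) auto
    ultimately show "(\<lambda>i. h (Suc i) * sqrt (real (Suc i))) \<longlonglongrightarrow> 0" by simp
  qed
  let ?ub = "\<lambda>n. sqrt (y N n) * (1 / sqrt (real n)) + norm (\<theta>\<^sub>0 - \<theta>s) * (1 / sqrt (real n))
    + cH * ((\<Sum>i<n. (\<rho> (Suc i) - \<rho> i) * sqrt (y N i)) / sqrt (real n) + (\<rho> n * sqrt (y N n)) * (1 / sqrt (real n))
      + CR * ((\<Sum>i<n. y N i) / sqrt (real n)) + Cb * ((\<Sum>i<n. h (Suc i)) / sqrt (real n))
      + expectation (\<lambda>\<omega>. norm (Mart N n \<omega>)) / sqrt (real n))"
  have "?ub \<longlonglongrightarrow> 0 + norm (\<theta>\<^sub>0 - \<theta>s) * 0 + cH * (0 + 0 + CR * 0 + Cb * 0 + 0)"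
    by (intro tendsto_intros t1 t2 t3 t4 t5 inv Mart_null)
  then have ub: "?ub \<longlonglongrightarrow> 0" by simp
  show ?thesis
  proof (rule real_tendsto_sandwich[OF _ _ tendsto_const ub])
    show "\<forall>\<^sub>F n in sequentially. 0 \<le> expectation (err N n) / sqrt (real n)"
      by (intro always_eventually allI divide_nonneg_nonneg Bochner_Integration.integral_nonneg err_nonneg) auto
    show "\<forall>\<^sub>F n in sequentially. expectation (err N n) / sqrt (real n) \<le> ?ub n"
    proof (intro always_eventually allI)
      fix n
      show "expectation (err N n) / sqrt (real n) \<le> ?ub n"
        by (rule order_trans[OF divide_right_mono[OF err_expectation_le]])
           (simp_all add: add_divide_distrib distrib_left)
    qed
  qed
qed

text \<open>Where the path stays in the ball, \<open>err\<close> bounds the distance of the two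
  arguments; elsewhere a test function changes by at most \<open>2 * B\<close>. Since
  \<open>err_null\<close> holds for each fixed \<open>N\<close>, the exit probability can determine
  \<open>N\<close> before \<open>n\<close> grows.\<close>

theorem average_linearization:
  fixes k :: "'a \<Rightarrow> real"
  assumes bd: "\<And>z. \<bar>k z\<bar> \<le> B" and lip: "\<And>z z'. \<bar>k z - k z'\<bar> \<le> L * dist z z'"
    and k_meas: "k \<in> borel_measurable borel" and L: "0 \<le> L"
  shows "(\<lambda>n. expectation (\<lambda>\<omega>. k (sqrt (real n) *\<^sub>R ((1 / real n) *\<^sub>R (\<Sum>i=1..n. th i \<omega>) - \<theta>s)))
    - expectation (\<lambda>\<omega>. k (- (1 / sqrt (real n)) *\<^sub>R Hi (\<Sum>i<n. Gs (W (Suc i) \<omega>))))) \<longlonglongrightarrow> 0"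
proof -
  define U where "U n \<omega> = sqrt (real n) *\<^sub>R ((1 / real n) *\<^sub>R (\<Sum>i=1..n. th i \<omega>) - \<theta>s)" for n \<omega>
  define V where "V n \<omega> = - (1 / sqrt (real n)) *\<^sub>R Hi (\<Sum>i<n. Gs (W (Suc i) \<omega>))" for n \<omega>
  have B: "0 \<le> B" using order_trans[OF abs_ge_zero bd] .
  have Um[measurable]: "U n \<in> borel_measurable \<Omega>" for n unfolding U_def[abs_def] by measurable
  have Vm[measurable]: "V n \<in> borel_measurable \<Omega>" for n
  proof -
    have Him: "Hi \<in> borel_measurable borel"
      by (intro borel_measurable_continuous_onI linear_continuous_on Hi(1))
    have "(\<lambda>\<omega>. \<Sum>i<n. Gs (W (Suc i) \<omega>)) \<in> borel_measurable \<Omega>"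
      by (intro borel_measurable_sum measurable_compose[OF W_measurable Gs_meas])
    from measurable_compose[OF this Him] show ?thesis unfolding V_def[abs_def] by simp
  qed
  have ki: "integrable \<Omega> (\<lambda>\<omega>. k (Z \<omega>))" if "Z \<in> borel_measurable \<Omega>" for Z
    by (rule integrable_const_bound[where B=B]) (use measurable_compose[OF that k_meas] bd in auto)
  have bound: "\<bar>expectation (\<lambda>\<omega>. k (U n \<omega>)) - expectation (\<lambda>\<omega>. k (V n \<omega>))\<bar>
      \<le> L * (expectation (err N n) / sqrt (real n)) + 2 * B * (1 - expectation (J N n))" if n: "n > 0" for n N
  proof -
    have pw: "\<bar>k (U n \<omega>) - k (V n \<omega>)\<bar> \<le> L * (err N n \<omega> / sqrt (real n)) + 2 * B * (1 - J N n \<omega>)" for \<omega>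
    proof (cases "J N n \<omega> = 1")
      case True
      have "U n \<omega> = (1 / sqrt (real n)) *\<^sub>R (\<Sum>i=1..n. x i \<omega>)"
      proof -
        have "(\<Sum>i=1..n. x i \<omega>) = (\<Sum>i=1..n. th i \<omega>) - real n *\<^sub>R \<theta>s"
          by (simp add: x_def sum_subtractf scaleR_conv_of_real sum_constant_scaleR)
        moreover have "sqrt (real n) / real n = 1 / sqrt (real n)" "real n / sqrt (real n) = sqrt (real n)"
          using n by (simp_all add: field_simps real_div_sqrt)
        ultimately show ?thesis unfolding U_def by (simp add: scaleR_diff_right)
      qed
      then have "U n \<omega> - V n \<omega> = (1 / sqrt (real n)) *\<^sub>R ((\<Sum>i=1..n. x i \<omega>) + Hi (\<Sum>i<n. Gs (W (Suc i) \<omega>)))"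
        by (simp add: V_def scaleR_add_right)
      then have "dist (U n \<omega>) (V n \<omega>) \<le> err N n \<omega> / sqrt (real n)"
        using sum_x_decomposition[OF True] n by (simp add: dist_norm divide_right_mono)
      then have "L * dist (U n \<omega>) (V n \<omega>) \<le> L * (err N n \<omega> / sqrt (real n))"
        using L by (rule mult_left_mono)
      then show ?thesis using lip[of "U n \<omega>" "V n \<omega>"] True by simp
    next
      case False
      then have "J N n \<omega> = 0" using J_cases by blast
      moreover have "\<bar>k (U n \<omega>) - k (V n \<omega>)\<bar> \<le> 2 * B" using bd[of "U n \<omega>"] bd[of "V n \<omega>"] by linarith
      moreover have "0 \<le> L * (err N n \<omega> / sqrt (real n))" using L err_nonneg by simp
      ultimately show ?thesis by simp
    qed
    have "\<bar>expectation (\<lambda>\<omega>. k (U n \<omega>)) - expectation (\<lambda>\<omega>. k (V n \<omega>))\<bar> = \<bar>expectation (\<lambda>\<omega>. k (U n \<omega>) - k (V n \<omega>))\<bar>"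
      using ki[OF Um] ki[OF Vm] by simp
    also have "\<dots> \<le> expectation (\<lambda>\<omega>. \<bar>k (U n \<omega>) - k (V n \<omega>)\<bar>)"
      using integral_norm_bound[of \<Omega> "\<lambda>\<omega>. k (U n \<omega>) - k (V n \<omega>)"] by simp
    also have "\<dots> \<le> expectation (\<lambda>\<omega>. L * (err N n \<omega> / sqrt (real n)) + 2 * B * (1 - J N n \<omega>))"
      using ki[OF Um] ki[OF Vm] by (intro integral_mono pw) auto
    also have "\<dots> = L * (expectation (err N n) / sqrt (real n)) + 2 * B * (1 - expectation (J N n))"
      by (simp add: prob_space)
    finally show ?thesis .
  qed
  have "(\<lambda>n. expectation (\<lambda>\<omega>. k (U n \<omega>)) - expectation (\<lambda>\<omega>. k (V n \<omega>))) \<longlonglongrightarrow> 0"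
  proof (rule LIMSEQ_I)
    fix r :: real assume r: "0 < r"
    \<comment> \<open>Adding 1 to \<open>B\<close> keeps the denominator positive when
      \<open>B = 0\<close>.\<close>
    obtain N where N: "\<And>n. n \<ge> N \<Longrightarrow> 1 - expectation (J N n) \<le> r / (4 * (B + 1))"
      using stays_near[of "r / (4 * (B + 1))"] r B by auto
    have "(\<lambda>n. L * (expectation (err N n) / sqrt (real n))) \<longlonglongrightarrow> 0"
      by (intro tendsto_mult_right_zero err_null)
    then have "\<forall>\<^sub>F n in sequentially. L * (expectation (err N n) / sqrt (real n)) < r / 2"
      using r by (intro order_tendstoD(2)) auto
    then have "\<forall>\<^sub>F n in sequentially. norm (expectation (\<lambda>\<omega>. k (U n \<omega>)) - expectation (\<lambda>\<omega>. k (V n \<omega>)) - 0) < r"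
      using eventually_ge_at_top[of N] eventually_gt_at_top[of 0]
    proof eventually_elim
      case (elim n)
      have "2 * B * (1 - expectation (J N n)) \<le> 2 * B * (r / (4 * (B + 1)))"
        using N[OF elim(2)] B by (intro mult_left_mono) auto
      also have "\<dots> \<le> r / 2" using B r by (simp add: field_simps)
      finally show ?case using bound[OF elim(3), of N] elim(1) unfolding real_norm_def diff_0_right by linarith
    qed
    then show "\<exists>no. \<forall>n\<ge>no. norm (expectation (\<lambda>\<omega>. k (U n \<omega>)) - expectation (\<lambda>\<omega>. k (V n \<omega>)) - 0) < r"
      by (simp add: eventually_sequentially)
  qed
  then show ?thesis by (simp add: U_def V_def)
qed

end

subsection \<open>Sampling without replacement\<close>

lemma orthonormal_basis_finite_card:
  fixes B :: "(real^'n) set"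
  assumes "orthonormal_basis B"
  shows "finite B" and "card B = CARD('n)" and "(\<Sum>u\<in>B. (u \<bullet> x) *\<^sub>R u) = x"
proof -
  have ortho: "pairwise orthogonal B" and norm1: "\<And>u. u \<in> B \<Longrightarrow> norm u = 1" and span: "span B = UNIV"
    using assms by (auto simp: orthonormal_basis_def)
  have ind: "independent B"
    using norm1 by (intro pairwise_orthogonal_independent ortho) force
  show fin: "finite B" using ind by (rule independent_imp_finite)
  have "dim (span B) = card B" using ind by (rule dim_span_eq_card_independent)
  then show "card B = CARD('n)" by (simp add: span)
  have "(\<Sum>u\<in>B. (x \<bullet> u) *\<^sub>R u) = x"
    by (rule orthonormal_basis_expand[OF ortho norm1 _ fin]) (simp_all add: span)
  then show "(\<Sum>u\<in>B. (u \<bullet> x) *\<^sub>R u) = x" by (simp add: inner_commute)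
qed

lemma scaled_directions_props:
  fixes B :: "(real^'n) set"
  assumes "orthonormal_basis B"
  defines "D \<equiv> scaled_directions B"
  shows "finite D" and "card D = CARD('n)" and "(\<Sum>v\<in>D. (v \<bullet> x) *\<^sub>R v) = real CARD('n) *\<^sub>R x"
    and "v \<in> D \<Longrightarrow> (norm v)\<^sup>2 = real CARD('n)"
proof -
  let ?s = "sqrt (real CARD('n))"
  have inj: "inj_on (\<lambda>u. ?s *\<^sub>R u) B" by (auto simp: inj_on_def)
  show "finite D" using orthonormal_basis_finite_card(1)[OF assms(1)] by (simp add: D_def scaled_directions_def)
  show "card D = CARD('n)"
    using orthonormal_basis_finite_card(2)[OF assms(1)] card_image[OF inj] by (simp add: D_def scaled_directions_def)
  have "(\<Sum>v\<in>D. (v \<bullet> x) *\<^sub>R v) = (\<Sum>u\<in>B. real CARD('n) *\<^sub>R ((u \<bullet> x) *\<^sub>R u))"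
    unfolding D_def scaled_directions_def sum.reindex[OF inj] by (intro sum.cong) auto
  also have "\<dots> = real CARD('n) *\<^sub>R x"
    unfolding scaleR_sum_right[symmetric] orthonormal_basis_finite_card(3)[OF assms(1)] ..
  finally show "(\<Sum>v\<in>D. (v \<bullet> x) *\<^sub>R v) = real CARD('n) *\<^sub>R x" .
  show "v \<in> D \<Longrightarrow> (norm v)\<^sup>2 = real CARD('n)"
    using assms(1) by (auto simp: D_def scaled_directions_def orthonormal_basis_def power_mult_distrib)
qed

lemma wor_tuples_finite: "finite D \<Longrightarrow> finite (wor_tuples m D)"
  unfolding wor_tuples_def by (rule finite_subset[of _ "{1..m} \<rightarrow>\<^sub>E D"]) (auto intro: finite_PiE)

lemma wor_tuples_nonempty:
  assumes "finite D" "m \<le> card D"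
  shows "wor_tuples m D \<noteq> {}"
proof -
  obtain f :: "nat \<Rightarrow> 'a" where f: "f ` {1..m} \<subseteq> D" "inj_on f {1..m}"
    using card_le_inj[of "{1..m}" D] assms by auto
  have "restrict f {1..m} \<in> {1..m} \<rightarrow>\<^sub>E D" using f(1) by auto
  moreover have "inj_on (restrict f {1..m}) {1..m}" using f(2) by (simp only: inj_on_restrict_eq)
  ultimately show ?thesis unfolding wor_tuples_def by blast
qed

lemma wor_tuples_memD: "w \<in> wor_tuples m D \<Longrightarrow> j \<in> {1..m} \<Longrightarrow> w j \<in> D"
  by (auto simp: wor_tuples_def)

definition swap :: "'a \<Rightarrow> 'a \<Rightarrow> 'a \<Rightarrow> 'a" where
  "swap a b x = (if x = a then b else if x = b then a else x)"

lemma swap_swap [simp]: "swap a b (swap a b x) = x"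
  by (auto simp: swap_def)

lemma swap_eq_left: "swap a b x = a \<longleftrightarrow> x = b"
  by (auto simp: swap_def)

lemma swap_eq_other: "c \<noteq> a \<Longrightarrow> c \<noteq> b \<Longrightarrow> swap a b x = c \<longleftrightarrow> x = c"
  by (auto simp: swap_def)

text \<open>Exchanging two values in a tuple is an involution of the set of tuples. This symmetry
  replaces explicit counting: the number of tuples is never computed.\<close>

lemma sum_wor_tuples_swap:
  assumes "a \<in> D" "b \<in> D"
  shows "(\<Sum>w\<in>wor_tuples m D. \<Phi> (\<lambda>i\<in>{1..m}. swap a b (w i))) = (\<Sum>w\<in>wor_tuples m D. \<Phi> w)"
proof (rule sum.reindex_bij_betw)
  let ?T = "\<lambda>w. \<lambda>i\<in>{1..m}. swap a b (w i)"
  have mem: "?T w \<in> wor_tuples m D" if "w \<in> wor_tuples m D" for w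
  proof -
    have "swap a b (w i) \<in> D" if "i \<in> {1..m}" for i
      using wor_tuples_memD[OF \<open>w \<in> wor_tuples m D\<close> that] assms by (auto simp: swap_def)
    then have "?T w \<in> {1..m} \<rightarrow>\<^sub>E D" by (rule restrict_PiE_iff[THEN iffD2, OF ballI])
    moreover have "inj_on (?T w) {1..m}"
      unfolding inj_on_restrict_eq
    proof (rule inj_onI)
      fix i k assume ik: "i \<in> {1..m}" "k \<in> {1..m}" "swap a b (w i) = swap a b (w k)"
      have "inj_on w {1..m}" using that by (simp add: wor_tuples_def)
      moreover have "w i = w k" using arg_cong[OF ik(3), of "swap a b"] by simp
      ultimately show "i = k" using ik(1,2) by (rule inj_onD)
    qed
    ultimately show ?thesis unfolding wor_tuples_def by blast
  qed
  have inv: "?T (?T w) = w" if "w \<in> wor_tuples m D" for w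
  proof -
    have "w \<in> extensional {1..m}" using that by (auto simp: wor_tuples_def PiE_def)
    then show ?thesis by (auto simp: fun_eq_iff extensional_def)
  qed
  show "bij_betw ?T (wor_tuples m D) (wor_tuples m D)"
    by (rule bij_betwI[where g="?T"]) (use mem inv in auto)
qed

text \<open>By symmetry all values are equally frequent at position \<open>j\<close>, and their
  frequencies sum to the number of tuples.\<close>

lemma wor_single_count:
  fixes D :: "'a set"
  assumes fin: "finite D" and j: "j \<in> {1..m}" and a: "a \<in> D"
  shows "real (card D) * (\<Sum>w\<in>wor_tuples m D. if w j = a then 1 else 0) = real (card (wor_tuples m D))"
proof -
  define c where "c a = (\<Sum>w\<in>wor_tuples m D. if w j = a then 1 else (0::real))" for a
  have eq: "c b = c a" if "b \<in> D" for b
  proof -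
    have "c a = (\<Sum>w\<in>wor_tuples m D. if (\<lambda>i\<in>{1..m}. swap a b (w i)) j = a then 1 else (0::real))"
      unfolding c_def by (rule sum_wor_tuples_swap[OF a that, symmetric])
    also have "\<dots> = c b"
      unfolding c_def using j by (simp add: swap_eq_left)
    finally show ?thesis ..
  qed
  have "real (card (wor_tuples m D)) = (\<Sum>w\<in>wor_tuples m D. \<Sum>b\<in>D. if w j = b then 1 else 0)"
    using fin j by (simp add: wor_tuples_memD)
  also have "\<dots> = (\<Sum>b\<in>D. c b)" unfolding c_def by (rule sum.swap)
  also have "\<dots> = real (card D) * c a" using eq by simp
  finally show ?thesis by (simp add: c_def)
qed

lemma wor_marginal:
  fixes \<Phi> :: "'a \<Rightarrow> 'b::real_vector"
  assumes fin: "finite D" and j: "j \<in> {1..m}"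
  shows "real (card D) *\<^sub>R (\<Sum>w\<in>wor_tuples m D. \<Phi> (w j)) = real (card (wor_tuples m D)) *\<^sub>R (\<Sum>a\<in>D. \<Phi> a)"
proof -
  have "(\<Sum>w\<in>wor_tuples m D. \<Phi> (w j)) = (\<Sum>w\<in>wor_tuples m D. \<Sum>a\<in>D. (if w j = a then 1 else 0) *\<^sub>R \<Phi> a)"
  proof (rule sum.cong[OF refl])
    fix w assume "w \<in> wor_tuples m D"
    then have "w j \<in> D" using j by (rule wor_tuples_memD)
    then have "(\<Sum>a\<in>D. if w j = a then \<Phi> a else 0) = \<Phi> (w j)" using fin by simp
    then show "\<Phi> (w j) = (\<Sum>a\<in>D. (if w j = a then 1 else 0) *\<^sub>R \<Phi> a)"
      by (simp add: if_distrib[of "\<lambda>t. t *\<^sub>R _"] cong: if_cong)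
  qed
  also have "\<dots> = (\<Sum>a\<in>D. (\<Sum>w\<in>wor_tuples m D. if w j = a then 1 else 0) *\<^sub>R \<Phi> a)"
    unfolding scaleR_sum_left by (rule sum.swap)
  finally show ?thesis
    by (simp add: scaleR_sum_right wor_single_count[OF fin j])
qed

text \<open>Exchanging \<open>b\<close> with another value different from \<open>a\<close> does not
  affect the condition \<open>w j = a\<close>, so the \<open>card D - 1\<close> values left for
  position \<open>k\<close> are equally frequent; \<open>a\<close> itself cannot recur.\<close>

lemma wor_pair_count:
  fixes D :: "'a set"
  assumes fin: "finite D" and jk: "j \<in> {1..m}" "k \<in> {1..m}" "j \<noteq> k" and ab: "a \<in> D" "b \<in> D" "a \<noteq> b"
  shows "real (card D) * (real (card D) - 1) * (\<Sum>w\<in>wor_tuples m D. if w j = a \<and> w k = b then 1 else 0)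
    = real (card (wor_tuples m D))"
proof -
  define c where "c b = (\<Sum>w\<in>wor_tuples m D. if w j = a \<and> w k = b then 1 else (0::real))" for b
  have eq: "c b' = c b" if "b' \<in> D - {a}" for b'
  proof -
    have oth: "swap b b' x = a \<longleftrightarrow> x = a" for x
      using ab that by (intro swap_eq_other) auto
    have "c b = (\<Sum>w\<in>wor_tuples m D. if (\<lambda>i\<in>{1..m}. swap b b' (w i)) j = a \<and> (\<lambda>i\<in>{1..m}. swap b b' (w i)) k = b then 1 else (0::real))"
      unfolding c_def using that by (intro sum_wor_tuples_swap[OF ab(2), symmetric]) auto
    also have "\<dots> = c b'"
      unfolding c_def using jk by (simp add: swap_eq_left oth)
    finally show ?thesis ..
  qed
  have "c a = 0"
    unfolding c_def
  proof (intro sum.neutral ballI)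
    fix w assume "w \<in> wor_tuples m D"
    then have "inj_on w {1..m}" by (simp add: wor_tuples_def)
    then show "(if w j = a \<and> w k = a then 1 else (0::real)) = 0"
      using jk by (auto dest: inj_onD)
  qed
  have "(\<Sum>w\<in>wor_tuples m D. if w j = a then 1 else 0) = (\<Sum>w\<in>wor_tuples m D. \<Sum>b\<in>D. if w j = a \<and> w k = b then 1 else (0::real))"
  proof (rule sum.cong[OF refl])
    fix w assume "w \<in> wor_tuples m D"
    then have "w k \<in> D" using jk(2) by (rule wor_tuples_memD)
    then show "(if w j = a then 1 else 0) = (\<Sum>b\<in>D. if w j = a \<and> w k = b then 1 else (0::real))"
      using fin by simp
  qed
  also have "\<dots> = (\<Sum>b\<in>D. c b)" unfolding c_def by (rule sum.swap)
  also have "\<dots> = c a + (\<Sum>b\<in>D - {a}. c b)" using fin ab by (intro sum.remove) auto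
  also have "\<dots> = (\<Sum>b'\<in>D - {a}. c b)" using eq \<open>c a = 0\<close> by simp
  also have "\<dots> = (real (card D) - 1) * c b"
  proof -
    have "card D \<ge> 1" using fin ab by (metis One_nat_def Suc_leI card_gt_0_iff empty_iff)
    then show ?thesis using fin ab by (simp add: of_nat_diff)
  qed
  finally show ?thesis using wor_single_count[OF fin jk(1) ab(1)] by (simp add: c_def mult.assoc)
qed

lemma wor_pair_marginal:
  fixes \<Phi> :: "'a \<Rightarrow> 'a \<Rightarrow> real"
  assumes fin: "finite D" and jk: "j \<in> {1..m}" "k \<in> {1..m}" "j \<noteq> k"
  shows "real (card D) * (real (card D) - 1) * (\<Sum>w\<in>wor_tuples m D. \<Phi> (w j) (w k))
    = real (card (wor_tuples m D)) * ((\<Sum>a\<in>D. \<Sum>b\<in>D. \<Phi> a b) - (\<Sum>a\<in>D. \<Phi> a a))"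
proof -
  let ?d = "real (card D) * (real (card D) - 1)"
  have "(\<Sum>w\<in>wor_tuples m D. \<Phi> (w j) (w k))
      = (\<Sum>w\<in>wor_tuples m D. \<Sum>a\<in>D. \<Sum>b\<in>D - {a}. (if w j = a \<and> w k = b then 1 else 0) * \<Phi> a b)"
  proof (rule sum.cong[OF refl])
    fix w assume w: "w \<in> wor_tuples m D"
    then have mem: "w j \<in> D" "w k \<in> D" using jk by (auto intro: wor_tuples_memD)
    have "inj_on w {1..m}" using w by (simp add: wor_tuples_def)
    then have ne: "w k \<noteq> w j" using jk by (auto dest: inj_onD)
    have "(\<Sum>b\<in>D - {a}. (if w j = a \<and> w k = b then 1 else 0) * \<Phi> a b) = (if w j = a then \<Phi> (w j) (w k) else 0)" for a
    proof (cases "w j = a")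
      case True
      then have "(\<Sum>b\<in>D - {a}. (if w j = a \<and> w k = b then 1 else 0) * \<Phi> a b) = (\<Sum>b\<in>D - {a}. if w k = b then \<Phi> a b else 0)"
        by (intro sum.cong) auto
      also have "\<dots> = \<Phi> a (w k)" using fin mem ne True by simp
      finally show ?thesis using True by simp
    qed simp
    then show "\<Phi> (w j) (w k) = (\<Sum>a\<in>D. \<Sum>b\<in>D - {a}. (if w j = a \<and> w k = b then 1 else 0) * \<Phi> a b)"
      using fin mem by simp
  qed
  also have "\<dots> = (\<Sum>a\<in>D. \<Sum>b\<in>D - {a}. (\<Sum>w\<in>wor_tuples m D. if w j = a \<and> w k = b then 1 else 0) * \<Phi> a b)"
    unfolding sum_distrib_right by (subst sum.swap, intro sum.cong refl, rule sum.swap)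
  also have "?d * \<dots> = (\<Sum>a\<in>D. \<Sum>b\<in>D - {a}. (?d * (\<Sum>w\<in>wor_tuples m D. if w j = a \<and> w k = b then 1 else 0)) * \<Phi> a b)"
  proof -
    have "?d * (\<Sum>a\<in>D. \<Sum>b\<in>D - {a}. c a b * \<Phi> a b) = (\<Sum>a\<in>D. \<Sum>b\<in>D - {a}. (?d * c a b) * \<Phi> a b)" for c
      by (simp only: sum_distrib_left mult.assoc)
    then show ?thesis .
  qed
  also have "\<dots> = (\<Sum>a\<in>D. \<Sum>b\<in>D - {a}. real (card (wor_tuples m D)) * \<Phi> a b)"
  proof (intro sum.cong refl)
    fix a b assume "a \<in> D" "b \<in> D - {a}"
    then have ab: "a \<in> D" "b \<in> D" "a \<noteq> b" by auto
    show "(?d * (\<Sum>w\<in>wor_tuples m D. if w j = a \<and> w k = b then 1 else 0)) * \<Phi> a b = real (card (wor_tuples m D)) * \<Phi> a b"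
      by (simp only: wor_pair_count[OF fin jk ab])
  qed
  also have "\<dots> = real (card (wor_tuples m D)) * (\<Sum>a\<in>D. \<Sum>b\<in>D - {a}. \<Phi> a b)"
    by (simp add: sum_distrib_left)
  also have "(\<Sum>a\<in>D. \<Sum>b\<in>D - {a}. \<Phi> a b) = (\<Sum>a\<in>D. (\<Sum>b\<in>D. \<Phi> a b) - \<Phi> a a)"
    using fin by (intro sum.cong) (auto simp: sum_diff1)
  also have "\<dots> = (\<Sum>a\<in>D. \<Sum>b\<in>D. \<Phi> a b) - (\<Sum>a\<in>D. \<Phi> a a)" by (rule sum_subtractf)
  finally show ?thesis .
qed

lemma integral_uniform_count_measure_scaleR:
  fixes f :: "'a \<Rightarrow> 'b::{banach, second_countable_topology}"
  assumes "finite A"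
  shows "(\<integral>x. f x \<partial>uniform_count_measure A) = (1 / real (card A)) *\<^sub>R (\<Sum>x\<in>A. f x)"
  unfolding uniform_count_measure_def
  by (subst lebesgue_integral_point_measure_finite[OF assms]) (auto simp: scaleR_sum_right)

text \<open>The matrix m^-1 sum_j v_j v_j^T applied to \<open>x\<close>: for a loss with gradient
  \<open>x\<close>, the limit of the averaged query as the spacing tends to 0.\<close>

definition dir_avg :: "nat \<Rightarrow> (nat \<Rightarrow> real^'n) \<Rightarrow> real^'n \<Rightarrow> real^'n" where
  "dir_avg m v x = (1 / real m) *\<^sub>R (\<Sum>j=1..m. (v j \<bullet> x) *\<^sub>R v j)"

lemma dir_avg_symmetric: "u \<bullet> dir_avg m v x = dir_avg m v u \<bullet> x"
  by (simp add: dir_avg_def inner_sum_right inner_sum_left inner_commute mult.commute)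

locale wor_directions =
  fixes B D :: "(real^'n) set" and d m :: nat
  assumes B: "orthonormal_basis B" and D: "D = scaled_directions B"
    and d: "d = CARD('n)" "2 \<le> d" and m: "1 \<le> m" "m \<le> d"
begin

lemma D_finite: "finite D" and card_D: "card D = d" and D_sum: "(\<Sum>v\<in>D. (v \<bullet> x) *\<^sub>R v) = real d *\<^sub>R x"
  and D_norm: "v \<in> D \<Longrightarrow> (norm v)\<^sup>2 = real d"
  using scaled_directions_props[OF B] by (auto simp: D d)

abbreviation tuples :: "(nat \<Rightarrow> real^'n) set" where "tuples \<equiv> wor_tuples m D"

lemma tuples_finite: "finite tuples" by (rule wor_tuples_finite[OF D_finite])

lemma tuples_nonempty: "tuples \<noteq> {}" by (rule wor_tuples_nonempty) (use D_finite card_D m in auto)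

lemma card_tuples_pos: "0 < real (card tuples)"
  using tuples_finite tuples_nonempty by (simp add: card_gt_0_iff)

lemma tuple_norm: "w \<in> tuples \<Longrightarrow> j \<in> {1..m} \<Longrightarrow> (norm (w j))\<^sup>2 = real d"
  by (rule D_norm) (rule wor_tuples_memD)

lemma mean_dir_avg: "(1 / real (card tuples)) *\<^sub>R (\<Sum>w\<in>tuples. dir_avg m w x) = x"
proof -
  have one: "(\<Sum>w\<in>tuples. (w j \<bullet> x) *\<^sub>R w j) = real (card tuples) *\<^sub>R x" if "j \<in> {1..m}" for j
  proof -
    have "real d *\<^sub>R (\<Sum>w\<in>tuples. (w j \<bullet> x) *\<^sub>R w j) = real (card tuples) *\<^sub>R (real d *\<^sub>R x)"
      using wor_marginal[OF D_finite that, of "\<lambda>v. (v \<bullet> x) *\<^sub>R v"] by (simp add: card_D D_sum)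
    also have "\<dots> = real d *\<^sub>R (real (card tuples) *\<^sub>R x)" by simp
    finally show ?thesis using d by (simp del: scaleR_scaleR)
  qed
  have "(\<Sum>w\<in>tuples. dir_avg m w x) = (1 / real m) *\<^sub>R (\<Sum>j=1..m. \<Sum>w\<in>tuples. (w j \<bullet> x) *\<^sub>R w j)"
    unfolding dir_avg_def scaleR_sum_right[symmetric] by (subst sum.swap) simp
  also have "(\<Sum>j=1..m. \<Sum>w\<in>tuples. (w j \<bullet> x) *\<^sub>R w j) = (\<Sum>j=1..m. real (card tuples) *\<^sub>R x)"
    by (intro sum.cong one) auto
  also have "(1 / real m) *\<^sub>R \<dots> = real (card tuples) *\<^sub>R x" using m by (simp add: sum_constant_scaleR del: sum_constant)
  finally show ?thesis using card_tuples_pos by simp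
qed

text \<open>Positions \<open>j = k\<close> contribute \<open>q\<close>. For
  \<open>j \<noteq> k\<close> the sum over all pairs of directions collapses by \<open>D_sum\<close>
  to d^2 s, and removing the diagonal leaves \<open>K\<close>. The negative share of
  \<open>q\<close> in \<open>K\<close> is why the weight of \<open>Q\<close> vanishes at m =
  d.\<close>

lemma mean_quadratic_form:
  fixes S :: "real^'n^'n"
  defines "Q \<equiv> (\<integral>v. outer v ** S ** outer v \<partial>uniform_count_measure D)"
  shows "(1 / real (card tuples)) * (\<Sum>w\<in>tuples. dir_avg m w u \<bullet> (S *v dir_avg m w u))
    = u \<bullet> ((((real d - real m) / (real m * (real d - 1))) *\<^sub>R Q
         + ((real d * (real m - 1)) / (real m * (real d - 1))) *\<^sub>R S) *v u)"
proof -
  define b where "b v v' = (v \<bullet> u) * (v' \<bullet> u) * (v \<bullet> (S *v v'))" for v v' :: "real^'n"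
  define q s where "q = u \<bullet> (Q *v u)" and "s = u \<bullet> (S *v u)"
  have lin: "S *v (\<Sum>i\<in>A. c i *\<^sub>R f i) = (\<Sum>i\<in>A. c i *\<^sub>R (S *v f i))" for A :: "'i set" and c f
    by (simp add: linear_sum[OF matrix_vector_mul_linear, of S] o_def matrix_vector_mult_scaleR)
  have bsum: "(\<Sum>v\<in>A. (v' v \<bullet> u) *\<^sub>R v' v) \<bullet> (S *v (\<Sum>v\<in>A. (v' v \<bullet> u) *\<^sub>R v' v)) = (\<Sum>v\<in>A. \<Sum>w\<in>A. b (v' v) (v' w))"
    for A :: "'i set" and v'
    unfolding lin inner_sum_left inner_sum_right by (subst sum.swap) (simp add: b_def mult_ac)
  have bD: "(\<Sum>v\<in>D. \<Sum>w\<in>D. b v w) = (real d)\<^sup>2 * s"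
    using bsum[of "\<lambda>v. v" D] unfolding D_sum by (simp add: s_def matrix_vector_mult_scaleR power2_eq_square)
  have Qeq: "Q = (1 / real d) *\<^sub>R (\<Sum>v\<in>D. outer v ** S ** outer v)"
    unfolding Q_def using integral_uniform_count_measure_scaleR[OF D_finite] by (simp add: card_D)
  have diag: "(\<Sum>v\<in>D. b v v) = real d * q"
  proof -
    have "u \<bullet> ((outer v ** S ** outer v) *v u) = b v v" for v
      by (simp add: matrix_vector_mul_assoc[symmetric] outer_mult_vec matrix_vector_mult_scaleR b_def inner_commute)
    moreover have "u \<bullet> ((\<Sum>v\<in>D. outer v ** S ** outer v) *v u) = (\<Sum>v\<in>D. u \<bullet> ((outer v ** S ** outer v) *v u))"
      using D_finite by induction (simp_all add: matrix_vector_mult_add_rdistrib inner_add_right)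
    ultimately have "u \<bullet> ((\<Sum>v\<in>D. outer v ** S ** outer v) *v u) = (\<Sum>v\<in>D. b v v)" by simp
    moreover have "(\<Sum>v\<in>D. outer v ** S ** outer v) = real d *\<^sub>R Q" using d by (simp add: Qeq)
    ultimately show ?thesis by (simp add: q_def scaleR_matrix_vector_assoc[symmetric])
  qed
  let ?N = "real (card tuples)"
  have jj: "(\<Sum>w\<in>tuples. b (w j) (w j)) = ?N * q" if "j \<in> {1..m}" for j
    using wor_marginal[OF D_finite that, of "\<lambda>v. b v v"] d by (simp add: card_D diag)
  \<comment> \<open>The mean of \<open>b\<close> over ordered pairs of distinct directions, (d^2 s -
    d q) / (d (d - 1)).\<close>
  define K where "K = (real d * s - q) / (real d - 1)"
  have jk: "(\<Sum>w\<in>tuples. b (w j) (w k)) = ?N * K"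
    if "j \<in> {1..m}" "k \<in> {1..m}" "j \<noteq> k" for j k
  proof -
    have "real d * ((real d - 1) * (\<Sum>w\<in>tuples. b (w j) (w k))) = real d * (?N * (real d * s - q))"
      using wor_pair_marginal[OF D_finite that, of b]
      by (simp add: card_D diag bD power2_eq_square algebra_simps)
    then have "(real d - 1) * (\<Sum>w\<in>tuples. b (w j) (w k)) = ?N * (real d * s - q)" using d by simp
    then show ?thesis using d by (simp add: K_def field_simps)
  qed
  have "(\<Sum>w\<in>tuples. dir_avg m w u \<bullet> (S *v dir_avg m w u)) = (1 / (real m)\<^sup>2) * (\<Sum>w\<in>tuples. \<Sum>j=1..m. \<Sum>k=1..m. b (w j) (w k))"
    by (subst sum_distrib_left, intro sum.cong refl)
       (simp add: dir_avg_def matrix_vector_mult_scaleR bsum power2_eq_square)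
  also have "(\<Sum>w\<in>tuples. \<Sum>j=1..m. \<Sum>k=1..m. b (w j) (w k)) = (\<Sum>j=1..m. \<Sum>k=1..m. \<Sum>w\<in>tuples. b (w j) (w k))"
    by (subst sum.swap, intro sum.cong refl, rule sum.swap)
  also have "\<dots> = (\<Sum>j=1..m. ?N * q + (real m - 1) * (?N * K))"
  proof (intro sum.cong refl)
    fix j assume j: "j \<in> {1..m}"
    have "(\<Sum>k=1..m. \<Sum>w\<in>tuples. b (w j) (w k)) = (\<Sum>w\<in>tuples. b (w j) (w j)) + (\<Sum>k\<in>{1..m} - {j}. \<Sum>w\<in>tuples. b (w j) (w k))"
      using j by (intro sum.remove) auto
    also have "(\<Sum>k\<in>{1..m} - {j}. \<Sum>w\<in>tuples. b (w j) (w k)) = (\<Sum>k\<in>{1..m} - {j}. ?N * K)"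
      using j by (intro sum.cong jk) auto
    finally show "(\<Sum>k=1..m. \<Sum>w\<in>tuples. b (w j) (w k)) = ?N * q + (real m - 1) * (?N * K)"
      using j m by (simp add: jj of_nat_diff)
  qed
  also have "(1 / (real m)\<^sup>2) * \<dots> = (1 / real m) * (?N * q + (real m - 1) * (?N * K))"
    using m by (simp add: power2_eq_square)
  finally have T: "(\<Sum>w\<in>tuples. dir_avg m w u \<bullet> (S *v dir_avg m w u)) = (1 / real m) * (?N * q + (real m - 1) * (?N * K))" .
  have "(1 / ?N) * (\<Sum>w\<in>tuples. dir_avg m w u \<bullet> (S *v dir_avg m w u)) = q / real m + (real m - 1) / real m * K"
    unfolding T using card_tuples_pos m by (simp add: field_simps)
  also have "\<dots> = ((real d - real m) / (real m * (real d - 1))) * q + ((real d * (real m - 1)) / (real m * (real d - 1))) * s"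
    unfolding K_def using d m by (simp add: divide_simps) (simp add: algebra_simps)
  finally show ?thesis
    by (simp add: q_def s_def matrix_vector_mult_add_rdistrib inner_add_right scaleR_matrix_vector_assoc[symmetric])
qed

end

subsection \<open>Gradients and Hessians\<close>

text \<open>\<open>grad\<close> is a definite description, so a representing vector must exist
  (expand in the basis) and be unique (test on the difference of two).\<close>

lemma grad_has_derivative:
  fixes g :: "'a::euclidean_space \<Rightarrow> real"
  assumes "g differentiable (at x)"
  shows "(g has_derivative (\<lambda>v. grad g x \<bullet> v)) (at x)"
proof -
  obtain g' where g': "(g has_derivative g') (at x)" using assms by (auto simp: differentiable_def)
  interpret g': bounded_linear g' using g' by (rule has_derivative_bounded_linear)
  define D where "D = (\<Sum>b\<in>Basis. g' b *\<^sub>R b)"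
  have eq: "g' v = v \<bullet> D" for v
  proof -
    have "g' v = g' (\<Sum>b\<in>Basis. (v \<bullet> b) *\<^sub>R b)" by (simp add: euclidean_representation)
    also have "\<dots> = v \<bullet> D" by (simp add: g'.sum g'.scaleR D_def inner_sum_right mult.commute)
    finally show ?thesis .
  qed
  have ex: "GDERIV g x :> D" using g' unfolding gderiv_def eq[abs_def] .
  have "D' = D" if "GDERIV g x :> D'" for D'
  proof -
    have "(\<lambda>h. h \<bullet> D') = (\<lambda>h. h \<bullet> D)"
      using that ex unfolding gderiv_def by (rule has_derivative_unique)
    then have "h \<bullet> D' = h \<bullet> D" for h by (rule fun_cong)
    then have "(D' - D) \<bullet> (D' - D) = 0" by (simp add: inner_diff_right)
    then show ?thesis by simp
  qed
  with ex have "grad g x = D" unfolding grad_def by (rule the_equality)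
  then show ?thesis using ex by (simp add: gderiv_def inner_commute)
qed

lemma twice_differentiableD:
  fixes g :: "real^'n \<Rightarrow> real"
  assumes "twice_differentiable g"
  shows "(g has_derivative (\<lambda>v. grad g x \<bullet> v)) (at x)"
    and "(grad g has_derivative (\<lambda>v. hess g x *v v)) (at x)"
    and "continuous_on UNIV g" and "continuous_on UNIV (grad g)"
proof -
  have d: "g differentiable_on UNIV" "grad g differentiable_on UNIV"
    using assms by (auto simp: twice_differentiable_def)
  then have dx: "g differentiable (at x)" "grad g differentiable (at x)"
    by (auto simp: differentiable_on_def)
  show "(g has_derivative (\<lambda>v. grad g x \<bullet> v)) (at x)" by (rule grad_has_derivative[OF dx(1)])
  show "(grad g has_derivative (\<lambda>v. hess g x *v v)) (at x)"
    unfolding hess_def using dx(2) by (simp add: jacobian_works)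
  show "continuous_on UNIV g" "continuous_on UNIV (grad g)"
    using d by (auto intro: differentiable_imp_continuous_on)
qed

lemma has_vector_derivative_line:
  fixes g :: "'a::real_normed_vector \<Rightarrow> 'b::real_normed_vector"
  assumes "(g has_derivative g') (at (a + t *\<^sub>R v))"
  shows "((\<lambda>s. g (a + s *\<^sub>R v)) has_vector_derivative g' v) (at t)"
proof -
  have "((\<lambda>s. a + s *\<^sub>R v) has_derivative (\<lambda>s. s *\<^sub>R v)) (at t)"
    by (auto intro!: derivative_eq_intros)
  from has_derivative_compose[OF this assms]
  have "((\<lambda>s. g (a + s *\<^sub>R v)) has_derivative (\<lambda>s. g' (s *\<^sub>R v))) (at t)" .
  then show ?thesis
    unfolding has_vector_derivative_def
    using linear_scale[OF has_derivative_linear[OF assms]] by simp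
qed

lemma convex_above_tangent:
  fixes g :: "'a::euclidean_space \<Rightarrow> real"
  assumes conv: "convex_on UNIV g" and der: "(g has_derivative (\<lambda>v. D \<bullet> v)) (at x)"
  shows "D \<bullet> (y - x) \<le> g y - g x"
proof -
  define \<phi> where "\<phi> t = g (x + t *\<^sub>R (y - x))" for t
  have "convex_on UNIV \<phi>"
  proof (rule convex_onI)
    fix t a b :: real assume t: "0 < t" "t < 1"
    have "x + ((1 - t) *\<^sub>R a + t *\<^sub>R b) *\<^sub>R (y - x) = (1 - t) *\<^sub>R (x + a *\<^sub>R (y - x)) + t *\<^sub>R (x + b *\<^sub>R (y - x))"
      by (simp add: algebra_simps)
    then show "\<phi> ((1 - t) *\<^sub>R a + t *\<^sub>R b) \<le> (1 - t) * \<phi> a + t * \<phi> b"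
      unfolding \<phi>_def using convex_onD[OF conv, of t] t by simp
  qed simp
  moreover have "(\<phi> has_field_derivative D \<bullet> (y - x)) (at 0 within UNIV)"
    unfolding \<phi>_def has_real_derivative_iff_has_vector_derivative
    by (rule has_vector_derivative_line) (use der in simp)
  ultimately have "(D \<bullet> (y - x)) * (1 - 0) \<le> \<phi> 1 - \<phi> 0"
    by (intro convex_on_imp_above_tangent) auto
  then show ?thesis by (simp add: \<phi>_def)
qed

text \<open>A convex function lies above its tangents, here those at \<open>\<theta>\<close> and at
  \<open>\<theta> + h *\<^sub>R v\<close>. The sandwich takes the place of a second-order expansion
  of the individual loss.\<close>

lemma convex_quotient_bounds:
  fixes g :: "real^'n \<Rightarrow> real"
  assumes conv: "convex_on UNIV g" and d: "twice_differentiable g" and h: "0 < h"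
  shows "grad g \<theta> \<bullet> v \<le> (g (\<theta> + h *\<^sub>R v) - g \<theta>) / h"
    and "(g (\<theta> + h *\<^sub>R v) - g \<theta>) / h \<le> grad g (\<theta> + h *\<^sub>R v) \<bullet> v"
proof -
  have "grad g \<theta> \<bullet> (h *\<^sub>R v) \<le> g (\<theta> + h *\<^sub>R v) - g \<theta>"
    using convex_above_tangent[OF conv twice_differentiableD(1)[OF d], of \<theta> "\<theta> + h *\<^sub>R v"] by simp
  then show "grad g \<theta> \<bullet> v \<le> (g (\<theta> + h *\<^sub>R v) - g \<theta>) / h" using h by (simp add: field_simps)
  have "grad g (\<theta> + h *\<^sub>R v) \<bullet> (- (h *\<^sub>R v)) \<le> g \<theta> - g (\<theta> + h *\<^sub>R v)"
    using convex_above_tangent[OF conv twice_differentiableD(1)[OF d], of "\<theta> + h *\<^sub>R v" \<theta>] by simp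
  then show "(g (\<theta> + h *\<^sub>R v) - g \<theta>) / h \<le> grad g (\<theta> + h *\<^sub>R v) \<bullet> v" using h by (simp add: field_simps)
qed

text \<open>\<open>q k\<close> rounds down to a lattice of mesh 1/(k+1), which has countably many
  points, so the rounded function is jointly measurable; continuity in the first argument passes to
  the limit.\<close>

lemma caratheodory_measurable:
  fixes f :: "real^'n \<Rightarrow> 'z \<Rightarrow> 'b::metric_space"
  assumes cont: "\<And>z. z \<in> space P \<Longrightarrow> continuous_on UNIV (\<lambda>\<theta>. f \<theta> z)"
    and meas: "\<And>\<theta>. f \<theta> \<in> borel_measurable P"
  shows "(\<lambda>(\<theta>, z). f \<theta> z) \<in> borel_measurable (borel \<Otimes>\<^sub>M P)"
proof -
  define r :: "nat \<Rightarrow> int^'n \<Rightarrow> real^'n" where "r k c = (\<chi> i. of_int (c $ i) / real (Suc k))" for k c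
  define q :: "nat \<Rightarrow> real^'n \<Rightarrow> int^'n" where "q k \<theta> = (\<chi> i. \<lfloor>real (Suc k) * \<theta> $ i\<rfloor>)" for k \<theta>
  have nth: "(\<lambda>x::real^'n. x $ i) \<in> borel_measurable borel" for i
    by (intro borel_measurable_continuous_onI continuous_intros)
  have qm: "q k \<in> borel \<rightarrow>\<^sub>M count_space UNIV" for k
  proof (subst measurable_count_space_eq2_countable, intro conjI ballI)
    fix c :: "int^'n"
    have "q k -` {c} \<inter> space borel = (\<Inter>i\<in>UNIV. {\<theta> \<in> space borel. \<lfloor>real (Suc k) * \<theta> $ i\<rfloor> = c $ i})"
      by (auto simp: q_def vec_eq_iff)
    also have "\<dots> \<in> sets borel"
    proof (intro sets.finite_INT)
      fix i
      have "(\<lambda>\<theta>::real^'n. \<lfloor>real (Suc k) * \<theta> $ i\<rfloor>) \<in> borel \<rightarrow>\<^sub>M count_space UNIV"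
        by (intro measurable_compose[OF _ measurable_real_floor] borel_measurable_times nth) simp
      from measurable_sets[OF this, of "{c $ i}"]
      show "{\<theta> \<in> space borel. \<lfloor>real (Suc k) * \<theta> $ i\<rfloor> = c $ i} \<in> sets borel"
        by (simp add: vimage_def)
    qed auto
    finally show "q k -` {c} \<inter> space borel \<in> sets borel" .
  qed simp
  have rq: "(\<lambda>k. r k (q k \<theta>)) \<longlonglongrightarrow> \<theta>" for \<theta>
  proof (rule vec_tendstoI)
    fix i
    show "(\<lambda>k. r k (q k \<theta>) $ i) \<longlonglongrightarrow> \<theta> $ i"
    proof (rule real_tendsto_sandwich)
      have b: "\<theta> $ i - 1 / real (Suc k) \<le> r k (q k \<theta>) $ i" "r k (q k \<theta>) $ i \<le> \<theta> $ i" for k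
      proof -
        define y where "y = real (Suc k) * \<theta> $ i"
        have S: "0 < real (Suc k)" by simp
        have "y - 1 \<le> of_int \<lfloor>y\<rfloor>" "of_int \<lfloor>y\<rfloor> \<le> y" by linarith+
        then have "(y - 1) / real (Suc k) \<le> of_int \<lfloor>y\<rfloor> / real (Suc k)" "of_int \<lfloor>y\<rfloor> / real (Suc k) \<le> y / real (Suc k)"
          by (auto intro!: divide_right_mono)
        moreover have "y / real (Suc k) = \<theta> $ i" unfolding y_def by simp
        ultimately show "\<theta> $ i - 1 / real (Suc k) \<le> r k (q k \<theta>) $ i" "r k (q k \<theta>) $ i \<le> \<theta> $ i"
          by (simp_all add: r_def q_def y_def[symmetric] diff_divide_distrib del: of_nat_Suc)
      qed
      show "\<forall>\<^sub>F k in sequentially. \<theta> $ i - 1 / real (Suc k) \<le> r k (q k \<theta>) $ i"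
        "\<forall>\<^sub>F k in sequentially. r k (q k \<theta>) $ i \<le> \<theta> $ i"
        using b by simp_all
      show "(\<lambda>k. \<theta> $ i - 1 / real (Suc k)) \<longlonglongrightarrow> \<theta> $ i"
        using tendsto_diff[OF tendsto_const LIMSEQ_inverse_real_of_nat, of "\<theta> $ i"] by (simp add: inverse_eq_divide)
    qed simp
  qed
  have "(\<lambda>p. f (fst p) (snd p)) \<in> borel_measurable (borel \<Otimes>\<^sub>M P)"
  proof (rule borel_measurable_LIMSEQ_metric)
    show "(\<lambda>p. f (r k (q k (fst p))) (snd p)) \<in> borel_measurable (borel \<Otimes>\<^sub>M P)" for k
    proof (rule measurable_compose_countable)
      show "(\<lambda>p. f (r k c) (snd p)) \<in> borel_measurable (borel \<Otimes>\<^sub>M P)" for c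
        by (rule measurable_compose[OF measurable_snd meas])
      show "(\<lambda>p. q k (fst p)) \<in> borel \<Otimes>\<^sub>M P \<rightarrow>\<^sub>M count_space UNIV"
        by (rule measurable_compose[OF measurable_fst qm])
    qed
    fix p :: "(real^'n) \<times> 'z" assume p: "p \<in> space (borel \<Otimes>\<^sub>M P)"
    then have "isCont (\<lambda>\<theta>. f \<theta> (snd p)) (fst p)"
      using cont[of "snd p"] by (auto simp: space_pair_measure continuous_on_eq_continuous_at)
    then show "(\<lambda>k. f (r k (q k (fst p))) (snd p)) \<longlonglongrightarrow> f (fst p) (snd p)"
      by (rule isCont_tendsto_compose) (rule rq)
  qed
  then show ?thesis by (simp only: case_prod_unfold)
qed

text \<open>The derivative exists everywhere on the interval but need not be continuous or
  integrable. If its norm has infinite integral the bound is trivial; otherwise its Lebesgue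
  integral agrees with the gauge integral, to which the fundamental theorem applies.\<close>

lemma ftc_norm_bound:
  fixes \<Psi> \<nu> :: "real \<Rightarrow> 'a::euclidean_space"
  assumes der: "\<And>t. t \<in> {0..1} \<Longrightarrow> (\<Psi> has_vector_derivative \<nu> t) (at t)"
    and [measurable]: "\<nu> \<in> borel_measurable borel"
  shows "ennreal (norm (\<Psi> 1 - \<Psi> 0)) \<le> (\<integral>\<^sup>+t. indicator {0..1} t * ennreal (norm (\<nu> t)) \<partial>lborel)"
proof (cases "(\<integral>\<^sup>+t. indicator {0..1} t * ennreal (norm (\<nu> t)) \<partial>lborel) = \<infinity>")
  case False
  have eq: "indicator {0..1} t * ennreal (norm (\<nu> t)) = ennreal (norm (indicat_real {0..1} t *\<^sub>R \<nu> t))" for t :: real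
    by (auto simp: indicator_def)
  have int: "integrable lborel (\<lambda>t. indicat_real {0..1} t *\<^sub>R \<nu> t)"
    using False unfolding eq by (intro integrableI_bounded) (auto simp: top.not_eq_extremum)
  then have si: "set_integrable lborel {0..1} \<nu>" by (simp add: set_integrable_def)
  have "(\<nu> has_integral (\<Psi> 1 - \<Psi> 0)) {0..1}"
    using der by (intro fundamental_theorem_of_calculus) (auto intro: has_vector_derivative_at_within)
  then have "\<Psi> 1 - \<Psi> 0 = (LINT t:{0..1}|lborel. \<nu> t)"
    using set_borel_integral_eq_integral(2)[OF si] by (simp add: integral_unique)
  then have "norm (\<Psi> 1 - \<Psi> 0) \<le> (\<integral>t. norm (indicat_real {0..1} t *\<^sub>R \<nu> t) \<partial>lborel)"
    unfolding set_lebesgue_integral_def by (simp only: integral_norm_bound)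
  then have "ennreal (norm (\<Psi> 1 - \<Psi> 0)) \<le> ennreal (\<integral>t. norm (indicat_real {0..1} t *\<^sub>R \<nu> t) \<partial>lborel)"
    by (rule ennreal_leI)
  also have "\<dots> = (\<integral>\<^sup>+t. ennreal (norm (indicat_real {0..1} t *\<^sub>R \<nu> t)) \<partial>lborel)"
    by (intro nn_integral_eq_integral[symmetric] integrable_norm int) simp
  finally show ?thesis by (simp only: eq)
qed simp

text \<open>The derivative need only exist pointwise, so that no continuity of the individual Hessians is
  required.\<close>

lemma L1_mean_value:
  fixes \<Psi> \<nu> :: "real \<Rightarrow> 'z \<Rightarrow> 'a::euclidean_space"
  assumes "sigma_finite_measure P"
    and der: "\<And>t z. z \<in> space P \<Longrightarrow> ((\<lambda>s. \<Psi> s z) has_vector_derivative \<nu> t z) (at t)"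
    and meas[measurable]: "(\<lambda>(t, z). \<nu> t z) \<in> borel_measurable (borel \<Otimes>\<^sub>M P)"
    and le: "\<And>t. t \<in> {0..1} \<Longrightarrow> (\<integral>\<^sup>+z. ennreal (norm (\<nu> t z)) \<partial>P) \<le> c"
  shows "(\<integral>\<^sup>+z. ennreal (norm (\<Psi> 1 z - \<Psi> 0 z)) \<partial>P) \<le> c"
proof -
  interpret P: sigma_finite_measure P by fact
  interpret pair_sigma_finite P "lborel :: real measure" by standard
  have "(\<integral>\<^sup>+z. ennreal (norm (\<Psi> 1 z - \<Psi> 0 z)) \<partial>P)
      \<le> (\<integral>\<^sup>+z. (\<integral>\<^sup>+t. indicator {0..1} t * ennreal (norm (\<nu> t z)) \<partial>lborel) \<partial>P)"
  proof (intro nn_integral_mono ftc_norm_bound der)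
    fix z assume z: "z \<in> space P"
    show "(\<lambda>t. \<nu> t z) \<in> borel_measurable borel"
      using measurable_compose[OF measurable_Pair2'[OF z] meas] by simp
  qed
  also have "\<dots> = (\<integral>\<^sup>+t. (\<integral>\<^sup>+z. indicator {0..1} t * ennreal (norm (\<nu> t z)) \<partial>P) \<partial>lborel)"
  proof (rule Fubini'[symmetric])
    have "(\<lambda>p. (snd p, fst p)) \<in> P \<Otimes>\<^sub>M lborel \<rightarrow>\<^sub>M borel \<Otimes>\<^sub>M P" by measurable
    from measurable_compose[OF this meas]
    have m: "(\<lambda>p. \<nu> (snd p) (fst p)) \<in> borel_measurable (P \<Otimes>\<^sub>M lborel)" by simp
    show "(\<lambda>(z, t). indicator {0..1} t * ennreal (norm (\<nu> t z))) \<in> borel_measurable (P \<Otimes>\<^sub>M lborel)"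
      unfolding case_prod_unfold
      by (intro borel_measurable_times_ennreal measurable_compose[OF m borel_measurable_norm, THEN measurable_compose[OF _ measurable_ennreal]]
          measurable_compose[OF measurable_snd borel_measurable_indicator]) simp
  qed
  also have "\<dots> \<le> (\<integral>\<^sup>+t. indicator {0..1::real} t * c \<partial>lborel)"
  proof (intro nn_integral_mono)
    fix t :: real
    have m: "(\<lambda>z. \<nu> t z) \<in> borel_measurable P"
      using measurable_compose[OF measurable_Pair1'[of t borel P] meas] by simp
    show "(\<integral>\<^sup>+z. indicator {0..1} t * ennreal (norm (\<nu> t z)) \<partial>P) \<le> indicator {0..1::real} t * c"
    proof (cases "t \<in> {0..1}")
      case True
      then show ?thesis using le[OF True] by simp
    qed simp
  qed
  also have "\<dots> = c" by (simp add: nn_integral_multc)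
  finally show ?thesis .
qed

subsection \<open>The random loss\<close>

text \<open>A sequential form of the derivative serves two ends: measurability of the Hessian along
  a line, and the identification of the mean Hessian.\<close>

lemma vector_derivative_LIMSEQ:
  fixes g :: "real \<Rightarrow> 'a::real_normed_vector"
  assumes "(g has_vector_derivative d) (at t)"
  shows "(\<lambda>k. real (Suc k) *\<^sub>R (g (t + 1 / real (Suc k)) - g t)) \<longlonglongrightarrow> d"
proof -
  have lim: "((\<lambda>h. norm (g (t + h) - g t - h *\<^sub>R d) / norm h) \<longlongrightarrow> 0) (at 0)"
    using assms unfolding has_vector_derivative_def has_derivative_at by simp
  have "filterlim (\<lambda>k. 1 / real (Suc k)) (at 0) sequentially"
    using LIMSEQ_inverse_real_of_nat by (intro filterlim_atI) (simp_all add: inverse_eq_divide)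
  from filterlim_compose[OF lim this]
  have "(\<lambda>k. norm (g (t + 1 / real (Suc k)) - g t - (1 / real (Suc k)) *\<^sub>R d) / norm (1 / real (Suc k))) \<longlonglongrightarrow> 0" .
  moreover have "norm (g (t + 1 / real (Suc k)) - g t - (1 / real (Suc k)) *\<^sub>R d) / norm (1 / real (Suc k))
      = norm (real (Suc k) *\<^sub>R (g (t + 1 / real (Suc k)) - g t) - d)" for k
  proof -
    have "real (Suc k) *\<^sub>R (g (t + 1 / real (Suc k)) - g t) - d
        = real (Suc k) *\<^sub>R (g (t + 1 / real (Suc k)) - g t - (1 / real (Suc k)) *\<^sub>R d)"
      by (simp add: scaleR_diff_right del: of_nat_Suc)
    then show ?thesis by (simp del: of_nat_Suc)
  qed
  ultimately have "(\<lambda>k. norm (real (Suc k) *\<^sub>R (g (t + 1 / real (Suc k)) - g t) - d)) \<longlonglongrightarrow> 0" by simp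
  then show ?thesis by (simp only: tendsto_norm_zero_iff LIM_zero_iff)
qed

lemma norm_mult_vec_le_spectral: "norm (A *v x) \<le> spectral_norm (A :: real^'n^'n) * norm x"
  unfolding spectral_norm_def by (intro onorm matrix_vector_mul_bounded_linear)

lemma powr_sum3_le:
  fixes a b c p :: real
  assumes "0 \<le> a" "0 \<le> b" "0 \<le> c" "0 \<le> p"
  shows "(a + b + c) powr p \<le> 3 powr p * (a powr p + b powr p + c powr p)"
proof -
  define m where "m = max a (max b c)"
  have m: "0 \<le> m" "a + b + c \<le> 3 * m" using assms by (auto simp: m_def)
  have "(a + b + c) powr p \<le> (3 * m) powr p" using m assms by (intro powr_mono2) auto
  also have "\<dots> = 3 powr p * m powr p" using m by (simp add: powr_mult)
  also have "m powr p \<le> a powr p + b powr p + c powr p"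
    unfolding m_def max_def by auto
  finally show ?thesis by simp
qed

text \<open>Below the level \<open>K\<close> one factor is at most \<open>K\<close>; above it (y /
  K)^\<delta> exceeds 1. The level trades the first moment against the higher one.\<close>

lemma square_le_truncation:
  fixes y K \<delta> :: real
  assumes "0 \<le> y" "0 < K" "0 < \<delta>"
  shows "y\<^sup>2 \<le> K * y + K powr (- \<delta>) * y powr (2 + \<delta>)"
proof (cases "y \<le> K")
  case True
  then have "y\<^sup>2 \<le> K * y" using assms by (simp add: power2_eq_square mult_right_mono)
  then show ?thesis by (smt (verit) powr_ge_zero mult_nonneg_nonneg)
next
  case False
  then have y: "0 < y" using assms by simp
  have "y\<^sup>2 = y powr (- \<delta>) * y powr (2 + \<delta>)"
    using y by (simp add: powr_add[symmetric])
  also have "\<dots> \<le> K powr (- \<delta>) * y powr (2 + \<delta>)"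
    using False assms by (intro mult_right_mono powr_mono2') auto
  finally show ?thesis using mult_nonneg_nonneg[of K y] assms by linarith
qed

lemma integrable_nn_boundI:
  fixes u :: "'a \<Rightarrow> real"
  assumes [measurable]: "u \<in> borel_measurable M" and nn: "\<And>x. 0 \<le> u x" and le: "(\<integral>\<^sup>+x. ennreal (u x) \<partial>M) \<le> ennreal c" and c: "0 \<le> c"
  shows "integrable M u" and "(\<integral>x. u x \<partial>M) \<le> c"
proof -
  show "integrable M u"
    using nn le by (intro integrableI_nonneg) (auto intro: le_less_trans)
  show "(\<integral>x. u x \<partial>M) \<le> c" by (rule integral_real_bounded[OF c le])
qed

locale kw_model = prob_space P for P :: "'z measure" +
  fixes f :: "real^'n \<Rightarrow> 'z \<Rightarrow> real" and F :: "real^'n \<Rightarrow> real" and \<theta>s :: "real^'n"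
    and L\<^sub>f \<delta>1 lam \<delta> M L\<^sub>h :: real
  assumes f_int: "\<And>\<theta>. integrable P (f \<theta>)"
    and f_convex: "\<And>z. z \<in> space P \<Longrightarrow> convex_on UNIV (\<lambda>\<theta>. f \<theta> z)"
    and f_diff: "\<And>z. z \<in> space P \<Longrightarrow> twice_differentiable (\<lambda>\<theta>. f \<theta> z)"
    and argmin: "is_arg_min F (\<lambda>_. True) \<theta>s"
    and F_diff: "twice_differentiable F"
    and F_hess: "\<And>\<theta>. 0 \<preceq>\<^sub>L hess F \<theta>" "\<And>\<theta>. hess F \<theta> \<preceq>\<^sub>L mat L\<^sub>f"
    and F_strong: "0 < \<delta>1" "0 < lam" "\<And>\<theta>. \<theta> \<in> ball \<theta>s \<delta>1 \<Longrightarrow> mat lam \<preceq>\<^sub>L hess F \<theta>"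
    and grad_unbiased:
      "\<And>\<theta>. has_bochner_integral P (\<lambda>z. grad (\<lambda>t. f t z) \<theta>) (grad F \<theta>)"
    and grad_moment: "0 < \<delta>" "0 < M"
      "\<And>\<theta>. (\<integral>\<^sup>+z. ennreal (norm (grad (\<lambda>t. f t z) \<theta> - grad F \<theta>) powr (2 + \<delta>)) \<partial>P)
             \<le> ennreal (M * (norm (\<theta> - \<theta>s) powr (2 + \<delta>) + 1))"
    and hess_lipschitz: "0 < L\<^sub>h"
      "\<And>\<theta> \<theta>'. (\<integral>\<^sup>+z. ennreal ((spectral_norm (hess (\<lambda>t. f t z) \<theta> - hess (\<lambda>t. f t z) \<theta>'))\<^sup>2) \<partial>P)
             \<le> ennreal (L\<^sub>h * (norm (\<theta> - \<theta>'))\<^sup>2)"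
begin

definition G :: "real^'n \<Rightarrow> 'z \<Rightarrow> real^'n" where "G \<theta> z = grad (\<lambda>t. f t z) \<theta>"

abbreviation "gF \<equiv> grad F"
abbreviation "H \<equiv> hess F \<theta>s"

lemma f_joint: "(\<lambda>(\<theta>, z). f \<theta> z) \<in> borel_measurable (borel \<Otimes>\<^sub>M P)"
  using f_int by (intro caratheodory_measurable twice_differentiableD(3)[OF f_diff]) auto

lemma G_measurable [measurable]: "G \<theta> \<in> borel_measurable P"
  using grad_unbiased[of \<theta>] unfolding G_def[abs_def] by (rule borel_measurable_has_bochner_integral)

lemma G_integrable: "integrable P (G \<theta>)" and G_expectation: "(\<integral>z. G \<theta> z \<partial>P) = gF \<theta>"
  using grad_unbiased[of \<theta>] unfolding G_def[abs_def] by (auto simp: has_bochner_integral_iff)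

lemma G_continuous: "z \<in> space P \<Longrightarrow> continuous_on UNIV (\<lambda>\<theta>. G \<theta> z)"
  unfolding G_def using twice_differentiableD(4)[OF f_diff] by simp

lemma G_joint: "(\<lambda>(\<theta>, z). G \<theta> z) \<in> borel_measurable (borel \<Otimes>\<^sub>M P)"
  by (rule caratheodory_measurable[OF G_continuous G_measurable])

section \<open>The mean gradient, difference quotients and second moments\<close>

lemma hess_F_psd: "psd (hess F \<theta>)" and hess_F_le: "psd (mat L\<^sub>f - hess F \<theta>)"
  using F_hess by (auto simp: loewner_le_def)

lemma mat_mult_vec: "mat c *v (x::real^'n) = c *\<^sub>R x"
  by (simp add: vec_eq_iff matrix_vector_mult_def mat_def if_distrib if_distribR cong: if_cong)

lemma L\<^sub>f_nonneg: "0 \<le> L\<^sub>f"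
proof -
  let ?e = "axis undefined 1 :: real^'n"
  have "0 \<le> norm (hess F \<theta>s *v ?e)" by simp
  also have "\<dots> \<le> L\<^sub>f * norm ?e" by (rule psd_norm_mult_le[OF hess_F_psd hess_F_le])
  finally have "0 \<le> L\<^sub>f * norm ?e" .
  moreover have "0 < norm ?e" by (simp add: axis_eq_0_iff)
  ultimately show ?thesis by (simp add: zero_le_mult_iff)
qed

lemma gF_lipschitz: "norm (gF \<theta> - gF \<theta>') \<le> L\<^sub>f * norm (\<theta> - \<theta>')"
proof (rule differentiable_bound[where S=UNIV])
  show "(gF has_derivative (\<lambda>v. hess F x *v v)) (at x within UNIV)" for x
    using twice_differentiableD(2)[OF F_diff] by simp
  show "onorm (\<lambda>v. hess F x *v v) \<le> L\<^sub>f" for x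
    by (rule onorm_le) (rule psd_norm_mult_le[OF hess_F_psd hess_F_le])
qed auto

lemma gF_min: "gF \<theta>s = 0"
proof -
  have "F \<theta>s \<le> F y" for y using argmin by (auto simp: is_arg_min_def not_less)
  then have "(\<lambda>v. gF \<theta>s \<bullet> v) = (\<lambda>v. 0)"
    by (intro differential_zero_maxmin[OF UNIV_I open_UNIV twice_differentiableD(1)[OF F_diff]]) auto
  from fun_cong[OF this, of "gF \<theta>s"] show ?thesis by simp
qed

lemma gF_line_derivative:
  "((\<lambda>t. x \<bullet> gF (\<theta>s + t *\<^sub>R x)) has_real_derivative x \<bullet> (hess F (\<theta>s + t *\<^sub>R x) *v x)) (at t)"
  unfolding has_real_derivative_iff_has_vector_derivative
  by (rule bounded_linear.has_vector_derivative[OF bounded_linear_inner_right])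
     (rule has_vector_derivative_line[OF twice_differentiableD(2)[OF F_diff]])

text \<open>On the segment from \<open>\<theta>s\<close> the Hessian is at least \<open>lam\<close>
  up to distance \<open>\<rho>\<close> and nonnegative beyond, so the inner product grows linearly
  over the initial fraction \<open>s\<close> and does not decrease afterwards. Halving
  \<open>\<delta>1\<close> keeps that initial part inside the open ball.\<close>

lemma gF_monotone:
  fixes \<theta> :: "real^'n"
  defines "\<rho> \<equiv> \<delta>1 / 2"
  shows "lam * min ((norm (\<theta> - \<theta>s))\<^sup>2) (\<rho>\<^sup>2) \<le> (\<theta> - \<theta>s) \<bullet> gF \<theta>"
proof (cases "\<theta> = \<theta>s")
  case False
  define x where "x = \<theta> - \<theta>s"
  define k where "k t = x \<bullet> gF (\<theta>s + t *\<^sub>R x)" for t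
  have \<rho>: "0 < \<rho>" "\<rho> < \<delta>1" using F_strong(1) by (auto simp: \<rho>_def)
  have nx: "0 < norm x" using False by (simp add: x_def)
  define s where "s = min 1 (\<rho> / norm x)"
  have s: "0 < s" "s \<le> 1" "s * norm x \<le> \<rho>" using \<rho> nx by (auto simp: s_def min_def field_simps)
  have der: "(k has_real_derivative x \<bullet> (hess F (\<theta>s + t *\<^sub>R x) *v x)) (at t)" for t
    unfolding k_def by (rule gF_line_derivative)
  obtain t where t: "0 < t" "t < s" "k s - k 0 = s * (x \<bullet> (hess F (\<theta>s + t *\<^sub>R x) *v x))"
    using MVT2[of 0 s k "\<lambda>t. x \<bullet> (hess F (\<theta>s + t *\<^sub>R x) *v x)"] s der by auto
  have "t * norm x \<le> s * norm x" using t nx by (intro mult_right_mono) auto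
  then have "\<theta>s + t *\<^sub>R x \<in> ball \<theta>s \<delta>1" using s \<rho> t(1) by (simp add: dist_norm)
  then have "psd (hess F (\<theta>s + t *\<^sub>R x) - mat lam)" using F_strong(3) by (simp add: loewner_le_def)
  then have "0 \<le> x \<bullet> ((hess F (\<theta>s + t *\<^sub>R x) - mat lam) *v x)" by (simp add: psd_def)
  then have "lam * (norm x)\<^sup>2 \<le> x \<bullet> (hess F (\<theta>s + t *\<^sub>R x) *v x)"
    by (simp add: matrix_vector_mult_diff_rdistrib mat_mult_vec inner_diff_right power2_norm_eq_inner)
  then have "s * (lam * (norm x)\<^sup>2) \<le> k s - k 0" unfolding t(3) using s by (intro mult_left_mono) auto
  moreover have "k 0 = 0" by (simp add: k_def gF_min)
  moreover have "k s \<le> k 1"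
    using s(2) der hess_F_psd
    by (intro DERIV_nonneg_imp_nondecreasing[of s 1 k]) (auto simp: psd_def)
  ultimately have "s * (lam * (norm x)\<^sup>2) \<le> k 1" by linarith
  moreover have "lam * min ((norm x)\<^sup>2) (\<rho>\<^sup>2) \<le> s * (lam * (norm x)\<^sup>2)"
  proof -
    have "min ((norm x)\<^sup>2) (\<rho>\<^sup>2) \<le> s * (norm x)\<^sup>2"
    proof (cases "norm x \<le> \<rho>")
      case True
      then have "s = 1" using nx by (simp add: s_def min_def field_simps)
      then show ?thesis by simp
    next
      case False
      then have "s * norm x = \<rho>" using nx by (simp add: s_def min_def field_simps)
      then have "s * (norm x)\<^sup>2 = \<rho> * norm x" by (simp add: power2_eq_square flip: mult.assoc)
      moreover have "\<rho> * \<rho> \<le> \<rho> * norm x" using False \<rho> by (intro mult_left_mono) auto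
      ultimately show ?thesis by (simp only: power2_eq_square min.coboundedI2)
    qed
    then show ?thesis using F_strong(2) by (simp add: mult.left_commute)
  qed
  ultimately show ?thesis by (simp add: k_def x_def)
qed simp

text \<open>Averaging \<open>convex_quotient_bounds\<close> puts the mean quotient between
  \<open>gF \<theta> \<bullet> v\<close> and
  \<open>gF (\<theta> + h *\<^sub>R v) \<bullet> v\<close>, and \<open>gF\<close> is
  Lipschitz.\<close>

lemma quotient_bias:
  assumes h: "0 < h"
  shows "integrable P (\<lambda>z. (f (\<theta> + h *\<^sub>R v) z - f \<theta> z) / h)"
    and "\<bar>(\<integral>z. (f (\<theta> + h *\<^sub>R v) z - f \<theta> z) / h \<partial>P) - gF \<theta> \<bullet> v\<bar> \<le> L\<^sub>f * h * (norm v)\<^sup>2"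
proof -
  let ?q = "\<lambda>z. (f (\<theta> + h *\<^sub>R v) z - f \<theta> z) / h"
  show int: "integrable P ?q" using f_int by simp
  have Gv: "integrable P (\<lambda>z. G \<theta>' z \<bullet> v)" "(\<integral>z. G \<theta>' z \<bullet> v \<partial>P) = gF \<theta>' \<bullet> v" for \<theta>'
    using G_integrable[of \<theta>'] G_expectation[of \<theta>'] by auto
  have lo: "gF \<theta> \<bullet> v \<le> (\<integral>z. ?q z \<partial>P)"
    unfolding Gv(2)[symmetric]
    by (intro integral_mono Gv(1) int) (simp add: G_def convex_quotient_bounds(1)[OF f_convex f_diff h])
  have "(\<integral>z. ?q z \<partial>P) \<le> gF (\<theta> + h *\<^sub>R v) \<bullet> v"
    unfolding Gv(2)[symmetric]
    by (intro integral_mono Gv(1) int) (simp add: G_def convex_quotient_bounds(2)[OF f_convex f_diff h])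
  then have "(\<integral>z. ?q z \<partial>P) - gF \<theta> \<bullet> v \<le> (gF (\<theta> + h *\<^sub>R v) - gF \<theta>) \<bullet> v" by (simp add: inner_diff_left)
  also have "\<dots> \<le> norm (gF (\<theta> + h *\<^sub>R v) - gF \<theta>) * norm v" by (rule norm_cauchy_schwarz)
  also have "\<dots> \<le> (L\<^sub>f * norm (\<theta> + h *\<^sub>R v - \<theta>)) * norm v" by (intro mult_right_mono gF_lipschitz) simp
  also have "\<dots> = L\<^sub>f * h * (norm v)\<^sup>2" using h by (simp add: power2_eq_square)
  finally show "\<bar>(\<integral>z. ?q z \<partial>P) - gF \<theta> \<bullet> v\<bar> \<le> L\<^sub>f * h * (norm v)\<^sup>2" using lo by linarith
qed

text \<open>A number between \<open>l\<close> and \<open>u\<close> has square at most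
  \<open>l\<^sup>2 + u\<^sup>2\<close>. The vector \<open>c\<close> will be 0 for second moments and
  the random gradient at \<open>\<theta>s\<close> for the comparison with the idealised
  query.\<close>

lemma quotient_square_le:
  assumes "z \<in> space P" "0 < h"
  shows "((f (\<theta> + h *\<^sub>R v) z - f \<theta> z) / h - c \<bullet> v)\<^sup>2
    \<le> (norm v)\<^sup>2 * ((norm (G \<theta> z - c))\<^sup>2 + (norm (G (\<theta> + h *\<^sub>R v) z - c))\<^sup>2)"
proof -
  let ?q = "(f (\<theta> + h *\<^sub>R v) z - f \<theta> z) / h - c \<bullet> v"
  define l u where "l = (G \<theta> z - c) \<bullet> v" and "u = (G (\<theta> + h *\<^sub>R v) z - c) \<bullet> v"
  have b: "l \<le> ?q" "?q \<le> u"
    using convex_quotient_bounds[OF f_convex f_diff assms(2), OF assms(1) assms(1), of \<theta> v]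
    by (auto simp: l_def u_def G_def inner_diff_left)
  have "?q\<^sup>2 \<le> l\<^sup>2 + u\<^sup>2"
  proof (cases "0 \<le> ?q")
    case True
    then have "?q\<^sup>2 \<le> u\<^sup>2" using b by (intro power_mono) auto
    then show ?thesis using zero_le_power2[of l] by linarith
  next
    case False
    then have "(- ?q)\<^sup>2 \<le> (- l)\<^sup>2" using b by (intro power_mono) auto
    then show ?thesis using zero_le_power2[of u] unfolding power2_minus by linarith
  qed
  moreover have "(a \<bullet> v)\<^sup>2 \<le> (norm v)\<^sup>2 * (norm a)\<^sup>2" for a :: "real^'n"
    using Cauchy_Schwarz_ineq[of a v] by (simp add: power2_norm_eq_inner mult.commute)
  ultimately show ?thesis unfolding l_def u_def distrib_left by (meson add_mono order_trans)
qed

text \<open>Interpolation at the scale s = sqrt(1 + r^2): through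
  \<open>(y / s)\<^sup>2 \<le> 1 + (y / s) powr p\<close>, growth of order 2 + \<delta> of the
  higher moment becomes quadratic growth of the second one.\<close>

lemma gradient_noise_sq: "integrable P (\<lambda>z. (norm (G \<theta> z - gF \<theta>))\<^sup>2)"
  "(\<integral>z. (norm (G \<theta> z - gF \<theta>))\<^sup>2 \<partial>P) \<le> (1 + 2 * M) * (1 + (norm (\<theta> - \<theta>s))\<^sup>2)"
proof -
  define r where "r = norm (\<theta> - \<theta>s)"
  define s where "s = sqrt (1 + r\<^sup>2)"
  define p where "p = 2 + \<delta>"
  have p: "2 < p" using grad_moment(1) by (simp add: p_def)
  have s2: "s\<^sup>2 = 1 + r\<^sup>2" and s1: "1 \<le> s" by (auto simp: s_def)
  have rs: "r \<le> s" by (rule power2_le_imp_le) (use s2 s1 in auto)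
  have r0: "0 \<le> r" by (simp add: r_def)
  have key: "y\<^sup>2 \<le> s\<^sup>2 + s\<^sup>2 * s powr (- p) * y powr p" if "0 \<le> y" for y
  proof -
    have "(y / s)\<^sup>2 \<le> 1 + (y / s) powr p"
    proof (cases "y / s \<le> 1")
      case True
      have "(y / s)\<^sup>2 \<le> 1" using True that s1 by (simp add: power_le_one)
      then show ?thesis by (smt (verit) powr_ge_zero)
    next
      case False
      then have "(y / s) powr 2 \<le> (y / s) powr p" using p by (intro powr_mono) auto
      then show ?thesis using False by simp
    qed
    then have "s\<^sup>2 * (y / s)\<^sup>2 \<le> s\<^sup>2 * (1 + (y / s) powr p)" by (intro mult_left_mono) auto
    then show ?thesis using s1 that by (simp add: powr_divide powr_minus_divide power_divide field_simps)
  qed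
  have int: "(\<integral>\<^sup>+z. ennreal ((norm (G \<theta> z - gF \<theta>))\<^sup>2) \<partial>P) \<le> ennreal ((1 + 2 * M) * (1 + r\<^sup>2))"
  proof -
    have "(\<integral>\<^sup>+z. ennreal ((norm (G \<theta> z - gF \<theta>))\<^sup>2) \<partial>P)
        \<le> (\<integral>\<^sup>+z. ennreal (s\<^sup>2) + ennreal (s\<^sup>2 * s powr (- p)) * ennreal (norm (G \<theta> z - gF \<theta>) powr p) \<partial>P)"
      by (intro nn_integral_mono) (simp add: key ennreal_mult'[symmetric] flip: ennreal_plus)
    also have "\<dots> = ennreal (s\<^sup>2) + ennreal (s\<^sup>2 * s powr (- p)) * (\<integral>\<^sup>+z. ennreal (norm (G \<theta> z - gF \<theta>) powr p) \<partial>P)"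
      by (subst nn_integral_add) (auto simp: nn_integral_cmult emeasure_space_1)
    also have "\<dots> \<le> ennreal (s\<^sup>2) + ennreal (s\<^sup>2 * s powr (- p)) * ennreal (M * (r powr p + 1))"
      using grad_moment(3)[of \<theta>] by (intro add_left_mono mult_left_mono) (auto simp: p_def r_def G_def)
    also have "\<dots> = ennreal (s\<^sup>2 + s\<^sup>2 * s powr (- p) * (M * (r powr p + 1)))"
      using grad_moment(2) by (simp add: ennreal_mult'[symmetric] ennreal_plus[symmetric] del: ennreal_plus)
    also have "\<dots> \<le> ennreal ((1 + 2 * M) * (1 + r\<^sup>2))"
    proof (rule ennreal_leI)
      have "r powr p + 1 \<le> 2 * s powr p"
        using powr_mono2[OF _ r0 rs, of p] powr_mono2[of p 1 s] s1 p by simp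
      then have "s\<^sup>2 * s powr (- p) * (M * (r powr p + 1)) \<le> s\<^sup>2 * s powr (- p) * (M * (2 * s powr p))"
        using grad_moment(2) by (intro mult_left_mono) auto
      also have "\<dots> = 2 * M * s\<^sup>2" using s1 by (simp add: powr_minus_divide)
      finally show "s\<^sup>2 + s\<^sup>2 * s powr (- p) * (M * (r powr p + 1)) \<le> (1 + 2 * M) * (1 + r\<^sup>2)"
        by (simp add: s2[symmetric] algebra_simps)
    qed
    finally show ?thesis .
  qed
  have m: "(\<lambda>z. (norm (G \<theta> z - gF \<theta>))\<^sup>2) \<in> borel_measurable P" by measurable
  have nn: "0 \<le> (1 + 2 * M) * (1 + r\<^sup>2)" using grad_moment(2) by simp
  show "integrable P (\<lambda>z. (norm (G \<theta> z - gF \<theta>))\<^sup>2)" by (rule integrable_nn_boundI(1)[OF m _ int nn]) simp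
  show "(\<integral>z. (norm (G \<theta> z - gF \<theta>))\<^sup>2 \<partial>P) \<le> (1 + 2 * M) * (1 + (norm (\<theta> - \<theta>s))\<^sup>2)"
    unfolding r_def[symmetric] by (rule integrable_nn_boundI(2)[OF m _ int nn]) simp
qed

lemma norm_add_sq_le: "(norm (a + b))\<^sup>2 \<le> 2 * (norm a)\<^sup>2 + 2 * (norm b)\<^sup>2" for a b :: "'b::real_normed_vector"
proof -
  have "(norm (a + b))\<^sup>2 \<le> (norm a + norm b)\<^sup>2" by (intro power_mono norm_triangle_ineq) simp
  also have "\<dots> \<le> 2 * (norm a)\<^sup>2 + 2 * (norm b)\<^sup>2"
    using zero_le_power2[of "norm a - norm b"] by (simp add: power2_eq_square algebra_simps)
  finally show ?thesis .
qed

definition Cg :: real where "Cg = 2 * (1 + 2 * M) + 2 * L\<^sub>f\<^sup>2"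

lemma Cg_nonneg: "0 \<le> Cg" using grad_moment(2) by (simp add: Cg_def)

lemma gradient_sq: "integrable P (\<lambda>z. (norm (G \<theta> z))\<^sup>2)"
  "(\<integral>z. (norm (G \<theta> z))\<^sup>2 \<partial>P) \<le> Cg * (1 + (norm (\<theta> - \<theta>s))\<^sup>2)"
proof -
  have le: "(norm (G \<theta> z))\<^sup>2 \<le> 2 * (norm (G \<theta> z - gF \<theta>))\<^sup>2 + 2 * (norm (gF \<theta>))\<^sup>2" for z
    using norm_add_sq_le[of "G \<theta> z - gF \<theta>" "gF \<theta>"] by simp
  have int: "integrable P (\<lambda>z. 2 * (norm (G \<theta> z - gF \<theta>))\<^sup>2 + 2 * (norm (gF \<theta>))\<^sup>2)"
    using gradient_noise_sq(1) by simp
  show i: "integrable P (\<lambda>z. (norm (G \<theta> z))\<^sup>2)"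
    by (rule Bochner_Integration.integrable_bound[OF int]) (use le in \<open>auto intro!: AE_I2\<close>)
  have "norm (gF \<theta>) \<le> L\<^sub>f * norm (\<theta> - \<theta>s)" using gF_lipschitz[of \<theta> \<theta>s] by (simp add: gF_min)
  then have "(norm (gF \<theta>))\<^sup>2 \<le> (L\<^sub>f * norm (\<theta> - \<theta>s))\<^sup>2" by (intro power_mono) auto
  also have "\<dots> \<le> L\<^sub>f\<^sup>2 * (1 + (norm (\<theta> - \<theta>s))\<^sup>2)" by (simp add: power_mult_distrib mult_left_mono)
  finally have g: "(norm (gF \<theta>))\<^sup>2 \<le> L\<^sub>f\<^sup>2 * (1 + (norm (\<theta> - \<theta>s))\<^sup>2)" .
  have "(\<integral>z. (norm (G \<theta> z))\<^sup>2 \<partial>P) \<le> (\<integral>z. 2 * (norm (G \<theta> z - gF \<theta>))\<^sup>2 + 2 * (norm (gF \<theta>))\<^sup>2 \<partial>P)"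
    by (intro integral_mono i int le)
  also have "\<dots> = 2 * (\<integral>z. (norm (G \<theta> z - gF \<theta>))\<^sup>2 \<partial>P) + 2 * (norm (gF \<theta>))\<^sup>2"
    using gradient_noise_sq(1) by (simp add: prob_space)
  also have "\<dots> \<le> Cg * (1 + (norm (\<theta> - \<theta>s))\<^sup>2)"
    using gradient_noise_sq(2)[of \<theta>] g by (simp add: Cg_def algebra_simps)
  finally show "(\<integral>z. (norm (G \<theta> z))\<^sup>2 \<partial>P) \<le> Cg * (1 + (norm (\<theta> - \<theta>s))\<^sup>2)" .
qed

section \<open>Taylor expansion of the random gradient at the minimiser\<close>

definition U :: "real^'n \<Rightarrow> 'z \<Rightarrow> real^'n" where "U x z = hess (\<lambda>t. f t z) \<theta>s *v x"

lemma G_line_derivative: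
  "z \<in> space P \<Longrightarrow> ((\<lambda>s. G (\<theta>s + s *\<^sub>R x) z) has_vector_derivative hess (\<lambda>t. f t z) (\<theta>s + t *\<^sub>R x) *v x) (at t)"
  unfolding G_def by (rule has_vector_derivative_line[OF twice_differentiableD(2)[OF f_diff]])

text \<open>The Hessians are known only as derivatives; along a line they are limits of difference
  quotients of \<open>G\<close>, which is jointly measurable.\<close>

lemma hess_line_measurable:
  "(\<lambda>(t, z). hess (\<lambda>s. f s z) (\<theta>s + t *\<^sub>R x) *v x) \<in> borel_measurable (borel \<Otimes>\<^sub>M P)"
  unfolding case_prod_unfold
proof (rule borel_measurable_LIMSEQ_metric)
  fix k
  have m: "(\<lambda>p. G (\<theta>s + (fst p + c) *\<^sub>R x) (snd p)) \<in> borel_measurable (borel \<Otimes>\<^sub>M P)" for c :: real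
  proof -
    have "(\<lambda>p. (\<theta>s + (fst p + c) *\<^sub>R x, snd p)) \<in> borel \<Otimes>\<^sub>M P \<rightarrow>\<^sub>M borel \<Otimes>\<^sub>M P" by measurable
    from measurable_compose[OF this G_joint] show ?thesis by simp
  qed
  show "(\<lambda>p. real (Suc k) *\<^sub>R (G (\<theta>s + (fst p + 1 / real (Suc k)) *\<^sub>R x) (snd p) - G (\<theta>s + fst p *\<^sub>R x) (snd p)))
      \<in> borel_measurable (borel \<Otimes>\<^sub>M P)"
    using m[of "1 / real (Suc k)"] m[of 0]
    by (intro borel_measurable_scaleR borel_measurable_diff) (simp_all del: of_nat_Suc)
next
  fix p :: "real \<times> 'z" assume "p \<in> space (borel \<Otimes>\<^sub>M P)"
  then have "snd p \<in> space P" by (auto simp: space_pair_measure)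
  from vector_derivative_LIMSEQ[OF G_line_derivative[OF this]]
  show "(\<lambda>k. real (Suc k) *\<^sub>R (G (\<theta>s + (fst p + 1 / real (Suc k)) *\<^sub>R x) (snd p) - G (\<theta>s + fst p *\<^sub>R x) (snd p)))
    \<longlonglongrightarrow> hess (\<lambda>s. f s (snd p)) (\<theta>s + fst p *\<^sub>R x) *v x" .
qed

lemma U_measurable [measurable]: "U x \<in> borel_measurable P"
  using measurable_compose[OF measurable_Pair1'[of 0 borel P] hess_line_measurable[of x]] by (simp add: U_def[abs_def])

text \<open>Subtracting \<open>s *\<^sub>R U x z\<close> along the segment leaves the Hessian
  increment applied to \<open>x\<close> as derivative. Its mean square is at most
  \<open>L\<^sub>h\<close> |x|^4 by the Lipschitz condition, and the root of this bounds its mean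
  norm.\<close>

lemma L1_taylor: "(\<integral>\<^sup>+z. ennreal (norm (G (\<theta>s + x) z - G \<theta>s z - U x z)) \<partial>P) \<le> ennreal (sqrt L\<^sub>h * (norm x)\<^sup>2)"
proof -
  define \<Psi> where "\<Psi> s z = G (\<theta>s + s *\<^sub>R x) z - s *\<^sub>R U x z" for s z
  define \<nu> where "\<nu> t z = hess (\<lambda>s. f s z) (\<theta>s + t *\<^sub>R x) *v x - U x z" for t z
  have meas: "(\<lambda>(t, z). \<nu> t z) \<in> borel_measurable (borel \<Otimes>\<^sub>M P)"
  proof -
    have "(\<lambda>p. U x (snd p)) \<in> borel_measurable (borel \<Otimes>\<^sub>M P)"
      by (rule measurable_compose[OF measurable_snd U_measurable])
    with hess_line_measurable[of x] show ?thesis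
      unfolding \<nu>_def case_prod_unfold by (intro borel_measurable_diff)
  qed
  have "(\<integral>\<^sup>+z. ennreal (norm (\<Psi> 1 z - \<Psi> 0 z)) \<partial>P) \<le> ennreal (sqrt L\<^sub>h * (norm x)\<^sup>2)"
  proof (rule L1_mean_value[OF _ _ meas])
    show "sigma_finite_measure P" ..
    show "((\<lambda>s. \<Psi> s z) has_vector_derivative \<nu> t z) (at t)" if "z \<in> space P" for t z
      unfolding \<Psi>_def \<nu>_def
      by (intro has_vector_derivative_diff G_line_derivative that) (auto intro!: derivative_eq_intros)
    fix t :: real assume t: "t \<in> {0..1}"
    have [measurable]: "(\<lambda>z. \<nu> t z) \<in> borel_measurable P"
      using measurable_compose[OF measurable_Pair1'[of t borel P] meas] by simp
    have \<nu>_eq: "\<nu> t z = (hess (\<lambda>s. f s z) (\<theta>s + t *\<^sub>R x) - hess (\<lambda>s. f s z) \<theta>s) *v x" for z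
      by (simp add: \<nu>_def U_def matrix_vector_mult_diff_rdistrib)
    \<comment> \<open>Dividing by \<open>norm x\<close> puts the constant on the side of the
      measurable \<open>\<nu>\<close>; the spectral norm then enters only through monotonicity of
      the integral, which does not presuppose its measurability.\<close>
    have pt: "(norm (\<nu> t z) / norm x)\<^sup>2 \<le> (spectral_norm (hess (\<lambda>s. f s z) (\<theta>s + t *\<^sub>R x) - hess (\<lambda>s. f s z) \<theta>s))\<^sup>2" for z
    proof (cases "x = 0")
      case False
      have "norm (\<nu> t z) \<le> spectral_norm (hess (\<lambda>s. f s z) (\<theta>s + t *\<^sub>R x) - hess (\<lambda>s. f s z) \<theta>s) * norm x"
        unfolding \<nu>_eq by (rule norm_mult_vec_le_spectral)
      with False show ?thesis by (intro power_mono) (auto simp: pos_divide_le_eq)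
    qed simp
    have sq: "(norm (\<nu> t z))\<^sup>2 = (norm x)\<^sup>2 * (norm (\<nu> t z) / norm x)\<^sup>2" for z
      by (cases "x = 0") (auto simp: \<nu>_eq power_divide)
    have "(\<integral>\<^sup>+z. ennreal ((norm (\<nu> t z))\<^sup>2) \<partial>P) = ennreal ((norm x)\<^sup>2) * (\<integral>\<^sup>+z. ennreal ((norm (\<nu> t z) / norm x)\<^sup>2) \<partial>P)"
      by (subst sq) (simp add: ennreal_mult' nn_integral_cmult)
    also have "\<dots> \<le> ennreal ((norm x)\<^sup>2) * ennreal (L\<^sub>h * (norm (\<theta>s + t *\<^sub>R x - \<theta>s))\<^sup>2)"
      by (intro mult_left_mono order_trans[OF nn_integral_mono hess_lipschitz(2)]) (simp_all add: pt ennreal_leI)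
    also have "\<dots> = ennreal ((norm x)\<^sup>2 * L\<^sub>h * (t * norm x)\<^sup>2)"
      using t hess_lipschitz(1) by (simp add: ennreal_mult'[symmetric] mult.assoc)
    also have "\<dots> \<le> ennreal ((norm x)\<^sup>2 * L\<^sub>h * (1 * norm x)\<^sup>2)"
      using t hess_lipschitz(1) by (intro ennreal_leI mult_left_mono power_mono mult_right_mono) auto
    also have "\<dots> = ennreal (L\<^sub>h * (norm x)\<^sup>2 * (norm x)\<^sup>2)" by (simp add: mult_ac)
    finally have n: "(\<integral>\<^sup>+z. ennreal ((norm (\<nu> t z))\<^sup>2) \<partial>P) \<le> ennreal (L\<^sub>h * (norm x)\<^sup>2 * (norm x)\<^sup>2)" .
    have m: "(\<lambda>z. (norm (\<nu> t z))\<^sup>2) \<in> borel_measurable P" by measurable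
    have nn: "0 \<le> L\<^sub>h * (norm x)\<^sup>2 * (norm x)\<^sup>2" using hess_lipschitz(1) by simp
    have i2: "integrable P (\<lambda>z. (norm (\<nu> t z))\<^sup>2)" by (rule integrable_nn_boundI(1)[OF m _ n nn]) simp
    have "expectation (\<lambda>z. (norm (\<nu> t z))\<^sup>2) \<le> L\<^sub>h * (norm x)\<^sup>2 * (norm x)\<^sup>2" by (rule integrable_nn_boundI(2)[OF m _ n nn]) simp
    moreover have "expectation (\<lambda>z. norm (\<nu> t z)) \<le> sqrt (expectation (\<lambda>z. (norm (\<nu> t z))\<^sup>2))"
      by (rule expectation_le_sqrt[OF _ i2]) measurable
    ultimately have "expectation (\<lambda>z. norm (\<nu> t z)) \<le> sqrt (L\<^sub>h * (norm x)\<^sup>2 * (norm x)\<^sup>2)"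
      by (meson order_trans real_sqrt_le_iff)
    also have "\<dots> = sqrt L\<^sub>h * (norm x)\<^sup>2" by (simp add: real_sqrt_mult power2_eq_square)
    finally have e: "expectation (\<lambda>z. norm (\<nu> t z)) \<le> sqrt L\<^sub>h * (norm x)\<^sup>2" .
    have "integrable P (\<lambda>z. norm (\<nu> t z))"
      by (rule square_integrable_imp_integrable[OF _ i2]) measurable
    then have "(\<integral>\<^sup>+z. ennreal (norm (\<nu> t z)) \<partial>P) = ennreal (expectation (\<lambda>z. norm (\<nu> t z)))"
      by (intro nn_integral_eq_integral) auto
    then show "(\<integral>\<^sup>+z. ennreal (norm (\<nu> t z)) \<partial>P) \<le> ennreal (sqrt L\<^sub>h * (norm x)\<^sup>2)"
      using e by (simp add: ennreal_leI)
  qed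
  then show ?thesis by (simp add: \<Psi>_def algebra_simps)
qed

lemma U_scaleR: "U (c *\<^sub>R x) z = c *\<^sub>R U x z"
  by (simp add: U_def matrix_vector_mult_scaleR)

text \<open>The bounds restate \<open>L1_taylor\<close> for the Bochner integral; integrability of
  \<open>U x\<close> follows by subtracting the integrable remainder from integrable
  gradients.\<close>

lemma taylor_remainder:
  shows "integrable P (\<lambda>z. norm (G (\<theta>s + x) z - G \<theta>s z - U x z))"
    and "expectation (\<lambda>z. norm (G (\<theta>s + x) z - G \<theta>s z - U x z)) \<le> sqrt L\<^sub>h * (norm x)\<^sup>2"
    and "integrable P (U x)"
proof -
  let ?W = "\<lambda>z. G (\<theta>s + x) z - G \<theta>s z - U x z"
  have m: "(\<lambda>z. norm (?W z)) \<in> borel_measurable P" by measurable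
  have nn: "0 \<le> sqrt L\<^sub>h * (norm x)\<^sup>2" using hess_lipschitz(1) by simp
  show i: "integrable P (\<lambda>z. norm (?W z))" by (rule integrable_nn_boundI(1)[OF m _ L1_taylor nn]) simp
  show "expectation (\<lambda>z. norm (?W z)) \<le> sqrt L\<^sub>h * (norm x)\<^sup>2"
    by (rule integrable_nn_boundI(2)[OF m _ L1_taylor nn]) simp
  have W: "integrable P ?W" using i by (subst (asm) integrable_norm_iff) measurable
  have "integrable P (\<lambda>z. G (\<theta>s + x) z - G \<theta>s z - ?W z)"
    by (rule Bochner_Integration.integrable_diff[OF Bochner_Integration.integrable_diff[OF G_integrable G_integrable] W])
  moreover have "(\<lambda>z. G (\<theta>s + x) z - G \<theta>s z - ?W z) = U x" by (simp add: fun_eq_iff)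
  ultimately show "integrable P (U x)" by (simp only:)
qed

lemma expectation_U_approx: "norm (gF (\<theta>s + x) - (\<integral>z. U x z \<partial>P)) \<le> sqrt L\<^sub>h * (norm x)\<^sup>2"
proof -
  have "gF (\<theta>s + x) - (\<integral>z. U x z \<partial>P) = (\<integral>z. G (\<theta>s + x) z - G \<theta>s z - U x z \<partial>P)"
    using G_integrable taylor_remainder(3) by (simp add: G_expectation gF_min)
  also have "norm \<dots> \<le> expectation (\<lambda>z. norm (G (\<theta>s + x) z - G \<theta>s z - U x z))"
    by (rule integral_norm_bound)
  also have "\<dots> \<le> sqrt L\<^sub>h * (norm x)\<^sup>2" by (rule taylor_remainder(2))
  finally show ?thesis .
qed

text \<open>Derivative and expectation are exchanged by computing one limit twice: with
  \<open>x\<close> scaled by 1/(k+1), the quadratic error in \<open>expectation_U_approx\<close>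
  still vanishes after multiplication by k+1.\<close>

lemma expectation_U: "(\<integral>z. U x z \<partial>P) = H *v x"
proof (rule LIMSEQ_unique)
  let ?a = "\<lambda>k. real (Suc k) *\<^sub>R gF (\<theta>s + (1 / real (Suc k)) *\<^sub>R x)"
  have "((\<lambda>s. gF (\<theta>s + s *\<^sub>R x)) has_vector_derivative H *v x) (at 0)"
    by (rule has_vector_derivative_line) (use twice_differentiableD(2)[OF F_diff, of \<theta>s] in simp)
  from vector_derivative_LIMSEQ[OF this]
  show "?a \<longlonglongrightarrow> H *v x" by (simp add: gF_min del: of_nat_Suc)
  show "?a \<longlonglongrightarrow> (\<integral>z. U x z \<partial>P)"
  proof (rule LIM_zero_cancel, rule Lim_null_comparison, intro always_eventually allI)
    fix k
    let ?t = "1 / real (Suc k)"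
    have "?a k - (\<integral>z. U x z \<partial>P) = real (Suc k) *\<^sub>R (gF (\<theta>s + ?t *\<^sub>R x) - (\<integral>z. U (?t *\<^sub>R x) z \<partial>P))"
      by (simp add: U_scaleR scaleR_diff_right del: of_nat_Suc)
    then have "norm (?a k - (\<integral>z. U x z \<partial>P)) \<le> real (Suc k) * (sqrt L\<^sub>h * (norm (?t *\<^sub>R x))\<^sup>2)"
      using expectation_U_approx[of "?t *\<^sub>R x"] by (simp add: mult_left_mono del: of_nat_Suc)
    also have "\<dots> = (sqrt L\<^sub>h * (norm x)\<^sup>2) * inverse (real (Suc k))"
      by (simp add: power2_eq_square inverse_eq_divide power_divide del: of_nat_Suc)
    finally show "norm (?a k - (\<integral>z. U x z \<partial>P)) \<le> (sqrt L\<^sub>h * (norm x)\<^sup>2) * inverse (real (Suc k))" .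
  next
    show "(\<lambda>k. (sqrt L\<^sub>h * (norm x)\<^sup>2) * inverse (real (Suc k))) \<longlonglongrightarrow> 0"
      by (intro tendsto_mult_right_zero LIMSEQ_inverse_real_of_nat)
  qed
qed

lemma gF_linearization: "norm (gF \<theta> - H *v (\<theta> - \<theta>s)) \<le> sqrt L\<^sub>h * (norm (\<theta> - \<theta>s))\<^sup>2"
  using expectation_U_approx[of "\<theta> - \<theta>s"] by (simp add: expectation_U)

lemma L1_gradient_continuity:
  "\<exists>C\<ge>0. \<forall>x. expectation (\<lambda>z. norm (G (\<theta>s + x) z - G \<theta>s z)) \<le> C * norm x + sqrt L\<^sub>h * (norm x)\<^sup>2"
proof (intro exI conjI allI)
  \<comment> \<open>\<open>U\<close> is linear in \<open>x\<close>, so its mean norm is controlled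
    by the values on the coordinate axes, each coordinate being at most
    \<open>norm x\<close>.\<close>
  define C where "C = (\<Sum>i\<in>UNIV. expectation (\<lambda>z. norm (U (axis i 1) z)))"
  show "0 \<le> C" unfolding C_def by (intro sum_nonneg Bochner_Integration.integral_nonneg) simp
  fix x
  have Ux: "norm (U x z) \<le> (\<Sum>i\<in>UNIV. norm x * norm (U (axis i 1) z))" for z
  proof -
    have "U x z = (\<Sum>i\<in>UNIV. x $ i *\<^sub>R U (axis i 1) z)"
      by (simp add: U_def matrix_mult_sum[of _ x] matrix_vector_mult_basis scalar_mult_eq_scaleR)
    also have "norm \<dots> \<le> (\<Sum>i\<in>UNIV. norm x * norm (U (axis i 1) z))"
      by (intro sum_norm_le) (simp add: mult_right_mono component_le_norm_cart)
    finally show ?thesis .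
  qed
  have iU: "integrable P (\<lambda>z. norm (U x z))" for x
    using taylor_remainder(3) by (rule integrable_norm)
  have "expectation (\<lambda>z. norm (U x z)) \<le> expectation (\<lambda>z. \<Sum>i\<in>UNIV. norm x * norm (U (axis i 1) z))"
    using iU by (intro integral_mono Ux) auto
  also have "\<dots> = C * norm x"
    using iU by (simp add: C_def sum_distrib_left mult.commute[of _ "norm x"])
  finally have EU: "expectation (\<lambda>z. norm (U x z)) \<le> C * norm x" .
  let ?W = "\<lambda>z. norm (G (\<theta>s + x) z - G \<theta>s z - U x z)"
  have "expectation (\<lambda>z. norm (G (\<theta>s + x) z - G \<theta>s z)) \<le> expectation (\<lambda>z. norm (U x z) + ?W z)"
  proof (rule integral_mono)
    show "integrable P (\<lambda>z. norm (G (\<theta>s + x) z - G \<theta>s z))"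
      by (intro integrable_norm Bochner_Integration.integrable_diff G_integrable)
    show "integrable P (\<lambda>z. norm (U x z) + ?W z)" using iU taylor_remainder(1) by simp
    fix z
    show "norm (G (\<theta>s + x) z - G \<theta>s z) \<le> norm (U x z) + ?W z"
      using norm_triangle_ineq[of "U x z" "G (\<theta>s + x) z - G \<theta>s z - U x z"] by simp
  qed
  also have "\<dots> = expectation (\<lambda>z. norm (U x z)) + expectation ?W"
    using iU taylor_remainder(1) by simp
  also have "\<dots> \<le> C * norm x + sqrt L\<^sub>h * (norm x)\<^sup>2" by (rule add_mono[OF EU taylor_remainder(2)])
  finally show "expectation (\<lambda>z. norm (G (\<theta>s + x) z - G \<theta>s z)) \<le> C * norm x + sqrt L\<^sub>h * (norm x)\<^sup>2" .
qed

text \<open>Interpolation between the \<open>L\<^sup>1\<close> bound and the moment of order \<open>2 + \<delta>\<close>.\<close>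

lemma L2_gradient_continuity:
  assumes \<epsilon>: "0 < \<epsilon>" and \<rho>: "0 < \<rho>"
  shows "\<exists>K\<ge>0. \<forall>x. norm x \<le> \<rho> \<longrightarrow>
    expectation (\<lambda>z. (norm (G (\<theta>s + x) z - G \<theta>s z))\<^sup>2) \<le> \<epsilon> + K * norm x"
proof -
  define p where "p = 2 + \<delta>"
  have p: "2 < p" using grad_moment(1) by (simp add: p_def)
  obtain C where C: "0 \<le> C" "\<And>x. expectation (\<lambda>z. norm (G (\<theta>s + x) z - G \<theta>s z)) \<le> C * norm x + sqrt L\<^sub>h * (norm x)\<^sup>2"
    using L1_gradient_continuity by blast
  \<comment> \<open>Bounds the moment of order \<open>p\<close> of the gradient increment over the
    ball of radius \<open>\<rho>\<close>: the three terms stem from the noise at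
    \<open>\<theta>s + x\<close>, the noise at \<open>\<theta>s\<close> and the change of the mean
    gradient.\<close>
  define A where "A = 3 powr p * (M * (\<rho> powr p + 1) + M + (L\<^sub>f * \<rho>) powr p)"
  have A: "0 < A" using grad_moment(2) p \<rho> unfolding A_def
    by (intro mult_pos_pos add_pos_nonneg add_pos_pos) auto
  have pth: "(\<integral>\<^sup>+z. ennreal (norm (G (\<theta>s + x) z - G \<theta>s z) powr p) \<partial>P) \<le> ennreal A" if x: "norm x \<le> \<rho>" for x
  proof -
    let ?a = "\<lambda>z. norm (G (\<theta>s + x) z - gF (\<theta>s + x))" and ?b = "\<lambda>z. norm (G \<theta>s z - gF \<theta>s)"
    have pt: "norm (G (\<theta>s + x) z - G \<theta>s z) powr p \<le> 3 powr p * (?a z powr p + ?b z powr p + (L\<^sub>f * \<rho>) powr p)" for z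
    proof -
      have "G (\<theta>s + x) z - G \<theta>s z = (G (\<theta>s + x) z - gF (\<theta>s + x)) - (G \<theta>s z - gF \<theta>s) + (gF (\<theta>s + x) - gF \<theta>s)"
        by (simp add: gF_min)
      then have "norm (G (\<theta>s + x) z - G \<theta>s z) \<le> norm ((G (\<theta>s + x) z - gF (\<theta>s + x)) - (G \<theta>s z - gF \<theta>s)) + norm (gF (\<theta>s + x) - gF \<theta>s)"
        by (simp only: norm_triangle_ineq)
      also have "norm ((G (\<theta>s + x) z - gF (\<theta>s + x)) - (G \<theta>s z - gF \<theta>s)) \<le> ?a z + ?b z" by (rule norm_triangle_ineq4)
      also have "norm (gF (\<theta>s + x) - gF \<theta>s) \<le> L\<^sub>f * \<rho>"
        using gF_lipschitz[of "\<theta>s + x" \<theta>s] mult_left_mono[OF x L\<^sub>f_nonneg] by simp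
      finally have "norm (G (\<theta>s + x) z - G \<theta>s z) \<le> ?a z + ?b z + L\<^sub>f * \<rho>" by simp
      then have "norm (G (\<theta>s + x) z - G \<theta>s z) powr p \<le> (?a z + ?b z + L\<^sub>f * \<rho>) powr p"
        using p by (intro powr_mono2) auto
      also have "\<dots> \<le> 3 powr p * (?a z powr p + ?b z powr p + (L\<^sub>f * \<rho>) powr p)"
        using p L\<^sub>f_nonneg \<rho> by (intro powr_sum3_le) auto
      finally show ?thesis .
    qed
    have "(\<integral>\<^sup>+z. ennreal (norm (G (\<theta>s + x) z - G \<theta>s z) powr p) \<partial>P)
        \<le> (\<integral>\<^sup>+z. ennreal (3 powr p) * (ennreal (?a z powr p) + ennreal (?b z powr p) + ennreal ((L\<^sub>f * \<rho>) powr p)) \<partial>P)"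
      by (intro nn_integral_mono) (simp add: pt ennreal_leI ennreal_mult'[symmetric] ennreal_plus[symmetric] del: ennreal_plus)
    also have "\<dots> = ennreal (3 powr p) * ((\<integral>\<^sup>+z. ennreal (?a z powr p) \<partial>P) + (\<integral>\<^sup>+z. ennreal (?b z powr p) \<partial>P) + ennreal ((L\<^sub>f * \<rho>) powr p))"
      by (simp add: nn_integral_cmult nn_integral_add emeasure_space_1)
    also have "\<dots> \<le> ennreal (3 powr p) * (ennreal (M * (\<rho> powr p + 1)) + ennreal M + ennreal ((L\<^sub>f * \<rho>) powr p))"
    proof (intro mult_left_mono add_right_mono add_mono)
      have "(\<integral>\<^sup>+z. ennreal (?a z powr p) \<partial>P) \<le> ennreal (M * (norm x powr p + 1))"
        using grad_moment(3)[of "\<theta>s + x"] by (simp add: p_def G_def)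
      also have "\<dots> \<le> ennreal (M * (\<rho> powr p + 1))"
        using x p grad_moment(2) by (intro ennreal_leI mult_left_mono add_right_mono powr_mono2) auto
      finally show "(\<integral>\<^sup>+z. ennreal (?a z powr p) \<partial>P) \<le> ennreal (M * (\<rho> powr p + 1))" .
      show "(\<integral>\<^sup>+z. ennreal (?b z powr p) \<partial>P) \<le> ennreal M"
        using grad_moment(3)[of \<theta>s] by (simp add: p_def G_def)
    qed simp
    also have "\<dots> = ennreal A"
      using grad_moment(2) unfolding A_def
      by (simp add: ennreal_mult'[symmetric] ennreal_plus[symmetric] del: ennreal_plus)
    finally show ?thesis .
  qed
  \<comment> \<open>The truncation level at which the higher moment contributes at most
    \<open>\<epsilon>\<close>.\<close>
  define K where "K = (A / \<epsilon>) powr (1 / \<delta>)"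
  have K: "0 < K" using A \<epsilon> by (simp add: K_def)
  have Kd: "K powr (- \<delta>) * A = \<epsilon>"
    using A \<epsilon> grad_moment(1) by (simp add: K_def powr_powr powr_minus_divide)
  define K' where "K' = K * (C + sqrt L\<^sub>h * \<rho>)"
  show ?thesis
  proof (intro exI[of _ K'] conjI allI impI)
    show "0 \<le> K'" unfolding K'_def using K C(1) \<rho> hess_lipschitz(1) by simp
    fix x :: "real^'n" assume x: "norm x \<le> \<rho>"
    let ?Y = "\<lambda>z. norm (G (\<theta>s + x) z - G \<theta>s z)"
    have mp: "(\<lambda>z. ?Y z powr p) \<in> borel_measurable P" by measurable
    have ip: "integrable P (\<lambda>z. ?Y z powr p)" "expectation (\<lambda>z. ?Y z powr p) \<le> A"
      by (rule integrable_nn_boundI[OF mp _ pth[OF x]], use A in simp_all)+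
    have iY: "integrable P ?Y"
      by (intro integrable_norm Bochner_Integration.integrable_diff G_integrable)
    have int: "integrable P (\<lambda>z. K * ?Y z + K powr (- \<delta>) * ?Y z powr p)" using iY ip by simp
    have le: "(?Y z)\<^sup>2 \<le> K * ?Y z + K powr (- \<delta>) * ?Y z powr p" for z
      unfolding p_def by (rule square_le_truncation[OF norm_ge_zero K grad_moment(1)])
    have i2: "integrable P (\<lambda>z. (?Y z)\<^sup>2)"
      by (rule Bochner_Integration.integrable_bound[OF int]) (use le in \<open>auto intro!: AE_I2 order_trans[OF _ abs_ge_self]\<close>)
    have "expectation (\<lambda>z. (?Y z)\<^sup>2) \<le> expectation (\<lambda>z. K * ?Y z + K powr (- \<delta>) * ?Y z powr p)"
      by (intro integral_mono i2 int le)
    also have "\<dots> = K * expectation ?Y + K powr (- \<delta>) * expectation (\<lambda>z. ?Y z powr p)" using iY ip by simp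
    also have "\<dots> \<le> K * (C * norm x + sqrt L\<^sub>h * (norm x)\<^sup>2) + K powr (- \<delta>) * A"
      using C(2)[of x] ip(2) K by (intro add_mono mult_left_mono) auto
    also have "K powr (- \<delta>) * A = \<epsilon>" by (rule Kd)
    also have "K * (C * norm x + sqrt L\<^sub>h * (norm x)\<^sup>2) + \<epsilon> \<le> \<epsilon> + K' * norm x"
    proof -
      have "sqrt L\<^sub>h * (norm x)\<^sup>2 \<le> sqrt L\<^sub>h * (\<rho> * norm x)"
        using x hess_lipschitz(1) unfolding power2_eq_square by (intro mult_left_mono mult_right_mono) auto
      then have "K * (C * norm x + sqrt L\<^sub>h * (norm x)\<^sup>2) \<le> K * (C * norm x + sqrt L\<^sub>h * (\<rho> * norm x))"
        using K by (intro mult_left_mono) auto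
      then show ?thesis by (simp add: K'_def algebra_simps)
    qed
    finally show "expectation (\<lambda>z. (?Y z)\<^sup>2) \<le> \<epsilon> + K' * norm x" .
  qed
qed

end

subsection \<open>Independence of data and directions\<close>

text \<open>Rectangles generate the product sigma-algebra and are stable under intersection. On them
  probabilities factor between the two sequences, which are independent as wholes, and then over the
  indices within each.\<close>

lemma (in prob_space) indep_vars_pair_sequences:
  fixes \<zeta> :: "nat \<Rightarrow> 'a \<Rightarrow> 'b" and V :: "nat \<Rightarrow> 'a \<Rightarrow> 'c"
  assumes \<zeta>: "indep_vars (\<lambda>_. P) \<zeta> {1..}" and V: "indep_vars (\<lambda>_. K) V {1..}"
    and ind: "indep_set
      (sets (vimage_algebra (space M) (\<lambda>\<omega>. \<lambda>i\<in>{1..}. \<zeta> i \<omega>) (Pi\<^sub>M {1..} (\<lambda>_. P))))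
      (sets (vimage_algebra (space M) (\<lambda>\<omega>. \<lambda>i\<in>{1..}. V i \<omega>) (Pi\<^sub>M {1..} (\<lambda>_. K))))"
  shows "indep_vars (\<lambda>_. P \<Otimes>\<^sub>M K) (\<lambda>i \<omega>. (\<zeta> (Suc i) \<omega>, V (Suc i) \<omega>)) UNIV"
    and "a \<in> sets P \<Longrightarrow> b \<in> sets K \<Longrightarrow>
      prob ((\<lambda>\<omega>. (\<zeta> (Suc i) \<omega>, V (Suc i) \<omega>)) -` (a \<times> b) \<inter> space M)
        = prob (\<zeta> (Suc i) -` a \<inter> space M) * prob (V (Suc i) -` b \<inter> space M)"
proof -
  let ?A = "vimage_algebra (space M) (\<lambda>\<omega>. \<lambda>i\<in>{1..}. \<zeta> i \<omega>) (Pi\<^sub>M {1..} (\<lambda>_. P))"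
  let ?B = "vimage_algebra (space M) (\<lambda>\<omega>. \<lambda>i\<in>{1..}. V i \<omega>) (Pi\<^sub>M {1..} (\<lambda>_. K))"
  have component: "X (Suc i) -` a \<inter> space M \<in> sets (vimage_algebra (space M) (\<lambda>\<omega>. \<lambda>i\<in>{1..}. X i \<omega>) (Pi\<^sub>M {1..} (\<lambda>_. N)))"
    if X: "indep_vars (\<lambda>_. N) X {1..}" and a: "a \<in> sets N" for X :: "nat \<Rightarrow> 'a \<Rightarrow> 'd" and N i a
  proof -
    have rv: "X k \<in> M \<rightarrow>\<^sub>M N" if "k \<ge> 1" for k using X that by (simp add: indep_vars_def2)
    then have "(\<lambda>\<omega>. \<lambda>i\<in>{1..}. X i \<omega>) \<in> M \<rightarrow>\<^sub>M Pi\<^sub>M {1..} (\<lambda>_. N)"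
      by (intro measurable_restrict) auto
    then have "(\<lambda>\<omega>. \<lambda>i\<in>{1..}. X i \<omega>) \<in> space M \<rightarrow> space (Pi\<^sub>M {1..} (\<lambda>_. N))"
      by (auto dest: measurable_space)
    from measurable_vimage_algebra1[OF this]
    have "(\<lambda>\<omega>. (\<lambda>i\<in>{1..}. X i \<omega>) (Suc i)) \<in> vimage_algebra (space M) (\<lambda>\<omega>. \<lambda>i\<in>{1..}. X i \<omega>) (Pi\<^sub>M {1..} (\<lambda>_. N)) \<rightarrow>\<^sub>M N"
      by (rule measurable_compose[OF _ measurable_component_singleton]) simp
    from measurable_sets[OF this a] show ?thesis by (simp add: vimage_def)
  qed
  have rv: "\<zeta> (Suc i) \<in> M \<rightarrow>\<^sub>M P" "V (Suc i) \<in> M \<rightarrow>\<^sub>M K" for i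
    using \<zeta> V by (simp_all add: indep_vars_def2)
  have product: "prob (\<Inter>j\<in>J. (\<lambda>\<omega>. (\<zeta> (Suc j) \<omega>, V (Suc j) \<omega>)) -` (a j \<times> b j) \<inter> space M)
      = (\<Prod>j\<in>J. prob (\<zeta> (Suc j) -` a j \<inter> space M)) * (\<Prod>j\<in>J. prob (V (Suc j) -` b j \<inter> space M))"
    if J: "finite J" "J \<noteq> {}" and ab: "\<And>j. j \<in> J \<Longrightarrow> a j \<in> sets P" "\<And>j. j \<in> J \<Longrightarrow> b j \<in> sets K" for J a b
  proof -
    have each: "prob (\<Inter>j\<in>J. X (Suc j) -` c j \<inter> space M) = (\<Prod>j\<in>J. prob (X (Suc j) -` c j \<inter> space M))"
      if X: "indep_vars (\<lambda>_. N) X {1..}" and c: "\<And>j. j \<in> J \<Longrightarrow> c j \<in> sets N" for X :: "nat \<Rightarrow> 'a \<Rightarrow> 'd" and N c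
    proof -
      have "prob (\<Inter>k\<in>Suc ` J. X k -` c (k - 1) \<inter> space M) = (\<Prod>k\<in>Suc ` J. prob (X k -` c (k - 1) \<inter> space M))"
        using J c by (intro indep_varsD[OF X]) auto
      moreover have "(\<Inter>k\<in>Suc ` J. X k -` c (k - 1) \<inter> space M) = (\<Inter>j\<in>J. X (Suc j) -` c j \<inter> space M)"
        by (intro set_eqI) auto
      moreover have "(\<Prod>k\<in>Suc ` J. prob (X k -` c (k - 1) \<inter> space M)) = (\<Prod>j\<in>J. prob (X (Suc j) -` c j \<inter> space M))"
        by (simp add: prod.reindex)
      ultimately show ?thesis by (simp only:)
    qed
    have "(\<Inter>j\<in>J. (\<lambda>\<omega>. (\<zeta> (Suc j) \<omega>, V (Suc j) \<omega>)) -` (a j \<times> b j) \<inter> space M)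
        = (\<Inter>j\<in>J. \<zeta> (Suc j) -` a j \<inter> space M) \<inter> (\<Inter>j\<in>J. V (Suc j) -` b j \<inter> space M)"
      using J by auto
    also have "prob \<dots> = prob (\<Inter>j\<in>J. \<zeta> (Suc j) -` a j \<inter> space M) * prob (\<Inter>j\<in>J. V (Suc j) -` b j \<inter> space M)"
      using J ab by (intro indep_setD[OF ind] sets.finite_INT component[OF \<zeta>] component[OF V]) auto
    finally show ?thesis using each[OF \<zeta> ab(1)] each[OF V ab(2)] by simp
  qed
  show pair: "prob ((\<lambda>\<omega>. (\<zeta> (Suc i) \<omega>, V (Suc i) \<omega>)) -` (a \<times> b) \<inter> space M)
        = prob (\<zeta> (Suc i) -` a \<inter> space M) * prob (V (Suc i) -` b \<inter> space M)"
    if "a \<in> sets P" "b \<in> sets K" for a b i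
    using product[of "{i}" "\<lambda>_. a" "\<lambda>_. b"] that by simp
  define Y where "Y i \<omega> = (\<zeta> (Suc i) \<omega>, V (Suc i) \<omega>)" for i \<omega>
  have Y: "Y i \<in> M \<rightarrow>\<^sub>M P \<Otimes>\<^sub>M K" for i unfolding Y_def[abs_def] using rv by simp
  define E where "E i = {Y i -` A \<inter> space M | A. A \<in> {a \<times> b | a b. a \<in> sets P \<and> b \<in> sets K}}" for i
  have "indep_sets E UNIV"
  proof (rule indep_setsI)
    show "E i \<subseteq> events" for i unfolding E_def using measurable_sets[OF Y] by blast
    fix A J assume J: "J \<noteq> {}" "finite (J :: nat set)" and A: "\<forall>j\<in>J. A j \<in> E j"
    then have "\<forall>j\<in>J. \<exists>ab. A j = Y j -` (fst ab \<times> snd ab) \<inter> space M \<and> fst ab \<in> sets P \<and> snd ab \<in> sets K"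
      unfolding E_def by fastforce
    from bchoice[OF this] obtain ab where ab: "\<And>j. j \<in> J \<Longrightarrow> A j = Y j -` (fst (ab j) \<times> snd (ab j)) \<inter> space M"
      "\<And>j. j \<in> J \<Longrightarrow> fst (ab j) \<in> sets P" "\<And>j. j \<in> J \<Longrightarrow> snd (ab j) \<in> sets K" by blast
    have "prob (\<Inter>j\<in>J. A j) = prob (\<Inter>j\<in>J. Y j -` (fst (ab j) \<times> snd (ab j)) \<inter> space M)"
      using ab(1) by simp
    also have "\<dots> = (\<Prod>j\<in>J. prob (\<zeta> (Suc j) -` fst (ab j) \<inter> space M)) * (\<Prod>j\<in>J. prob (V (Suc j) -` snd (ab j) \<inter> space M))"
      unfolding Y_def by (rule product) (use J ab in auto)
    also have "\<dots> = (\<Prod>j\<in>J. prob (A j))"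
      unfolding prod.distrib[symmetric] using ab by (intro prod.cong) (auto simp: pair[symmetric] Y_def[abs_def])
    finally show "prob (\<Inter>j\<in>J. A j) = (\<Prod>j\<in>J. prob (A j))" .
  qed
  then have "indep_sets (\<lambda>i. sigma_sets (space M) (E i)) UNIV"
  proof (rule indep_sets_sigma)
    fix i
    show "Int_stable (E i)"
    proof (rule Int_stableI)
      fix A A' assume "A \<in> E i" "A' \<in> E i"
      then obtain a b a' b' where e: "A = Y i -` (a \<times> b) \<inter> space M" "A' = Y i -` (a' \<times> b') \<inter> space M"
        "a \<in> sets P" "b \<in> sets K" "a' \<in> sets P" "b' \<in> sets K"
        unfolding E_def by auto
      then have "A \<inter> A' = Y i -` ((a \<inter> a') \<times> (b \<inter> b')) \<inter> space M" by auto
      moreover have "a \<inter> a' \<in> sets P" "b \<inter> b' \<in> sets K" using e by auto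
      ultimately show "A \<inter> A' \<in> E i" unfolding E_def by blast
    qed
  qed
  moreover have "sigma_sets (space M) (E i) = {Y i -` A \<inter> space M | A. A \<in> sets (P \<Otimes>\<^sub>M K)}" for i
    unfolding E_def sets_pair_measure
    by (rule sigma_sets_vimage_commute[symmetric]) (use measurable_space[OF Y] in \<open>auto simp: space_pair_measure\<close>)
  ultimately have "indep_vars (\<lambda>_. P \<Otimes>\<^sub>M K) Y UNIV" using Y by (simp add: indep_vars_def2)
  then show "indep_vars (\<lambda>_. P \<Otimes>\<^sub>M K) (\<lambda>i \<omega>. (\<zeta> (Suc i) \<omega>, V (Suc i) \<omega>)) UNIV" by (simp add: Y_def[abs_def])
qed

lemma pair_law:
  assumes \<Omega>: "prob_space \<Omega>" and P: "prob_space P" and U: "prob_space U"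
    and X: "X \<in> \<Omega> \<rightarrow>\<^sub>M P" "distr \<Omega> P X = P" and Y: "Y \<in> \<Omega> \<rightarrow>\<^sub>M U" "distr \<Omega> U Y = U"
    and ind: "\<And>a b. a \<in> sets P \<Longrightarrow> b \<in> sets U \<Longrightarrow>
      measure \<Omega> ((\<lambda>\<omega>. (X \<omega>, Y \<omega>)) -` (a \<times> b) \<inter> space \<Omega>) = measure \<Omega> (X -` a \<inter> space \<Omega>) * measure \<Omega> (Y -` b \<inter> space \<Omega>)"
  shows "distr \<Omega> (P \<Otimes>\<^sub>M U) (\<lambda>\<omega>. (X \<omega>, Y \<omega>)) = P \<Otimes>\<^sub>M U"
proof (rule sym, rule pair_measure_eqI)
  interpret \<Omega>: prob_space \<Omega> by fact
  interpret P: prob_space P by fact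
  interpret U: prob_space U by fact
  show "sigma_finite_measure P" "sigma_finite_measure U" by unfold_locales
  show "sets (P \<Otimes>\<^sub>M U) = sets (distr \<Omega> (P \<Otimes>\<^sub>M U) (\<lambda>\<omega>. (X \<omega>, Y \<omega>)))" by simp
  fix a b assume ab: "a \<in> sets P" "b \<in> sets U"
  have "emeasure (distr \<Omega> (P \<Otimes>\<^sub>M U) (\<lambda>\<omega>. (X \<omega>, Y \<omega>))) (a \<times> b) = emeasure \<Omega> ((\<lambda>\<omega>. (X \<omega>, Y \<omega>)) -` (a \<times> b) \<inter> space \<Omega>)"
    using X Y ab by (intro emeasure_distr) auto
  also have "\<dots> = emeasure \<Omega> (X -` a \<inter> space \<Omega>) * emeasure \<Omega> (Y -` b \<inter> space \<Omega>)"
    using ind[OF ab] by (simp add: \<Omega>.emeasure_eq_measure ennreal_mult')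
  also have "emeasure \<Omega> (X -` a \<inter> space \<Omega>) = emeasure P a"
    using emeasure_distr[OF X(1) ab(1)] X(2) by simp
  also have "emeasure \<Omega> (Y -` b \<inter> space \<Omega>) = emeasure U b"
    using emeasure_distr[OF Y(1) ab(2)] Y(2) by simp
  finally show "emeasure P a * emeasure U b = emeasure (distr \<Omega> (P \<Otimes>\<^sub>M U) (\<lambda>\<omega>. (X \<omega>, Y \<omega>))) (a \<times> b)" ..
qed

text \<open>Stage \<open>i\<close> knows \<open>Y 0\<close> to \<open>Y (i - 1)\<close>. With
  \<open>W (Suc i) = Y i\<close> these are the innovations consumed up to step \<open>i\<close>, so
  step \<open>Suc i\<close> reads a fresh one.\<close>

definition natural_filtration :: "'w measure \<Rightarrow> 'z measure \<Rightarrow> (nat \<Rightarrow> 'w \<Rightarrow> 'z) \<Rightarrow> nat \<Rightarrow> 'w measure" where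
  "natural_filtration \<Omega> N Y i = vimage_algebra (space \<Omega>) (\<lambda>\<omega>. \<lambda>k\<in>{..<i}. Y k \<omega>) (Pi\<^sub>M {..<i} (\<lambda>_. N))"

text \<open>The pair of \<open>\<omega>\<close>, seen through the past sigma-algebra, and
  \<open>Y i\<close> has a product law because past and present are independent. The integration
  rule is Fubini for this product.\<close>

lemma innovation_filtration_natural:
  fixes Y :: "nat \<Rightarrow> 'w \<Rightarrow> 'z"
  assumes \<Omega>: "prob_space \<Omega>" and ind: "prob_space.indep_vars \<Omega> (\<lambda>_. N) Y UNIV"
    and law: "\<And>i. distr \<Omega> N (Y i) = N" and W: "\<And>i. W (Suc i) = Y i"
  shows "innovation_filtration \<Omega> N (natural_filtration \<Omega> N Y) W"
proof -
  interpret prob_space \<Omega> by fact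
  let ?F = "natural_filtration \<Omega> N Y"
  have rv: "Y i \<in> \<Omega> \<rightarrow>\<^sub>M N" for i using ind by (simp add: indep_vars_def2)
  interpret N: prob_space N using prob_space_distr[OF rv[of 0]] law by simp
  have past_rv: "(\<lambda>\<omega>. \<lambda>k\<in>{..<i}. Y k \<omega>) \<in> \<Omega> \<rightarrow>\<^sub>M Pi\<^sub>M {..<i} (\<lambda>_. N)" for i
    using rv by (intro measurable_restrict) auto
  have past_space: "(\<lambda>\<omega>. \<lambda>k\<in>{..<i}. Y k \<omega>) \<in> space \<Omega> \<rightarrow> space (Pi\<^sub>M {..<i} (\<lambda>_. N))" for i
    using measurable_space[OF past_rv] by blast
  have sp: "space (?F i) = space \<Omega>" for i by (simp add: natural_filtration_def)
  have sub: "sets (?F i) \<subseteq> sets \<Omega>" for i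
    unfolding natural_filtration_def by (rule sets_image_in_sets) (simp_all add: past_rv)
  have comp: "Y k \<in> ?F i \<rightarrow>\<^sub>M N" if "k < i" for k i
  proof -
    have "(\<lambda>\<omega>. (\<lambda>k\<in>{..<i}. Y k \<omega>) k) \<in> ?F i \<rightarrow>\<^sub>M N"
      unfolding natural_filtration_def
      by (rule measurable_compose[OF measurable_vimage_algebra1[OF past_space] measurable_component_singleton]) (use that in simp)
    then show ?thesis using that by simp
  qed
  have mono: "sets (?F i) \<subseteq> sets (?F (Suc i))" for i
    unfolding natural_filtration_def[of _ _ _ i]
  proof (rule sets_image_in_sets)
    show "(\<lambda>\<omega>. \<lambda>k\<in>{..<i}. Y k \<omega>) \<in> ?F (Suc i) \<rightarrow>\<^sub>M Pi\<^sub>M {..<i} (\<lambda>_. N)"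
      by (intro measurable_restrict comp) auto
  qed (simp add: sp)
  have id: "(\<lambda>\<omega>. \<omega>) \<in> \<Omega> \<rightarrow>\<^sub>M ?F i" for i
    using sub[of i] sp by (auto simp: measurable_def Int_absorb2 dest: sets.sets_into_space)
  have indep: "prob (A \<inter> (Y i -` b \<inter> space \<Omega>)) = prob A * prob (Y i -` b \<inter> space \<Omega>)"
    if A: "A \<in> sets (?F i)" and b: "b \<in> sets N" for A b i
  proof -
    let ?past = "\<lambda>\<omega>. restrict (\<lambda>k. Y k \<omega>) {..<i}" and ?now = "\<lambda>\<omega>. restrict (\<lambda>k. Y k \<omega>) {i}"
    have "indep_var (Pi\<^sub>M {..<i} (\<lambda>_. N)) ?past (Pi\<^sub>M {i} (\<lambda>_. N)) ?now"
      by (rule indep_var_restrict[OF ind]) auto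
    then have iset: "indep_set (sigma_sets (space \<Omega>) {?past -` A \<inter> space \<Omega> | A. A \<in> sets (Pi\<^sub>M {..<i} (\<lambda>_. N))})
        (sigma_sets (space \<Omega>) {?now -` A \<inter> space \<Omega> | A. A \<in> sets (Pi\<^sub>M {i} (\<lambda>_. N))})"
      unfolding indep_var_eq by blast
    have "A \<in> sigma_sets (space \<Omega>) {?past -` A \<inter> space \<Omega> | A. A \<in> sets (Pi\<^sub>M {..<i} (\<lambda>_. N))}"
      using A unfolding natural_filtration_def sets_vimage_algebra .
    moreover have "Y i -` b \<inter> space \<Omega> \<in> sigma_sets (space \<Omega>) {?now -` A \<inter> space \<Omega> | A. A \<in> sets (Pi\<^sub>M {i} (\<lambda>_. N))}"
    proof (rule sigma_sets.Basic)
      have "(\<lambda>w. w i) -` b \<inter> space (Pi\<^sub>M {i} (\<lambda>_. N)) \<in> sets (Pi\<^sub>M {i} (\<lambda>_. N))"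
        by (rule measurable_sets[OF _ b]) (rule measurable_component_singleton, simp)
      moreover have "Y i -` b \<inter> space \<Omega> = ?now -` ((\<lambda>w. w i) -` b \<inter> space (Pi\<^sub>M {i} (\<lambda>_. N))) \<inter> space \<Omega>"
        using measurable_space[OF rv[of i]] by (auto simp: space_PiM)
      ultimately show "Y i -` b \<inter> space \<Omega> \<in> {?now -` A \<inter> space \<Omega> | A. A \<in> sets (Pi\<^sub>M {i} (\<lambda>_. N))}" by blast
    qed
    ultimately show ?thesis by (rule indep_setD[OF iset])
  qed
  \<comment> \<open>The restriction of \<open>\<Omega>\<close> to the events of the past.\<close>
  define D where "D i = distr \<Omega> (?F i) (\<lambda>\<omega>. \<omega>)" for i
  have joint: "distr \<Omega> (D i \<Otimes>\<^sub>M N) (\<lambda>\<omega>. (\<omega>, Y i \<omega>)) = D i \<Otimes>\<^sub>M N" for i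
  proof (rule pair_law)
    show "prob_space (D i)" unfolding D_def by (rule prob_space_distr[OF id])
    show "(\<lambda>\<omega>. \<omega>) \<in> \<Omega> \<rightarrow>\<^sub>M D i" using id[of i] by (simp add: D_def)
    show "distr \<Omega> (D i) (\<lambda>\<omega>. \<omega>) = D i" unfolding D_def by (rule distr_cong) simp_all
    fix a b assume ab: "a \<in> sets (D i)" "b \<in> sets N"
    then have a: "a \<in> sets (?F i)" by (simp add: D_def)
    then have "a \<subseteq> space \<Omega>" using sets.sets_into_space sp by blast
    then have "(\<lambda>\<omega>. (\<omega>, Y i \<omega>)) -` (a \<times> b) \<inter> space \<Omega> = a \<inter> (Y i -` b \<inter> space \<Omega>)" "(\<lambda>\<omega>. \<omega>) -` a \<inter> space \<Omega> = a" by auto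
    then show "prob ((\<lambda>\<omega>. (\<omega>, Y i \<omega>)) -` (a \<times> b) \<inter> space \<Omega>) = prob ((\<lambda>\<omega>. \<omega>) -` a \<inter> space \<Omega>) * prob (Y i -` b \<inter> space \<Omega>)"
      using indep[OF a ab(2)] by simp
  qed (rule \<Omega> N.prob_space_axioms rv law)+
  show ?thesis
  proof
    show "space (?F i) = space \<Omega>" "sets (?F i) \<subseteq> sets \<Omega>" "sets (?F i) \<subseteq> sets (?F (Suc i))" for i
      by (rule sp sub mono)+
    show "W (Suc i) \<in> ?F (Suc i) \<rightarrow>\<^sub>M N" for i unfolding W by (rule comp) simp
    fix i and \<phi> :: "'w \<times> 'z \<Rightarrow> ennreal" assume \<phi>: "\<phi> \<in> borel_measurable (?F i \<Otimes>\<^sub>M N)"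
    have D_sets: "sets (D i) = sets (?F i)" by (simp add: D_def)
    have \<phi>D: "\<phi> \<in> borel_measurable (D i \<Otimes>\<^sub>M N)"
      using \<phi> measurable_cong_sets[OF sets_pair_measure_cong[OF D_sets refl] refl] by blast
    have "(\<lambda>\<omega>. (\<omega>, Y i \<omega>)) \<in> \<Omega> \<rightarrow>\<^sub>M D i \<Otimes>\<^sub>M N"
      using id[of i] rv by (intro measurable_Pair) (simp_all add: D_def)
    then have "(\<integral>\<^sup>+p. \<phi> p \<partial>distr \<Omega> (D i \<Otimes>\<^sub>M N) (\<lambda>\<omega>. (\<omega>, Y i \<omega>))) = (\<integral>\<^sup>+\<omega>. \<phi> (\<omega>, Y i \<omega>) \<partial>\<Omega>)"
      by (rule nn_integral_distr) (use \<phi>D in simp)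
    then have "(\<integral>\<^sup>+\<omega>. \<phi> (\<omega>, Y i \<omega>) \<partial>\<Omega>) = (\<integral>\<^sup>+p. \<phi> p \<partial>(D i \<Otimes>\<^sub>M N))" by (simp only: joint)
    also have "\<dots> = (\<integral>\<^sup>+\<omega>. (\<integral>\<^sup>+w. \<phi> (\<omega>, w) \<partial>N) \<partial>D i)"
      by (rule N.nn_integral_fst[OF \<phi>D, symmetric])
    also have "\<dots> = (\<integral>\<^sup>+\<omega>. (\<integral>\<^sup>+w. \<phi> (\<omega>, w) \<partial>N) \<partial>\<Omega>)"
      unfolding D_def by (rule nn_integral_distr[OF id]) (use N.borel_measurable_nn_integral_fst[OF \<phi>] in simp)
    finally show "(\<integral>\<^sup>+\<omega>. \<phi> (\<omega>, W (Suc i) \<omega>) \<partial>\<Omega>) = (\<integral>\<^sup>+\<omega>. (\<integral>\<^sup>+w. \<phi> (\<omega>, w) \<partial>N) \<partial>\<Omega>)" by (simp only: W)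
  qed
qed

text \<open>With finitely many values in the second factor, joint measurability is glued together
  from the sections, and the inner integral is an average.\<close>

lemma integral_pair_uniform:
  fixes k :: "'z \<times> 'v \<Rightarrow> 'b::{banach, second_countable_topology}"
  assumes P: "prob_space P" and T: "finite T" "T \<noteq> {}"
    and int: "\<And>v. v \<in> T \<Longrightarrow> integrable P (\<lambda>z. k (z, v))"
  shows "integrable (P \<Otimes>\<^sub>M uniform_count_measure T) k"
    and "(\<integral>p. k p \<partial>(P \<Otimes>\<^sub>M uniform_count_measure T)) = (1 / real (card T)) *\<^sub>R (\<Sum>v\<in>T. \<integral>z. k (z, v) \<partial>P)"
proof -
  interpret P: prob_space P by fact
  interpret U: prob_space "uniform_count_measure T" by (rule prob_space_uniform_count_measure[OF T])
  interpret pair_sigma_finite P "uniform_count_measure T" ..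
  let ?U = "uniform_count_measure T"
  have intU: "integrable ?U l" for l :: "'v \<Rightarrow> 'c::{banach, second_countable_topology}"
    unfolding uniform_count_measure_def by (rule integrable_point_measure_finite[OF T(1)])
  have km: "k \<in> borel_measurable (P \<Otimes>\<^sub>M ?U)"
  proof -
    have "(\<lambda>p. k (fst p, snd p)) \<in> borel_measurable (P \<Otimes>\<^sub>M ?U)"
    proof (rule measurable_compose_countable'[where I=T])
      fix v assume "v \<in> T"
      then show "(\<lambda>p. k (fst p, v)) \<in> borel_measurable (P \<Otimes>\<^sub>M ?U)"
        using int by (intro measurable_compose[OF measurable_fst]) auto
    qed (use T in \<open>auto simp: countable_finite intro!: measurable_compose[OF measurable_snd] cong: measurable_cong_sets\<close>)
    then show ?thesis by simp
  qed
  have inner: "(\<integral>v. l v \<partial>?U) = (1 / real (card T)) *\<^sub>R (\<Sum>v\<in>T. l v)" for l :: "'v \<Rightarrow> 'c::{banach, second_countable_topology}"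
    by (rule integral_uniform_count_measure_scaleR[OF T(1)])
  show i: "integrable (P \<Otimes>\<^sub>M ?U) k"
  proof (rule Fubini_integrable[OF km])
    show "integrable P (\<lambda>z. \<integral>v. norm (k (z, v)) \<partial>?U)"
      unfolding inner using int by (intro integrable_scaleR_right Bochner_Integration.integrable_sum integrable_norm)
    show "AE z in P. integrable ?U (\<lambda>v. k (z, v))" by (intro AE_I2 intU)
  qed
  have "(\<integral>p. k p \<partial>(P \<Otimes>\<^sub>M ?U)) = (\<integral>z. (\<integral>v. k (z, v) \<partial>?U) \<partial>P)"
    using integral_fst'[of k] i by simp
  also have "\<dots> = (1 / real (card T)) *\<^sub>R (\<Sum>v\<in>T. \<integral>z. k (z, v) \<partial>P)"
    unfolding inner using int by (simp add: Bochner_Integration.integral_sum)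
  finally show "(\<integral>p. k p \<partial>(P \<Otimes>\<^sub>M ?U)) = (1 / real (card T)) *\<^sub>R (\<Sum>v\<in>T. \<integral>z. k (z, v) \<partial>P)" .
qed

subsection \<open>Kiefer-Wolfowitz gradients\<close>

lemma norm_avg_sq_le:
  fixes a :: "nat \<Rightarrow> 'a::real_normed_vector"
  assumes "1 \<le> m"
  shows "(norm ((1 / real m) *\<^sub>R (\<Sum>j=1..m. a j)))\<^sup>2 \<le> (1 / real m) * (\<Sum>j=1..m. (norm (a j))\<^sup>2)"
proof -
  have "(norm (\<Sum>j=1..m. a j))\<^sup>2 \<le> (\<Sum>j=1..m. norm (a j))\<^sup>2"
    by (intro power_mono norm_sum) simp
  also have "\<dots> \<le> (\<Sum>j=1..m. (norm (a j))\<^sup>2) * real m"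
    using sum_squared_le_sum_of_squares[of "\<lambda>j. norm (a j)" "{1..m}"] by simp
  finally show ?thesis using assms by (simp add: power_mult_distrib power_divide field_simps power2_eq_square)
qed

lemma norm_outer: "norm (outer x) = (norm x)\<^sup>2"
proof -
  have row: "outer x $ i = x $ i *\<^sub>R x" for i by (simp add: outer_def vec_eq_iff)
  have "norm (outer x) = L2_set (\<lambda>i. norm (outer x $ i)) UNIV" by (rule norm_vec_def)
  also have "\<dots> = L2_set (\<lambda>i. norm (x $ i) * norm x) UNIV" by (simp only: row norm_scaleR real_norm_def)
  also have "\<dots> = L2_set (\<lambda>i. norm (x $ i)) UNIV * norm x" by (rule L2_set_left_distrib[symmetric]) simp
  finally show ?thesis by (simp add: norm_vec_def power2_eq_square)
qed

lemma quadratic_form_outer: "a \<bullet> (outer x *v b) = (a \<bullet> x) * (x \<bullet> b)"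
  by (simp add: outer_mult_vec)

locale kw_wor = kw_model P f F \<theta>s L\<^sub>f \<delta>1 lam \<delta> M L\<^sub>h + wor_directions B D d m
  for P :: "'z measure" and f :: "real^'n \<Rightarrow> 'z \<Rightarrow> real" and F \<theta>s L\<^sub>f \<delta>1 lam \<delta> M L\<^sub>h
    and B D :: "(real^'n) set" and d m :: nat
begin

abbreviation N :: "('z \<times> (nat \<Rightarrow> real^'n)) measure" where
  "N \<equiv> P \<Otimes>\<^sub>M uniform_count_measure tuples"

definition kwG :: "real \<Rightarrow> real^'n \<Rightarrow> 'z \<times> (nat \<Rightarrow> real^'n) \<Rightarrow> real^'n" where
  "kwG h \<theta> w = (1 / real m) *\<^sub>R (\<Sum>j=1..m. kw_gradient f h (snd w j) \<theta> (fst w))"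

definition Gs :: "'z \<times> (nat \<Rightarrow> real^'n) \<Rightarrow> real^'n" where
  "Gs w = dir_avg m (snd w) (G \<theta>s (fst w))"

lemmas integral_N = integral_pair_uniform[OF prob_space_axioms tuples_finite tuples_nonempty]

lemma average_le:
  assumes "\<And>v. v \<in> tuples \<Longrightarrow> a v \<le> (b::real)"
  shows "(1 / real (card tuples)) * (\<Sum>v\<in>tuples. a v) \<le> b"
proof -
  have "(\<Sum>v\<in>tuples. a v) \<le> real (card tuples) * b" using sum_bounded_above[of tuples a b] assms by simp
  then show ?thesis using card_tuples_pos by (simp add: field_simps)
qed

lemma tuple_vec_norm: "v \<in> tuples \<Longrightarrow> j \<in> {1..m} \<Longrightarrow> norm (v j) = sqrt (real d)"
  using tuple_norm[of v j] by (metis norm_ge_zero real_sqrt_unique)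

lemma f_measurable: "f \<theta> \<in> borel_measurable P"
  using f_int by auto

lemma kw_gradient_measurable: "(\<lambda>z. kw_gradient f h v \<theta> z) \<in> borel_measurable P"
  unfolding kw_gradient_def using f_measurable by simp

lemma kwG_measurable: "(\<lambda>(\<theta>, w). kwG h \<theta> w) \<in> borel_measurable (borel \<Otimes>\<^sub>M N)"
proof -
  have "(\<lambda>p. kwG h (fst p) (fst (snd p), snd (snd p))) \<in> borel_measurable (borel \<Otimes>\<^sub>M N)"
  proof (rule measurable_compose_countable'[where f="\<lambda>v p. kwG h (fst p) (fst (snd p), v)" and g="\<lambda>p. snd (snd p)" and I=tuples])
    fix v :: "nat \<Rightarrow> real^'n"
    have m: "(\<lambda>p. f (fst p + c) (fst (snd p))) \<in> borel_measurable (borel \<Otimes>\<^sub>M N)" for c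
    proof -
      have "(\<lambda>p. (fst p + c, fst (snd p))) \<in> borel \<Otimes>\<^sub>M N \<rightarrow>\<^sub>M borel \<Otimes>\<^sub>M P" by measurable
      from measurable_compose[OF this f_joint] show ?thesis by simp
    qed
    show "(\<lambda>p. kwG h (fst p) (fst (snd p), v)) \<in> borel_measurable (borel \<Otimes>\<^sub>M N)"
      unfolding kwG_def kw_gradient_def fst_conv snd_conv
      using m m[of 0] by (intro borel_measurable_scaleR borel_measurable_sum borel_measurable_divide borel_measurable_diff) simp_all
  next
    have "(\<lambda>p. snd (snd p)) \<in> borel \<Otimes>\<^sub>M N \<rightarrow>\<^sub>M uniform_count_measure tuples" by measurable
    then show "(\<lambda>p. snd (snd p)) \<in> borel \<Otimes>\<^sub>M N \<rightarrow>\<^sub>M count_space tuples"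
      using measurable_cong_sets[OF refl sets_uniform_count_measure_count_space] by blast
  qed (simp add: tuples_finite countable_finite)
  then show ?thesis by (simp add: case_prod_unfold)
qed

text \<open>One factor \<open>d\<close> comes from the length of \<open>v j\<close> inside the
  quotient, the other from the vector \<open>v j\<close> that multiplies it; the average over
  \<open>j\<close> is handled by convexity of the square.\<close>

lemma kwG_deviation:
  assumes z: "z \<in> space P" and v: "v \<in> tuples" and h: "0 < h"
  shows "(norm (kwG h \<theta> (z, v) - dir_avg m v c))\<^sup>2
    \<le> (1 / real m) * (\<Sum>j=1..m. (real d)\<^sup>2 * ((norm (G \<theta> z - c))\<^sup>2 + (norm (G (\<theta> + h *\<^sub>R v j) z - c))\<^sup>2))"
proof -
  let ?q = "\<lambda>j. (f (\<theta> + h *\<^sub>R v j) z - f \<theta> z) / h - c \<bullet> v j"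
  have "kwG h \<theta> (z, v) - dir_avg m v c = (1 / real m) *\<^sub>R (\<Sum>j=1..m. ?q j *\<^sub>R v j)"
    by (simp add: kwG_def dir_avg_def kw_gradient_def scaleR_diff_right[symmetric] sum_subtractf[symmetric]
        scaleR_diff_left inner_commute del: scaleR_diff_right)
  then have "(norm (kwG h \<theta> (z, v) - dir_avg m v c))\<^sup>2 \<le> (1 / real m) * (\<Sum>j=1..m. (norm (?q j *\<^sub>R v j))\<^sup>2)"
    using norm_avg_sq_le[OF m(1), of "\<lambda>j. ?q j *\<^sub>R v j"] by simp
  also have "\<dots> \<le> (1 / real m) * (\<Sum>j=1..m. (real d)\<^sup>2 * ((norm (G \<theta> z - c))\<^sup>2 + (norm (G (\<theta> + h *\<^sub>R v j) z - c))\<^sup>2))"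
  proof (intro mult_left_mono sum_mono)
    fix j assume j: "j \<in> {1..m}"
    have "(norm (?q j *\<^sub>R v j))\<^sup>2 = (?q j)\<^sup>2 * real d"
      using tuple_norm[OF v j] by (simp add: power_mult_distrib)
    also have "\<dots> \<le> (real d * ((norm (G \<theta> z - c))\<^sup>2 + (norm (G (\<theta> + h *\<^sub>R v j) z - c))\<^sup>2)) * real d"
      using quotient_square_le[OF z h, of \<theta> "v j" c] tuple_norm[OF v j] by (intro mult_right_mono) auto
    finally show "(norm (?q j *\<^sub>R v j))\<^sup>2 \<le> (real d)\<^sup>2 * ((norm (G \<theta> z - c))\<^sup>2 + (norm (G (\<theta> + h *\<^sub>R v j) z - c))\<^sup>2)"
      by (simp add: power2_eq_square mult_ac)
  qed simp
  finally show ?thesis .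
qed

lemma dir_avg_linear: "bounded_linear (dir_avg m v)"
  unfolding dir_avg_def
  by (intro bounded_linear_intros)

text \<open>Common source of the growth bound (\<open>c\<close> zero) and of the closeness to the
  idealised query (\<open>c\<close> the gradient at \<open>\<theta>s\<close>). The factor 2 counts
  the two endpoints of a difference quotient.\<close>

lemma kwG_deviation_integral:
  assumes h: "0 < h" and c[measurable]: "c \<in> borel_measurable P"
    and int: "\<And>\<theta>. integrable P (\<lambda>z. (norm (G \<theta> z - c z))\<^sup>2)"
    and b: "expectation (\<lambda>z. (norm (G \<theta> z - c z))\<^sup>2) \<le> b"
      "\<And>v. norm v = sqrt (real d) \<Longrightarrow> expectation (\<lambda>z. (norm (G (\<theta> + h *\<^sub>R v) z - c z))\<^sup>2) \<le> b"
  shows "integrable N (\<lambda>w. (norm (kwG h \<theta> w - dir_avg m (snd w) (c (fst w))))\<^sup>2)"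
    and "(\<integral>w. (norm (kwG h \<theta> w - dir_avg m (snd w) (c (fst w))))\<^sup>2 \<partial>N) \<le> 2 * (real d)\<^sup>2 * b"
proof -
  let ?r = "\<lambda>v z. (1 / real m) * (\<Sum>j=1..m. (real d)\<^sup>2 * ((norm (G \<theta> z - c z))\<^sup>2 + (norm (G (\<theta> + h *\<^sub>R v j) z - c z))\<^sup>2))"
  have ri: "integrable P (?r v)" for v
    using int by (intro integrable_mult_right Bochner_Integration.integrable_sum Bochner_Integration.integrable_add)
  have sec: "integrable P (\<lambda>z. (norm (kwG h \<theta> (z, v) - dir_avg m v (c z)))\<^sup>2)"
    "expectation (\<lambda>z. (norm (kwG h \<theta> (z, v) - dir_avg m v (c z)))\<^sup>2) \<le> 2 * (real d)\<^sup>2 * b" if v: "v \<in> tuples" for v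
  proof -
    have "dir_avg m v \<in> borel_measurable borel"
      by (intro borel_measurable_continuous_onI linear_continuous_on dir_avg_linear)
    from measurable_compose[OF c this]
    have [measurable]: "(\<lambda>z. dir_avg m v (c z)) \<in> borel_measurable P" .
    have [measurable]: "(\<lambda>z. kwG h \<theta> (z, v)) \<in> borel_measurable P"
      unfolding kwG_def fst_conv snd_conv
      by (intro borel_measurable_scaleR borel_measurable_sum kw_gradient_measurable) simp
    show i: "integrable P (\<lambda>z. (norm (kwG h \<theta> (z, v) - dir_avg m v (c z)))\<^sup>2)"
    proof (rule Bochner_Integration.integrable_bound[OF ri[of v]])
      show "AE z in P. norm ((norm (kwG h \<theta> (z, v) - dir_avg m v (c z)))\<^sup>2) \<le> norm (?r v z)"
      proof (intro AE_I2)
        fix z assume z: "z \<in> space P"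
        show "norm ((norm (kwG h \<theta> (z, v) - dir_avg m v (c z)))\<^sup>2) \<le> norm (?r v z)"
          using kwG_deviation[OF z v h, of \<theta> "c z"] unfolding real_norm_def abs_of_nonneg[OF zero_le_power2] by linarith
      qed
    qed measurable
    have "expectation (\<lambda>z. (norm (kwG h \<theta> (z, v) - dir_avg m v (c z)))\<^sup>2) \<le> expectation (?r v)"
      by (intro integral_mono i ri kwG_deviation v h)
    also have "\<dots> = (1 / real m) * (\<Sum>j=1..m. (real d)\<^sup>2 * (expectation (\<lambda>z. (norm (G \<theta> z - c z))\<^sup>2)
        + expectation (\<lambda>z. (norm (G (\<theta> + h *\<^sub>R v j) z - c z))\<^sup>2)))"
      using int by (simp add: Bochner_Integration.integral_sum)
    also have "\<dots> \<le> (1 / real m) * (\<Sum>j=1..m. (real d)\<^sup>2 * (b + b))"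
      using b tuple_vec_norm[OF v] by (intro mult_left_mono sum_mono add_mono) auto
    also have "\<dots> = 2 * (real d)\<^sup>2 * b" using m by simp
    finally show "expectation (\<lambda>z. (norm (kwG h \<theta> (z, v) - dir_avg m v (c z)))\<^sup>2) \<le> 2 * (real d)\<^sup>2 * b" .
  qed
  note I = integral_N[where k="\<lambda>w. (norm (kwG h \<theta> w - dir_avg m (snd w) (c (fst w))))\<^sup>2", unfolded fst_conv snd_conv, OF sec(1)]
  show "integrable N (\<lambda>w. (norm (kwG h \<theta> w - dir_avg m (snd w) (c (fst w))))\<^sup>2)" by (rule I(1))
  show "(\<integral>w. (norm (kwG h \<theta> w - dir_avg m (snd w) (c (fst w))))\<^sup>2 \<partial>N) \<le> 2 * (real d)\<^sup>2 * b"
  proof -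
    have "(\<integral>w. (norm (kwG h \<theta> w - dir_avg m (snd w) (c (fst w))))\<^sup>2 \<partial>N)
        = (1 / real (card tuples)) * (\<Sum>v\<in>tuples. \<integral>z. (norm (kwG h \<theta> (z, v) - dir_avg m v (c z)))\<^sup>2 \<partial>P)"
      using I(2) by simp
    also have "\<dots> \<le> 2 * (real d)\<^sup>2 * b" by (rule average_le) (rule sec(2))
    finally show ?thesis .
  qed
qed

lemma norm_shift_sq_le:
  assumes "0 < h" "h \<le> h0" "norm v = sqrt (real d)"
  shows "(norm (\<theta> + h *\<^sub>R v - \<theta>s))\<^sup>2 \<le> 2 * (norm (\<theta> - \<theta>s))\<^sup>2 + 2 * h0\<^sup>2 * real d"
proof -
  have "(norm ((\<theta> - \<theta>s) + h *\<^sub>R v))\<^sup>2 \<le> 2 * (norm (\<theta> - \<theta>s))\<^sup>2 + 2 * (norm (h *\<^sub>R v))\<^sup>2" by (rule norm_add_sq_le)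
  also have "(norm (h *\<^sub>R v))\<^sup>2 = h\<^sup>2 * real d" using assms by (simp add: power_mult_distrib)
  also have "\<dots> \<le> h0\<^sup>2 * real d" using assms by (intro mult_right_mono power_mono) auto
  finally show ?thesis by (simp add: algebra_simps)
qed

text \<open>The factor \<open>3 + 2 * h0\<^sup>2 * real d\<close> absorbs 1 + 2 r^2 + 2 h0^2 d, the
  bound at the shifted point, into a multiple of 1 + r^2.\<close>

lemma kwG_sq:
  assumes h: "0 < h" "h \<le> h0"
  shows "integrable N (\<lambda>w. (norm (kwG h \<theta> w))\<^sup>2)"
    and "(\<integral>w. (norm (kwG h \<theta> w))\<^sup>2 \<partial>N) \<le> 2 * (real d)\<^sup>2 * Cg * (3 + 2 * h0\<^sup>2 * real d) * (1 + (norm (\<theta> - \<theta>s))\<^sup>2)"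
proof -
  let ?r2 = "(norm (\<theta> - \<theta>s))\<^sup>2"
  let ?b = "Cg * ((3 + 2 * h0\<^sup>2 * real d) * (1 + ?r2))"
  have i: "integrable P (\<lambda>z. (norm (G \<theta>' z - 0))\<^sup>2)" for \<theta>' using gradient_sq(1) by simp
  have nn: "0 \<le> 2 * h0\<^sup>2 * real d * ?r2" by simp
  have b1: "expectation (\<lambda>z. (norm (G \<theta> z - 0))\<^sup>2) \<le> ?b"
  proof -
    have "expectation (\<lambda>z. (norm (G \<theta> z - 0))\<^sup>2) \<le> Cg * (1 + ?r2)" using gradient_sq(2)[of \<theta>] by simp
    also have "\<dots> \<le> ?b"
      using Cg_nonneg nn by (intro mult_left_mono) (auto simp: algebra_simps)
    finally show ?thesis .
  qed
  have b2: "expectation (\<lambda>z. (norm (G (\<theta> + h *\<^sub>R v) z - 0))\<^sup>2) \<le> ?b" if v: "norm v = sqrt (real d)" for v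
  proof -
    have "expectation (\<lambda>z. (norm (G (\<theta> + h *\<^sub>R v) z - 0))\<^sup>2) \<le> Cg * (1 + (norm (\<theta> + h *\<^sub>R v - \<theta>s))\<^sup>2)"
      using gradient_sq(2)[of "\<theta> + h *\<^sub>R v"] by simp
    also have "\<dots> \<le> ?b"
    proof (rule mult_left_mono[OF _ Cg_nonneg])
      have "(3 + 2 * h0\<^sup>2 * real d) * (1 + ?r2) = 3 + 3 * ?r2 + 2 * h0\<^sup>2 * real d + 2 * h0\<^sup>2 * real d * ?r2"
        by (simp add: algebra_simps)
      then show "1 + (norm (\<theta> + h *\<^sub>R v - \<theta>s))\<^sup>2 \<le> (3 + 2 * h0\<^sup>2 * real d) * (1 + ?r2)"
        using norm_shift_sq_le[OF h v, of \<theta>] nn zero_le_power2[of "norm (\<theta> - \<theta>s)"] by linarith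
    qed
    finally show ?thesis .
  qed
  have z: "dir_avg m v 0 = 0" for v by (simp add: dir_avg_def)
  note K = kwG_deviation_integral[OF h(1) borel_measurable_const i b1 b2, unfolded z diff_0_right]
  show "integrable N (\<lambda>w. (norm (kwG h \<theta> w))\<^sup>2)" by (rule K(1))
  show "(\<integral>w. (norm (kwG h \<theta> w))\<^sup>2 \<partial>N) \<le> 2 * (real d)\<^sup>2 * Cg * (3 + 2 * h0\<^sup>2 * real d) * (1 + ?r2)"
    using K(2) by (simp add: mult.assoc)
qed

lemma gradient_diff_sq_integrable: "integrable P (\<lambda>z. (norm (G \<theta> z - G \<theta>' z))\<^sup>2)"
proof (rule Bochner_Integration.integrable_bound)
  show "integrable P (\<lambda>z. 2 * (norm (G \<theta> z))\<^sup>2 + 2 * (norm (G \<theta>' z))\<^sup>2)" using gradient_sq(1) by simp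
  show "AE z in P. norm ((norm (G \<theta> z - G \<theta>' z))\<^sup>2) \<le> norm (2 * (norm (G \<theta> z))\<^sup>2 + 2 * (norm (G \<theta>' z))\<^sup>2)"
    using norm_add_sq_le[of "G \<theta> z" "- G \<theta>' z" for z] by (intro AE_I2) simp
qed measurable

lemma kwG_close:
  assumes \<epsilon>: "0 < \<epsilon>" and h0: "0 < h0" and \<rho>: "0 < \<rho>"
  shows "\<exists>K. \<forall>h \<theta>. 0 < h \<longrightarrow> h \<le> h0 \<longrightarrow> norm (\<theta> - \<theta>s) \<le> \<rho> \<longrightarrow>
    (\<integral>w. (norm (kwG h \<theta> w - Gs w))\<^sup>2 \<partial>N) \<le> \<epsilon> + K * (norm (\<theta> - \<theta>s) + h)"
proof -
  let ?d2 = "2 * (real d)\<^sup>2"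
  have d2: "0 < ?d2" using d by simp
  \<comment> \<open>The enlarged ball contains every perturbed point, and \<open>\<epsilon>\<close>
    is divided in advance by the constant of \<open>kwG_deviation_integral\<close>.\<close>
  obtain K where K: "0 \<le> K" "\<And>x. norm x \<le> \<rho> + h0 * sqrt (real d) \<Longrightarrow>
      expectation (\<lambda>z. (norm (G (\<theta>s + x) z - G \<theta>s z))\<^sup>2) \<le> \<epsilon> / ?d2 + K * norm x"
  proof -
    have "0 < \<epsilon> / ?d2" "0 < \<rho> + h0 * sqrt (real d)" using \<epsilon> \<rho> h0 d2 by (auto intro!: add_pos_nonneg)
    from L2_gradient_continuity[OF this] that show thesis by blast
  qed
  define K' where "K' = ?d2 * K * (1 + sqrt (real d))"
  have "(\<integral>w. (norm (kwG h \<theta> w - Gs w))\<^sup>2 \<partial>N) \<le> \<epsilon> + K' * (norm (\<theta> - \<theta>s) + h)"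
    if h: "0 < h" "h \<le> h0" and \<theta>: "norm (\<theta> - \<theta>s) \<le> \<rho>" for h \<theta>
  proof -
    let ?r = "norm (\<theta> - \<theta>s)"
    let ?b = "\<epsilon> / ?d2 + K * (?r + h * sqrt (real d))"
    have hs: "0 \<le> h * sqrt (real d)" using h by simp
    have hh: "h * sqrt (real d) \<le> h0 * sqrt (real d)" using h by (intro mult_right_mono) auto
    have gen: "expectation (\<lambda>z. (norm (G (\<theta>s + x) z - G \<theta>s z))\<^sup>2) \<le> ?b" if x: "norm x \<le> ?r + h * sqrt (real d)" for x
    proof -
      have "norm x \<le> \<rho> + h0 * sqrt (real d)" using x hh \<theta> by linarith
      from K(2)[OF this] show ?thesis using mult_left_mono[OF x K(1)] by linarith
    qed
    have b1: "expectation (\<lambda>z. (norm (G \<theta> z - G \<theta>s z))\<^sup>2) \<le> ?b" using gen[of "\<theta> - \<theta>s"] hs by simp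
    have b2: "expectation (\<lambda>z. (norm (G (\<theta> + h *\<^sub>R v) z - G \<theta>s z))\<^sup>2) \<le> ?b" if v: "norm v = sqrt (real d)" for v
    proof -
      have "norm ((\<theta> - \<theta>s) + h *\<^sub>R v) \<le> ?r + h * sqrt (real d)"
        using norm_triangle_ineq[of "\<theta> - \<theta>s" "h *\<^sub>R v"] h v by simp
      from gen[OF this] show ?thesis by (simp add: algebra_simps)
    qed
    have "(\<integral>w. (norm (kwG h \<theta> w - Gs w))\<^sup>2 \<partial>N) \<le> ?d2 * ?b"
      unfolding Gs_def by (rule kwG_deviation_integral(2)[OF h(1) G_measurable gradient_diff_sq_integrable b1 b2])
    also have "?d2 * ?b = \<epsilon> + ?d2 * K * (?r + h * sqrt (real d))" using d by (simp add: distrib_left)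
    also have "?d2 * K * (?r + h * sqrt (real d)) \<le> ?d2 * K * ((1 + sqrt (real d)) * (?r + h))"
      using K(1) h by (intro mult_left_mono) (auto simp: algebra_simps)
    finally show ?thesis by (simp add: K'_def mult.assoc)
  qed
  then show ?thesis by blast
qed

text \<open>By \<open>mean_dir_avg\<close>, \<open>gF \<theta>\<close> is the mean of its own
  idealised queries, so the comparison can be made tuple by tuple; each direction contributes |v|^3
  = d sqrt d.\<close>

lemma kwG_bias:
  assumes h: "0 < h"
  shows "norm ((\<integral>w. kwG h \<theta> w \<partial>N) - gF \<theta>) \<le> L\<^sub>f * real d * sqrt (real d) * h"
proof -
  let ?q = "\<lambda>v. \<integral>z. (f (\<theta> + h *\<^sub>R v) z - f \<theta> z) / h \<partial>P"
  have kg: "integrable P (\<lambda>z. kw_gradient f h v \<theta> z)" "(\<integral>z. kw_gradient f h v \<theta> z \<partial>P) = ?q v *\<^sub>R v" for v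
    using quotient_bias(1)[OF h, of \<theta> v] unfolding kw_gradient_def by simp_all
  have i: "integrable P (\<lambda>z. kwG h \<theta> (z, v))" for v
    unfolding kwG_def fst_conv snd_conv by (intro integrable_scaleR_right Bochner_Integration.integrable_sum kg(1))
  have e: "(\<integral>z. kwG h \<theta> (z, v) \<partial>P) = (1 / real m) *\<^sub>R (\<Sum>j=1..m. ?q (v j) *\<^sub>R v j)" for v
    unfolding kwG_def fst_conv snd_conv using kg by (simp add: Bochner_Integration.integral_sum)
  let ?c = "1 / real (card tuples)"
  have "(\<integral>w. kwG h \<theta> w \<partial>N) - gF \<theta> = ?c *\<^sub>R (\<Sum>v\<in>tuples. \<integral>z. kwG h \<theta> (z, v) \<partial>P) - ?c *\<^sub>R (\<Sum>v\<in>tuples. dir_avg m v (gF \<theta>))"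
    using integral_N(2)[of "kwG h \<theta>", OF i] by (simp add: mean_dir_avg)
  also have "\<dots> = ?c *\<^sub>R (\<Sum>v\<in>tuples. (\<integral>z. kwG h \<theta> (z, v) \<partial>P) - dir_avg m v (gF \<theta>))"
    by (simp add: sum_subtractf scaleR_diff_right)
  finally have eq: "(\<integral>w. kwG h \<theta> w \<partial>N) - gF \<theta> = ?c *\<^sub>R (\<Sum>v\<in>tuples. (\<integral>z. kwG h \<theta> (z, v) \<partial>P) - dir_avg m v (gF \<theta>))" .
  have each: "norm ((\<integral>z. kwG h \<theta> (z, v) \<partial>P) - dir_avg m v (gF \<theta>)) \<le> L\<^sub>f * real d * sqrt (real d) * h" if v: "v \<in> tuples" for v
  proof -
    have "(\<integral>z. kwG h \<theta> (z, v) \<partial>P) - dir_avg m v (gF \<theta>) = (1 / real m) *\<^sub>R (\<Sum>j=1..m. (?q (v j) - gF \<theta> \<bullet> v j) *\<^sub>R v j)"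
      unfolding e dir_avg_def by (simp add: scaleR_diff_left sum_subtractf scaleR_diff_right inner_commute)
    also have "norm \<dots> \<le> (1 / real m) * (\<Sum>j=1..m. L\<^sub>f * real d * sqrt (real d) * h)"
      unfolding norm_scaleR
    proof (intro mult_mono sum_norm_le)
      fix j assume j: "j \<in> {1..m}"
      have "norm ((?q (v j) - gF \<theta> \<bullet> v j) *\<^sub>R v j) \<le> (L\<^sub>f * h * (norm (v j))\<^sup>2) * norm (v j)"
        using quotient_bias(2)[OF h, of \<theta> "v j"] by (simp add: mult_right_mono)
      also have "\<dots> = L\<^sub>f * real d * sqrt (real d) * h" using tuple_norm[OF v j] tuple_vec_norm[OF v j] by simp
      finally show "norm ((?q (v j) - gF \<theta> \<bullet> v j) *\<^sub>R v j) \<le> L\<^sub>f * real d * sqrt (real d) * h" .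
    qed auto
    also have "\<dots> = L\<^sub>f * real d * sqrt (real d) * h" using m by simp
    finally show ?thesis .
  qed
  have "norm ((\<integral>w. kwG h \<theta> w \<partial>N) - gF \<theta>) \<le> ?c * (\<Sum>v\<in>tuples. norm ((\<integral>z. kwG h \<theta> (z, v) \<partial>P) - dir_avg m v (gF \<theta>)))"
    unfolding eq norm_scaleR by (rule mult_mono) (auto intro: norm_sum sum_nonneg)
  also have "\<dots> \<le> L\<^sub>f * real d * sqrt (real d) * h" by (rule average_le[OF each])
  finally show ?thesis .
qed

section \<open>Moments of the idealised query and the inverse Hessian\<close>

lemma Gs_measurable: "Gs \<in> borel_measurable N" and Gs_mean: "(\<integral>w. Gs w \<partial>N) = 0"
proof -
  have i: "integrable P (\<lambda>z. Gs (z, v))" for v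
    unfolding Gs_def fst_conv snd_conv by (rule integrable_bounded_linear[OF dir_avg_linear G_integrable])
  show "Gs \<in> borel_measurable N" by (rule borel_measurable_integrable[OF integral_N(1)[OF i]])
  have "(\<integral>z. Gs (z, v) \<partial>P) = 0" for v
  proof -
    have "(\<integral>z. Gs (z, v) \<partial>P) = dir_avg m v (\<integral>z. G \<theta>s z \<partial>P)"
      unfolding Gs_def fst_conv snd_conv by (rule integral_bounded_linear[OF dir_avg_linear G_integrable])
    then show ?thesis by (simp add: G_expectation gF_min dir_avg_def)
  qed
  then show "(\<integral>w. Gs w \<partial>N) = 0" using integral_N(2)[of Gs, OF i] by simp
qed

text \<open>Since \<open>dir_avg\<close> is self-adjoint, \<open>u \<bullet> Gs w\<close> is the
  inner product of \<open>dir_avg m (snd w) u\<close> with the gradient at \<open>\<theta>s\<close>.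
  For a fixed tuple its second moment is the form of \<open>S\<close> at that vector, and the mean
  over tuples is \<open>mean_quadratic_form\<close>.\<close>

lemma inner_Gs_sq:
  fixes S Q Qm :: "real^'n^'n"
  defines "S \<equiv> (\<integral>z. outer (G \<theta>s z) \<partial>P)"
  defines "Q \<equiv> (\<integral>v. outer v ** S ** outer v \<partial>uniform_count_measure D)"
  defines "Qm \<equiv> ((real d - real m) / (real m * (real d - 1))) *\<^sub>R Q + ((real d * (real m - 1)) / (real m * (real d - 1))) *\<^sub>R S"
  shows "integrable N (\<lambda>w. (u \<bullet> Gs w)\<^sup>2)" and "(\<integral>w. (u \<bullet> Gs w)\<^sup>2 \<partial>N) = u \<bullet> (Qm *v u)"
    and "transpose Qm = Qm"
proof -
  have om: "outer \<in> borel_measurable borel"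
    unfolding outer_def by (intro borel_measurable_continuous_onI continuous_intros)
  have oi: "integrable P (\<lambda>z. outer (G \<theta>s z))"
  proof -
    have "(\<lambda>z. outer (G \<theta>s z)) \<in> borel_measurable P" by (rule measurable_compose[OF G_measurable om])
    then show ?thesis using gradient_sq(1)[of \<theta>s] by (subst integrable_norm_iff[symmetric]) (simp_all add: norm_outer)
  qed
  have form: "bounded_linear (\<lambda>A :: real^'n^'n. a \<bullet> (A *v b))" for a b :: "real^'n"
  proof -
    have "linear (\<lambda>A :: real^'n^'n. a \<bullet> (A *v b))"
      by (rule linearI) (simp_all add: matrix_vector_mult_add_rdistrib inner_add_right scaleR_matrix_vector_assoc[symmetric])
    then show ?thesis by (simp add: linear_conv_bounded_linear)
  qed
  have S_form: "a \<bullet> (S *v b) = (\<integral>z. (a \<bullet> G \<theta>s z) * (G \<theta>s z \<bullet> b) \<partial>P)" for a b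
    unfolding S_def by (subst integral_bounded_linear[OF form oi, symmetric]) (simp add: quadratic_form_outer)
  have S_sym: "transpose S = S"
  proof -
    have "a \<bullet> (S *v b) = b \<bullet> (S *v a)" for a b unfolding S_form by (simp add: inner_commute mult.commute)
    moreover have "axis i 1 \<bullet> (S *v axis j 1) = S $ i $ j" for i j
      by (simp add: matrix_vector_mult_basis column_def inner_axis')
    ultimately have "S $ i $ j = S $ j $ i" for i j by metis
    then show ?thesis by (simp add: transpose_def vec_eq_iff)
  qed
  have sq: "integrable P (\<lambda>z. (a \<bullet> G \<theta>s z)\<^sup>2)" for a
  proof (rule Bochner_Integration.integrable_bound)
    show "integrable P (\<lambda>z. (norm a)\<^sup>2 * (norm (G \<theta>s z))\<^sup>2)" using gradient_sq(1) by simp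
    show "AE z in P. norm ((a \<bullet> G \<theta>s z)\<^sup>2) \<le> norm ((norm a)\<^sup>2 * (norm (G \<theta>s z))\<^sup>2)"
      using Cauchy_Schwarz_ineq[of a] by (intro AE_I2) (simp add: power2_norm_eq_inner)
  qed measurable
  have sec: "(u \<bullet> Gs (z, v))\<^sup>2 = (dir_avg m v u \<bullet> G \<theta>s z)\<^sup>2" for z v
    by (simp add: Gs_def dir_avg_symmetric)
  have i: "integrable P (\<lambda>z. (u \<bullet> Gs (z, v))\<^sup>2)" for v unfolding sec by (rule sq)
  show "integrable N (\<lambda>w. (u \<bullet> Gs w)\<^sup>2)" by (rule integral_N(1)[OF i])
  have "(\<integral>w. (u \<bullet> Gs w)\<^sup>2 \<partial>N) = (1 / real (card tuples)) * (\<Sum>v\<in>tuples. \<integral>z. (u \<bullet> Gs (z, v))\<^sup>2 \<partial>P)"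
    using integral_N(2)[OF i] by simp
  also have "\<dots> = (1 / real (card tuples)) * (\<Sum>v\<in>tuples. dir_avg m v u \<bullet> (S *v dir_avg m v u))"
    unfolding sec S_form by (simp add: power2_eq_square inner_commute)
  also have "\<dots> = u \<bullet> (Qm *v u)" unfolding Qm_def Q_def by (rule mean_quadratic_form)
  finally show "(\<integral>w. (u \<bullet> Gs w)\<^sup>2 \<partial>N) = u \<bullet> (Qm *v u)" .
  have oso: "transpose (outer v ** S ** outer v) = outer v ** S ** outer v" for v
    by (simp add: matrix_transpose_mul S_sym transpose_outer matrix_mul_assoc)
  have "transpose (c *\<^sub>R A + c' *\<^sub>R A') = c *\<^sub>R transpose A + c' *\<^sub>R transpose A'" for c c' and A A' :: "real^'n^'n"
    by (simp add: transpose_def vec_eq_iff)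
  moreover have "transpose Q = Q"
  proof -
    have "bounded_linear (transpose :: real^'n^'n \<Rightarrow> real^'n^'n)"
      unfolding linear_conv_bounded_linear[symmetric] by (rule linearI) (simp_all add: transpose_def vec_eq_iff)
    moreover have "integrable (uniform_count_measure D) (\<lambda>v. outer v ** S ** outer v)"
      unfolding uniform_count_measure_def by (rule integrable_point_measure_finite[OF D_finite])
    ultimately have "transpose Q = (\<integral>v. transpose (outer v ** S ** outer v) \<partial>uniform_count_measure D)"
      unfolding Q_def by (rule integral_bounded_linear[symmetric])
    then show ?thesis unfolding oso Q_def .
  qed
  ultimately show "transpose Qm = Qm" by (simp add: Qm_def S_sym)
qed

lemma Gs_sq: "integrable N (\<lambda>w. (norm (Gs w))\<^sup>2)"
proof -
  have "(norm (Gs w))\<^sup>2 = (\<Sum>b\<in>Basis. (b \<bullet> Gs w)\<^sup>2)" for w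
  proof -
    have "(norm (Gs w))\<^sup>2 = (\<Sum>b\<in>Basis. (Gs w \<bullet> b) * (Gs w \<bullet> b))"
      unfolding power2_norm_eq_inner by (rule euclidean_inner)
    then show ?thesis by (simp add: power2_eq_square inner_commute)
  qed
  then show ?thesis using inner_Gs_sq(1) by simp
qed

text \<open>\<open>H\<close> is positive definite because \<open>\<theta>s\<close> is the centre of
  the ball of strong convexity.\<close>

lemma H_invertible: "matrix_inv H ** H = mat 1" "H ** matrix_inv H = mat 1"
proof -
  have inj: "x = 0" if "H *v x = 0" for x
  proof -
    have "psd (H - mat lam)" using F_strong(3)[of \<theta>s] F_strong(1) by (simp add: loewner_le_def)
    then have "0 \<le> x \<bullet> ((H - mat lam) *v x)" by (simp add: psd_def)
    then have "lam * (x \<bullet> x) \<le> 0" using that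
      by (simp add: matrix_vector_mult_diff_rdistrib mat_mult_vec inner_diff_right)
    then have "x \<bullet> x \<le> 0" using F_strong(2) by (simp add: mult_le_0_iff)
    then have "x \<bullet> x = 0" using inner_ge_zero[of x] by linarith
    then show ?thesis by simp
  qed
  then have "\<exists>A. A ** H = mat 1" by (simp add: matrix_left_invertible_ker)
  then have "invertible H" by (simp add: invertible_left_inverse)
  then have "\<exists>A. H ** A = mat 1 \<and> A ** H = mat 1" by (simp add: invertible_def)
  from someI_ex[OF this] show "matrix_inv H ** H = mat 1" "H ** matrix_inv H = mat 1"
    unfolding matrix_inv_def by auto
qed

lemma H_inv_symmetric: "x \<bullet> (matrix_inv H *v y) = (matrix_inv H *v x) \<bullet> y"
proof -
  let ?I = "matrix_inv H"
  have HI: "H *v (?I *v v) = v" for v by (simp add: matrix_vector_mul_assoc H_invertible)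
  have "x \<bullet> (?I *v y) = (H *v (?I *v x)) \<bullet> (?I *v y)" by (simp add: HI)
  also have "\<dots> = (?I *v x) \<bullet> (H *v (?I *v y))"
    using psd_bilinear_sym[OF hess_F_psd, of "?I *v y" \<theta>s "?I *v x"] by (simp add: inner_commute)
  finally show ?thesis by (simp add: HI)
qed

end

theorem (in kw_wor) averaged_iterates_clt:
  fixes \<Omega> :: "'w measure" and \<zeta> :: "nat \<Rightarrow> 'w \<Rightarrow> 'z" and V :: "nat \<Rightarrow> 'w \<Rightarrow> nat \<Rightarrow> real^'n"
    and \<eta>\<^sub>0 \<alpha> h\<^sub>0 \<gamma> :: real and \<eta> h :: "nat \<Rightarrow> real" and S Q Qm :: "real^'n^'n"
  assumes \<Omega>: "prob_space \<Omega>"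
    and \<zeta>_indep: "prob_space.indep_vars \<Omega> (\<lambda>_. P) \<zeta> {1..}"
    and \<zeta>_law: "\<And>i. 1 \<le> i \<Longrightarrow> distr \<Omega> P (\<zeta> i) = P"
    and V_indep: "prob_space.indep_vars \<Omega> (\<lambda>_. count_space tuples) V {1..}"
    and V_law: "\<And>i. 1 \<le> i \<Longrightarrow> distr \<Omega> (count_space tuples) (V i) = uniform_count_measure tuples"
    and V_\<zeta>_indep:
      "prob_space.indep_set \<Omega>
         (sets (vimage_algebra (space \<Omega>) (\<lambda>\<omega>. \<lambda>i\<in>{1..}. \<zeta> i \<omega>) (Pi\<^sub>M {1..} (\<lambda>_. P))))
         (sets (vimage_algebra (space \<Omega>) (\<lambda>\<omega>. \<lambda>i\<in>{1..}. V i \<omega>) (Pi\<^sub>M {1..} (\<lambda>_. count_space tuples))))"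
    and \<eta>: "0 < \<eta>\<^sub>0" "1/2 < \<alpha>" "\<alpha> < 1" "\<And>n. \<eta> n = \<eta>\<^sub>0 * real n powr (- \<alpha>)"
    and h: "0 < h\<^sub>0" "1/2 < \<gamma>" "\<And>n. h n = h\<^sub>0 * real n powr (- \<gamma>)"
  defines "S \<equiv> (\<integral>z. outer (G \<theta>s z) \<partial>P)"
  defines "Q \<equiv> (\<integral>v. outer v ** S ** outer v \<partial>uniform_count_measure D)"
  defines "Qm \<equiv> ((real d - real m) / (real m * (real d - 1))) *\<^sub>R Q
                 + ((real d * (real m - 1)) / (real m * (real d - 1))) *\<^sub>R S"
  shows "weak_conv_vec
    (\<lambda>n. distr \<Omega> borel (\<lambda>\<omega>. sqrt (real n) *\<^sub>R
        (kw_average f m \<eta> h \<theta>\<^sub>0 (\<lambda>i. \<zeta> i \<omega>) (\<lambda>i. V i \<omega>) n - \<theta>s)))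
    (multi_normal 0 (matrix_inv H ** Qm ** matrix_inv H))"
proof -
  interpret O: prob_space \<Omega> by fact
  let ?K = "count_space tuples" and ?U = "uniform_count_measure tuples" and ?I = "matrix_inv H"
  define Y where "Y i \<omega> = (\<zeta> (Suc i) \<omega>, V (Suc i) \<omega>)" for i \<omega>
  define W where "W i \<omega> = (\<zeta> i \<omega>, V i \<omega>)" for i \<omega>
  have sets_N: "sets (P \<Otimes>\<^sub>M ?K) = sets N"
    by (rule sets_pair_measure_cong[OF refl sets_uniform_count_measure_count_space[symmetric]])
  \<comment> \<open>Counting measure and uniform measure on the tuples have the same sigma-algebra,
    so independence transfers to \<open>N\<close>, which is at the same time the common law.\<close>
  have indY: "O.indep_vars (\<lambda>_. N) Y UNIV"
  proof -
    have indK: "O.indep_vars (\<lambda>_. P \<Otimes>\<^sub>M ?K) Y UNIV"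
      unfolding Y_def[abs_def] by (rule O.indep_vars_pair_sequences(1)[OF \<zeta>_indep V_indep V_\<zeta>_indep])
    have "Y i \<in> \<Omega> \<rightarrow>\<^sub>M N" for i
      using indK measurable_cong_sets[OF refl sets_N, of \<Omega>] by (simp add: O.indep_vars_def2)
    moreover have "O.indep_sets (\<lambda>i. {Y i -` A \<inter> space \<Omega> |A. A \<in> sets N}) UNIV"
      using indK by (simp add: O.indep_vars_def2 sets_N)
    ultimately show ?thesis by (simp add: O.indep_vars_def2)
  qed
  have rvY: "Y i \<in> \<Omega> \<rightarrow>\<^sub>M N" for i using indY by (simp add: O.indep_vars_def2)
  have lawY: "distr \<Omega> N (Y i) = N" for i
    unfolding Y_def[abs_def]
  proof (rule pair_law)
    show "prob_space ?U" by (rule prob_space_uniform_count_measure[OF tuples_finite tuples_nonempty])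
    show "\<zeta> (Suc i) \<in> \<Omega> \<rightarrow>\<^sub>M P" using \<zeta>_indep by (simp add: O.indep_vars_def2)
    show "distr \<Omega> P (\<zeta> (Suc i)) = P" by (rule \<zeta>_law) simp
    have "V (Suc i) \<in> \<Omega> \<rightarrow>\<^sub>M ?K" using V_indep by (simp add: O.indep_vars_def2)
    then show "V (Suc i) \<in> \<Omega> \<rightarrow>\<^sub>M ?U"
      using measurable_cong_sets[OF refl sets_uniform_count_measure_count_space] by blast
    have "distr \<Omega> ?U (V (Suc i)) = distr \<Omega> ?K (V (Suc i))"
      by (rule distr_cong) (simp_all add: sets_uniform_count_measure_count_space)
    then show "distr \<Omega> ?U (V (Suc i)) = ?U" by (simp add: V_law)
    fix a b assume "a \<in> sets P" "b \<in> sets ?U"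
    then show "O.prob ((\<lambda>\<omega>. (\<zeta> (Suc i) \<omega>, V (Suc i) \<omega>)) -` (a \<times> b) \<inter> space \<Omega>)
        = O.prob (\<zeta> (Suc i) -` a \<inter> space \<Omega>) * O.prob (V (Suc i) -` b \<inter> space \<Omega>)"
      by (intro O.indep_vars_pair_sequences(2)[OF \<zeta>_indep V_indep V_\<zeta>_indep])
         (simp_all only: sets_uniform_count_measure_count_space)
  qed (rule \<Omega> prob_space_axioms)+
  let ?F = "natural_filtration \<Omega> N Y"
  have filt: "innovation_filtration \<Omega> N ?F W"
    by (rule innovation_filtration_natural[OF \<Omega> indY lawY]) (simp add: W_def[abs_def] Y_def[abs_def])
  have h_pos: "0 < h i" "h i \<le> h\<^sub>0" if "1 \<le> i" for i
  proof -
    show "0 < h i" using h that by simp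
    have "real i powr (- \<gamma>) \<le> real i powr 0" using that h(2) by (intro powr_mono) auto
    then have "h\<^sub>0 * real i powr (- \<gamma>) \<le> h\<^sub>0 * 1" using that h(1) by (intro mult_left_mono) auto
    then show "h i \<le> h\<^sub>0" by (simp add: h(3))
  qed
  let ?C2 = "2 * (real d)\<^sup>2 * Cg * (3 + 2 * h\<^sub>0\<^sup>2 * real d)" and ?Cb = "L\<^sub>f * real d * sqrt (real d)"
  interpret innovation_filtration \<Omega> N ?F W by (rule filt)
  \<comment> \<open>The localisation radius is half of \<open>\<delta>1\<close>, as in
    \<open>gF_monotone\<close>; the constants are those of \<open>kwG_sq\<close>,
    \<open>kwG_bias\<close> and \<open>gF_linearization\<close>.\<close>
  interpret sa: stochastic_approximation \<Omega> N ?F W "\<lambda>i. kwG (h i)" Gs gF "(*v) H" "(*v) ?I" \<theta>s \<theta>\<^sub>0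
    \<eta>\<^sub>0 \<alpha> h\<^sub>0 \<gamma> "\<delta>1 / 2" lam ?C2 ?Cb "sqrt L\<^sub>h" \<eta> h
  proof
    show "(\<lambda>(\<theta>, w). kwG (h i) \<theta> w) \<in> borel_measurable (borel \<Otimes>\<^sub>M N)" for i by (rule kwG_measurable)
    show "Gs \<in> borel_measurable N" by (rule Gs_measurable)
    show "gF \<in> borel_measurable borel"
      by (rule borel_measurable_continuous_onI[OF twice_differentiableD(4)[OF F_diff]])
    show "integrable N (\<lambda>w. (norm (kwG (h i) \<theta> w))\<^sup>2)"
      "(\<integral>w. (norm (kwG (h i) \<theta> w))\<^sup>2 \<partial>N) \<le> ?C2 * (1 + (norm (\<theta> - \<theta>s))\<^sup>2)" if "1 \<le> i" for i \<theta>
      using kwG_sq[OF h_pos[OF that]] by auto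
    show "integrable N (\<lambda>w. (norm (Gs w))\<^sup>2)" "(\<integral>w. Gs w \<partial>N) = 0" by (rule Gs_sq Gs_mean)+
    show "norm ((\<integral>w. kwG (h i) \<theta> w \<partial>N) - gF \<theta>) \<le> ?Cb * h i" if "1 \<le> i" for i \<theta>
      by (rule kwG_bias[OF h_pos(1)[OF that]])
    show "\<exists>K. \<forall>i\<ge>1. \<forall>\<theta>. norm (\<theta> - \<theta>s) \<le> \<delta>1 / 2 \<longrightarrow>
      (\<integral>w. (norm (kwG (h i) \<theta> w - Gs w))\<^sup>2 \<partial>N) \<le> \<epsilon> + K * (norm (\<theta> - \<theta>s) + h i)" if "0 < \<epsilon>" for \<epsilon>
    proof -
      have "0 < \<delta>1 / 2" using F_strong(1) by simp
      from kwG_close[OF that h(1) this] obtain K where K: "\<And>h' \<theta>. 0 < h' \<Longrightarrow> h' \<le> h\<^sub>0 \<Longrightarrow>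
          norm (\<theta> - \<theta>s) \<le> \<delta>1 / 2 \<Longrightarrow>
          (\<integral>w. (norm (kwG h' \<theta> w - Gs w))\<^sup>2 \<partial>N) \<le> \<epsilon> + K * (norm (\<theta> - \<theta>s) + h')"
        by blast
      show ?thesis
        by (intro exI[of _ K] allI impI) (rule K[OF h_pos])
    qed
    show "lam * min ((norm (\<theta> - \<theta>s))\<^sup>2) ((\<delta>1 / 2)\<^sup>2) \<le> (\<theta> - \<theta>s) \<bullet> gF \<theta>" for \<theta> by (rule gF_monotone)
    show "norm (gF \<theta> - H *v (\<theta> - \<theta>s)) \<le> sqrt L\<^sub>h * (norm (\<theta> - \<theta>s))\<^sup>2" for \<theta> by (rule gF_linearization)
    interpret I: bounded_linear "(*v) ?I" by (rule matrix_vector_mul_bounded_linear)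
    show "?I *v (x + y) = ?I *v x + ?I *v y" "?I *v (r *\<^sub>R x) = r *\<^sub>R (?I *v x)" for x y r
      by (rule I.add I.scaleR)+
    show "\<exists>K. \<forall>x. norm (?I *v x) \<le> norm x * K" by (rule I.bounded)
    show "?I *v (H *v x) = x" for x by (simp add: matrix_vector_mul_assoc H_invertible)
  qed (use \<eta> h F_strong in auto)
  have th: "sa.th i \<omega> = kw_iterate f m \<eta> h \<theta>\<^sub>0 (\<lambda>i. \<zeta> i \<omega>) (\<lambda>i. V i \<omega>) i" for i \<omega>
  proof (induction i)
    case (Suc i)
    have step: "sa.th (Suc i) \<omega> = sa.th i \<omega> - \<eta> (Suc i) *\<^sub>R kwG (h (Suc i)) (sa.th i \<omega>) (\<zeta> (Suc i) \<omega>, V (Suc i) \<omega>)"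
      using sa.th.simps(2)[of i \<omega>] by (simp only: W_def)
    show ?case unfolding step Suc by (simp add: kwG_def)
  qed simp
  define Z where "Z n \<omega> = sqrt (real n) *\<^sub>R ((1 / real n) *\<^sub>R (\<Sum>i=1..n. sa.th i \<omega>) - \<theta>s)" for n \<omega>
  have Z_eq: "sqrt (real n) *\<^sub>R (kw_average f m \<eta> h \<theta>\<^sub>0 (\<lambda>i. \<zeta> i \<omega>) (\<lambda>i. V i \<omega>) n - \<theta>s) = Z n \<omega>" for n \<omega>
    by (simp add: Z_def kw_average_def th)
  have Zm[measurable]: "Z n \<in> borel_measurable \<Omega>" for n
    unfolding Z_def[abs_def] by measurable
  define C where "C = ?I ** Qm ** ?I"
  have C_form: "u \<bullet> (C *v u) = (?I *v u) \<bullet> (Qm *v (?I *v u))" for u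
    unfolding C_def by (simp add: matrix_vector_mul_assoc[symmetric] H_inv_symmetric)
  note Gs2 = inner_Gs_sq[folded S_def Q_def Qm_def, folded Q_def Qm_def, folded Qm_def]
  have psdC: "psd C"
  proof -
    have I_sym: "transpose ?I = ?I"
    proof -
      have "?I $ i $ j = ?I $ j $ i" for i j
      proof -
        have ax: "axis i 1 \<bullet> (?I *v axis j 1) = ?I $ i $ j" for i j
          by (simp add: matrix_vector_mult_basis column_def inner_axis')
        have "axis i 1 \<bullet> (?I *v axis j 1) = axis j 1 \<bullet> (?I *v axis i 1)"
          using H_inv_symmetric[of "axis i 1" "axis j 1"] by (simp add: inner_commute)
        then show ?thesis by (simp only: ax)
      qed
      then show ?thesis by (simp add: transpose_def vec_eq_iff)
    qed
    have "transpose C = C"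
      unfolding C_def by (simp add: matrix_transpose_mul I_sym Gs2(3) matrix_mul_assoc)
    \<comment> \<open>The form of \<open>Qm\<close> is a second moment by
      \<open>inner_Gs_sq\<close>, hence nonnegative.\<close>
    moreover have "0 \<le> u \<bullet> (C *v u)" for u
      unfolding C_form Gs2(2)[symmetric] by simp
    ultimately show ?thesis by (simp add: psd_def)
  qed
  \<comment> \<open>The sign is included so that the normalised sums of \<open>X\<close> are exactly
    the linear approximation in \<open>average_linearization\<close>.\<close>
  define X where "X i \<omega> = - (?I *v Gs (Y i \<omega>))" for i \<omega>
  have IGm: "(\<lambda>w. - (?I *v Gs w)) \<in> borel_measurable N"
  proof -
    have "(\<lambda>x. - (?I *v x)) \<in> borel_measurable borel"
      by (intro borel_measurable_continuous_onI continuous_intros linear_continuous_on matrix_vector_mul_bounded_linear)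
    from measurable_compose[OF Gs_measurable this] show ?thesis .
  qed
  have Xm[measurable]: "X i \<in> borel_measurable \<Omega>" for i
    unfolding X_def[abs_def] by (rule measurable_compose[OF rvY IGm])
  have indX: "O.indep_vars (\<lambda>_. borel) X UNIV"
    unfolding X_def[abs_def] by (rule O.indep_vars_compose2[OF indY]) (rule IGm)
  have lawX: "distr \<Omega> borel (X i) = distr N borel (\<lambda>w. - (?I *v Gs w))" for i
  proof -
    have "distr (distr \<Omega> N (Y i)) borel (\<lambda>w. - (?I *v Gs w)) = distr \<Omega> borel (X i)"
      unfolding X_def[abs_def] by (subst distr_distr[OF IGm rvY]) (simp add: comp_def)
    then show ?thesis by (simp only: lawY)
  qed
  define VV where "VV n \<omega> = (1 / sqrt (real n)) *\<^sub>R (\<Sum>i<n. X i \<omega>)" for n \<omega>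
  have VVm[measurable]: "VV n \<in> borel_measurable \<Omega>" for n unfolding VV_def[abs_def] by measurable
  have charlim: "(\<lambda>n. \<integral>x. iexp (u \<bullet> x) \<partial>distr \<Omega> borel (VV n)) \<longlonglongrightarrow> (\<integral>x. iexp (u \<bullet> x) \<partial>multi_normal 0 C)" for u
  proof -
    have uX: "u \<bullet> X 0 \<omega> = - ((?I *v u) \<bullet> Gs (Y 0 \<omega>))" for \<omega> by (simp add: X_def H_inv_symmetric)
    have int_Y: "integrable \<Omega> (\<lambda>\<omega>. k (Y 0 \<omega>))" "(\<integral>\<omega>. k (Y 0 \<omega>) \<partial>\<Omega>) = (\<integral>w. k w \<partial>N)"
      if k: "integrable N k" for k :: "'z \<times> (nat \<Rightarrow> real^'n) \<Rightarrow> real"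
    proof -
      have km: "k \<in> borel_measurable N" using k by simp
      show "integrable \<Omega> (\<lambda>\<omega>. k (Y 0 \<omega>))" using integrable_distr_eq[OF rvY km, of 0] k by (simp add: lawY)
      show "(\<integral>\<omega>. k (Y 0 \<omega>) \<partial>\<Omega>) = (\<integral>w. k w \<partial>N)" using integral_distr[OF rvY km, of 0] by (simp add: lawY)
    qed
    have sq: "integrable \<Omega> (\<lambda>\<omega>. (u \<bullet> X 0 \<omega>)\<^sup>2)" and var: "O.expectation (\<lambda>\<omega>. (u \<bullet> X 0 \<omega>)\<^sup>2) = u \<bullet> (C *v u)"
      unfolding uX power2_minus C_form using int_Y[OF Gs2(1)] by (simp_all add: Gs2(2))
    have iGs: "integrable N (\<lambda>w. (?I *v u) \<bullet> Gs w)"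
      by (intro integrable_inner_right sa.integrable_Gs)
    have "(\<integral>w. (?I *v u) \<bullet> Gs w \<partial>N) = (?I *v u) \<bullet> (\<integral>w. Gs w \<partial>N)"
      by (rule integral_inner_right) (rule sa.integrable_Gs)
    then have mean: "O.expectation (\<lambda>\<omega>. u \<bullet> X 0 \<omega>) = 0"
      unfolding uX using int_Y[OF iGs] by (simp add: Gs_mean)
    have "(\<lambda>n. \<integral>\<omega>. iexp (u \<bullet> VV n \<omega>) \<partial>\<Omega>) \<longlonglongrightarrow> complex_of_real (exp (- (u \<bullet> (C *v u)) / 2))"
      unfolding VV_def by (rule O.clt_char_vec[OF indX _ sq mean var]) (simp only: lawX)
    moreover have "(\<integral>x. iexp (u \<bullet> x) \<partial>distr \<Omega> borel (VV n)) = (\<integral>\<omega>. iexp (u \<bullet> VV n \<omega>) \<partial>\<Omega>)" for n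
      by (rule integral_distr) (rule VVm, measurable)
    ultimately show ?thesis by (simp only: char_multi_normal[OF psdC])
  qed
  have "weak_conv_vec (\<lambda>n. distr \<Omega> borel (Z n)) (multi_normal 0 C)"
  proof (rule weak_conv_vec_lipschitzI)
    show "prob_space (distr \<Omega> borel (Z n))" for n by (rule O.prob_space_distr[OF Zm])
    show "prob_space (multi_normal 0 C)" by (rule prob_space_multi_normal)
    fix g :: "real^'n \<Rightarrow> real" and B L :: real
    assume bd: "\<And>x. \<bar>g x\<bar> \<le> B" and lip: "\<And>x y. \<bar>g x - g y\<bar> \<le> L * dist x y"
    have gm[measurable]: "g \<in> borel_measurable borel" by (rule lipschitz_borel_measurable[OF lip])
    have L: "0 \<le> L"
    proof -
      have "0 \<le> L * dist (axis undefined 1 :: real^'n) 0" using order_trans[OF abs_ge_zero lip] .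
      moreover have "0 < dist (axis undefined 1 :: real^'n) 0" by (simp add: axis_eq_0_iff)
      ultimately show ?thesis by (simp add: zero_le_mult_iff)
    qed
    have "(\<lambda>n. \<integral>x. g x \<partial>distr \<Omega> borel (VV n)) \<longlonglongrightarrow> (\<integral>x. g x \<partial>multi_normal 0 C)"
      by (rule lipschitz_weak_conv[OF _ _ prob_space_multi_normal sets_multi_normal charlim bd lip])
         (simp_all add: O.prob_space_distr)
    then have lim: "(\<lambda>n. O.expectation (\<lambda>\<omega>. g (VV n \<omega>))) \<longlonglongrightarrow> (\<integral>x. g x \<partial>multi_normal 0 C)"
      by (simp add: integral_distr)
    have VV_eq: "- (1 / sqrt (real n)) *\<^sub>R (?I *v (\<Sum>i<n. Gs (W (Suc i) \<omega>))) = VV n \<omega>" for n \<omega>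
    proof -
      have "W (Suc i) \<omega> = Y i \<omega>" for i by (simp add: W_def Y_def)
      then show ?thesis
        by (simp add: VV_def X_def sum_negf linear_sum[OF matrix_vector_mul_linear, of ?I] o_def)
    qed
    have "(\<lambda>n. O.expectation (\<lambda>\<omega>. g (Z n \<omega>)) - O.expectation (\<lambda>\<omega>. g (VV n \<omega>))) \<longlonglongrightarrow> 0"
      using sa.average_linearization[OF bd lip gm L] unfolding VV_eq Z_def .
    from tendsto_add[OF this lim]
    show "(\<lambda>n. \<integral>x. g x \<partial>distr \<Omega> borel (Z n)) \<longlonglongrightarrow> (\<integral>x. g x \<partial>multi_normal 0 C)"
      by (simp add: integral_distr)
  qed simp_all
  then show ?thesis unfolding Z_eq C_def .
qed

theorem theorem3p7:
  fixes P :: "'z measure" and \<Omega> :: "'w measure"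
    and f :: "real^'n \<Rightarrow> 'z \<Rightarrow> real" and F :: "real^'n \<Rightarrow> real"
    and \<theta>s \<theta>\<^sub>0 :: "real^'n"
    and \<zeta> :: "nat \<Rightarrow> 'w \<Rightarrow> 'z" and V :: "nat \<Rightarrow> 'w \<Rightarrow> nat \<Rightarrow> real^'n"
    and B D :: "(real^'n) set"
    and H S Q Qm :: "real^'n^'n"
    and d m :: nat
    and L\<^sub>f \<delta>1 lam \<delta> M L\<^sub>h L\<^sub>p \<eta>\<^sub>0 \<alpha> h\<^sub>0 \<gamma> :: real
    and \<eta> h :: "nat \<Rightarrow> real"
  assumes d: "d = CARD('n)" "2 \<le> d"
    and m: "1 \<le> m" "m \<le> d"
    \<comment> \<open>setting\<close>
    and P: "prob_space P"
    and f_int: "\<And>\<theta>. integrable P (f \<theta>)"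
    and f_convex: "\<And>z. z \<in> space P \<Longrightarrow> convex_on UNIV (\<lambda>\<theta>. f \<theta> z)"
    and f_diff: "\<And>z. z \<in> space P \<Longrightarrow> twice_differentiable (\<lambda>\<theta>. f \<theta> z)"
    and F: "\<And>\<theta>. F \<theta> = (\<integral>z. f \<theta> z \<partial>P)"
    and argmin: "is_arg_min F (\<lambda>_. True) \<theta>s"
    and H: "H = hess F \<theta>s"
    \<comment> \<open>assumption (1)\<close>
    and F_C2: "twice_differentiable F" "continuous_on UNIV (hess F)"
    and F_convex: "convex_on UNIV F"
    and F_hess: "\<And>\<theta>. 0 \<preceq>\<^sub>L hess F \<theta>" "\<And>\<theta>. hess F \<theta> \<preceq>\<^sub>L mat L\<^sub>f"
    and F_strong: "0 < \<delta>1" "0 < lam" "\<And>\<theta>. \<theta> \<in> ball \<theta>s \<delta>1 \<Longrightarrow> mat lam \<preceq>\<^sub>L hess F \<theta>"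
    \<comment> \<open>assumption (2)\<close>
    and grad_unbiased:
      "\<And>\<theta>. has_bochner_integral P (\<lambda>z. grad (\<lambda>t. f t z) \<theta>) (grad F \<theta>)"
    and grad_moment: "0 < \<delta>" "\<delta> \<le> 2" "0 < M"
      "\<And>\<theta>. (\<integral>\<^sup>+z. ennreal (norm (grad (\<lambda>t. f t z) \<theta> - grad F \<theta>) powr (2 + \<delta>)) \<partial>P)
             \<le> ennreal (M * (norm (\<theta> - \<theta>s) powr (2 + \<delta>) + 1))"
    \<comment> \<open>assumption (3)\<close>
    and hess_lipschitz: "0 < L\<^sub>h"
      "\<And>\<theta> \<theta>'. (\<integral>\<^sup>+z. ennreal ((spectral_norm (hess (\<lambda>t. f t z) \<theta> - hess (\<lambda>t. f t z) \<theta>'))\<^sup>2) \<partial>P)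
             \<le> ennreal (L\<^sub>h * (norm (\<theta> - \<theta>'))\<^sup>2)"
    and hess_square: "0 < L\<^sub>p"
      "(\<integral>\<^sup>+z. ennreal (spectral_norm
             (hess (\<lambda>t. f t z) \<theta>s ** hess (\<lambda>t. f t z) \<theta>s - H ** H)) \<partial>P) \<le> ennreal L\<^sub>p"
    \<comment> \<open>the data\<close>
    and \<Omega>: "prob_space \<Omega>"
    and \<zeta>_indep: "prob_space.indep_vars \<Omega> (\<lambda>_. P) \<zeta> {1..}"
    and \<zeta>_law: "\<And>i. 1 \<le> i \<Longrightarrow> distr \<Omega> P (\<zeta> i) = P"
    \<comment> \<open>assumption (4)\<close>
    and B: "orthonormal_basis B"
    and D: "D = scaled_directions B"
    and V_indep:
      "prob_space.indep_vars \<Omega> (\<lambda>_. count_space (wor_tuples m D)) V {1..}"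
    and V_law: "\<And>i. 1 \<le> i \<Longrightarrow>
      distr \<Omega> (count_space (wor_tuples m D)) (V i) = uniform_count_measure (wor_tuples m D)"
    and V_\<zeta>_indep:
      "prob_space.indep_set \<Omega>
         (sets (vimage_algebra (space \<Omega>) (\<lambda>\<omega>. \<lambda>i\<in>{1..}. \<zeta> i \<omega>) (Pi\<^sub>M {1..} (\<lambda>_. P))))
         (sets (vimage_algebra (space \<Omega>) (\<lambda>\<omega>. \<lambda>i\<in>{1..}. V i \<omega>)
                  (Pi\<^sub>M {1..} (\<lambda>_. count_space (wor_tuples m D)))))"
    \<comment> \<open>step sizes and spacing parameters\<close>
    and \<eta>: "0 < \<eta>\<^sub>0" "1/2 < \<alpha>" "\<alpha> < 1" "\<And>n. \<eta> n = \<eta>\<^sub>0 * real n powr (- \<alpha>)"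
    and h: "0 < h\<^sub>0" "1/2 < \<gamma>" "\<gamma> < 1" "\<And>n. h n = h\<^sub>0 * real n powr (- \<gamma>)"
    \<comment> \<open>limiting covariance\<close>
    and S: "S = (\<integral>z. outer (grad (\<lambda>t. f t z) \<theta>s) \<partial>P)"
    and Q: "Q = (\<integral>v. outer v ** S ** outer v \<partial>uniform_count_measure D)"
    and Qm: "Qm = ((real d - real m) / (real m * (real d - 1))) *\<^sub>R Q
                 + ((real d * (real m - 1)) / (real m * (real d - 1))) *\<^sub>R S"
  shows "weak_conv_vec
    (\<lambda>n. distr \<Omega> borel (\<lambda>\<omega>. sqrt (real n) *\<^sub>R
        (kw_average f m \<eta> h \<theta>\<^sub>0 (\<lambda>i. \<zeta> i \<omega>) (\<lambda>i. V i \<omega>) n - \<theta>s)))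
    (multi_normal 0 (matrix_inv H ** Qm ** matrix_inv H))"
proof -
  interpret P: prob_space P by (rule P)
  have kw: "kw_wor P f F \<theta>s L\<^sub>f \<delta>1 lam \<delta> M L\<^sub>h B D d m"
    by (intro kw_wor.intro kw_model.intro kw_model_axioms.intro wor_directions.intro)
       (fact P f_int f_convex f_diff argmin F_C2 F_hess F_strong grad_unbiased grad_moment hess_lipschitz B D d m)+
  show ?thesis
    using kw_wor.averaged_iterates_clt[OF kw \<Omega> \<zeta>_indep \<zeta>_law V_indep V_law V_\<zeta>_indep \<eta> h(1,2,4), of \<theta>\<^sub>0]
    unfolding kw_model.G_def[OF kw_wor.axioms(1)[OF kw]] S[symmetric] Q[symmetric] Qm[symmetric] H[symmetric] .
qed

end
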